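(* Let $q\colon (K,G,\varphi)\to(L,G,\psi)$ be an open extension of topological dynamical systems such that $(L,G,\psi)$ is topologically ergodic. Then the following assertions are equivalent. (a) $q$ is pseudoisometric. (b) The uniform enveloping semigroupoid $\mathcal{E}_{\mathrm u}(q)$ is a compact groupoid. (c) The union of all locally trivial $T_\varphi$-invariant subbundles of $\mathrm{C}_q(K)$ is fiberwise dense in $\mathrm{C}_q(K)$. (d) The union of all finitely generated, projective, closed, $T_\varphi$-invariant $\mathrm{C}(L)$-submodules of $\mathrm{C}(K)$ is dense in $\mathrm{C}(K)$. If these assertions hold, then the locally trivial $T_\varphi$-invariant subbundles in (c) are of constant finite dimension. Moreover, if $K$ is metrizable, then (a) can be replaced by (a') $q$ is isometric.
   Context: All compact spaces are Hausdorff. A topological dynamical system $(K,G,\varphi)$ consists of a nonempty compact space $K$, a Hausdorff topological group $G$ and a continuous action $\varphi\colon G\times K\to K$; write $\varphi_g=\varphi(g,\cdot)$. An extension $q\colon(K,G,\varphi)\to(L,G,\psi)$ is a continuous surjection $q\colon K\to L$ with $q\circ\varphi_g=\psi_g\circ q$ for all $g\in G$; it is open if $q$ is an open map. Write $K_l=q^{-1}(l)$, $gl=\psi_g(l)$ and $K\times_qK=\{(x,y)\in K\times K: q(x)=q(y)\}$. $(L,G,\psi)$ is topologically ergodic if the only $f\in\mathrm C(L)$ (continuous complex-valued functions) with $f\circ\psi_g=f$ for all $g\in G$ are the constants. Pseudoisometric / isometric: $q$ is pseudoisometric if there is a set $P$ of continuous maps $p\colon K\times_qK\to[0,\infty)$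 such that for every $l\in L$ each $p|_{K_l\times K_l}$ ($p\in P$) is a pseudometric on $K_l$, these pseudometrics ($p\in P$) generate the topology of $K_l$, and $p(\varphi_gx,\varphi_gy)=p(x,y)$ for all $p\in P$, $(x,y)\in K\times_qK$, $g\in G$. It is isometric if $P$ can be chosen to consist of a single map. Uniform enveloping semigroupoid: let $\mathrm C_q^q(K,K)=\bigcup_{l,l'\in L}\mathrm C(K_l,K_{l'})$; for $\theta\in\mathrm C(K_l,K_{l'})$ put $s(\theta)=l$, $r(\theta)=l'$. It is a semigroupoid under composition $\theta\circ\eta$, defined when $r(\eta)=s(\theta)$. It carries the compact-open topology, generated by the sets $W(C,O)=\{\theta: \theta(C\cap K_{s(\theta)})\subset O\}$ with $C\subset K$ compact and $O\subset K$ open. $\mathcal E_{\mathrm u}(q)$ is the smallest closed subset of $\mathrm C_q^q(K,K)$ that is closed under all defined compositions and contains all maps $\varphi_g|_{K_l}\colon K_l\to K_{gl}$ ($g\in G$, $l\in L$). It is a compact groupoid if it is compact in the subspace topology, every $\theta\in\mathcal E_{\mathrm u}(q)$ is bijective with $\theta^{-1}\in\mathcal E_{\mathrm u}(q)$, and inversion is continuous. The bundle $\mathrm C_q(K)$: $\mathrm C_q(K)=\bigcup_{l\in L}\mathrm C(K_l)$ (disjoint union), with projection $p\colon\mathrm C_q(K)\to L$ sending $f\in\mathrm C(K_l)$ to $l$, sup-norm on each fiber, and the topology with base $V(F,U,\epsilon)=\{f: p(f)\in U,\ \|f-F|_{K_{p(f)}}\|<\epsilon\}$, for $F\in\mathrm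 C(K)$, $U\subset L$ open, $\epsilon>0$. A subbundle is a subset $F\subset\mathrm C_q(K)$ such that each $F_l=F\cap\mathrm C(K_l)$ is a closed linear subspace of $\mathrm C(K_l)$ and $p|_F\colon F\to L$ is open. It is of constant finite dimension if for some $n\in\mathbb N_0$ one has $\dim F_l=n$ for all $l\in L$. It is locally trivial if each $l\in L$ has a compact neighborhood $W$ for which there are $n\in\mathbb N_0$, constants $c_1,c_2>0$ and a homeomorphism $\Phi\colon (p|_F)^{-1}(W)\to W\times\mathbb C^n$ over $W$ that is a linear isomorphism on each fiber and satisfies $c_1\|e\|\le\|\mathrm{pr}_2\Phi(e)\|\le c_2\|e\|$ for all $e$. It is $T_\varphi$-invariant if $f\circ\varphi_{g^{-1}}|_{K_{gl}}\in F_{gl}$ for all $f\in F_l$, $g\in G$, $l\in L$. A subset of $\mathrm C_q(K)$ is fiberwise dense if its intersection with each $\mathrm C(K_l)$ is dense in $\mathrm C(K_l)$. $\mathrm C(K)$ is a $\mathrm C(L)$-module via $(h\cdot f)(x)=h(q(x))f(x)$. A submodule $M\subset \mathrm C(K)$ is $T_\varphi$-invariant if $f\circ\varphi_g\in M$ for all $f\in M$, $g\in G$. *)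

theory Defs
  imports "HOL-Analysis.Analysis" "HOL-Algebra.Group_Action" "HOL-Algebra.Module"
begin

text \<open>
  Elements of function spaces on \<open>X\<close>, and the maps \<open>\<phi> g\<close> of an action on \<open>X\<close> (via \<open>group_action\<close>),
  are represented by functions that are \<open>undefined\<close> outside \<open>topspace X\<close>. The values of the factor
  map \<open>q\<close> and of the pseudometrics outside their domains are irrelevant.
\<close>

section \<open>Topological dynamical systems\<close>

locale topological_group = group G for G (structure) +
  fixes T
  assumes topspace_group: "topspace T = carrier G"
    and Hausdorff_group: "Hausdorff_space T"
    and continuous_mult: "continuous_map (prod_topology T T) T (\<lambda>(g, h). g \<otimes> h)"
    and continuous_inv: "continuous_map T T (\<lambda>g. inv g)"

locale top_dyn_system = topological_group G T + group_action G "topspace K" \<phi>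
  for G (structure) and T and K and \<phi> +
  assumes nonempty_space: "topspace K \<noteq> {}"
    and compact_space: "compact_space K"
    and Hausdorff_space: "Hausdorff_space K"
    and continuous_action: "continuous_map (prod_topology T K) K (\<lambda>(g, x). \<phi> g x)"

locale tds_extension =
  total: top_dyn_system G T K \<phi> + base: top_dyn_system G T L \<psi>
  for G (structure) and T and K and \<phi> and L and \<psi> +
  fixes q
  assumes continuous_proj: "continuous_map K L q"
    and surj_proj: "q ` topspace K = topspace L"
    and equivariant: "\<lbrakk>g \<in> carrier G; x \<in> topspace K\<rbrakk> \<Longrightarrow> q (\<phi> g x) = \<psi> g (q x)"

definition topologically_ergodic ::
  "('g, 'r) monoid_scheme \<Rightarrow> 'l topology \<Rightarrow> ('g \<Rightarrow> 'l \<Rightarrow> 'l) \<Rightarrow> bool" where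
  "topologically_ergodic G L \<psi> \<longleftrightarrow>
    (\<forall>f :: 'l \<Rightarrow> complex.
       continuous_map L euclidean f \<and> (\<forall>g\<in>carrier G. \<forall>y\<in>topspace L. f (\<psi> g y) = f y)
       \<longrightarrow> (\<exists>c. \<forall>y\<in>topspace L. f y = c))"

definition fibre :: "'k topology \<Rightarrow> ('k \<Rightarrow> 'l) \<Rightarrow> 'l \<Rightarrow> 'k set" where
  "fibre K q l = {x \<in> topspace K. q x = l}"

abbreviation fibre_space :: "'k topology \<Rightarrow> ('k \<Rightarrow> 'l) \<Rightarrow> 'l \<Rightarrow> 'k topology" where
  "fibre_space K q l \<equiv> subtopology K (fibre K q l)"

definition fibre_product :: "'k topology \<Rightarrow> ('k \<Rightarrow> 'l) \<Rightarrow> ('k \<times> 'k) set" where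
  "fibre_product K q = {(x, y). x \<in> topspace K \<and> y \<in> topspace K \<and> q x = q y}"


section \<open>Pseudoisometric and isometric extensions\<close>

definition pseudometric_on :: "'k set \<Rightarrow> ('k \<times> 'k \<Rightarrow> real) \<Rightarrow> bool" where
  "pseudometric_on X p \<longleftrightarrow>
    (\<forall>x\<in>X. \<forall>y\<in>X. 0 \<le> p (x, y)) \<and> (\<forall>x\<in>X. p (x, x) = 0) \<and>
    (\<forall>x\<in>X. \<forall>y\<in>X. p (x, y) = p (y, x)) \<and>
    (\<forall>x\<in>X. \<forall>y\<in>X. \<forall>z\<in>X. p (x, z) \<le> p (x, y) + p (y, z))"

text \<open>The whole set \<open>X\<close> is included in the subbase so that the empty family generates the
  indiscrete topology on \<open>X\<close>.\<close>

definition pseudometrics_topology :: "'k set \<Rightarrow> ('k \<times> 'k \<Rightarrow> real) set \<Rightarrow> 'k topology" where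
  "pseudometrics_topology X P =
    topology_generated_by
      (insert X {{y \<in> X. p (x, y) < \<epsilon>} | p x \<epsilon>. p \<in> P \<and> x \<in> X \<and> 0 < \<epsilon>})"

definition isometric_family ::
  "('g, 'r) monoid_scheme \<Rightarrow> 'k topology \<Rightarrow> ('g \<Rightarrow> 'k \<Rightarrow> 'k) \<Rightarrow> 'l topology \<Rightarrow> ('k \<Rightarrow> 'l)
    \<Rightarrow> ('k \<times> 'k \<Rightarrow> real) set \<Rightarrow> bool" where
  "isometric_family G K \<phi> L q P \<longleftrightarrow>
    (\<forall>p\<in>P.
       continuous_map (subtopology (prod_topology K K) (fibre_product K q)) euclideanreal p \<and>
       (\<forall>z\<in>fibre_product K q. 0 \<le> p z) \<and>
       (\<forall>(x, y)\<in>fibre_product K q. \<forall>g\<in>carrier G. p (\<phi> g x, \<phi> g y) = p (x, y))) \<and>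
    (\<forall>l\<in>topspace L.
       (\<forall>p\<in>P. pseudometric_on (fibre K q l) p) \<and>
       pseudometrics_topology (fibre K q l) P = fibre_space K q l)"

definition pseudoisometric ::
  "('g, 'r) monoid_scheme \<Rightarrow> 'k topology \<Rightarrow> ('g \<Rightarrow> 'k \<Rightarrow> 'k) \<Rightarrow> 'l topology \<Rightarrow> ('k \<Rightarrow> 'l) \<Rightarrow> bool" where
  "pseudoisometric G K \<phi> L q \<longleftrightarrow> (\<exists>P. isometric_family G K \<phi> L q P)"

definition isometric ::
  "('g, 'r) monoid_scheme \<Rightarrow> 'k topology \<Rightarrow> ('g \<Rightarrow> 'k \<Rightarrow> 'k) \<Rightarrow> 'l topology \<Rightarrow> ('k \<Rightarrow> 'l) \<Rightarrow> bool" where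
  "isometric G K \<phi> L q \<longleftrightarrow> (\<exists>p. isometric_family G K \<phi> L q {p})"


section \<open>The uniform enveloping semigroupoid\<close>

text \<open>A map \<open>\<theta> : K\<^sub>l \<rightarrow> K\<^sub>l\<^sub>'\<close> is encoded as the triple \<open>(l, l', \<theta>)\<close>.\<close>

type_synonym ('l, 'k) arrow = "'l \<times> 'l \<times> ('k \<Rightarrow> 'k)"

definition src :: "('l, 'k) arrow \<Rightarrow> 'l" where "src \<theta> = fst \<theta>"
definition tgt :: "('l, 'k) arrow \<Rightarrow> 'l" where "tgt \<theta> = fst (snd \<theta>)"
definition arr :: "('l, 'k) arrow \<Rightarrow> 'k \<Rightarrow> 'k" where "arr \<theta> = snd (snd \<theta>)"

definition fibre_maps :: "'k topology \<Rightarrow> 'l topology \<Rightarrow> ('k \<Rightarrow> 'l) \<Rightarrow> ('l, 'k) arrow set" where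
  "fibre_maps K L q =
    {\<theta>. src \<theta> \<in> topspace L \<and> tgt \<theta> \<in> topspace L \<and> arr \<theta> \<in> extensional (fibre K q (src \<theta>)) \<and>
        continuous_map (fibre_space K q (src \<theta>)) (fibre_space K q (tgt \<theta>)) (arr \<theta>)}"

definition fibre_maps_topology ::
  "'k topology \<Rightarrow> 'l topology \<Rightarrow> ('k \<Rightarrow> 'l) \<Rightarrow> ('l, 'k) arrow topology" where
  "fibre_maps_topology K L q =
    topology_generated_by
      {{\<theta> \<in> fibre_maps K L q. arr \<theta> ` (C \<inter> fibre K q (src \<theta>)) \<subseteq> V} | C V.
        compactin K C \<and> openin K V}"

definition arrow_comp ::
  "'k topology \<Rightarrow> ('k \<Rightarrow> 'l) \<Rightarrow> ('l, 'k) arrow \<Rightarrow> ('l, 'k) arrow \<Rightarrow> ('l, 'k) arrow" where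
  "arrow_comp K q \<theta> \<eta> = (src \<eta>, tgt \<theta>, compose (fibre K q (src \<eta>)) (arr \<theta>) (arr \<eta>))"

definition arrow_inv ::
  "'k topology \<Rightarrow> ('k \<Rightarrow> 'l) \<Rightarrow> ('l, 'k) arrow \<Rightarrow> ('l, 'k) arrow" where
  "arrow_inv K q \<theta> =
    (tgt \<theta>, src \<theta>, restrict (inv_into (fibre K q (src \<theta>)) (arr \<theta>)) (fibre K q (tgt \<theta>)))"

definition action_arrow ::
  "'k topology \<Rightarrow> ('g \<Rightarrow> 'k \<Rightarrow> 'k) \<Rightarrow> ('g \<Rightarrow> 'l \<Rightarrow> 'l) \<Rightarrow> ('k \<Rightarrow> 'l) \<Rightarrow> 'g \<Rightarrow> 'l \<Rightarrow> ('l, 'k) arrow" where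
  "action_arrow K \<phi> \<psi> q g l = (l, \<psi> g l, restrict (\<phi> g) (fibre K q l))"

definition uniform_enveloping_semigroupoid ::
  "('g, 'r) monoid_scheme \<Rightarrow> 'k topology \<Rightarrow> ('g \<Rightarrow> 'k \<Rightarrow> 'k) \<Rightarrow> 'l topology \<Rightarrow> ('g \<Rightarrow> 'l \<Rightarrow> 'l)
    \<Rightarrow> ('k \<Rightarrow> 'l) \<Rightarrow> ('l, 'k) arrow set" where
  "uniform_enveloping_semigroupoid G K \<phi> L \<psi> q =
    \<Inter>{A. closedin (fibre_maps_topology K L q) A \<and>
          (\<forall>\<theta>\<in>A. \<forall>\<eta>\<in>A. tgt \<eta> = src \<theta> \<longrightarrow> arrow_comp K q \<theta> \<eta> \<in> A) \<and>
          (\<forall>g\<in>carrier G. \<forall>l\<in>topspace L. action_arrow K \<phi> \<psi> q g l \<in> A)}"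

text \<open>The Hausdorff property is part of compactness here.\<close>

definition compact_groupoid ::
  "'k topology \<Rightarrow> 'l topology \<Rightarrow> ('k \<Rightarrow> 'l) \<Rightarrow> ('l, 'k) arrow set \<Rightarrow> bool" where
  "compact_groupoid K L q E \<longleftrightarrow>
    (let X = subtopology (fibre_maps_topology K L q) E in
      compact_space X \<and> Hausdorff_space X \<and>
      (\<forall>\<theta>\<in>E. bij_betw (arr \<theta>) (fibre K q (src \<theta>)) (fibre K q (tgt \<theta>)) \<and> arrow_inv K q \<theta> \<in> E) \<and>
      continuous_map X X (arrow_inv K q))"


section \<open>Linear structure on spaces of continuous functions\<close>

text \<open>The space of continuous functions on \<open>X\<close> with the supremum metric; for compact \<open>X\<close> the
  boundedness required by \<open>cfunspace\<close> is automatic.\<close>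

abbreviation CX :: "'a topology \<Rightarrow> ('a \<Rightarrow> complex) metric" where
  "CX X \<equiv> cfunspace X euclidean_metric"

definition sup_norm :: "'a topology \<Rightarrow> ('a \<Rightarrow> complex) \<Rightarrow> real" where
  "sup_norm X f = mdist (CX X) f (\<lambda>x\<in>topspace X. 0)"

definition complex_field :: "complex ring" where
  "complex_field = \<lparr>carrier = UNIV, mult = (*), one = 1, zero = 0, add = (+)\<rparr>"

definition cfun_ring :: "'a topology \<Rightarrow> ('a \<Rightarrow> complex) ring" where
  "cfun_ring X =
    \<lparr>carrier = mspace (CX X),
     mult = (\<lambda>f g. \<lambda>x\<in>topspace X. f x * g x),
     one = (\<lambda>x\<in>topspace X. 1),
     zero = (\<lambda>x\<in>topspace X. 0),
     add = (\<lambda>f g. \<lambda>x\<in>topspace X. f x + g x)\<rparr>"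

definition cfun_vec :: "'a topology \<Rightarrow> (complex, 'a \<Rightarrow> complex) module" where
  "cfun_vec X =
    ring.extend (cfun_ring X) (module.fields (\<lambda>c f. \<lambda>x\<in>topspace X. c * f x))"

definition cfun_module ::
  "'k topology \<Rightarrow> ('k \<Rightarrow> 'l) \<Rightarrow> ('l \<Rightarrow> complex, 'k \<Rightarrow> complex) module" where
  "cfun_module K q =
    ring.extend (cfun_ring K) (module.fields (\<lambda>h f. \<lambda>x\<in>topspace K. h (q x) * f x))"

definition module_iso ::
  "('r, 'a) ring_scheme \<Rightarrow> ('r, 'm, 'b) module_scheme \<Rightarrow> ('r, 'n, 'c) module_scheme
    \<Rightarrow> ('m \<Rightarrow> 'n) \<Rightarrow> bool" where
  "module_iso R M N h \<longleftrightarrow>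
    bij_betw h (carrier M) (carrier N) \<and>
    (\<forall>x\<in>carrier M. \<forall>y\<in>carrier M. h (x \<oplus>\<^bsub>M\<^esub> y) = h x \<oplus>\<^bsub>N\<^esub> h y) \<and>
    (\<forall>a\<in>carrier R. \<forall>x\<in>carrier M. h (a \<odot>\<^bsub>M\<^esub> x) = a \<odot>\<^bsub>N\<^esub> h x)"

text \<open>The free module on a set \<open>I\<close>, i.e. the direct sum of copies of \<open>R\<close> indexed by \<open>I\<close>.
  The ring multiplication fields of the record are irrelevant for modules.\<close>

definition free_module :: "('r, 'a) ring_scheme \<Rightarrow> 'i set \<Rightarrow> ('r, 'i \<Rightarrow> 'r) module" where
  "free_module R I =
    \<lparr>carrier = {c \<in> I \<rightarrow>\<^sub>E carrier R. finite {i \<in> I. c i \<noteq> \<zero>\<^bsub>R\<^esub>}},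
     mult = undefined,
     one = undefined,
     zero = (\<lambda>i\<in>I. \<zero>\<^bsub>R\<^esub>),
     add = (\<lambda>c d. \<lambda>i\<in>I. c i \<oplus>\<^bsub>R\<^esub> d i),
     smult = (\<lambda>a c. \<lambda>i\<in>I. a \<otimes>\<^bsub>R\<^esub> c i)\<rparr>"

definition finitely_generated_module ::
  "('r, 'a) ring_scheme \<Rightarrow> ('r, 'm, 'b) module_scheme \<Rightarrow> bool" where
  "finitely_generated_module R M \<longleftrightarrow>
    (\<exists>S. finite S \<and> S \<subseteq> carrier M \<and> \<Inter>{N. submodule N R M \<and> S \<subseteq> N} = carrier M)"

text \<open>A module is projective if it is isomorphic to a direct summand of a free module. Taking the
  index set \<open>I\<close> inside the type of the elements of \<open>M\<close> is no restriction: if \<open>M\<close> is a direct summand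
  of any free module, then the canonical map onto \<open>M\<close> from the free module on the set
  \<open>carrier M\<close> splits.\<close>

definition projective_module ::
  "('r, 'a) ring_scheme \<Rightarrow> ('r, 'm, 'b) module_scheme \<Rightarrow> bool" where
  "projective_module R M \<longleftrightarrow>
    (\<exists>(I :: 'm set) P Q h.
      let F = free_module R I in
        submodule P R F \<and> submodule Q R F \<and> P \<inter> Q = {\<zero>\<^bsub>F\<^esub>} \<and>
        (\<forall>x\<in>carrier F. \<exists>u\<in>P. \<exists>v\<in>Q. x = u \<oplus>\<^bsub>F\<^esub> v) \<and>
        module_iso R M (F\<lparr>carrier := P\<rparr>) h)"

definition has_complex_dim :: "'a topology \<Rightarrow> nat \<Rightarrow> ('a \<Rightarrow> complex) set \<Rightarrow> bool" where
  "has_complex_dim X n V \<longleftrightarrow>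
    (\<exists>h. module_iso complex_field (cfun_vec X\<lparr>carrier := V\<rparr>)
           (free_module complex_field {..<n}) h)"


section \<open>The bundle of continuous functions on the fibres\<close>

text \<open>An element \<open>f\<close> of the fibre over \<open>l\<close> is encoded as the pair \<open>(l, f)\<close>.\<close>

type_synonym ('l, 'k) fibre_functions = "('l \<times> ('k \<Rightarrow> complex)) set"

definition fun_bundle :: "'k topology \<Rightarrow> 'l topology \<Rightarrow> ('k \<Rightarrow> 'l) \<Rightarrow> ('l, 'k) fibre_functions" where
  "fun_bundle K L q = Sigma (topspace L) (\<lambda>l. mspace (CX (fibre_space K q l)))"

text \<open>The sets in the following definition form a base if \<open>q\<close> is a continuous map of compact
  Hausdorff spaces, so their unions are already all open sets.\<close>

definition fun_bundle_topology ::
  "'k topology \<Rightarrow> 'l topology \<Rightarrow> ('k \<Rightarrow> 'l) \<Rightarrow> ('l \<times> ('k \<Rightarrow> complex)) topology" where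
  "fun_bundle_topology K L q =
    topology_generated_by
      {{(l, f) \<in> fun_bundle K L q.
          l \<in> U \<and> mdist (CX (fibre_space K q l)) f (restrict F (fibre K q l)) < \<epsilon>} | F U \<epsilon>.
        F \<in> mspace (CX K) \<and> openin L U \<and> 0 < \<epsilon>}"

definition bundle_fibre :: "('l, 'k) fibre_functions \<Rightarrow> 'l \<Rightarrow> ('k \<Rightarrow> complex) set" where
  "bundle_fibre F l = {f. (l, f) \<in> F}"

definition subbundle ::
  "'k topology \<Rightarrow> 'l topology \<Rightarrow> ('k \<Rightarrow> 'l) \<Rightarrow> ('l, 'k) fibre_functions \<Rightarrow> bool" where
  "subbundle K L q F \<longleftrightarrow>
    F \<subseteq> fun_bundle K L q \<and>
    (\<forall>l\<in>topspace L.
       submodule (bundle_fibre F l) complex_field (cfun_vec (fibre_space K q l)) \<and>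
       closedin (mtopology_of (CX (fibre_space K q l))) (bundle_fibre F l)) \<and>
    open_map (subtopology (fun_bundle_topology K L q) F) L fst"

definition constant_finite_dim ::
  "'k topology \<Rightarrow> 'l topology \<Rightarrow> ('k \<Rightarrow> 'l) \<Rightarrow> ('l, 'k) fibre_functions \<Rightarrow> bool" where
  "constant_finite_dim K L q F \<longleftrightarrow>
    (\<exists>n. \<forall>l\<in>topspace L. has_complex_dim (fibre_space K q l) n (bundle_fibre F l))"

definition locally_trivial ::
  "'k topology \<Rightarrow> 'l topology \<Rightarrow> ('k \<Rightarrow> 'l) \<Rightarrow> ('l, 'k) fibre_functions \<Rightarrow> bool" where
  "locally_trivial K L q F \<longleftrightarrow>
    (\<forall>l\<in>topspace L. \<exists>W.
       compactin L W \<and> (\<exists>U. openin L U \<and> l \<in> U \<and> U \<subseteq> W) \<and>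
       (\<exists>(n :: nat) (c1 :: real) (c2 :: real) \<Phi>.
          0 < c1 \<and> 0 < c2 \<and>
          homeomorphic_map
            (subtopology (fun_bundle_topology K L q) {e \<in> F. fst e \<in> W})
            (prod_topology (subtopology L W) (product_topology (\<lambda>_. euclidean) {..<n})) \<Phi> \<and>
          (\<forall>e\<in>F. fst e \<in> W \<longrightarrow> fst (\<Phi> e) = fst e) \<and>
          (\<forall>m\<in>W. module_iso complex_field
                     (cfun_vec (fibre_space K q m)\<lparr>carrier := bundle_fibre F m\<rparr>)
                     (free_module complex_field {..<n})
                     (\<lambda>f. snd (\<Phi> (m, f)))) \<and>
          (\<forall>(m, f)\<in>F. m \<in> W \<longrightarrow>
             c1 * sup_norm (fibre_space K q m) f \<le> L2_set (\<lambda>i. cmod (snd (\<Phi> (m, f)) i)) {..<n} \<and>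
             L2_set (\<lambda>i. cmod (snd (\<Phi> (m, f)) i)) {..<n} \<le> c2 * sup_norm (fibre_space K q m) f)))"

definition invariant_subbundle ::
  "('g, 'r) monoid_scheme \<Rightarrow> 'k topology \<Rightarrow> ('g \<Rightarrow> 'k \<Rightarrow> 'k) \<Rightarrow> 'l topology \<Rightarrow> ('g \<Rightarrow> 'l \<Rightarrow> 'l)
    \<Rightarrow> ('k \<Rightarrow> 'l) \<Rightarrow> ('l, 'k) fibre_functions \<Rightarrow> bool" where
  "invariant_subbundle G K \<phi> L \<psi> q F \<longleftrightarrow>
    subbundle K L q F \<and>
    (\<forall>g\<in>carrier G. \<forall>(l, f)\<in>F. (\<psi> g l, compose (fibre K q (\<psi> g l)) f (\<phi> (inv\<^bsub>G\<^esub> g))) \<in> F)"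

definition fibrewise_dense ::
  "'k topology \<Rightarrow> 'l topology \<Rightarrow> ('k \<Rightarrow> 'l) \<Rightarrow> ('l, 'k) fibre_functions \<Rightarrow> bool" where
  "fibrewise_dense K L q A \<longleftrightarrow>
    (\<forall>l\<in>topspace L.
       mtopology_of (CX (fibre_space K q l)) closure_of bundle_fibre A l
         = mspace (CX (fibre_space K q l)))"

definition locally_trivial_invariant_subbundles ::
  "('g, 'r) monoid_scheme \<Rightarrow> 'k topology \<Rightarrow> ('g \<Rightarrow> 'k \<Rightarrow> 'k) \<Rightarrow> 'l topology \<Rightarrow> ('g \<Rightarrow> 'l \<Rightarrow> 'l)
    \<Rightarrow> ('k \<Rightarrow> 'l) \<Rightarrow> ('l, 'k) fibre_functions set" where
  "locally_trivial_invariant_subbundles G K \<phi> L \<psi> q =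
    {F. invariant_subbundle G K \<phi> L \<psi> q F \<and> locally_trivial K L q F}"


section \<open>Invariant submodules\<close>

definition fg_projective_closed_invariant_submodules ::
  "('g, 'r) monoid_scheme \<Rightarrow> 'k topology \<Rightarrow> ('g \<Rightarrow> 'k \<Rightarrow> 'k) \<Rightarrow> 'l topology \<Rightarrow> ('k \<Rightarrow> 'l)
    \<Rightarrow> ('k \<Rightarrow> complex) set set" where
  "fg_projective_closed_invariant_submodules G K \<phi> L q =
    {M. submodule M (cfun_ring L) (cfun_module K q) \<and>
        finitely_generated_module (cfun_ring L) (cfun_module K q\<lparr>carrier := M\<rparr>) \<and>
        projective_module (cfun_ring L) (cfun_module K q\<lparr>carrier := M\<rparr>) \<and>
        closedin (mtopology_of (CX K)) M \<and>
        (\<forall>f\<in>M. \<forall>g\<in>carrier G. compose (topspace K) f (\<phi> g) \<in> M)}"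

end

theory Submission
  imports Defs "HOL-Complex_Analysis.Great_Picard"
begin

text \<open>
Given invariant pseudometrics, the arrows that preserve them form a compact set, by a limit argument
along ultrafilters; it contains the enveloping semigroupoid, which is therefore a compact groupoid.
Conversely, by ergodicity a compact enveloping groupoid is transitive. The mean of almost periodic
functions replaces the Haar measure of its isotropy groups: convolution operators give finite
dimensional invariant spaces of functions that are dense on each fibre (Peter--Weyl), and transport
along the arrows turns each of them into an invariant bundle of finite rank. Averaging a projection
yields continuous local frames of this bundle, hence (c), and its sections form a module as in (d).
Finally, the unit balls of the fibres of a bundle with local frames define a continuous invariant
pseudometric. This leads from (c) and (d) back to (a), where in case (d) the local frames come from
Nakayama's lemma.
\<close>

text \<open>The isotropy groups are treated as bare groups: almost periodicity is expressed by
  finite colourings, and an invariant pseudometric on one fibre, totally bounded by compactness,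
  supplies the colourings. Fibres over different points are not identified with each other, so they
  can be compared only through functions that are continuous on all of K. Openness of q makes this
  possible: close to l0, every point of either fibre is approximated by points of the other, hence
  estimates with finitely many sections persist on neighbouring fibres. Continuity of whatever is
  defined by transport along arrows is tested on the compact product of \<open>out_space l\<close>
  with one fibre; by transitivity its evaluation map reaches all of K and is therefore a quotient
  map. The spectral argument uses the square of the symmetric operator \<open>conv\<close>, because
  maximising the norm of \<open>conv a\<close> yields an eigenfunction of the square, with a
  positive eigenvalue. Harmonic analysis is done for real functions; complex scalars enter with the
  bundles.\<close>

abbreviation cnt :: "'a topology => ('a => 'b::topological_space) => bool" where
 "cnt X == continuous_map X euclidean"
abbreviation cntR :: "'a topology => ('a => real) => bool" where
 "cntR X == continuous_map X euclidean"

section \<open>Averages over finite lists\<close>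

lemma average_bounds:
 fixes f :: "'a => real"
 assumes "gs ~= []" "!!g. g:set gs ==> lo<=f g & f g<=hi"
 shows "lo<=(\<Sum>g\<leftarrow>gs. f g) / length gs & (\<Sum>g\<leftarrow>gs. f g) / length gs<=hi"
proof -
 have "(\<Sum>g\<leftarrow>gs. lo)<=(\<Sum>g\<leftarrow>gs. f g)" "(\<Sum>g\<leftarrow>gs. f g)<=(\<Sum>g\<leftarrow>gs. hi)"
  using assms(2) by (auto intro!: sum_list_mono)
 hence "length gs * lo<=(\<Sum>g\<leftarrow>gs. f g)" "(\<Sum>g\<leftarrow>gs. f g)<=length gs * hi" by (auto simp: sum_list_triv)
 moreover have "real (length gs) > 0" using assms(1) by simp
 ultimately show ?thesis by (simp add: field_simps)
qed

lemma average_dist: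
 fixes f f' :: "'a => real"
 assumes "gs ~= []" "!!g. g:set gs ==> abs (f g - f' g)<=e"
 shows "abs ((\<Sum>g\<leftarrow>gs. f g) / length gs - (\<Sum>g\<leftarrow>gs. f' g) / length gs)<=e"
proof -
 have "(\<Sum>g\<leftarrow>gs. f g) / length gs - (\<Sum>g\<leftarrow>gs. f' g) / length gs
  = (\<Sum>g\<leftarrow>gs. f g - f' g) / length gs" by (simp add: sum_list_subtractf diff_divide_distrib)
 moreover have "- e<=(\<Sum>g\<leftarrow>gs. f g - f' g) / length gs &
  (\<Sum>g\<leftarrow>gs. f g - f' g) / length gs<=e" by (rule average_bounds) (use assms in \<open>force simp: abs_le_iff\<close>)+
 ultimately show ?thesis by linarith
qed

lemma sum_list_product:
 "(\<Sum>p\<leftarrow>List.product xs ys. f p)=(\<Sum>x\<leftarrow>xs. \<Sum>y\<leftarrow>ys. f (x, y))"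
 for f :: "'a \<times> 'b => 'c::comm_monoid_add" by (induction xs) (simp_all add: comp_def)

lemma sum_list_swap':
 "(\<Sum>x\<leftarrow>xs. \<Sum>y\<leftarrow>ys. f x y)=(\<Sum>y\<leftarrow>ys. \<Sum>x\<leftarrow>xs. f x y)"
 for f :: "'a => 'b => 'c::comm_monoid_add" by (induction xs) (simp_all add: sum_list_addf)

text \<open>The polynomial is tested at its minimum t = B / C. If C = 0 it is affine, and a nonzero
  slope would give the value -1 at t = (A + 1) / (2 * B).\<close>

lemma discriminant_nonpos:
 fixes A B C :: real
 assumes "!!t. A - 2 * t * B + t\<^sup>2 * C >= 0" "C >= 0"
 shows "B\<^sup>2<=A * C"
proof (cases "C=0")
 case True
 have "B=0"
 proof (rule ccontr)
  assume "B ~= 0"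
  thus False using assms(1)[of "(A + 1) / (2 * B)"] True by (simp add: field_simps)
 qed
 thus ?thesis using True by simp
next
 case False
 thus ?thesis using assms(2) assms(1)[of "B / C"] by (simp add: field_simps power2_eq_square)
qed

section \<open>Almost periodic functions on a group and their mean\<close>

context group
begin

abbreviation GG where "GG == carrier G"
abbreviation gmult (infixl "##" 70) where "x ## y == x \<otimes> y"

text \<open>Maak's description of almost periodicity: elements of equal colour cannot be told apart,
  up to e, by any two-sided translate of the function. Colours are natural numbers so that
  \<open>prod_encode\<close> gives the common refinement of two colourings.\<close>

definition modulus :: "('a => nat) => real => ('a => real) => bool" where
 "modulus c e a \<longleftrightarrow> (ALL g:GG. ALL h:GG. c g=c h -->
  (ALL k:GG. ALL l:GG. abs (a (k ## g ## l) - a (k ## h ## l))<=e))"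

definition ap :: "('a => real) => bool" where
 "ap a \<longleftrightarrow> (ALL e>0. EX c. finite (c ` GG) & modulus c e a)"

definition avg :: "'a list => ('a => real) => 'a => real" where
 "avg gs a x=(\<Sum>g\<leftarrow>gs. a (g ## x)) / length gs"

definition avgr :: "'a list => ('a => real) => 'a => real" where
 "avgr gs a x=(\<Sum>g\<leftarrow>gs. a (x ## g)) / length gs"

definition lap :: "('a => real) => real => real => bool" where
 "lap a e m \<longleftrightarrow> (EX gs. gs ~= [] & set gs<=GG & (ALL x:GG. abs (avg gs a x - m)<=e))"

definition rap :: "('a => real) => real => real => bool" where
 "rap a e m \<longleftrightarrow> (EX gs. gs ~= [] & set gs<=GG & (ALL x:GG. abs (avgr gs a x - m)<=e))"

text \<open>Von Neumann's mean: the unique constant that is a uniform limit of averages of left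
  translates. Right translates lead to the same constant, see \<open>mean_lap_rap\<close>.\<close>

definition mean :: "('a => real) => real" where
 "mean a=(THE m. ALL e>0. lap a e m)"

lemma modulusD:
 "[|modulus c e a; c g=c h; g:GG; h:GG; k:GG; l:GG|]
  ==> abs (a (k ## g ## l) - a (k ## h ## l))<=e" unfolding modulus_def by blast

lemma colour_representatives:
 assumes "finite (c ` GG)"
 obtains Z where "finite Z" "Z<=GG" "Z ~= {}" "!!x. x:GG ==> EX z:Z. c z=c x"
proof
 let ?Z = "inv_into (GG) c ` (c ` GG)"
 show "finite ?Z" using assms by simp
 show "?Z<=GG" by (auto intro: inv_into_into)
 show "?Z ~= {}" using one_closed by blast
 show "EX z:?Z. c z=c x" if "x:GG" for x using that by (intro bexI[of _ "inv_into (GG) c (c x)"]) (auto simp: f_inv_into_f)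
qed

lemma modulus_mono: "modulus c e a ==> e<=e' ==> modulus c e' a" unfolding modulus_def by fastforce

lemma finite_pair_colour:
 assumes "finite (c ` GG)" "finite (c' ` GG)"
 shows "finite ((%g. prod_encode (c g, c' g)) ` GG)"
 by (rule finite_subset[of _ "prod_encode ` (c ` GG \<times> c' ` GG)"]) (use assms in auto)

lemma modulus_pair_colour:
 "modulus c e a ==> modulus (%g. prod_encode (c g, c' g)) e a"
 "modulus c' e a ==> modulus (%g. prod_encode (c g, c' g)) e a" unfolding modulus_def by auto

lemma modulus_combine:
 assumes "modulus c d a" "modulus c d b"
  "!!x y. [|x:GG; y:GG; abs (a x - a y)<=d; abs (b x - b y)<=d|] ==> abs (f x - f y)<=e"
 shows "modulus c e f" using assms unfolding modulus_def by auto

lemma ap_combine: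
 assumes "ap a" "ap b"
  "!!e. e > 0 ==> EX d>0. ALL x:GG. ALL y:GG.
  abs (a x - a y)<=d & abs (b x - b y)<=d --> abs (f x - f y)<=e"
 shows "ap f" unfolding ap_def
proof (intro allI impI)
 fix e :: real assume "e > 0"
 then obtain d where d: "d > 0" "!!x y. [|x:GG; y:GG;
  abs (a x - a y)<=d; abs (b x - b y)<=d|] ==> abs (f x - f y)<=e" using assms(3) by meson
 obtain c c' where c: "finite (c ` GG)" "modulus c d a"
  and c': "finite (c' ` GG)" "modulus c' d b" using assms(1,2) \<open>d > 0\<close> unfolding ap_def by blast
 show "EX c. finite (c ` GG) & modulus c e f"
 proof (intro exI conjI)
  show "finite ((%g. prod_encode (c g, c' g)) ` GG)" by (rule finite_pair_colour[OF c(1) c'(1)])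
  show "modulus (%g. prod_encode (c g, c' g)) e f"
  by (rule modulus_combine[OF modulus_pair_colour(1)[OF c(2)] modulus_pair_colour(2)[OF c'(2)] d(2)])
 qed
qed

lemma ap_bounded:
 assumes "ap a"
 obtains C where "C > 0" "!!x. x:GG ==> abs (a x)<=C"
proof -
 obtain c where c: "finite (c ` GG)" "modulus c 1 a" using assms unfolding ap_def by (meson zero_less_one)
 obtain Z where Z: "finite Z" "Z<=GG" "!!x. x:GG ==> EX z:Z. c z=c x" using colour_representatives[OF c(1)] by metis
 show thesis
 proof
  show "1 + (\<Sum>z\<in>Z. abs (a z)) > 0" by (simp add: add_pos_nonneg sum_nonneg)
  fix x assume x: "x:GG"
  then obtain z where z: "z:Z" "c z=c x" using Z by blast
  hence "abs (a x - a z)<=1" using modulusD[OF c(2), of x z \<one> \<one>] x Z(2) by auto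
  moreover have "abs (a z)<=(\<Sum>z\<in>Z. abs (a z))" using z Z(1) by (intro member_le_sum) auto
  ultimately show "abs (a x)<=1 + (\<Sum>z\<in>Z. abs (a z))" by linarith
 qed
qed

lemma ap_const [simp]: "ap (%x. r)" unfolding ap_def modulus_def by (auto intro!: exI[of _ "%_. 0"] simp: image_constant_conv)

lemma ap_add:
 assumes "ap a" "ap b"
 shows "ap (%x. a x + b x)"
proof (rule ap_combine[OF assms])
 fix e :: real assume "e > 0"
 thus "EX d>0. ALL x:GG. ALL y:GG.
  abs (a x - a y)<=d & abs (b x - b y)<=d --> abs (a x + b x - (a y + b y))<=e"
  by (intro exI[of _ "e / 2"] conjI ballI impI) (simp, linarith)
qed

lemma ap_mult:
 assumes "ap a" "ap b"
 shows "ap (%x. a x * b x)"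
proof (rule ap_combine[OF assms])
 fix e :: real assume e: "e > 0"
 obtain A where A: "A > 0" "!!x. x:GG ==> abs (a x)<=A" by (rule ap_bounded[OF assms(1)]) (rule that)
 obtain B where B: "B > 0" "!!x. x:GG ==> abs (b x)<=B" by (rule ap_bounded[OF assms(2)]) (rule that)
 show "EX d>0. ALL x:GG. ALL y:GG.
  abs (a x - a y)<=d & abs (b x - b y)<=d --> abs (a x * b x - a y * b y)<=e"
 proof (intro exI[of _ "e / (A + B)"] conjI ballI impI)
  show "e / (A + B) > 0" using e A(1) B(1) by simp
  fix x y assume xy: "x:GG" "y:GG"
  "abs (a x - a y)<=e / (A + B) & abs (b x - b y)<=e / (A + B)"
  have "a x * b x - a y * b y=a x * (b x - b y) + (a x - a y) * b y" by (simp add: algebra_simps)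
  hence "abs (a x * b x - a y * b y)<=abs (a x) * abs (b x - b y) + abs (a x - a y) * abs (b y)" by (metis abs_mult abs_triangle_ineq)
  also have "... <= A * (e / (A + B)) + (e / (A + B)) * B" using xy A B e by (intro add_mono mult_mono) auto
  also have "... = (A + B) * (e / (A + B))" by (simp only: distrib_right mult.commute)
  also have "... = e" using A(1) B(1) by simp
  finally show "abs (a x * b x - a y * b y)<=e" .
 qed
qed

lemma ap_cmult: "ap a ==> ap (%x. r * a x)" using ap_mult[OF ap_const] by blast

lemma ap_diff: "ap a ==> ap b ==> ap (%x. a x - b x)" using ap_add[of a "%x. -1 * b x"] ap_cmult[of b "-1"] by simp

lemma ap_sum: "(!!i. i:I ==> ap (f i)) ==> ap (%x. \<Sum>i\<in>I. f i x)" by (induction I rule: infinite_finite_induct) (auto intro: ap_add)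

lemma ap_sum_list: "(!!i. i:set I ==> ap (f i)) ==> ap (%x. \<Sum>i\<leftarrow>I. f i x)" by (induction I) (auto intro: ap_add)

lemma ap_cong:
 assumes "!!x. x:GG ==> a x=b x" "ap a"
 shows "ap b" using assms(2) unfolding ap_def modulus_def by (simp add: assms(1))

text \<open>Because \<open>modulus\<close> quantifies over two-sided translates, a left translate
  keeps the same colouring and tolerance. The averages inherit this, which is why the contraction of
  the oscillation can be iterated.\<close>

lemma modulus_left:
 assumes "modulus c e a" "s:GG"
 shows "modulus c e (%x. a (s ## x))" unfolding modulus_def
proof (intro ballI impI)
 fix g h k l assume *: "g:GG" "h:GG" "c g=c h" "k:GG" "l:GG"
 show "abs (a (s ## (k ## g ## l)) - a (s ## (k ## h ## l)))<=e"
  using modulusD[OF assms(1), of g h "s ## k" l] * assms(2) by (simp add: m_assoc)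
qed

lemma modulus_inv:
 assumes "modulus c e a"
 shows "modulus (%x. c (inv x)) e (%x. a (inv x))" unfolding modulus_def
proof (intro ballI impI)
 fix g h k l assume *: "g:GG" "h:GG" "c (inv g)=c (inv h)" "k:GG" "l:GG"
 show "abs (a (inv (k ## g ## l)) - a (inv (k ## h ## l)))<=e"
  using modulusD[OF assms(1), of "inv g" "inv h" "inv l" "inv k"] * by (simp add: m_assoc inv_mult_group)
qed

lemma ap_left: "ap a ==> s:GG ==> ap (%x. a (s ## x))" unfolding ap_def using modulus_left by blast

lemma finite_colour_inv: "finite (c ` GG) ==> finite ((%x. c (inv x)) ` GG)" by (rule finite_subset[of _ "c ` GG"]) auto

lemma ap_inv:
 assumes "ap a"
 shows "ap (%x. a (inv x))" unfolding ap_def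
proof (intro allI impI)
 fix e :: real assume "e > 0"
 then obtain c where "finite (c ` GG)" "modulus c e a" using assms unfolding ap_def by blast
 thus "EX c. finite (c ` GG) & modulus c e (%x. a (inv x))" using modulus_inv finite_colour_inv by (intro exI[of _ "%x. c (inv x)"]) blast
qed

lemma modulus_avg:
 assumes "modulus c e a" "gs ~= []" "set gs<=GG"
 shows "modulus c e (avg gs a)" unfolding modulus_def avg_def
proof (intro ballI impI)
 fix g h k l assume *: "g:GG" "h:GG" "c g=c h" "k:GG" "l:GG"
 show "abs ((\<Sum>s\<leftarrow>gs. a (s ## (k ## g ## l))) / length gs - (\<Sum>s\<leftarrow>gs. a (s ## (k ## h ## l))) / length gs)<=e"
  using assms * modulusD[OF modulus_left[OF assms(1)]] by (intro average_dist) auto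
qed

lemma ap_avg: "ap a ==> gs ~= [] ==> set gs<=GG ==> ap (avg gs a)" unfolding ap_def using modulus_avg by blast

lemma avg_avg:
 assumes "set gs<=GG" "set gs'<=GG" "x:GG"
 shows "avg gs' (avg gs a) x=avg (map (%(g', g). g ## g') (List.product gs' gs)) a x"
proof -
 have "(\<Sum>g'\<leftarrow>gs'. \<Sum>g\<leftarrow>gs. a (g ## (g' ## x)))=(\<Sum>g'\<leftarrow>gs'. \<Sum>g\<leftarrow>gs. a (g ## g' ## x))"
  using assms by (intro arg_cong[of _ _ sum_list] map_cong refl) (auto simp: m_assoc subset_iff)
 hence "(\<Sum>g'\<leftarrow>gs'. avg gs a (g' ## x))=(\<Sum>g'\<leftarrow>gs'. \<Sum>g\<leftarrow>gs. a (g ## g' ## x)) / length gs"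
  unfolding avg_def by (simp add: divide_inverse sum_list_mult_const)
 thus ?thesis unfolding avg_def[of gs'] avg_def[of "map _ _"] by (simp add: comp_def case_prod_unfold sum_list_product)
qed

text \<open>One term of the average at x matches one term of the average at y up to e: the
  representative i1 has the colour of i0 y x^-1. Each of the remaining card Z - 1 pairs of terms
  differs by at most w, since all values lie between U - w and U.\<close>

lemma avg_step:
 assumes Z: "finite Z" "Z<=GG" "Z ~= {}" "!!x. x:GG ==> EX z:Z. c z=c x"
  and gs: "set gs=Z" "distinct gs"
  and a: "modulus c e a" and w: "!!x y. [|x:GG; y:GG|] ==> a x - a y<=w"
  and xy: "x:GG" "y:GG"
 shows "avg gs a x - avg gs a y<=(1 - 1 / card Z) * w + e / card Z"
proof -
 define U where "U=(SUP t\<in>GG. a t)"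
 have bdd: "bdd_above (a ` GG)" using w[OF _ one_closed] by (intro bdd_aboveI[of _ "a \<one> + w"]) (auto simp: algebra_simps)
 have U1: "a t<=U" if "t:GG" for t unfolding U_def using that bdd by (intro cSUP_upper)
 have U2: "U - w<=a t" if "t:GG" for t
 proof -
  have "U<=a t + w" unfolding U_def using w that one_closed by (intro cSUP_least) (auto simp: algebra_simps)
  thus ?thesis by simp
 qed
 obtain i0 where i0: "i0:Z" using Z(3) by blast
 define u where "u=i0 ## y"
 have u: "u:GG" "u ## inv x:GG" using i0 Z(2) xy by (auto simp: u_def)
 obtain i1 where i1: "i1:Z" "c i1=c (u ## inv x)" using Z(4)[OF u(2)] by blast
 have key: "a (i1 ## x) - a (i0 ## y)<=e" using modulusD[OF a i1(2), of \<one> x] i1 Z(2) u xy by (auto simp: m_assoc u_def)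
 have N: "card Z ~= 0" "real (card Z - 1)=real (card Z) - 1" using Z(1,3) by (auto simp: of_nat_diff Suc_leI card_gt_0_iff)
 have eq: "avg gs a t=(\<Sum>z\<in>Z. a (z ## t)) / card Z" for t
  unfolding avg_def using gs by (metis sum_list_distinct_conv_sum_set distinct_card)
 have "(\<Sum>z\<in>Z - {i1}. a (z ## x))<=(\<Sum>z\<in>Z - {i1}. U)" using U1 Z(2) xy by (intro sum_mono) auto
 moreover have "(\<Sum>z\<in>Z - {i0}. a (z ## y)) >= (\<Sum>z\<in>Z - {i0}. U - w)" using U2 Z(2) xy by (intro sum_mono) auto
 ultimately have "(\<Sum>z\<in>Z. a (z ## x)) - (\<Sum>z\<in>Z. a (z ## y))<=(real (card Z) - 1) * w + e" using i0 i1 Z(1) N key sum.remove[OF Z(1) i1(1), of "%z. a (z ## x)"] sum.remove[OF Z(1) i0, of "%z. a (z ## y)"] by (simp add: algebra_simps)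
 thus ?thesis using eq N by (simp add: field_simps)
qed

text \<open>Averaging over representatives of the colours brings every value close to the minimum once,
 so the oscillation shrinks by a factor depending only on the number of colours. One list of
 translations therefore works for all functions with a common modulus and bound.\<close>

lemma avg_oscillation:
 assumes c: "finite (c ` GG)" and "e > 0" "C >= 0"
 obtains gs where "gs ~= []" "set gs<=GG"
  "!!a x y. [|modulus c e a; !!x. x:GG ==> abs (a x)<=C; x:GG; y:GG|]
  ==> avg gs a x - avg gs a y<=2 * e"
proof -
 obtain Z where Z: "finite Z" "Z<=GG" "Z ~= {}" "!!x. x:GG ==> EX z:Z. c z=c x" using colour_representatives[OF c] by metis
 obtain zs where zs: "set zs=Z" "distinct zs" using finite_distinct_list[OF Z(1)] by blast
 define q where "q=1 - 1 / real (card Z)"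
 have N: "real (card Z) >= 1" using Z(1,3) by (simp add: Suc_leI card_gt_0_iff)
 hence q: "0<=q" "q < 1" by (auto simp: q_def field_simps)
 have ex: "EX gs. gs ~= [] & set gs<=GG &
  (ALL a x y. modulus c e a & (ALL x:GG. abs (a x)<=C) & x:GG & y:GG
  --> avg gs a x - avg gs a y<=q ^ k * (2 * C) + e)" for k
 proof (induction k)
  case 0
  show ?case
  proof (intro exI[of _ "[\<one>]"] conjI allI impI)
  fix a x y
  assume *: "modulus c e a & (ALL x:GG. abs (a x)<=C) & x:GG & y:GG"
  hence "abs (a x)<=C" "abs (a y)<=C" by auto
  hence "a x - a y<=2 * C + e" using \<open>e > 0\<close> by linarith
  thus "avg [\<one>] a x - avg [\<one>] a y<=q ^ 0 * (2 * C) + e" using * by (simp add: avg_def)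
  qed auto
 next
  case (Suc k)
  then obtain gs where gs: "gs ~= []" "set gs<=GG"
  "!!a x y. modulus c e a & (ALL x:GG. abs (a x)<=C) & x:GG & y:GG
  ==> avg gs a x - avg gs a y<=q ^ k * (2 * C) + e" by blast
  let ?gs = "map (%(g', g). g ## g') (List.product zs gs)"
  show ?case
  proof (intro exI[of _ ?gs] conjI allI impI)
  have "zs ~= []" using zs Z by auto
  thus "?gs ~= []" using gs(1) by (metis length_0_conv length_map length_product mult_is_0)
  show "set ?gs<=GG" using gs(2) zs Z(2) by auto
  fix a x y
  assume *: "modulus c e a & (ALL x:GG. abs (a x)<=C) & x:GG & y:GG"
  have "avg zs (avg gs a) x - avg zs (avg gs a) y
  <= (1 - 1 / card Z) * (q ^ k * (2 * C) + e) + e / card Z" using * gs by (intro avg_step[OF Z zs modulus_avg]) auto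
  \<comment> \<open>The error e reproduces itself because q * e + e / card Z = e.\<close>
  also have "... = q ^ Suc k * (2 * C) + e" using N by (simp add: q_def field_simps)
  finally show "avg ?gs a x - avg ?gs a y<=q ^ Suc k * (2 * C) + e" using * gs(2) zs Z(2) by (simp add: avg_avg)
  qed
 qed
 have "(%k. q ^ k * (2 * C)) \<longlonglongrightarrow> 0" using q by (intro tendsto_mult_left_zero LIMSEQ_power_zero) auto
 hence "eventually (%k. q ^ k * (2 * C) < e) sequentially" using \<open>e > 0\<close> order_tendstoD(2) by blast
 then obtain k where k: "q ^ k * (2 * C) < e" by (meson eventually_sequentially order_refl)
 obtain gs where gs: "gs ~= []" "set gs<=GG"
  "!!a x y. modulus c e a & (ALL x:GG. abs (a x)<=C) & x:GG & y:GG
  ==> avg gs a x - avg gs a y<=q ^ k * (2 * C) + e" using ex[of k] by blast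
 show thesis by (rule that[OF gs(1,2)]) (use gs(3) k in fastforce)
qed

lemma lap_exists:
 assumes "ap a" "e > 0"
 shows "EX m. lap a e m"
proof -
 obtain c where c: "finite (c ` GG)" "modulus c (e / 2) a" using assms unfolding ap_def by (meson half_gt_zero)
 obtain C where C: "C > 0" "!!x. x:GG ==> abs (a x)<=C" by (rule ap_bounded[OF assms(1)]) (rule that)
 obtain gs where gs: "gs ~= []" "set gs<=GG"
  "!!x y. [|x:GG; y:GG|] ==> avg gs a x - avg gs a y<=e" using avg_oscillation[OF c(1), of "e/2" C] assms(2) c(2) C
  by (metis half_gt_zero less_eq_real_def mult_2 field_sum_of_halves)
 have "abs (avg gs a x - avg gs a \<one>)<=e" if "x:GG" for x
  using gs(3)[OF that one_closed] gs(3)[OF one_closed that] by (simp add: abs_le_iff)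
 thus ?thesis unfolding lap_def using gs(1,2) by blast
qed

lemma rap_exists:
 assumes "ap a" "e > 0"
 shows "EX m. rap a e m"
proof -
 obtain m gs where gs: "gs ~= []" "set gs<=GG"
  "!!x. x:GG ==> abs (avg gs (%x. a (inv x)) x - m)<=e" using lap_exists[OF ap_inv[OF assms(1)] assms(2)] unfolding lap_def by blast
 have "abs (avgr (map (%g. inv g) gs) a x - m)<=e" if "x:GG" for x
 proof -
  have "avgr (map (%g. inv g) gs) a x=avg gs (%x. a (inv x)) (inv x)" unfolding avg_def avgr_def using gs(2) that
  by (auto simp: comp_def inv_mult_group subset_iff intro!: arg_cong[of _ _ sum_list])
  thus ?thesis using gs(3) that by simp
 qed
 thus ?thesis unfolding rap_def using gs(1,2) by (intro exI[of _ m] exI[of _ "map (%g. inv g) gs"]) auto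
qed

lemma avg_avgr:
 assumes "set gs<=GG" "set hs<=GG" "x:GG"
 shows "avg gs (avgr hs a) x=avgr hs (avg gs a) x"
proof -
 have "(\<Sum>g\<leftarrow>gs. \<Sum>h\<leftarrow>hs. a (g ## x ## h))=(\<Sum>h\<leftarrow>hs. \<Sum>g\<leftarrow>gs. a (g ## x ## h))"
  by (rule sum_list_swap')
 also have "... = (\<Sum>h\<leftarrow>hs. \<Sum>g\<leftarrow>gs. a (g ## (x ## h)))"
  using assms by (intro arg_cong[of _ _ sum_list] map_cong refl) (auto simp: m_assoc subset_iff)
 finally show ?thesis unfolding avg_def avgr_def divide_inverse mult.commute[of _ "inverse _"] sum_list_const_mult by (simp add: mult_ac)
qed

lemma average_near:
 fixes f :: "'c => real"
 assumes "gs ~= []" "!!g. g:set gs ==> abs (f g - m)<=e"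
 shows "abs ((\<Sum>g\<leftarrow>gs. f g) / length gs - m)<=e" using average_dist[of gs f "%_. m" e] assms by (simp add: sum_list_triv)

lemma avg_near:
 assumes "gs ~= []" "set gs<=GG" "!!x. x:GG ==> abs (a x - m)<=e" "x:GG"
 shows "abs (avg gs a x - m)<=e" "abs (avgr gs a x - m)<=e"
proof -
 show "abs (avg gs a x - m)<=e" unfolding avg_def by (rule average_near) (use assms in auto)
 show "abs (avgr gs a x - m)<=e" unfolding avgr_def by (rule average_near) (use assms in auto)
qed

text \<open>Left and right averaging commute, so the double average at the identity is e-close to m
  and e'-close to m'.\<close>

lemma lap_rap:
 assumes "lap a e m" "rap a e' m'"
 shows "abs (m - m')<=e + e'"
proof -
 obtain gs where gs: "gs ~= []" "set gs<=GG" "!!x. x:GG ==> abs (avg gs a x - m)<=e" using assms(1) unfolding lap_def by blast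
 obtain hs where hs: "hs ~= []" "set hs<=GG" "!!x. x:GG ==> abs (avgr hs a x - m')<=e'" using assms(2) unfolding rap_def by blast
 show ?thesis using avg_near(1)[OF gs(1,2), of "avgr hs a" m' e' \<one>] hs(3)
  avg_near(2)[OF hs(1,2), of "avg gs a" m e \<one>] gs(3)
  avg_avgr[OF gs(2) hs(2) one_closed, of a] by fastforce
qed

text \<open>Every interval [t - e, t + e] with \<open>lap a e t\<close> meets every other one,
  because a right approximation with arbitrarily small error lies close to both centres. A point
  common to all of them is the mean.\<close>

lemma mean_exists:
 assumes "ap a"
 shows "EX m. ALL e>0. lap a e m & rap a e m"
proof -
 define S where "S={t - e | t e. lap a e t & e > 0}"
 \<comment> \<open>The supremum of the left end points lies in all the intervals, as these meet
   pairwise.\<close>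
 define m where "m=Sup S"
 have le: "t2 - e2<=t + e" if "lap a e t" "lap a e2 t2" for t e t2 e2
 proof (rule field_le_epsilon)
  fix d :: real assume "d > 0"
  then obtain s where s: "rap a (d / 2) s" using rap_exists[OF assms, of "d/2"] by auto
  show "t2 - e2<=t + e + d" using lap_rap[OF that(1) s] lap_rap[OF that(2) s] by (simp add: abs_le_iff)
 qed
 obtain t0 where t0: "lap a 1 t0" using lap_exists[OF assms, of 1] by auto
 have bdd: "bdd_above S" unfolding S_def using le[OF t0] by (intro bdd_aboveI[of _ "t0 + 1"]) auto
 have S: "S ~= {}" unfolding S_def using t0 by force
 have near: "abs (m - t)<=e" if "lap a e t" "e > 0" for e t
 proof -
  have "t - e<=m" unfolding m_def using that bdd by (intro cSup_upper) (auto simp: S_def)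
  moreover have "m<=t + e" unfolding m_def using le[OF that(1)] S by (intro cSup_least) (auto simp: S_def)
  ultimately show ?thesis by simp
 qed
 have "lap a e m & rap a e m" if e: "e > 0" for e
 proof
  obtain t where t: "lap a (e / 2) t" using lap_exists[OF assms, of "e/2"] e by auto
  show "lap a e m" using near[OF t] e t lap_def by (smt (verit) field_sum_of_halves)
  obtain s where s: "rap a (e / 4) s" using rap_exists[OF assms, of "e/4"] e by auto
  obtain t' where t': "lap a (e / 4) t'" using lap_exists[OF assms, of "e/4"] e by auto
  have "abs (m - s)<=3 * e / 4" using near[OF t'] e lap_rap[OF t' s] by linarith
  hence le: "abs (t - m)<=e" if "abs (t - s)<=e / 4" for t using that by linarith
  show "rap a e m" using s le unfolding rap_def by blast
 qed
 thus ?thesis by blast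
qed

lemma mean_eqI:
 assumes "ap a" "!!e. e > 0 ==> lap a e m"
 shows "mean a=m" unfolding mean_def
proof (rule the_equality)
 show "ALL e>0. lap a e m" using assms by blast
 obtain m0 where m0: "!!e. e > 0 ==> rap a e m0" using mean_exists[OF assms(1)] by blast
 have uniq: "m'=m0" if "ALL e>0. lap a e m'" for m'
 proof -
  have "abs (m' - m0)<=0 + e" if "e > 0" for e
  using lap_rap[of a "e/2" m' "e/2" m0] that m0 \<open>\<forall>e>0. lap a e m'\<close> by force
  hence "abs (m' - m0)<=0" using field_le_epsilon by blast
  thus ?thesis by simp
 qed
 show "m'=m" if "ALL e>0. lap a e m'" for m' using uniq[of m] uniq[OF that] assms(2) by blast
qed

lemma mean_lap_rap:
 assumes "ap a" "e > 0"
 shows "lap a e (mean a)" "rap a e (mean a)"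
proof -
 obtain m0 where m0: "!!e. e > 0 ==> lap a e m0 & rap a e m0" using mean_exists[OF assms(1)] by blast
 hence "mean a=m0" by (intro mean_eqI[OF assms(1)]) auto
 thus "lap a e (mean a)" "rap a e (mean a)" using m0 assms(2) by auto
qed

lemma mean_near_lap:
 assumes "ap a" "lap a e t"
 shows "abs (mean a - t)<=e"
proof (rule field_le_epsilon)
 fix d :: real assume "d > 0"
 thus "abs (mean a - t)<=e + d" using lap_rap[OF assms(2) mean_lap_rap(2)[OF assms(1)]] by (simp add: abs_minus_commute)
qed

lemma mean_eqI_rap:
 assumes "ap a" "!!e. e > 0 ==> rap a e m"
 shows "mean a=m"
proof -
 have "abs (mean a - m)<=0 + e" if "e > 0" for e using lap_rap[OF mean_lap_rap(1)[OF assms(1), of "e/2"] assms(2)[of "e/2"]] that by simp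
 hence "abs (mean a - m)<=0" using field_le_epsilon by blast
 thus ?thesis by simp
qed

lemma mean_cong:
 assumes "!!x. x:GG ==> a x=b x"
 shows "mean a=mean b"
proof -
 have "avg gs a x=avg gs b x" if "set gs<=GG" "x:GG" for gs x
  unfolding avg_def using that assms by (auto intro!: arg_cong[of _ _ sum_list] simp: subset_iff)
 hence "lap a=lap b" unfolding lap_def by (intro ext) (metis (no_types, lifting))
 thus ?thesis unfolding mean_def by simp
qed

lemma mean_const [simp]: "mean (%x. r)=r"
proof (rule mean_eqI[OF ap_const])
 fix e :: real assume "e > 0"
 thus "lap (%x. r) e r" unfolding lap_def avg_def by (intro exI[of _ "[\<one>]"]) auto
qed

text \<open>A list that nearly equalises \<open>a\<close> from the right also nearly equalises
  \<open>avg gs a\<close>, since right averages commute with left ones and averaging keeps values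
  close to the mean.\<close>

lemma mean_avg:
 assumes "ap a" "gs ~= []" "set gs<=GG"
 shows "mean (avg gs a)=mean a"
proof (rule mean_eqI_rap[OF ap_avg[OF assms]])
 fix e :: real assume "e > 0"
 obtain hs where hs: "hs ~= []" "set hs<=GG" "!!x. x:GG ==> abs (avgr hs a x - mean a)<=e"
  using mean_lap_rap(2)[OF assms(1) \<open>e > 0\<close>] unfolding rap_def by blast
 have "abs (avgr hs (avg gs a) x - mean a)<=e" if "x:GG" for x
  using avg_near(1)[OF assms(2,3), of "avgr hs a" "mean a" e x] hs(3) that avg_avgr[OF assms(3) hs(2) that, of a] by simp
 thus "rap (avg gs a) e (mean a)" unfolding rap_def using hs by blast
qed

lemma mean_left:
 assumes "ap a" "s:GG"
 shows "mean (%x. a (s ## x))=mean a" using mean_avg[OF assms(1), of "[s]"] assms(2) unfolding avg_def by simp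

text \<open>Both summands must be averaged by one list. The list hs is chosen for
  \<open>avg gs b\<close>, whose mean is that of b; applying it after gs does not spoil the
  approximation already achieved for a.\<close>

lemma mean_add:
 assumes "ap a" "ap b"
 shows "mean (%x. a x + b x)=mean a + mean b"
proof (rule mean_eqI[OF ap_add[OF assms]])
 fix e :: real assume e: "e > 0"
 obtain gs where gs: "gs ~= []" "set gs<=GG" "!!x. x:GG ==> abs (avg gs a x - mean a)<=e / 2"
  using mean_lap_rap(1)[OF assms(1), of "e/2"] e unfolding lap_def by auto
 note b = ap_avg[OF assms(2) gs(1,2)] mean_avg[OF assms(2) gs(1,2)]
 obtain hs where hs: "hs ~= []" "set hs<=GG" "!!x. x:GG ==> abs (avg hs (avg gs b) x - mean b)<=e / 2"
  using mean_lap_rap(1)[OF b(1), of "e/2"] b(2) e unfolding lap_def by auto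
 let ?ks = "map (%(g', g). g ## g') (List.product hs gs)"
 have "abs (avg ?ks (%x. a x + b x) x - (mean a + mean b))<=e" if x: "x:GG" for x
 proof -
  have "avg ks (%x. a x + b x) x=avg ks a x + avg ks b x" for ks unfolding avg_def by (simp add: sum_list_addf add_divide_distrib)
  hence "avg ?ks (%x. a x + b x) x=avg ?ks a x + avg ?ks b x" .
  hence "avg ?ks (%x. a x + b x) x=avg hs (avg gs a) x + avg hs (avg gs b) x" using avg_avg[OF gs(2) hs(2) x] by simp
  moreover have "abs (avg hs (avg gs a) x - mean a)<=e / 2" by (rule avg_near(1)[OF hs(1,2) _ x]) (rule gs(3))
  ultimately show ?thesis using hs(3)[OF x] by linarith
 qed
 moreover have "?ks ~= []" using gs(1) hs(1) by (metis length_0_conv length_map length_product mult_is_0)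
 moreover have "set ?ks<=GG" using gs(2) hs(2) by auto
 ultimately show "lap (%x. a x + b x) e (mean a + mean b)" unfolding lap_def by blast
qed

lemma mean_nonneg:
 assumes "ap a" "!!x. x:GG ==> a x >= 0"
 shows "mean a >= 0"
proof (rule field_le_epsilon)
 fix e :: real assume "e > 0"
 obtain gs where gs: "gs ~= []" "set gs<=GG" "!!x. x:GG ==> abs (avg gs a x - mean a)<=e"
  using mean_lap_rap(1)[OF assms(1) \<open>e > 0\<close>] unfolding lap_def by blast
 have "avg gs a \<one> >= 0" unfolding avg_def using gs(2) assms(2) by (intro divide_nonneg_nonneg sum_list_nonneg) auto
 thus "0<=mean a + e" using gs(3)[OF one_closed] by linarith
qed

lemma mean_cmult:
 assumes "ap a"
 shows "mean (%x. r * a x)=r * mean a"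
proof (rule mean_eqI[OF ap_cmult[OF assms]])
 fix e :: real assume "e > 0"
 hence e': "e / (abs (r) + 1) > 0" by simp
 obtain gs where gs: "gs ~= []" "set gs<=GG"
  "!!x. x:GG ==> abs (avg gs a x - mean a)<=e / (abs (r) + 1)" using mean_lap_rap(1)[OF assms e'] unfolding lap_def by blast
 have "abs (avg gs (%x. r * a x) x - r * mean a)<=e" if "x:GG" for x
 proof -
  have "avg gs (%x. r * a x) x - r * mean a=r * (avg gs a x - mean a)"
  unfolding avg_def by (simp add: sum_list_const_mult right_diff_distrib)
  hence "abs (avg gs (%x. r * a x) x - r * mean a)<=abs (r) * (e / (abs (r) + 1))"
  using mult_left_mono[OF gs(3)[OF that], of "abs (r)"] by (simp only: abs_mult)
  also have "... <= e" using \<open>e > 0\<close> by (simp add: field_simps)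
  finally show ?thesis .
 qed
 thus "lap (%x. r * a x) e (r * mean a)" unfolding lap_def using gs by blast
qed

lemma mean_diff: "ap a ==> ap b ==> mean (%x. a x - b x)=mean a - mean b"
 using mean_add[of a "%x. -1 * b x"] ap_cmult[of b "-1"] mean_cmult[of b "-1"] by simp

lemma mean_mono:
 assumes "ap a" "ap b" "!!x. x:GG ==> a x<=b x"
 shows "mean a<=mean b" using mean_nonneg[OF ap_diff[OF assms(2,1)]] mean_diff[OF assms(2,1)] assms(3) by simp

lemma mean_dist:
 assumes "ap a" "ap b" "!!x. x:GG ==> abs (a x - b x)<=e"
 shows "abs (mean a - mean b)<=e"
proof -
 have "mean a<=mean (%x. b x + e)" "mean b<=mean (%x. a x + e)"
  using assms by (auto intro!: mean_mono ap_add simp: abs_le_iff algebra_simps)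
 thus ?thesis using assms(1,2) by (simp add: mean_add)
qed

lemma mean_sum: "(!!i. i:I ==> ap (f i)) ==> mean (%x. \<Sum>i\<in>I. f i x)=(\<Sum>i\<in>I. mean (f i))"
 by (induction I rule: infinite_finite_induct) (auto simp: mean_add ap_sum)

lemma mean_sum_list: "(!!i. i:set I ==> ap (f i)) ==> mean (%x. \<Sum>i\<leftarrow>I. f i x)=(\<Sum>i\<leftarrow>I. mean (f i))"
 by (induction I) (auto simp: mean_add ap_sum_list)

text \<open>A modulus common to all F g yields one list of translations whose averages are close to
  the means of all F g simultaneously. A finite average over h commutes with the mean over g, so the
  exchange of the two means holds up to an arbitrary error.\<close>

lemma mean_fubini:
 assumes unif: "!!e. e > 0 ==> EX c. finite (c ` GG) & (ALL g:GG. modulus c e (F g))"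
  and C: "C >= 0" "!!g h. [|g:GG; h:GG|] ==> abs (F g h)<=C"
  and ap1: "ap (%g. mean (F g))" and ap2: "!!h. h:GG ==> ap (%g. F g h)"
  and ap3: "ap (%h. mean (%g. F g h))"
 shows "mean (%g. mean (F g))=mean (%h. mean (%g. F g h))"
proof -
 let ?L = "mean (%g. mean (F g))"
 have apF: "ap (F g)" if "g:GG" for g using unif that unfolding ap_def by meson
 have "abs (mean (%h. mean (%g. F g h)) - ?L)<=0 + e'" if e': "e' > 0" for e'
 proof -
  define e where "e=e' / 2"
  have "e > 0" using e' by (simp add: e_def)
  obtain c where c: "finite (c ` GG)" "!!g. g:GG ==> modulus c e (F g)" using unif[OF \<open>e > 0\<close>] by blast
  obtain gs where gs: "gs ~= []" "set gs<=GG"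
  "!!a x y. [|modulus c e a; !!x. x:GG ==> abs (a x)<=C; x:GG; y:GG|]
  ==> avg gs a x - avg gs a y<=2 * e" using avg_oscillation[OF c(1) \<open>e > 0\<close> C(1)] by metis
  have near: "abs (avg gs (F g) x - mean (F g))<=e'" if "g:GG" "x:GG" for g x
  proof -
  have "abs (avg gs (F g) y - avg gs (F g) x)<=e'" if "y:GG" for y
  using gs(3)[OF c(2), of g x y] gs(3)[OF c(2), of g y x] C(2) that \<open>g \<in> carrier G\<close> \<open>x \<in> carrier G\<close>
  by (simp add: e_def abs_le_iff)
  hence "abs (mean (avg gs (F g)) - mean (%_. avg gs (F g) x))<=e'" using that by (intro mean_dist ap_avg apF gs) auto
  thus ?thesis using mean_avg[OF apF gs(1,2)] that by (simp add: abs_minus_commute)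
  qed
  have "abs (avg gs (%h. mean (%g. F g h)) x - ?L)<=e'" if x: "x:GG" for x
  proof -
  have apa: "ap (%g. F g (s ## x))" if "s:set gs" for s using ap2 gs(2) that x by auto
  have apb: "ap (%g. avg gs (F g) x)" unfolding avg_def divide_inverse mult.commute[of _ "inverse _"] by (intro ap_cmult ap_sum_list apa)
  have "avg gs (%h. mean (%g. F g h)) x=mean (%g. avg gs (F g) x)" unfolding avg_def divide_inverse mult.commute[of _ "inverse _"]
  using mean_sum_list[of gs "%s g. F g (s ## x)"] apa mean_cmult[OF ap_sum_list[of gs "%s g. F g (s ## x)"]] by simp
  thus ?thesis using mean_dist[OF apb ap1 near[OF _ x]] by simp
  qed
  hence "lap (%h. mean (%g. F g h)) e' ?L" unfolding lap_def using gs by blast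
  thus ?thesis using mean_near_lap[OF ap3] by simp
 qed
 hence "abs (mean (%h. mean (%g. F g h)) - ?L)<=0" using field_le_epsilon by blast
 thus ?thesis by simp
qed

end

section \<open>Convolution operators on almost periodic functions\<close>

context group
begin

text \<open>The inner product of L2 with respect to the mean. It is handled as a semidefinite form:
  functions of norm zero are made to vanish by applying \<open>conv\<close>.\<close>

definition ip :: "('a => real) => ('a => real) => real" where
 "ip a b=mean (%x. a x * b x)"

definition nrm :: "('a => real) => real" where
 "nrm a=sqrt (ip a a)"

lemma ip_commute: "ip a b=ip b a" unfolding ip_def by (simp add: mult.commute)

lemma ip_cong:
 "(!!x. x:GG ==> a x=a' x) ==> (!!x. x:GG ==> b x=b' x) ==> ip a b=ip a' b'" unfolding ip_def by (rule mean_cong) simp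

lemma ip_diff_left: "[|ap a; ap b; ap c|] ==> ip (%x. a x - b x) c=ip a c - ip b c"
 unfolding ip_def by (simp add: left_diff_distrib mean_diff ap_mult)

lemma ip_diff_right: "[|ap a; ap b; ap c|] ==> ip c (%x. a x - b x)=ip c a - ip c b" by (simp add: ip_commute[of c] ip_diff_left)

lemma ip_cmult_left: "[|ap a; ap c|] ==> ip (%x. r * a x) c=r * ip a c" unfolding ip_def by (simp add: mult.assoc mean_cmult ap_mult)

lemma ip_cmult_right: "[|ap a; ap c|] ==> ip c (%x. r * a x)=r * ip c a" by (simp add: ip_commute[of c] ip_cmult_left)

lemma ip_sum_left: "[|!!i. i:I ==> ap (f i); ap c|] ==> ip (%x. \<Sum>i\<in>I. f i x) c=(\<Sum>i\<in>I. ip (f i) c)"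
 unfolding ip_def by (simp add: sum_distrib_right mean_sum ap_mult)

lemma ip_nonneg: "ap a ==> ip a a >= 0" unfolding ip_def by (rule mean_nonneg) (auto intro: ap_mult)

lemma nrm_nonneg: "ap a ==> nrm a >= 0" unfolding nrm_def using ip_nonneg by simp

lemma nrm_square: "ap a ==> (nrm a)\<^sup>2=ip a a" unfolding nrm_def using ip_nonneg by simp

lemma ip_diff_square:
 assumes "ap a" "ap b"
 shows "ip (%x. a x - t * b x) (%x. a x - t * b x)=ip a a - 2 * t * ip a b + t\<^sup>2 * ip b b"
 using assms ap_cmult[of b t] ap_diff[OF assms(1) ap_cmult[OF assms(2), of t]]
 by (simp add: ip_diff_left ip_diff_right ip_cmult_left ip_cmult_right ip_commute[of b a]
  power2_eq_square algebra_simps)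

lemma ip_cauchy_schwarz:
 assumes "ap a" "ap b"
 shows "abs (ip a b)<=nrm a * nrm b"
proof -
 have "(ip a b)\<^sup>2<=ip a a * ip b b"
 proof (rule discriminant_nonpos)
  show "ip a a - 2 * t * ip a b + t\<^sup>2 * ip b b >= 0" for t
  using ip_diff_square[OF assms] ip_nonneg[OF ap_diff[OF assms(1) ap_cmult[OF assms(2), of t]]] by simp
 qed (rule ip_nonneg[OF assms(2)])
 hence "(ip a b)\<^sup>2<=(nrm a * nrm b)\<^sup>2" using nrm_square assms by (simp add: power_mult_distrib)
 thus ?thesis using nrm_nonneg assms by (metis abs_le_square_iff abs_of_nonneg mult_nonneg_nonneg)
qed

lemma nrm_le:
 assumes "ap a" "e >= 0" "!!x. x:GG ==> abs (a x)<=e"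
 shows "nrm a<=e"
proof -
 have "a x * a x<=e * e" if "x:GG" for x using mult_mono[OF assms(3)[OF that] assms(3)[OF that]] assms(2) by (simp add: abs_mult_self_eq)
 hence "ip a a<=mean (%_. e * e)" unfolding ip_def using assms(1) by (intro mean_mono ap_mult ap_const) auto
 thus ?thesis unfolding nrm_def using assms(2) by (simp add: real_le_lsqrt power2_eq_square)
qed

lemma nrm_zero_ip: "[|ap a; ap b; ip a a=0|] ==> ip a b=0" using ip_cauchy_schwarz[of a b] by (simp add: nrm_def)

text \<open>An Arzela-Ascoli theorem, with a common modulus in place of equicontinuity. A diagonal
  subsequence converges on the countable union of all sets of representatives, and the colours carry
  this over to uniform convergence on the group.\<close>

lemma uniform_subsequence:
 fixes b :: "nat => 'a => real"
 assumes mod: "!!e. e > 0 ==> EX c. finite (c ` GG) & (ALL n. modulus c e (b n))"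
  and C: "!!n x. x:GG ==> abs (b n x)<=C"
 obtains r l where "strict_mono (r :: nat => nat)" "ap l"
  "!!e. e > 0 ==> EX N. ALL n>=N. ALL x:GG. abs (b (r n) x - l x)<=e"
proof -
 have "EX c. finite (c ` GG) & (ALL n. modulus c (1 / Suc j) (b n))" for j using mod[of "1 / Suc j"] by simp
 then obtain c where c: "!!j. finite (c j ` GG)" "!!j n. modulus (c j) (1 / Suc j) (b n)" by metis
 have "EX Z. finite Z & Z<=GG & (ALL x:GG. EX z:Z. c j z=c j x)" for j using colour_representatives[OF c(1)] by metis
 then obtain Z where Z: "!!j. finite (Z j)" "!!j. Z j<=GG"
  "!!j x. x:GG ==> EX z:Z j. c j z=c j x" by metis
 have "countable (\<Union>j. Z j)" using Z(1) by (simp add: countable_finite)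
 moreover have "norm (b n x)<=C" if "x:(\<Union>j. Z j)" for n x using C Z(2) that by auto
 ultimately obtain r where r: "strict_mono (r :: nat => nat)"
  "!!x. x:(\<Union>j. Z j) ==> EX l. (%n. b (r n) x) \<longlonglongrightarrow> l"
  using function_convergent_subsequence[of "\<Union>j. Z j" b C] by metis
 have "ALL e>0. EX N. ALL m n x. N<=m & N<=n & x:GG --> dist (b (r m) x) (b (r n) x) < e"
 proof (intro allI impI)
  fix e :: real assume "e > 0"
  then obtain j where j: "1 / Suc j < e / 3" using nat_approx_posE[of "e/3"] by auto
  have "EX N. ALL m>=N. ALL n>=N. dist (b (r m) z) (b (r n) z) < e / 3" if "z:Z j" for z
  proof -
  have "Cauchy (%n. b (r n) z)" using r(2)[of z] that by (intro convergent_Cauchy) (auto simp: convergent_def)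
  thus ?thesis using \<open>e > 0\<close> by (metis Cauchy_def divide_pos_pos zero_less_numeral)
  qed
  then obtain N where N: "!!z m n. [|z:Z j; m >= N z; n >= N z|] ==> dist (b (r m) z) (b (r n) z) < e / 3" by metis
  define M where "M=(\<Sum>z\<in>Z j. N z)"
  have M: "N z<=M" if "z:Z j" for z using that Z(1) by (auto simp: M_def intro: member_le_sum)
  show "EX N. ALL m n x. N<=m & N<=n & x:GG --> dist (b (r m) x) (b (r n) x) < e"
  proof (intro exI[of _ M] allI impI)
  fix m n x assume *: "M<=m & M<=n & x:GG"
  then obtain z where z: "z:Z j" "c j z=c j x" using Z(3) by blast
  have near: "abs (b k z - b k x)<=1 / Suc j" for k using modulusD[OF c(2)[of j k] z(2), of \<one> \<one>] z Z(2) * by auto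
  have "dist (b (r m) z) (b (r n) z) < e / 3" using M[OF z(1)] * by (intro N[OF z(1)]) auto
  thus "dist (b (r m) x) (b (r n) x) < e" using near[of "r m"] near[of "r n"] j unfolding dist_real_def by linarith
  qed
 qed
 then obtain l where l: "!!e. e > 0 ==> EX N. ALL n x. N<=n & x:GG --> dist (b (r n) x) (l x) < e"
  using uniformly_convergent_eq_cauchy[of "%x. x:GG" "%n. b (r n)"] by blast
 have lim: "EX N. ALL n>=N. ALL x:GG. abs (b (r n) x - l x)<=e" if "e > 0" for e
  using l[OF that] unfolding dist_real_def by (metis less_eq_real_def)
 have "ap l" unfolding ap_def
 proof (intro allI impI, goal_cases)
  case (1 e)
  then obtain N where N: "!!x. x:GG ==> abs (b (r N) x - l x)<=e / 3" using lim[of "e/3"] by auto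
  obtain c where c: "finite (c ` GG)" "modulus c (e / 3) (b (r N))" using mod[of "e/3"] \<open>e > 0\<close> by auto
  have "modulus c e l"
  proof (rule modulus_combine[OF c(2,2)], goal_cases)
  case (1 x y)
  thus ?case using N[of x] N[of y] by linarith
  qed
  thus ?case using c(1) by blast
 qed
 thus thesis using that[OF r(1)] lim by blast
qed

end

text \<open>The kernel of the operator is \<kappa>(g^-1 h). Invariance of \<kappa> under inversion
  makes it symmetric, dependence on g^-1 h makes the operator commute with left translations, and
  the bounds 0 and 1 make it a contraction.\<close>

locale conv_kernel = group +
 fixes \<kappa> :: "'a => real"
 assumes ap_kernel: "ap \<kappa>"
  and kernel_inv: "h:GG ==> \<kappa> (inv h)=\<kappa> h"
  and kernel_bounds: "h:GG ==> 0<=\<kappa> h & \<kappa> h<=1"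
begin

definition conv :: "('a => real) => 'a => real" where
 "conv a g=mean (%h. \<kappa> (inv g ## h) * a h)"

lemma ap_translate: "g:GG ==> ap (%h. \<kappa> (inv g ## h))" using ap_left[OF ap_kernel] by simp

lemma kernel_swap: "g:GG ==> h:GG ==> \<kappa> (inv g ## h)=\<kappa> (inv h ## g)"
 using kernel_inv[of "inv g ## h"] by (simp add: inv_mult_group)

lemma conv_eq_ip: "conv a g=ip (%h. \<kappa> (inv g ## h)) a" unfolding conv_def ip_def ..

lemma conv_cong: "(!!x. x:GG ==> a x=b x) ==> conv a=conv b" unfolding conv_def by (intro ext mean_cong) simp

lemma conv_cmult: "[|ap a; g:GG|] ==> conv (%x. r * a x) g=r * conv a g"
 unfolding conv_def by (simp add: mult.left_commute mean_cmult ap_mult ap_translate)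

lemma conv_diff: "[|ap a; ap b; g:GG|] ==> conv (%x. a x - b x) g=conv a g - conv b g"
 unfolding conv_def by (simp add: right_diff_distrib mean_diff ap_mult ap_translate)

lemma conv_sum: "[|!!i. i:I ==> ap (f i); g:GG|]
  ==> conv (%x. \<Sum>i\<in>I. f i x) g=(\<Sum>i\<in>I. conv (f i) g)"
 unfolding conv_def by (simp add: sum_distrib_left mean_sum ap_mult ap_translate)

text \<open>Cauchy-Schwarz against a translate of the kernel, whose norm is at most 1. This bridge
  from the L2 norm to the uniform norm is used wherever smallness in the mean has to become
  pointwise.\<close>

lemma conv_bound:
 assumes "ap a" "g:GG"
 shows "abs (conv a g)<=nrm a"
proof -
 have "nrm (%h. \<kappa> (inv g ## h))<=1" using kernel_bounds assms(2) by (intro nrm_le ap_translate) auto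
 hence "nrm (%h. \<kappa> (inv g ## h)) * nrm a<=1 * nrm a" using nrm_nonneg[OF assms(1)] by (intro mult_right_mono) auto
 thus ?thesis unfolding conv_eq_ip using ip_cauchy_schwarz[OF ap_translate[OF assms(2)] assms(1)] by linarith
qed

text \<open>The colouring is that of the kernel and the tolerance involves only the norm of a. So
  the images of a bounded set of functions share their moduli: this is the compactness of the
  operator.\<close>

lemma modulus_conv:
 assumes "ap a" "modulus c e \<kappa>" "e >= 0"
 shows "modulus c (e * nrm a) (conv a)" unfolding modulus_def
proof (intro ballI impI)
 fix g h k l assume *: "g:GG" "h:GG" "c g=c h" "k:GG" "l:GG"
 let ?d = "%s. \<kappa> (inv (k ## g ## l) ## s) - \<kappa> (inv (k ## h ## l) ## s)"
 have "abs (?d s)<=e" if s: "s:GG" for s using modulusD[OF assms(2) *(3), of "inv s ## k" l] * s by (simp add: kernel_swap[of _ s] m_assoc)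
 hence d: "ap ?d" "nrm ?d<=e" using * assms(3) by (auto intro!: ap_diff ap_translate nrm_le)
 have "conv a (k ## g ## l) - conv a (k ## h ## l)=ip ?d a"
  unfolding conv_eq_ip using * assms(1) by (subst ip_diff_left) (auto intro!: ap_translate)
 hence "abs (conv a (k ## g ## l) - conv a (k ## h ## l))<=nrm ?d * nrm a" using ip_cauchy_schwarz[OF d(1) assms(1)] by simp
 also have "... <= e * nrm a" using d(2) nrm_nonneg[OF assms(1)] by (rule mult_right_mono)
 finally show "abs (conv a (k ## g ## l) - conv a (k ## h ## l))<=e * nrm a" .
qed

lemma ap_conv:
 assumes "ap a"
 shows "ap (conv a)" unfolding ap_def
proof (intro allI impI)
 fix e :: real assume e: "e > 0"
 let ?d = "e / (nrm a + 1)"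
 have d: "?d > 0" using e nrm_nonneg[OF assms] by simp
 then obtain c where c: "finite (c ` GG)" "modulus c ?d \<kappa>" using ap_kernel unfolding ap_def by blast
 show "EX c. finite (c ` GG) & modulus c e (conv a)" using e nrm_nonneg[OF assms] modulus_mono[OF modulus_conv[OF assms c(2)]] d c(1) by (auto simp: field_simps)
qed

lemma conv_left:
 assumes "ap a" "s:GG" "g:GG"
 shows "conv (%x. a (s ## x)) g=conv a (s ## g)"
proof -
 have "conv a (s ## g)=mean (%h. \<kappa> (inv (s ## g) ## (s ## h)) * a (s ## h))" unfolding conv_def
  using mean_left[of "%h. \<kappa> (inv (s ## g) ## h) * a h" s] assms by (simp add: ap_mult ap_translate)
 also have "... = mean (%h. \<kappa> (inv g ## h) * a (s ## h))"
 proof (rule mean_cong)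
  fix h assume "h:GG"
  hence "inv s ## (s ## h)=h" using assms(2) by (metis inv_closed l_inv l_one m_assoc)
  hence "inv (s ## g) ## (s ## h)=inv g ## h" using assms \<open>h \<in> carrier G\<close> by (simp add: inv_mult_group m_assoc)
  thus "\<kappa> (inv (s ## g) ## (s ## h)) * a (s ## h)=\<kappa> (inv g ## h) * a (s ## h)" by simp
 qed
 finally show ?thesis unfolding conv_def by simp
qed

text \<open>Exchange of the two means together with the symmetry \<kappa>(g^-1 h) = \<kappa>(h^-1
  g). The modulus required by \<open>mean_fubini\<close> comes from the pair of colourings of the
  kernel and of a.\<close>

lemma conv_symmetric:
 assumes a: "ap a" and b: "ap b"
 shows "ip (conv a) b=ip a (conv b)"
proof -
 obtain A where A: "A > 0" "!!x. x:GG ==> abs (a x)<=A" by (rule ap_bounded[OF a]) (rule that)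
 obtain B where B: "B > 0" "!!x. x:GG ==> abs (b x)<=B" by (rule ap_bounded[OF b]) (rule that)
 let ?F = "%g h. \<kappa> (inv g ## h) * a h * b g"
 have m1: "mean (?F g)=conv a g * b g" if "g:GG" for g using mean_cmult[OF ap_mult[OF ap_translate[OF that] a], of "b g"]
  unfolding conv_def by (simp add: mult.commute mult.left_commute)
 have sw: "?F g h=a h * (\<kappa> (inv h ## g) * b g)" if "g:GG" "h:GG" for g h using kernel_swap[OF that] by simp
 have m2: "mean (%g. ?F g h)=a h * conv b h" if "h:GG" for h
 proof -
  have "mean (%g. ?F g h)=mean (%g. a h * (\<kappa> (inv h ## g) * b g))" using that by (intro mean_cong sw) auto
  thus ?thesis unfolding conv_def using mean_cmult[OF ap_mult[OF ap_translate[OF that] b]] by simp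
 qed
 have "mean (%g. mean (?F g))=mean (%h. mean (%g. ?F g h))"
 proof (rule mean_fubini)
  fix e :: real assume e: "e > 0"
  let ?d = "e / (B * (A + 1))"
  have d: "?d > 0" using e A B by simp
  obtain c where c: "finite (c ` GG)" "modulus c ?d \<kappa>" using ap_kernel d unfolding ap_def by blast
  obtain c' where c': "finite (c' ` GG)" "modulus c' ?d a" using a d unfolding ap_def by blast
  let ?c = "%g. prod_encode (c g, c' g)"
  have "modulus ?c e (?F g)" if g: "g:GG" for g
  proof (rule modulus_combine[OF modulus_pair_colour(1)[OF modulus_left[OF c(2)]] modulus_pair_colour(2)[OF c'(2)]])
  show "inv g:GG" using g by simp
  fix x y assume xy: "x:GG" "y:GG"
  "abs (\<kappa> (inv g ## x) - \<kappa> (inv g ## y))<=?d" "abs (a x - a y)<=?d"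
  have "?F g x - ?F g y=((\<kappa> (inv g ## x) - \<kappa> (inv g ## y)) * a x + \<kappa> (inv g ## y) * (a x - a y)) * b g"
  by (simp add: algebra_simps)
  also have "abs (...)<=(abs (\<kappa> (inv g ## x) - \<kappa> (inv g ## y)) * abs (a x) + abs (\<kappa> (inv g ## y)) * abs (a x - a y)) * abs (b g)"
  unfolding abs_mult by (intro mult_right_mono order_trans[OF abs_triangle_ineq]) (auto simp: abs_mult)
  also have "... <= (?d * A + 1 * ?d) * B" using xy g A B d kernel_bounds[of "inv g ## y"]
  by (intro mult_mono add_mono add_nonneg_nonneg mult_nonneg_nonneg) auto
  also have "... = ?d * (B * (A + 1))" by (simp only: distrib_left distrib_right mult_ac mult_1 mult_1_right)
  also have "... = e" using A B by simp
  finally show "abs (?F g x - ?F g y)<=e" .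
  qed
  thus "EX c. finite (c ` GG) & (ALL g:GG. modulus c e (?F g))" using finite_pair_colour[OF c(1) c'(1)] by blast
 next
  show "0<=1 * A * B" using A B by simp
  show "abs (?F g h)<=1 * A * B" if "g:GG" "h:GG" for g h
  unfolding abs_mult using kernel_bounds[of "inv g ## h"] A B that by (intro mult_mono) auto
  show "ap (%g. mean (?F g))" by (rule ap_cong[OF _ ap_mult[OF ap_conv[OF a] b]]) (simp add: m1)
  show "ap (%g. ?F g h)" if "h:GG" for h
  by (rule ap_cong[OF _ ap_cmult[OF ap_mult[OF ap_translate[OF that] b], of "a h"]]) (rule sw[OF _ that, symmetric])
  show "ap (%h. mean (%g. ?F g h))" by (rule ap_cong[OF _ ap_mult[OF a ap_conv[OF b]]]) (simp add: m2)
 qed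
 thus ?thesis unfolding ip_def
  using mean_cong[of "%g. mean (?F g)" "%g. conv a g * b g"] mean_cong[of "%h. mean (%g. ?F g h)" "%h. a h * conv b h"]
  m1 m2 by simp
qed

lemma nrm_conv: "ap a ==> nrm (conv a)<=nrm a" by (rule nrm_le) (auto intro: ap_conv nrm_nonneg conv_bound)

lemma conv_zero: "ap a ==> ip a a=0 ==> g:GG ==> conv a g=0" using conv_bound[of a g] by (simp add: nrm_def)

lemma ip_conv_conv: "ap a ==> ap b ==> ip (conv (conv a)) b=ip (conv a) (conv b)" by (simp add: conv_symmetric ap_conv)

definition orth :: "('a => real) set => ('a => real) => bool" where
 "orth E a \<longleftrightarrow> ap a & (ALL e:E. ip a e=0)"

text \<open>Scaling to norm one, except for functions of norm zero, which the operator
  annihilates.\<close>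

lemma orth_homogeneous:
 assumes E: "!!e. e:E ==> ap e"
  and le: "!!a. orth E a ==> ip a a<=1 ==> ip (conv a) (conv a)<=m"
  and a: "orth E a"
 shows "ip (conv a) (conv a)<=m * ip a a"
proof (cases "ip a a=0")
 case True
 have "ip (conv a) (conv a)=ip (conv a) (%_. 0)" using a True by (smt (verit) orth_def ip_cong conv_zero)
 thus ?thesis using True by (simp add: ip_def)
next
 case False
 have ap: "ap a" using a by (simp add: orth_def)
 have pos: "ip a a > 0" using ip_nonneg[OF ap] False by simp
 define t where "t=1 / nrm a"
 have t: "t * t * ip a a=1" using pos nrm_square[OF ap] by (simp add: t_def power2_eq_square nrm_def)
 have "orth E (%x. t * a x)" using a E unfolding orth_def by (auto simp: ap_cmult ip_cmult_left)
 moreover have "ip (%x. t * a x) (%x. t * a x)=1" using t by (simp add: ip_cmult_left ip_cmult_right ap ap_cmult mult.assoc)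
 ultimately have "ip (conv (%x. t * a x)) (conv (%x. t * a x))<=m" using le by simp
 moreover have "ip (conv (%x. t * a x)) (conv (%x. t * a x))=ip (%x. t * conv a x) (%x. t * conv a x)"
  by (rule ip_cong) (auto simp: conv_cmult ap)
 ultimately have "ip a a * (t * t * ip (conv a) (conv a))<=ip a a * m" using pos by (simp add: ip_cmult_left ip_cmult_right ap_conv ap ap_cmult mult.assoc)
 moreover have "ip a a * (t * t * ip (conv a) (conv a))=(t * t * ip a a) * ip (conv a) (conv a)" by (simp add: mult_ac)
 ultimately show ?thesis using t by (simp add: mult.commute)
qed

text \<open>The maximiser of the quadratic form is found as a limit of an almost maximising sequence,
 to which the operator is applied twice: its image is uniformly almost periodic, so a
 subsequence converges uniformly.\<close>

lemma eigenfunction_exists: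
 assumes E: "!!e. e:E ==> ap e" "!!e. e:E ==> EX r. ALL x:GG. conv (conv e) x=r * e x"
  and a0: "orth E a0" "ip a0 a0<=1" "ip (conv a0) (conv a0) >= f" and f: "f > 0"
 obtains b m where "orth E b" "m >= f" "ip b b > 0" "!!x. x:GG ==> conv (conv b) x=m * b x"
proof -
 define Q where "Q={ip (conv a) (conv a) | a. orth E a & ip a a<=1}"
 define m where "m=Sup Q"
 have n1: "nrm a<=1" if "orth E a" "ip a a<=1" for a using that by (simp add: nrm_def orth_def)
 have "q<=1" if "q:Q" for q
 proof -
  obtain a where a: "q=ip (conv a) (conv a)" "orth E a" "ip a a<=1" using \<open>q \<in> Q\<close> by (auto simp: Q_def)
  thus ?thesis using n1[OF a(2,3)] nrm_conv[of a] a ip_nonneg[of "conv a"] ap_conv by (simp add: nrm_def orth_def real_sqrt_le_1_iff)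
 qed
 hence bdd: "bdd_above Q" by (intro bdd_aboveI) auto
 have Qup: "q<=m" if "q:Q" for q unfolding m_def using that bdd by (rule cSup_upper)
 have "f<=m" using Qup[of "ip (conv a0) (conv a0)"] a0 by (fastforce simp: Q_def)
 hence "m > 0" using f by simp
 have hom: "ip (conv a) (conv a)<=m * ip a a" if "orth E a" for a
  by (rule orth_homogeneous[OF E(1) _ that]) (use Qup in \<open>auto simp: Q_def\<close>)
 have "EX a. orth E a & ip a a<=1 & ip (conv a) (conv a) > m - 1 / Suc n" for n
 proof -
  have "EX q:Q. m - 1 / Suc n < q" unfolding m_def using a0 bdd by (intro less_cSupD) (auto simp: Q_def)
  thus ?thesis by (auto simp: Q_def)
 qed
 then obtain a where a: "!!n. orth E (a n)" "!!n. ip (a n) (a n)<=1"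
  "!!n. ip (conv (a n)) (conv (a n)) > m - 1 / Suc n" by metis
 have apa: "ap (a n)" for n using a(1) by (simp add: orth_def)
 define b where "b n=conv (conv (a n))" for n
 have apb: "ap (b n)" for n unfolding b_def by (intro ap_conv apa)
 have na: "nrm (a n)<=1" "nrm (conv (a n))<=1" for n using n1[OF a(1,2)] nrm_conv[OF apa, of n] by (auto intro: order_trans)
 \<comment> \<open>The members of E are eigenfunctions of the squared operator, so their orthogonal
   complement is invariant under it. This allows \<open>hom\<close> to be applied to b n as
   well.\<close>
 have orthb: "orth E (b n)" for n unfolding orth_def
 proof (intro conjI ballI)
  show "ap (b n)" by (rule apb)
  fix e assume e: "e:E"
  then obtain r where r: "!!x. x:GG ==> conv (conv e) x=r * e x" using E(2) by blast
  have "ip (b n) e=ip (a n) (conv (conv e))" unfolding b_def using E(1)[OF e] apa by (simp add: conv_symmetric ap_conv)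
  also have "... = ip (a n) (%x. r * e x)" by (rule ip_cong) (auto simp: r)
  also have "... = 0" using a(1)[of n] e E(1)[OF e] by (simp add: ip_cmult_right orth_def)
  finally show "ip (b n) e=0" .
 qed
 define d where "d n x=b n x - m * a n x" for n x
 have apd: "ap (d n)" for n unfolding d_def by (intro ap_diff ap_cmult apb apa)
 \<comment> \<open>The square expands into at most m^2 - 2 m (m - 1/(n + 1)) + m^2. The bound by m
   for the norm of b n follows from writing its square as the inner product of
   \<open>conv (a n)\<close> and \<open>conv (b n)\<close> and using \<open>hom\<close> for both
   factors.\<close>
 have nd: "ip (d n) (d n)<=2 * m / Suc n" for n
 proof -
  have "ip (b n) (b n)=ip (conv (a n)) (conv (b n))" unfolding b_def[of n] by (subst ip_conv_conv) (auto intro: apa ap_conv)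
  also have "... <= nrm (conv (a n)) * nrm (conv (b n))" using ip_cauchy_schwarz[OF ap_conv[OF apa] ap_conv[OF apb]] by (meson abs_le_D1)
  also have "... <= sqrt (m * ip (a n) (a n)) * sqrt (m * ip (b n) (b n))"
  unfolding nrm_def using hom[OF a(1)] hom[OF orthb] \<open>m > 0\<close>
  by (intro mult_mono real_sqrt_le_mono) (auto simp: ip_nonneg apa apb ap_conv)
  also have "... = m * nrm (a n) * nrm (b n)" using \<open>m > 0\<close> by (simp add: nrm_def real_sqrt_mult)
  finally have "nrm (b n) * nrm (b n)<=m * nrm (a n) * nrm (b n)" using nrm_square[OF apb] by (simp add: power2_eq_square)
  hence "nrm (b n)<=m * nrm (a n)" if "nrm (b n) > 0" using that by simp
  moreover have "m * nrm (a n)<=m * 1" using na(1)[of n] \<open>m > 0\<close> by (intro mult_left_mono) auto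
  ultimately have "nrm (b n)<=m * 1" using nrm_nonneg[OF apb, of n] \<open>m > 0\<close> by (cases "nrm (b n) > 0") linarith+
  hence b2: "ip (b n) (b n)<=m * m"
  using mult_mono[of "nrm (b n)" m "nrm (b n)" m] nrm_square[OF apb, of n] nrm_nonneg[OF apb, of n] \<open>m > 0\<close>
  by (simp add: power2_eq_square)
  have "ip (b n) (a n)=ip (conv (a n)) (conv (a n))" unfolding b_def by (rule ip_conv_conv[OF apa apa])
  hence "ip (d n) (d n)=ip (b n) (b n) - 2 * m * ip (conv (a n)) (conv (a n)) + m\<^sup>2 * ip (a n) (a n)"
  unfolding d_def using ip_diff_square[OF apb apa, of n m n] by simp
  moreover have "m * (ip (conv (a n)) (conv (a n))) >= m * (m - 1 / Suc n)"
  using a(3)[of n] \<open>m > 0\<close> by (intro mult_left_mono) auto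
  moreover have "m\<^sup>2 * ip (a n) (a n)<=m\<^sup>2 * 1" using a(2) by (intro mult_left_mono) auto
  ultimately have "ip (d n) (d n)<=2 * (m * m) - 2 * (m * (m - 1 / Suc n))"
  using b2 unfolding power2_eq_square mult.assoc mult_1_right by linarith
  thus ?thesis by (simp add: algebra_simps)
 qed
 obtain r l where r: "strict_mono (r :: nat => nat)" "ap l"
  "!!e. e > 0 ==> EX N. ALL n>=N. ALL x:GG. abs (b (r n) x - l x)<=e"
 proof (rule uniform_subsequence[of b 1])
  fix e :: real assume e: "e > 0"
  then obtain c where c: "finite (c ` GG)" "modulus c e \<kappa>" using ap_kernel unfolding ap_def by blast
  have "modulus c e (b n)" for n unfolding b_def
  proof (rule modulus_mono[OF modulus_conv[OF ap_conv[OF apa] c(2)]])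
  show "e * nrm (conv (a n))<=e" using e na(2)[of n] by simp
  qed (use e in simp)
  thus "EX c. finite (c ` GG) & (ALL n. modulus c e (b n))" using c(1) by blast
 next
  show "abs (b n x)<=1" if "x:GG" for n x unfolding b_def using conv_bound[OF ap_conv[OF apa] that, of n] na(2)[of n] by simp
 qed (rule that)
 have nl: "EX N. ALL n>=N. nrm (%x. b (r n) x - l x)<=e" if "e > 0" for e
 proof -
  obtain N where "ALL n>=N. ALL x:GG. abs (b (r n) x - l x)<=e" using r(3)[OF \<open>e > 0\<close>] by blast
  thus ?thesis using that by (intro exI[of _ N] allI impI nrm_le ap_diff apb r(2)) auto
 qed
 have small: "EX N. ALL n>=N. 2 * m / Suc (r n)<=e" if "e > 0" for e
 proof -
  obtain N :: nat where N: "real N > 2 * m / e" using reals_Archimedean2 by blast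
  have "2 * m / Suc (r n)<=e" if "n >= N" for n
  proof -
  have "r n >= n" using r(1) by (rule seq_suble)
  hence "real (Suc (r n)) >= real N" using that by simp
  hence "2 * m / e<=real (Suc (r n))" using N by linarith
  thus ?thesis using \<open>e > 0\<close> by (simp add: field_simps)
  qed
  thus ?thesis by blast
 qed
 have eig: "conv (conv l) x=m * l x" if x: "x:GG" for x
 proof -
  have "abs (conv (conv l) x - m * l x)<=0 + e" if "e > 0" for e
  proof -
  \<comment> \<open>Three errors add up to (2 + m) t = e: the squared operator on the difference of
    b (r n) and l, the squared operator on d (r n), and m times the difference of b (r n) and
    l.\<close>
  define t where "t=e / (2 + m)"
  have t: "t > 0" "t * (2 + m)=e" using that \<open>m > 0\<close> by (auto simp: t_def)
  obtain N1 where N1: "ALL n>=N1. nrm (%x. b (r n) x - l x)<=t" using nl[OF t(1)] by blast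
  obtain N2 where N2: "ALL n>=N2. 2 * m / Suc (r n)<=t\<^sup>2" using small[of "t\<^sup>2"] t(1) by auto
  obtain N3 where N3: "ALL n>=N3. ALL x:GG. abs (b (r n) x - l x)<=t" using r(3)[OF t(1)] by blast
  define n where "n=max N1 (max N2 N3)"
  have "nrm (%x. b (r n) x - l x)<=t" using N1 by (simp add: n_def)
  hence "abs (conv (conv (%x. b (r n) x - l x)) x)<=t" using conv_bound[OF ap_conv[OF ap_diff[OF apb r(2)]] x, of "r n"]
  nrm_conv[OF ap_diff[OF apb r(2)], of "r n"] by linarith
  moreover have "conv (conv (%x. b (r n) x - l x)) x=conv (conv (b (r n))) x - conv (conv l) x"
  proof -
  have "conv (%x. b (r n) x - l x) y=conv (b (r n)) y - conv l y" if "y:GG" for y using that by (simp add: conv_diff apb r(2))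
  hence "conv (conv (%x. b (r n) x - l x))=conv (%y. conv (b (r n)) y - conv l y)" by (rule conv_cong)
  thus ?thesis using x by (simp add: conv_diff apb r(2) ap_conv)
  qed
  moreover have "nrm (d (r n))<=t"
  proof -
  have "ip (d (r n)) (d (r n))<=t\<^sup>2" using nd[of "r n"] N2 by (simp add: n_def) (meson max.cobounded1 max.cobounded2 order_trans)
  thus ?thesis unfolding nrm_def using t(1) by (intro real_le_lsqrt) auto
  qed
  hence "abs (conv (conv (d (r n))) x)<=t" using conv_bound[OF ap_conv[OF apd] x, of "r n"] nrm_conv[OF apd, of "r n"] by linarith
  moreover have "conv (conv (d (r n))) x=conv (conv (b (r n))) x - m * b (r n) x"
  proof -
  have "conv (d (r n)) y=conv (b (r n)) y - m * conv (a (r n)) y" if "y:GG" for y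
  unfolding d_def using that by (simp add: conv_diff conv_cmult apa apb ap_cmult)
  hence "conv (conv (d (r n)))=conv (%y. conv (b (r n)) y - m * conv (a (r n)) y)" by (rule conv_cong)
  thus ?thesis using x by (simp add: conv_diff conv_cmult apa apb ap_cmult ap_conv b_def[of "r n"])
  qed
  moreover have "m * abs (b (r n) x - l x)<=m * t" using N3 x \<open>m > 0\<close> by (intro mult_left_mono) (auto simp: n_def)
  hence "abs (m * b (r n) x - m * l x)<=m * t" using \<open>m > 0\<close> by (simp flip: right_diff_distrib add: abs_mult)
  ultimately have "abs (conv (conv l) x - m * l x)<=t + t + m * t" by linarith
  thus ?thesis using t(2) by (simp add: algebra_simps)
  qed
  hence "abs (conv (conv l) x - m * l x)<=0" using field_le_epsilon by blast
  thus ?thesis by simp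
 qed
 have orthl: "orth E l" unfolding orth_def
 proof (intro conjI ballI)
  show "ap l" by (rule r(2))
  fix e assume e: "e:E"
  have "abs (ip l e)<=0 + t" if "t > 0" for t
  proof -
  have "t / (nrm e + 1) > 0" using that nrm_nonneg[OF E(1)[OF e]] by simp
  then obtain n where n: "nrm (%x. b (r n) x - l x)<=t / (nrm e + 1)" using nl by blast
  have "ip (%x. b (r n) x - l x) e = - ip l e" using orthb[of "r n"] e by (simp add: ip_diff_left apb r(2) E(1) orth_def)
  hence "abs (ip l e)<=nrm (%x. b (r n) x - l x) * nrm e" using ip_cauchy_schwarz[OF ap_diff[OF apb r(2)] E(1)[OF e], of "r n"] by simp
  also have "... <= t / (nrm e + 1) * nrm e" using n nrm_nonneg[OF E(1)[OF e]] by (rule mult_right_mono)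
  also have "... <= t" using that nrm_nonneg[OF E(1)[OF e]] by (simp add: field_simps)
  finally show ?thesis by simp
  qed
  hence "abs (ip l e)<=0" using field_le_epsilon by blast
  thus "ip l e=0" by simp
 qed
 have "ip l l ~= 0"
 proof
  assume l0: "ip l l=0"
  \<comment> \<open>If l were null, the inner product of b (r n) - l with a (r n) would be that of b
    (r n), hence above m - t = 3 m / 4, whereas Cauchy-Schwarz bounds it by t = m / 4.\<close>
  define t where "t=m / 4"
  have t: "t > 0" using \<open>m > 0\<close> by (simp add: t_def)
  obtain N1 where N1: "ALL n>=N1. nrm (%x. b (r n) x - l x)<=t" using nl[OF t] by blast
  obtain N2 where N2: "ALL n>=N2. 2 * m / Suc (r n)<=2 * m * t" using small[of "2 * m * t"] t \<open>m > 0\<close> by auto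
  define n where "n=max N1 N2"
  have "n >= N2" by (simp add: n_def)
  hence "2 * m * (1 / Suc (r n))<=2 * m * t" using N2 by auto
  hence "1 / Suc (r n)<=t" using \<open>m > 0\<close> by (subst (asm) mult_le_cancel_left_pos) auto
  hence "ip (conv (a (r n))) (conv (a (r n))) > m - t" using a(3)[of "r n"] by linarith
  hence "ip (b (r n)) (a (r n)) > m - t" unfolding b_def by (simp add: ip_conv_conv[OF apa apa])
  moreover have "ip (%x. b (r n) x - l x) (a (r n))=ip (b (r n)) (a (r n))"
  using nrm_zero_ip[OF r(2) apa l0] by (simp add: ip_diff_left apb r(2) apa)
  moreover have "abs (ip (%x. b (r n) x - l x) (a (r n)))<=nrm (%x. b (r n) x - l x) * nrm (a (r n))"
  by (rule ip_cauchy_schwarz[OF ap_diff[OF apb r(2)] apa])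
  moreover have "nrm (%x. b (r n) x - l x) * nrm (a (r n))<=t * 1"
  using N1 na(1) t nrm_nonneg[OF apa] by (intro mult_mono) (auto simp: n_def)
  ultimately show False using \<open>m > 0\<close> by (simp add: t_def)
 qed
 hence "ip l l > 0" using ip_nonneg[OF r(2)] by simp
 thus thesis using that[OF orthl \<open>f \<le> m\<close> _ eig] by blast
qed


text \<open>Orthonormal eigenfunctions of the squared operator with eigenvalues at least r.\<close>

definition esys :: "real => nat => (nat => 'a => real) => bool" where
 "esys r n f \<longleftrightarrow> (ALL i<n. ap (f i)) &
  (ALL i<n. EX m>=r. ALL x:GG. conv (conv (f i)) x=m * f i x) &
  (ALL i<n. ALL j<n. ip (f i) (f j)=(if i=j then 1 else 0))"

lemma ip_orthonormal_sum:
 assumes "esys r n f" "j < n"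
 shows "ip (%x. \<Sum>i<n. c i * f i x) (f j)=c j"
proof -
 have "ip (%x. \<Sum>i<n. c i * f i x) (f j)=(\<Sum>i<n. c i * (if i=j then 1 else 0))" using assms unfolding esys_def
  by (subst ip_sum_left) (auto intro!: ap_cmult sum.cong simp: ip_cmult_left)
 also have "... = c j" using assms(2) by (simp add: sum.delta mult_if_delta if_distrib cong: if_cong)
 finally show ?thesis .
qed

lemma ap_eigen_sum: "esys r n f ==> ap (%x. \<Sum>i<n. c i * f i x)" by (auto simp: esys_def intro!: ap_sum ap_cmult)

lemma bessel_inequality:
 assumes "esys r n f" "ap u"
 shows "ip (%x. u x - (\<Sum>i<n. ip u (f i) * f i x)) (%x. u x - (\<Sum>i<n. ip u (f i) * f i x))
  = ip u u - (\<Sum>i<n. (ip u (f i))\<^sup>2)"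
proof -
 let ?s = "%x. \<Sum>i<n. ip u (f i) * f i x"
 have ap: "ap (f i)" if "i < n" for i using assms(1) that by (simp add: esys_def)
 have "ip ?s b=(\<Sum>i<n. ip u (f i) * ip (f i) b)" if "ap b" for b
  using ap that by (subst ip_sum_left) (auto intro!: ap_cmult sum.cong simp: ip_cmult_left)
 note expand = this
 have "ip u ?s=(\<Sum>i<n. (ip u (f i))\<^sup>2)"
  using expand[OF assms(2)] unfolding ip_commute[of ?s u] ip_commute[of "f _" u] power2_eq_square .
 moreover have "ip ?s ?s=(\<Sum>i<n. (ip u (f i))\<^sup>2)"
 proof -
  have "ip (f i) ?s=ip u (f i)" if "i < n" for i unfolding ip_commute[of "f i" ?s] by (rule ip_orthonormal_sum[OF assms(1) that])
  thus ?thesis using expand[OF ap_eigen_sum[OF assms(1), of "%i. ip u (f i)"]] by (simp add: power2_eq_square)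
 qed
 ultimately show ?thesis using ip_diff_square[OF assms(2) ap_eigen_sum[OF assms(1), of "%i. ip u (f i)"], of 1] by simp
qed

text \<open>The Hilbert-Schmidt bound. For fixed g the numbers \<open>conv (f i) g\<close> are the
  coefficients of a translate of the kernel, so Bessel bounds the sum of their squares by 1;
  averaging over g gives at least r for every i.\<close>

lemma eigensystem_card:
 assumes f: "esys r n f"
 shows "real n * r<=1"
proof -
 have ap: "ap (f i)" if "i < n" for i using f that by (simp add: esys_def)
 have point: "(\<Sum>i<n. conv (f i) g * conv (f i) g)<=1" if g: "g:GG" for g
 proof -
  let ?u = "%h. \<kappa> (inv g ## h)"
  have "nrm ?u<=1" using kernel_bounds g by (intro nrm_le ap_translate) auto
  hence "ip ?u ?u<=1" using nrm_square[OF ap_translate[OF g]] using nrm_nonneg[OF ap_translate[OF g]] by (metis power_le_one)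
  thus ?thesis using bessel_inequality[OF f ap_translate[OF g]]
  ip_nonneg[OF ap_diff[OF ap_translate[OF g] ap_eigen_sum[OF f, of "%i. ip ?u (f i)"]]] by (simp add: conv_eq_ip power2_eq_square)
 qed
 have "r<=ip (conv (f i)) (conv (f i))" if i: "i < n" for i
 proof -
  obtain m where m: "m >= r" "!!x. x:GG ==> conv (conv (f i)) x=m * f i x" using f i unfolding esys_def by blast
  have "ip (conv (f i)) (conv (f i))=ip (conv (conv (f i))) (f i)" using ap i by (simp add: ip_conv_conv)
  also have "... = ip (%x. m * f i x) (f i)" by (rule ip_cong) (auto simp: m)
  also have "... = m" using f i ap by (simp add: ip_cmult_left esys_def)
  finally show ?thesis using m(1) by simp
 qed
 hence "(\<Sum>i<n. r)<=(\<Sum>i<n. ip (conv (f i)) (conv (f i)))" by (intro sum_mono) auto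
 also have "... = mean (%g. \<Sum>i<n. conv (f i) g * conv (f i) g)"
  unfolding ip_def using ap by (intro mean_sum[symmetric] ap_mult ap_conv) auto
 also have "... <= mean (%_. 1)" using ap point by (intro mean_mono ap_sum ap_mult ap_conv ap_const) auto
 finally show ?thesis by simp
qed

text \<open>By the bound on n there is a longest system. An eigenfunction of positive norm that is
  orthogonal to it could be normalised and appended.\<close>

lemma maximal_eigensystem:
 assumes r: "r > 0"
 obtains n f where "esys r n f"
  "!!b m. [|orth (f ` {..<n}) b; m >= r; !!x. x:GG ==> conv (conv b) x=m * b x|] ==> ip b b=0"
proof -
 define P where "P n \<longleftrightarrow> (EX f. esys r n f)" for n
 have "P 0" by (simp add: P_def esys_def)
 moreover have "n<=nat \<lceil>1 / r\<rceil>" if "P n" for n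
 proof -
  have "real n<=1 / r" using that eigensystem_card r by (auto simp: P_def field_simps)
  thus ?thesis by linarith
 qed
 ultimately obtain n where n: "P n" "~P (Suc n)" by (metis GreatestI_nat Greatest_le_nat lessI not_le)
 obtain f where f: "esys r n f" using n(1) by (auto simp: P_def)
 show thesis
 proof (rule that[OF f])
  fix b m assume b: "orth (f ` {..<n}) b" "m >= r" "!!x. x:GG ==> conv (conv b) x=m * b x"
  show "ip b b=0"
  proof (rule ccontr)
  assume "ip b b ~= 0"
  have ap: "ap b" using b(1) by (simp add: orth_def)
  have nz: "nrm b * nrm b=ip b b" using nrm_square[OF ap] by (simp add: power2_eq_square)
  define t where "t=1 / nrm b"
  have t: "t * (t * ip b b)=1" using nz \<open>ip b b \<noteq> 0\<close> by (auto simp: t_def simp flip: nz)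
  define f' where "f'=f(n := %x. t * b x)"
  have eig: "conv (conv (%x. t * b x)) x=m * (t * b x)" if "x:GG" for x
  proof -
  have "conv (conv (%x. t * b x))=conv (%x. t * conv b x)" by (rule conv_cong) (simp add: conv_cmult ap)
  thus ?thesis using that b(3) by (simp add: conv_cmult ap_conv ap)
  qed
  have o: "ip (%x. t * b x) (f i)=0" "ip (f i) (%x. t * b x)=0" "ap (f i)" if "i < n" for i
  using b(1) f that by (auto simp: orth_def ip_cmult_left ap ip_commute[of "f i"] esys_def)
  have "ip (%x. t * b x) (%x. t * b x)=1" using t by (simp add: ip_cmult_left ip_cmult_right ap ap_cmult)
  hence "esys r (Suc n) f'" using f o eig b(2) ap by (auto simp: esys_def f'_def less_Suc_eq ap_cmult)
  thus False using n(2) by (auto simp: P_def)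
  qed
 qed
qed

text \<open>w is split into its projection to a maximal eigensystem and a remainder on which the
  operator is small. The span of the system is invariant under left translations because these
  commute with the operator.\<close>

lemma conv_conv_finite_approximation:
 assumes w: "ap w" and h: "h > 0"
 obtains n :: nat and f c where "!!i. i < n ==> ap (f i)"
  "!!s i. [|s:GG; i < n|] ==> EX d. ALL x:GG. f i (s ## x)=(\<Sum>j<n. d j * f j x)"
  "!!x. x:GG ==> abs (conv (conv w) x - (\<Sum>j<n. c j * f j x))<=h"
proof -
 \<comment> \<open>The remainder will satisfy a bound with factor sqrt k, and sqrt k * nrm w stays
   below h; adding 1 to the norm avoids a division by zero.\<close>
 define k where "k=(h / (nrm w + 1))\<^sup>2"
 have W: "nrm w >= 0" by (rule nrm_nonneg[OF w])
 have k: "k > 0" "sqrt k=h / (nrm w + 1)" using h W by (auto simp: k_def zero_less_power2)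
 obtain n f where f: "esys k n f"
  and max: "!!b m. [|orth (f ` {..<n}) b; m >= k; !!x. x:GG ==> conv (conv b) x=m * b x|] ==> ip b b=0"
  using maximal_eigensystem[OF k(1)] by metis
 have ap: "ap (f i)" if "i < n" for i using f that by (simp add: esys_def)
 have "ALL i. EX m. i < n --> m >= k & (ALL x:GG. conv (conv (f i)) x=m * f i x)" using f by (auto simp: esys_def)
 then obtain m where m: "!!i. i < n ==> m i >= k"
  "!!i x. [|i < n; x:GG|] ==> conv (conv (f i)) x=m i * f i x" by metis
 have orth_proj: "orth (f ` {..<n}) (%x. u x - (\<Sum>i<n. ip u (f i) * f i x))" if "ap u" for u using that ap ip_orthonormal_sum[OF f]
  by (auto simp: orth_def ip_diff_left ap_eigen_sum[OF f] intro!: ap_diff ap_eigen_sum[OF f])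
 have conv_comb: "conv (conv (%x. u x - (\<Sum>i<n. c i * f i x))) x=conv (conv u) x - (\<Sum>i<n. c i * (m i * f i x))"
  if u: "ap u" and x: "x:GG" for u c x
 proof -
  have "conv (conv (%x. u x - (\<Sum>i<n. c i * f i x)))=conv (%x. conv u x - (\<Sum>i<n. c i * conv (f i) x))"
  proof (rule conv_cong)
  fix x assume x: "x:GG"
  have "conv (%x. \<Sum>i<n. c i * f i x) x=(\<Sum>i<n. conv (%x. c i * f i x) x)" using ap x by (intro conv_sum ap_cmult) auto
  thus "conv (%x. u x - (\<Sum>i<n. c i * f i x)) x=conv u x - (\<Sum>i<n. c i * conv (f i) x)"
  using conv_diff[OF u ap_eigen_sum[OF f] x] ap x by (simp add: conv_cmult)
  qed
  moreover have "conv (%x. conv u x - (\<Sum>i<n. c i * conv (f i) x)) x=conv (conv u) x - (\<Sum>i<n. c i * conv (conv (f i)) x)"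
  proof -
  have ap': "ap (%x. c i * conv (f i) x)" if "i < n" for i using ap that by (intro ap_cmult ap_conv)
  hence "conv (%x. \<Sum>i<n. c i * conv (f i) x) x=(\<Sum>i<n. conv (%x. c i * conv (f i) x) x)" using x by (intro conv_sum) auto
  moreover have "ap (%x. \<Sum>i<n. c i * conv (f i) x)" using ap' by (intro ap_sum) auto
  ultimately show ?thesis using conv_diff[OF ap_conv[OF u] _ x] ap x by (simp add: conv_cmult ap_conv)
  qed
  ultimately show ?thesis using m(2) x by simp
 qed
 \<comment> \<open>A violation would provide, by \<open>eigenfunction_exists\<close>, an
   eigenfunction of positive norm and eigenvalue at least k orthogonal to the maximal
   system.\<close>
 have small: "ip (conv a) (conv a)<=k * ip a a" if "orth (f ` {..<n}) a" for a
 proof (rule orth_homogeneous[OF _ _ that])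
  show "ap e" if "e:f ` {..<n}" for e using that ap by auto
  fix a assume a: "orth (f ` {..<n}) a" "ip a a<=1"
  show "ip (conv a) (conv a)<=k"
  proof (rule ccontr)
  assume nle: "~ip (conv a) (conv a)<=k"
  obtain b \<nu> where "orth (f ` {..<n}) b" "\<nu> >= k" "ip b b > 0" "!!x. x:GG ==> conv (conv b) x=\<nu> * b x"
  proof (rule eigenfunction_exists[of "f ` {..<n}" a k])
  show "EX r. ALL x:GG. conv (conv e) x=r * e x" if "e:f ` {..<n}" for e using that m(2) by blast
  qed (use a nle k(1) ap in auto)
  thus False using max[of b \<nu>] by simp
  qed
 qed
 show thesis
 proof (rule that[of n f "%i. ip w (f i) * m i"])
  show "ap (f i)" if "i < n" for i by (rule ap[OF that])
  fix s i assume si: "s:GG" "i < n"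
  let ?e = "%x. f i (s ## x)"
  let ?e' = "%x. ?e x - (\<Sum>j<n. ip ?e (f j) * f j x)"
  have ape: "ap ?e" using ap_left[OF ap] si by blast
  have eig: "conv (conv ?e) x=m i * ?e x" if "x:GG" for x
  proof -
  have "conv (conv ?e)=conv (%x. conv (f i) (s ## x))" using si ap by (intro conv_cong) (simp add: conv_left)
  thus ?thesis using that si ap m(2) by (simp add: conv_left ap_conv)
  qed
  \<comment> \<open>The translate has eigenvalue m i and f j has eigenvalue m j, so by symmetry
    their inner product vanishes unless the eigenvalues agree. Hence the projected part of the
    translate is again an eigenfunction for m i.\<close>
  have same: "ip ?e (f j) * m j=ip ?e (f j) * m i" if "j < n" for j
  proof -
  have "m i * ip ?e (f j)=ip (%x. m i * ?e x) (f j)" using ape ap that by (simp add: ip_cmult_left)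
  also have "... = ip (conv (conv ?e)) (f j)" by (rule ip_cong) (auto simp: eig)
  also have "... = ip ?e (conv (conv (f j)))" using ape ap that by (simp add: conv_symmetric ap_conv)
  also have "... = ip ?e (%x. m j * f j x)" by (rule ip_cong) (auto simp: m that)
  also have "... = m j * ip ?e (f j)" using ape ap that by (simp add: ip_cmult_right)
  finally show ?thesis by (metis mult.commute)
  qed
  have eig': "conv (conv ?e') x=m i * ?e' x" if "x:GG" for x
  proof -
  have "(\<Sum>j<n. ip ?e (f j) * (m j * f j x))=(\<Sum>j<n. m i * (ip ?e (f j) * f j x))"
  proof (rule sum.cong[OF refl])
  fix j assume "j:{..<n}"
  hence "ip ?e (f j) * m j * f j x=ip ?e (f j) * m i * f j x" using same[of j] by simp
  thus "ip ?e (f j) * (m j * f j x)=m i * (ip ?e (f j) * f j x)" by (simp add: mult_ac)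
  qed
  thus ?thesis using conv_comb[OF ape that, of "%j. ip ?e (f j)"] eig[OF that] by (simp add: right_diff_distrib sum_distrib_left)
  qed
  have ape': "ap ?e'" using orth_proj[OF ape] by (simp add: orth_def)
  \<comment> \<open>By maximality the remainder of the translate is null. The operator sends null
    functions to zero pointwise, and the eigenvalue equation with m i > 0 then makes the remainder
    itself vanish pointwise.\<close>
  have "ip ?e' ?e'=0" using max[OF orth_proj[OF ape] m(1)[OF si(2)] eig'] by blast
  hence "conv ?e' g=0" if "g:GG" for g using conv_zero[OF ape'] that by blast
  hence "conv (conv ?e')=conv (%x. 0)" by (rule conv_cong)
  hence "m i * ?e' x=0" if "x:GG" for x using eig'[OF that] by (simp add: conv_def)
  hence "?e' x=0" if "x:GG" for x using that m(1)[OF si(2)] k(1) by fastforce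
  thus "EX d. ALL x:GG. f i (s ## x)=(\<Sum>j<n. d j * f j x)" by (intro exI[of _ "%j. ip ?e (f j)"]) auto
 next
  fix x assume x: "x:GG"
  let ?a = "%x. w x - (\<Sum>i<n. ip w (f i) * f i x)"
  have oa: "orth (f ` {..<n}) ?a" "ap ?a" using orth_proj[OF w] by (auto simp: orth_def)
  have "ip ?a ?a<=ip w w" using bessel_inequality[OF f w] by (simp add: sum_nonneg)
  hence "ip (conv ?a) (conv ?a)<=k * ip w w" using small[OF oa(1)] k(1) by (meson mult_left_mono less_imp_le order_trans)
  hence "nrm (conv ?a)<=sqrt k * nrm w" unfolding nrm_def using real_sqrt_le_mono by (fastforce simp flip: real_sqrt_mult)
  also have "... <= h" unfolding k(2) using W h by (simp add: field_simps)
  finally have "abs (conv (conv ?a) x)<=h" using conv_bound[OF ap_conv[OF oa(2)] x] by linarith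
  thus "abs (conv (conv w) x - (\<Sum>j<n. ip w (f j) * m j * f j x))<=h"
  using conv_comb[OF w x, of "%i. ip w (f i)"] by (simp add: mult.assoc)
 qed
qed

lemma conv_support:
 assumes "conv a g ~= 0"
 obtains h where "h:GG" "\<kappa> (inv g ## h) ~= 0" "a h ~= 0"
proof (rule ccontr)
 assume "~thesis"
 hence "conv a g=mean (%h. 0)" unfolding conv_def using that by (intro mean_cong) auto
 thus False using assms by simp
qed

lemma conv_nonneg: "ap a ==> (!!x. x:GG ==> a x >= 0) ==> g:GG ==> conv a g >= 0"
 unfolding conv_def using kernel_bounds by (intro mean_nonneg ap_mult ap_translate) auto

lemma mean_conv:
 assumes "ap a"
 shows "mean (conv a)=mean \<kappa> * mean a"
proof -
 have one: "conv (%x. 1) g=mean \<kappa>" if "g:GG" for g unfolding conv_def using mean_left[OF ap_kernel, of "inv g"] that by simp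
 have "mean (conv a)=ip (conv a) (%x. 1)" by (simp add: ip_def)
 also have "... = ip a (conv (%x. 1))" using assms by (simp add: conv_symmetric)
 also have "... = ip a (%x. mean \<kappa> * 1)" by (rule ip_cong) (auto simp: one)
 also have "... = mean \<kappa> * mean a" using assms by (subst ip_cmult_right) (auto simp: ip_def)
 finally show ?thesis .
qed

text \<open>Translates of the kernel to finitely many representatives add up to at least 1/2
  everywhere, since near its representative each point sees almost the value \<kappa>(1) = 1. All
  these translates have the same mean.\<close>

lemma mean_kernel_pos:
 assumes "\<kappa> \<one> = 1"
 shows "mean \<kappa> > 0"
proof -
 obtain c where c: "finite (c ` GG)" "modulus c (1/2) \<kappa>" using ap_kernel unfolding ap_def by (meson half_gt_zero zero_less_one)
 obtain Z where Z: "finite Z" "Z<=GG" "!!x. x:GG ==> EX z:Z. c z=c x" using colour_representatives[OF c(1)] by metis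
 have ap: "ap (%x. \<kappa> (inv z ## x))" if "z:Z" for z using that Z(2) ap_translate by blast
 have "1/2<=(\<Sum>z\<in>Z. \<kappa> (inv z ## x))" if x: "x:GG" for x
 proof -
  obtain z where z: "z:Z" "c z=c x" using Z(3)[OF x] by blast
  hence "abs (\<kappa> (inv z ## z ## \<one>) - \<kappa> (inv z ## x ## \<one>))<=1/2" using x Z(2) by (intro modulusD[OF c(2)]) auto
  moreover have "inv z ## z ## \<one> = \<one>" "inv z ## x ## \<one> = inv z ## x" using z(1) Z(2) x by auto
  ultimately have "1/2<=\<kappa> (inv z ## x)" using assms by (simp only: abs_le_iff) linarith
  also have "... <= (\<Sum>z\<in>Z. \<kappa> (inv z ## x))" using Z(1,2) z(1) x kernel_bounds by (intro member_le_sum) auto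
  finally show ?thesis .
 qed
 hence "mean (%x. 1/2)<=mean (%x. \<Sum>z\<in>Z. \<kappa> (inv z ## x))" using ap by (intro mean_mono ap_sum ap_const) auto
 also have "... = (\<Sum>z\<in>Z. mean (%x. \<kappa> (inv z ## x)))" using ap by (intro mean_sum)
 also have "... = (\<Sum>z\<in>Z. mean \<kappa>)" using Z(2) mean_left[OF ap_kernel] by (intro sum.cong) auto
 finally have "0 < real (card Z) * mean \<kappa>" by simp
 thus ?thesis by (metis mult_nonneg_nonpos not_less of_nat_0_le_iff)
qed

end

section \<open>Group actions on sets and equivariant projections\<close>

locale set_action = group +
 fixes X :: "'x set" and act :: "'a => 'x => 'x"
 assumes act_closed: "[|g:GG; x:X|] ==> act g x:X"
  and act_mult: "[|g:GG; h:GG; x:X|] ==> act (g ## h) x=act g (act h x)"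
  and act_one: "x:X ==> act \<one> x=x"
begin

lemma act_inv: "[|g:GG; x:X|] ==> act (inv g) (act g x)=x" "[|g:GG; x:X|] ==> act g (act (inv g) x)=x"
 by (metis act_mult act_one inv_closed l_inv) (metis act_mult act_one inv_closed r_inv)

definition orbit_ap :: "('x => real) => bool" where
 "orbit_ap u \<longleftrightarrow> (ALL x:X. ap (%h. u (act h x)))"

text \<open>Averaging the conjugates of a projection given by point evaluations makes it equivariant.\<close>

lemma equivariant_projection:
 fixes w :: "nat => 'x => real"
 assumes w: "!!i. i < n ==> orbit_ap (w i)"
  and bound: "!!i x. [|i < n; x:X|] ==> abs (w i x)<=C"
  and invar: "!!h i. [|h:GG; i < n|] ==> EX d. ALL x:X. w i (act h x)=(\<Sum>j<n. d j * w j x)"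
  and Y: "finite Y" "Y<=X"
  and dual: "!!i j. [|i < n; j < n|] ==> (\<Sum>y\<in>Y. \<alpha> j y * w i y)=(if i=j then 1 else 0)"
 obtains g :: "('x => real) => nat => real" and B where
  "!!u s x. [|orbit_ap u; s:GG; x:X|] ==>
  (\<Sum>i<n. g (%y. u (act s y)) i * w i x)=(\<Sum>i<n. g u i * w i (act s x))"
  "!!j x. [|j < n; x:X|] ==> (\<Sum>i<n. g (w j) i * w i x)=w j x"
  "!!u u' e i. [|orbit_ap u; orbit_ap u'; !!x. x:X ==> abs (u x - u' x)<=e; e >= 0; i < n|]
  ==> abs (g u i - g u' i)<=B * e"
proof -
 \<comment> \<open>The functionals \<open>a j\<close> are dual to the w j, so u |-> (\<Sum>j<n. a j
   u * w j) is a projection onto their span. The coordinates \<open>g u\<close> belong to its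
   average over the group: u is translated by h, projected and translated back.\<close>
 define a where "a j u=(\<Sum>y\<in>Y. \<alpha> j y * u y)" for j and u :: "'x => real"
 define g where "g u i=mean (%h. \<Sum>j<n. a j (%y. u (act h y)) * a i (%y. w j (act (inv h) y)))" for u i
 have expand: "w j (act h x)=(\<Sum>i<n. a i (%y. w j (act h y)) * w i x)"
  if h: "h:GG" and j: "j < n" and x: "x:X" for h j x
 proof -
  obtain d where d: "!!x. x:X ==> w j (act h x)=(\<Sum>i<n. d i * w i x)" using invar[OF h j] by blast
  have "a i (%y. w j (act h y))=d i" if "i < n" for i
  proof -
  have "a i (%y. w j (act h y))=(\<Sum>y\<in>Y. \<alpha> i y * (\<Sum>k<n. d k * w k y))"
  unfolding a_def using d Y(2) by (intro sum.cong) auto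
  also have "... = (\<Sum>k<n. d k * (\<Sum>y\<in>Y. \<alpha> i y * w k y))" by (simp add: sum_distrib_left sum.swap[of _ Y] mult_ac)
  also have "... = (\<Sum>k<n. d k * (if k=i then 1 else 0))" using dual that by (intro sum.cong) auto
  also have "... = d i" using that by (simp add: if_distrib cong: if_cong)
  finally show ?thesis .
  qed
  thus ?thesis using d[OF x] by simp
 qed
 have ap1: "ap (%h. a j (%y. u (act h y)))" if "orbit_ap u" for u j
  unfolding a_def using that Y(2) unfolding orbit_ap_def by (intro ap_sum ap_cmult) blast
 have ap2: "ap (%h. w j (act (inv h) x))" if "j < n" "x:X" for j x using ap_inv[of "%h. w j (act h x)"] w that by (simp add: orbit_ap_def)
 have ap3: "ap (%h. a i (%y. w j (act (inv h) y)))" if "j < n" for i j unfolding a_def using that Y(2) by (intro ap_sum ap_cmult ap2) auto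
 have proj: "(\<Sum>i<n. g u i * w i x)=mean (%h. \<Sum>j<n. a j (%y. u (act h y)) * w j (act (inv h) x))"
  if u: "orbit_ap u" and x: "x:X" for u x
 proof -
  have "mean (%h. \<Sum>j<n. a j (%y. u (act h y)) * w j (act (inv h) x))
  = mean (%h. \<Sum>i<n. w i x * (\<Sum>j<n. a j (%y. u (act h y)) * a i (%y. w j (act (inv h) y))))"
  proof (rule mean_cong)
  fix h assume h: "h:GG"
  have "(\<Sum>j<n. a j (%y. u (act h y)) * w j (act (inv h) x))
  = (\<Sum>j<n. a j (%y. u (act h y)) * (\<Sum>i<n. a i (%y. w j (act (inv h) y)) * w i x))"
  using expand[OF inv_closed[OF h] _ x] by simp
  also have "... = (\<Sum>i<n. w i x * (\<Sum>j<n. a j (%y. u (act h y)) * a i (%y. w j (act (inv h) y))))"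
  unfolding sum_distrib_left by (subst sum.swap) (simp add: mult_ac)
  finally show "(\<Sum>j<n. a j (%y. u (act h y)) * w j (act (inv h) x))
  = (\<Sum>i<n. w i x * (\<Sum>j<n. a j (%y. u (act h y)) * a i (%y. w j (act (inv h) y))))" .
  qed
  also have "... = (\<Sum>i<n. w i x * g u i)" unfolding g_def using ap1[OF u] ap3
  by (subst mean_sum) (auto intro!: ap_cmult ap_sum ap_mult sum.cong mean_cmult)
  finally show ?thesis by (simp add: mult.commute)
 qed
 have A: "EX A. ALL i<n. ALL h:GG. ALL j<n. abs (a i (%y. w j (act (inv h) y)))<=A & 0<=A"
 proof (intro exI[of _ "\<Sum>i<n. \<Sum>y\<in>Y. abs (\<alpha> i y) * abs (C)"] allI impI ballI conjI)
  fix i h j assume *: "i < n" "h:GG" "j < n"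
  have "abs (a i (%y. w j (act (inv h) y)))<=(\<Sum>y\<in>Y. abs (\<alpha> i y) * abs (C))" unfolding a_def
  proof (rule order_trans[OF sum_abs], rule sum_mono)
  fix y assume "y:Y"
  hence "abs (w j (act (inv h) y))<=abs (C)" using bound[of j "act (inv h) y"] * Y(2) act_closed[of "inv h" y] by force
  thus "abs (\<alpha> i y * w j (act (inv h) y))<=abs (\<alpha> i y) * abs (C)" unfolding abs_mult by (rule mult_left_mono) simp
  qed
  also have "... <= (\<Sum>i<n. \<Sum>y\<in>Y. abs (\<alpha> i y) * abs (C))" using * by (intro member_le_sum sum_nonneg) auto
  finally show "abs (a i (%y. w j (act (inv h) y)))<=(\<Sum>i<n. \<Sum>y\<in>Y. abs (\<alpha> i y) * abs (C))" .
 qed (simp add: sum_nonneg)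
 then obtain A where A: "!!i h j. [|i < n; h:GG; j < n|] ==> abs (a i (%y. w j (act (inv h) y)))<=A" by blast
 define B where "B=(\<Sum>j<n. (\<Sum>y\<in>Y. abs (\<alpha> j y)) * abs (A))"
 show thesis
 proof (rule that[of g B])
  fix u s x assume u: "orbit_ap u" and s: "s:GG" and x: "x:X"
  have us: "orbit_ap (%y. u (act s y))" unfolding orbit_ap_def
  proof
  fix x assume x: "x:X"
  have "ap (%h. u (act (s ## h) x))" using ap_left[of "%h. u (act h x)" s] u s x by (simp add: orbit_ap_def)
  thus "ap (%h. u (act s (act h x)))" by (rule ap_cong[rotated]) (simp add: act_mult s x)
  qed
  let ?m = "%h. \<Sum>j<n. a j (%y. u (act h y)) * w j (act (inv h) (act s x))"
  have apm: "ap ?m" using ap1[OF u] ap2 act_closed[OF s x] by (intro ap_sum ap_mult) auto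
  have "(\<Sum>i<n. g u i * w i (act s x))=mean ?m" using proj[OF u act_closed[OF s x]] .
  \<comment> \<open>Equivariance of the averaged projection is left invariance of the mean.\<close>
  also have "... = mean (%h. ?m (s ## h))" using mean_left[OF apm s] by simp
  also have "... = mean (%h. \<Sum>j<n. a j (%y. u (act s (act h y))) * w j (act (inv h) x))"
  proof (rule mean_cong)
  fix h assume h: "h:GG"
  have "act (inv (s ## h)) (act s x)=act (inv h) x" using h s x by (simp add: inv_mult_group act_mult act_closed act_inv)
  moreover have "a j (%y. u (act (s ## h) y))=a j (%y. u (act s (act h y)))" for j
  unfolding a_def using h s Y(2) by (intro sum.cong) (auto simp: act_mult subset_iff)
  ultimately show "?m (s ## h)=(\<Sum>j<n. a j (%y. u (act s (act h y))) * w j (act (inv h) x))" by simp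
  qed
  also have "... = (\<Sum>i<n. g (%y. u (act s y)) i * w i x)" using proj[OF us x] by simp
  finally show "(\<Sum>i<n. g (%y. u (act s y)) i * w i x)=(\<Sum>i<n. g u i * w i (act s x))" by simp
 next
  fix j x assume j: "j < n" and x: "x:X"
  have "(\<Sum>i<n. g (w j) i * w i x)=mean (%h. \<Sum>i<n. a i (%y. w j (act h y)) * w i (act (inv h) x))" by (rule proj[OF w[OF j] x])
  also have "... = mean (%h. w j x)"
  proof (rule mean_cong)
  fix h assume h: "h:GG"
  show "(\<Sum>i<n. a i (%y. w j (act h y)) * w i (act (inv h) x))=w j x"
  using expand[OF h j act_closed[OF inv_closed[OF h] x]] h x by (simp add: act_inv)
  qed
  finally show "(\<Sum>i<n. g (w j) i * w i x)=w j x" by simp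
 next
  fix u u' e i
  assume u: "orbit_ap u" "orbit_ap u'" and le: "!!x. x:X ==> abs (u x - u' x)<=e" and e: "e >= 0" and i: "i < n"
  show "abs (g u i - g u' i)<=B * e" unfolding g_def
  proof (rule mean_dist)
  fix h assume h: "h:GG"
  have d: "abs (a j (%y. u (act h y)) - a j (%y. u' (act h y)))<=(\<Sum>y\<in>Y. abs (\<alpha> j y)) * e" for j
  proof -
  have "a j (%y. u (act h y)) - a j (%y. u' (act h y))=(\<Sum>y\<in>Y. \<alpha> j y * (u (act h y) - u' (act h y)))"
  by (simp add: a_def sum_subtractf right_diff_distrib)
  also have "abs (...)<=(\<Sum>y\<in>Y. abs (\<alpha> j y) * e)"
  proof (rule order_trans[OF sum_abs], rule sum_mono, goal_cases)
  case (1 y)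
  hence "abs (u (act h y) - u' (act h y))<=e" using le act_closed h Y(2) by blast
  thus ?case unfolding abs_mult by (rule mult_left_mono) simp
  qed
  finally show ?thesis by (simp add: sum_distrib_right)
  qed
  have "(\<Sum>j<n. a j (%y. u (act h y)) * a i (%y. w j (act (inv h) y))) - (\<Sum>j<n. a j (%y. u' (act h y)) * a i (%y. w j (act (inv h) y)))
  = (\<Sum>j<n. (a j (%y. u (act h y)) - a j (%y. u' (act h y))) * a i (%y. w j (act (inv h) y)))"
  by (simp add: sum_subtractf left_diff_distrib)
  also have "abs (...)<=(\<Sum>j<n. ((\<Sum>y\<in>Y. abs (\<alpha> j y)) * e) * abs (A))"
  proof (rule order_trans[OF sum_abs], rule sum_mono, goal_cases)
  case (1 j)
  hence "abs (a i (%y. w j (act (inv h) y)))<=abs (A)" using A[OF i h, of j] by simp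
  thus ?case unfolding abs_mult using d[of j] e by (intro mult_mono) (auto intro!: mult_nonneg_nonneg sum_nonneg)
  qed
  also have "... = B * e" by (simp add: B_def sum_distrib_left sum_distrib_right mult_ac)
  finally show "abs ((\<Sum>j<n. a j (%y. u (act h y)) * a i (%y. w j (act (inv h) y))) - (\<Sum>j<n. a j (%y. u' (act h y)) * a i (%y. w j (act (inv h) y))))<=B * e" .
  qed (use ap1[OF u(1)] ap1[OF u(2)] ap3 in \<open>auto intro!: ap_sum ap_mult\<close>)
 qed
qed

end

section \<open>Isometric actions: finite dimensional invariant approximation\<close>

locale isometric_action = set_action +
 fixes p :: "'c => 'c => real"
 assumes nonempty: "X ~= {}"
  and p_nonneg: "[|x:X; y:X|] ==> 0<=p x y"
  and p_refl: "x:X ==> p x x=0"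
  and p_sym: "[|x:X; y:X|] ==> p x y=p y x"
  and p_triangle: "[|x:X; y:X; z:X|] ==> p x z<=p x y + p y z"
  and p_invariant: "[|g:GG; x:X; y:X|] ==> p (act g x) (act g y)=p x y"
  and totally_bounded: "e > 0 ==> EX c :: 'c => nat. finite (c ` X) & (ALL x:X. ALL y:X. c x=c y --> p x y<=e)"
begin

lemma representatives:
 assumes "e > 0"
 obtains Z where "finite Z" "Z<=X" "!!x. x:X ==> EX z:Z. p x z<=e"
proof -
 obtain c :: "'c => nat" where c: "finite (c ` X)" "!!x y. [|x:X; y:X; c x=c y|] ==> p x y<=e" using totally_bounded[OF assms] by metis
 show thesis
 proof (rule that[of "inv_into X c ` (c ` X)"])
  fix x assume "x:X"
  thus "EX z:inv_into X c ` (c ` X). p x z<=e" by (intro bexI[of _ "inv_into X c (c x)"] c(2)) (auto simp: f_inv_into_f inv_into_into)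
 qed (use c(1) in \<open>auto intro: inv_into_into\<close>)
qed

lemma p_bounded: obtains B where "!!x y. [|x:X; y:X|] ==> p x y<=B"
proof -
 obtain Z where Z: "finite Z" "Z<=X" "!!x. x:X ==> EX z:Z. p x z<=1" using representatives[of 1] by auto
 show thesis
 proof (rule that)
  fix x y assume x: "x:X" and y: "y:X"
  obtain z z' where z: "z:Z" "p x z<=1" "z':Z" "p y z'<=1" using Z(3) x y by meson
  have "p z z'=(%(z, z'). p z z') (z, z')" by simp
  also have "... <= (\<Sum>(z, z')\<in>Z \<times> Z. p z z')" by (rule member_le_sum) (use z Z(1,2) in \<open>auto intro!: p_nonneg\<close>)
  finally have "p z z'<=(\<Sum>(z, z')\<in>Z \<times> Z. p z z')" .
  moreover have "p x y<=p x z + p z y" "p z y<=p z z' + p z' y" "p z' y=p y z'" using x y z Z(2) by (auto intro: p_triangle p_sym)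
  ultimately show "p x y<=2 + (\<Sum>(z, z')\<in>Z \<times> Z. p z z')" using z by linarith
 qed
qed

text \<open>The uniform distance of two group elements as maps of X. It serves as a bi-invariant,
  totally bounded pseudometric on the group.\<close>

definition D :: "'a => 'a => real" where
 "D g h=(SUP x\<in>X. p (act g x) (act h x))"

lemma p_le_D:
 assumes "g:GG" "h:GG" "x:X"
 shows "p (act g x) (act h x)<=D g h"
proof -
 obtain B where "!!x y. [|x:X; y:X|] ==> p x y<=B" using p_bounded by blast
 hence "bdd_above ((%x. p (act g x) (act h x)) ` X)" using assms act_closed by (intro bdd_aboveI[of _ B]) auto
 thus ?thesis unfolding D_def using assms(3) by (intro cSUP_upper)
qed

lemma D_least: "(!!x. x:X ==> p (act g x) (act h x)<=e) ==> D g h<=e" unfolding D_def using nonempty by (intro cSUP_least) auto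

lemma D_sym: "[|g:GG; h:GG|] ==> D g h=D h g" unfolding D_def by (intro SUP_cong refl p_sym act_closed)

lemma D_nonneg: "[|g:GG; h:GG|] ==> 0<=D g h" using nonempty p_le_D[of g h] p_nonneg act_closed by (metis all_not_in_conv order_trans)

lemma D_refl: "g:GG ==> D g g=0" using D_nonneg[of g g] D_least[of g g 0] by (simp add: p_refl act_closed)

lemma D_triangle: "[|g:GG; h:GG; k:GG|] ==> D g k<=D g h + D h k"
 using p_triangle[OF act_closed act_closed act_closed] p_le_D by (intro D_least) (smt (verit))

text \<open>Invariance from the left is the invariance of p, from the right it holds because l
  permutes X.\<close>

lemma D_invariant:
 assumes "g:GG" "h:GG" "k:GG" "l:GG"
 shows "D (k ## g ## l) (k ## h ## l)=D g h"
proof (rule antisym)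
 have eq: "p (act (k ## g ## l) x) (act (k ## h ## l) x)=p (act g (act l x)) (act h (act l x))" if "x:X" for x
  using assms that by (simp add: act_mult act_closed p_invariant m_assoc)
 show "D (k ## g ## l) (k ## h ## l)<=D g h" using assms by (intro D_least) (simp add: eq act_closed p_le_D)
 show "D g h<=D (k ## g ## l) (k ## h ## l)"
 proof (rule D_least)
  fix x assume x: "x:X"
  have "p (act g x) (act h x)=p (act (k ## g ## l) (act (inv l) x)) (act (k ## h ## l) (act (inv l) x))"
  using eq[of "act (inv l) x"] assms x by (simp add: act_closed act_inv)
  also have "... <= D (k ## g ## l) (k ## h ## l)" using assms x by (intro p_le_D act_closed) auto
  finally show "p (act g x) (act h x)<=D (k ## g ## l) (k ## h ## l)" .
 qed
qed

text \<open>The colour of g records into which of finitely many small cells it moves each point of a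
  finite net. Both net and cells have scale e / 3, and isometry transfers the estimate from the net
  to X.\<close>

lemma D_totally_bounded:
 assumes "e > 0"
 obtains c :: "'a => nat" where "finite (c ` GG)"
  "!!g h. [|g:GG; h:GG; c g=c h|] ==> D g h<=e"
proof -
 have e3: "e / 3 > 0" using assms by simp
 obtain Z where Z: "finite Z" "Z<=X" "!!x. x:X ==> EX z:Z. p x z<=e / 3" using representatives[OF e3] by blast
 obtain c :: "'c => nat" where c: "finite (c ` X)" "!!x y. [|x:X; y:X; c x=c y|] ==> p x y<=e / 3" using totally_bounded[OF e3] by metis
 define F where "F g=(\<lambda>z\<in>Z. c (act g z))" for g
 have "F ` GG<=Z \<rightarrow>\<^sub>E c ` X" unfolding F_def using Z(2) act_closed by auto
 hence fin: "finite (F ` GG)" using finite_PiE[of Z "%_. c ` X"] Z(1) c(1) finite_subset by blast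
 obtain i :: "('c => nat) => nat" where i: "inj_on i (F ` GG)" using finite_imp_inj_to_nat_seg[OF fin] by metis
 show thesis
 proof (rule that[of "%g. i (F g)"])
  show "finite ((%g. i (F g)) ` GG)" using finite_imageI[OF fin, of i] by (simp add: image_image)
  fix g h assume gh: "g:GG" "h:GG" "i (F g)=i (F h)"
  hence Feq: "F g=F h" using i by (auto dest: inj_onD)
  show "D g h<=e"
  proof (rule D_least)
  fix x assume x: "x:X"
  then obtain z where z: "z:Z" "p x z<=e / 3" using Z(3) by blast
  have zX: "z:X" using z Z(2) by auto
  have "c (act g z)=c (act h z)" using fun_cong[OF Feq, of z] z(1) by (simp add: F_def)
  hence "p (act g z) (act h z)<=e / 3" using c(2) act_closed gh zX by blast
  moreover have "p (act g x) (act g z)<=e / 3" "p (act h z) (act h x)<=e / 3" using z gh x zX p_invariant p_sym by simp_all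
  moreover have "p (act g x) (act h x)<=p (act g x) (act g z) + p (act g z) (act h x)"
  "p (act g z) (act h x)<=p (act g z) (act h z) + p (act h z) (act h x)" using gh x zX by (auto intro!: p_triangle act_closed)
  ultimately show "p (act g x) (act h x)<=e" by linarith
  qed
 qed
qed

text \<open>A colouring for D is a modulus for the orbit functions because D is
  bi-invariant.\<close>

lemma orbit_ap_lipschitz:
 assumes "!!x y. [|x:X; y:X|] ==> abs (f x - f y)<=C * p x y"
 shows "orbit_ap f" unfolding orbit_ap_def ap_def
proof (intro ballI allI impI)
 fix x and e :: real assume x: "x:X" and e: "e > 0"
 let ?d = "e / (abs (C) + 1)"
 obtain c :: "'a => nat" where c: "finite (c ` GG)"
  "!!g h. [|g:GG; h:GG; c g=c h|] ==> D g h<=?d" using D_totally_bounded[of ?d] e by auto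
 have "modulus c e (%h. f (act h x))" unfolding modulus_def
 proof (intro ballI impI)
  fix g h k l assume *: "g:GG" "h:GG" "c g=c h" "k:GG" "l:GG"
  have P: "0<=p (act (k ## g ## l) x) (act (k ## h ## l) x)" using * x by (intro p_nonneg act_closed) auto
  have "p (act (k ## g ## l) x) (act (k ## h ## l) x)<=?d"
  using p_le_D[of "k ## g ## l" "k ## h ## l" x] D_invariant[of g h k l] c(2)[of g h] * x by simp
  hence "abs (C) * p (act (k ## g ## l) x) (act (k ## h ## l) x)<=abs (C) * ?d" by (rule mult_left_mono) simp
  also have "... <= e" using e by (simp add: field_simps)
  finally have "abs (C) * p (act (k ## g ## l) x) (act (k ## h ## l) x)<=e" .
  moreover have "C * p (act (k ## g ## l) x) (act (k ## h ## l) x)<=abs (C) * p (act (k ## g ## l) x) (act (k ## h ## l) x)"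
  using P by (intro mult_right_mono) auto
  moreover have "abs (f (act (k ## g ## l) x) - f (act (k ## h ## l) x))<=C * p (act (k ## g ## l) x) (act (k ## h ## l) x)"
  using * x by (intro assms act_closed) auto
  ultimately show "abs (f (act (k ## g ## l) x) - f (act (k ## h ## l) x))<=e" by linarith
 qed
 thus "EX c. finite (c ` GG) & modulus c e (%h. f (act h x))" using c(1) by blast
qed

text \<open>A tent of radius r around the identity; it is symmetric as D is invariant.\<close>

definition bump :: "real => 'a => real" where
 "bump r h=max 0 (1 - D h \<one> / r)"

lemma conv_kernel_bump:
 assumes r: "r > 0"
 shows "conv_kernel G (bump r)"
proof
 show "ap (bump r)" unfolding ap_def
 proof (intro allI impI)
  fix e :: real assume e: "e > 0"
  then obtain c :: "'a => nat" where c: "finite (c ` GG)"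
  "!!g h. [|g:GG; h:GG; c g=c h|] ==> D g h<=e * r" using D_totally_bounded[of "e * r"] r by auto
  have lip: "abs (bump r x - bump r y)<=D x y / r" if "x:GG" "y:GG" for x y
  proof -
  have "abs (D x \<one> - D y \<one>)<=D x y" using D_triangle[of x y \<one>] D_triangle[of y x \<one>] D_sym[of x y] that by auto
  hence "abs (D x \<one> / r - D y \<one> / r)<=D x y / r" using r by (simp add: divide_right_mono flip: diff_divide_distrib)
  thus ?thesis unfolding bump_def by linarith
  qed
  have "modulus c e (bump r)" unfolding modulus_def
  proof (intro ballI impI)
  fix g h k l assume *: "g:GG" "h:GG" "c g=c h" "k:GG" "l:GG"
  have "D (k ## g ## l) (k ## h ## l) / r<=e" using c(2)[of g h] * r by (simp add: D_invariant field_simps)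
  thus "abs (bump r (k ## g ## l) - bump r (k ## h ## l))<=e" using lip[of "k ## g ## l" "k ## h ## l"] * by simp
  qed
  thus "EX c. finite (c ` GG) & modulus c e (bump r)" using c(1) by blast
 qed
 show "bump r (inv h)=bump r h" if h: "h:GG" for h
  using D_invariant[of "inv h" \<one> h \<one>] D_sym[of \<one> h] h by (simp add: bump_def)
 show "0<=bump r h & bump r h<=1" if h: "h:GG" for h using D_nonneg[OF h one_closed] r by (simp add: bump_def)
qed

text \<open>Averaging f against a normalised kernel concentrated near the identity changes it by at
  most z / 2. Replacing the kernel by an element of a translation invariant space of finite
  dimension costs another z / 2 and leaves a combination of the w j.\<close>

lemma finite_approximation:
 fixes f :: "'c => real"
 assumes f: "!!x y. [|x:X; y:X|] ==> abs (f x - f y)<=p x y" and z: "z > 0"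
 obtains n :: nat and w c where
  "!!i. i < n ==> EX C. ALL x:X. ALL y:X. abs (w i x - w i y)<=C * p x y"
  "!!s i. [|s:GG; i < n|] ==> EX d. ALL x:X. w i (act s x)=(\<Sum>j<n. d j * w j x)"
  "!!x. x:X ==> abs (f x - (\<Sum>j<n. c j * w j x))<=z"
proof -
 \<comment> \<open>The twice convolved bump has radius 3 * r = z / 2.\<close>
 define r where "r=z / 6"
 have r: "r > 0" using z by (simp add: r_def)
 interpret conv_kernel G "bump r" by (rule conv_kernel_bump[OF r])
 obtain B where B: "!!x y. [|x:X; y:X|] ==> p x y<=B" using p_bounded by blast
 obtain x0 where x0: "x0:X" using nonempty by blast
 define F where "F=abs (f x0) + abs (B) + 1"
 have F: "F > 0" "abs (f x)<=F" if "x:X" for x using f[OF that x0] B[OF that x0] by (auto simp: F_def)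
 define m where "m=mean (conv (conv (bump r)))"
 have apb: "ap (bump r)" "ap (conv (bump r))" "ap (conv (conv (bump r)))" by (intro ap_conv ap_kernel)+
 have b1: "bump r \<one> = 1" by (simp add: bump_def D_refl)
 have m: "m > 0" unfolding m_def using mean_kernel_pos[OF b1] by (simp add: mean_conv apb)
 have ap_orbit: "ap (%h. f (act (inv h) x))" if "x:X" for x
  using orbit_ap_lipschitz[of f 1] f ap_inv[of "%h. f (act h x)"] that by (auto simp: orbit_ap_def)
 \<comment> \<open>Multiplied by the bound F for f and divided by the normalisation m, this
   tolerance becomes z / 2.\<close>
 have pos: "m * z / (2 * F) > 0" using m z F[OF x0] by simp
 obtain n :: nat and v c where v: "!!i. i < n ==> ap (v i)"
  "!!s i. [|s:GG; i < n|] ==> EX d. ALL x:GG. v i (s ## x)=(\<Sum>j<n. d j * v j x)"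
  "!!x. x:GG ==> abs (conv (conv (bump r)) x - (\<Sum>j<n. c j * v j x))<=m * z / (2 * F)"
  by (rule conv_conv_finite_approximation[OF apb(1) pos]) (rule that)
 \<comment> \<open>The function f smeared by v i along the orbit: the Lipschitz property comes from
   f, invariance of the span from v.\<close>
 define w where "w i x=mean (%h. v i h * f (act (inv h) x))" for i x
 define u where "u=conv (conv (bump r))"
 have u_nonneg: "u h >= 0" if "h:GG" for h unfolding u_def using that kernel_bounds by (intro conv_nonneg apb) auto
 \<comment> \<open>The bump has radius r and each of the two convolutions adds another r.\<close>
 have supp: "D h \<one><=3 * r" if h: "h:GG" and "u h ~= 0" for h
 proof -
  have close: "D g k < r" if "g:GG" "k:GG" "bump r (inv g ## k) ~= 0" for g k
  proof -
  have "D (inv g ## k) \<one> < r" using that(3) r by (auto simp: bump_def max_def field_simps split: if_splits)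
  moreover have "D (g ## (inv g ## k) ## \<one>) (g ## \<one> ## \<one>)=D (inv g ## k) \<one>" using that by (intro D_invariant) auto
  moreover have "g ## (inv g ## k)=k" using that by (simp flip: m_assoc)
  ultimately show ?thesis using that D_sym[of g k] by simp
  qed
  obtain k where k: "k:GG" "bump r (inv h ## k) ~= 0" "conv (bump r) k ~= 0"
  using conv_support \<open>u h \<noteq> 0\<close> unfolding u_def by metis
  then obtain l where l: "l:GG" "bump r (inv k ## l) ~= 0" "bump r l ~= 0" using conv_support by metis
  have "D h k < r" "D k l < r" "D l \<one> < r" using close[OF h k(1,2)] close[OF k(1) l(1,2)] l(3) r
  by (auto simp: bump_def max_def field_simps split: if_splits)
  thus ?thesis using D_triangle[of h k \<one>] D_triangle[of k l \<one>] h k(1) l(1) by simp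
 qed
 show thesis
 proof (rule that[of n w "%j. c j / m"])
  fix i assume i: "i < n"
  obtain C where C: "C > 0" "!!x. x:GG ==> abs (v i x)<=C" by (rule ap_bounded[OF v(1)[OF i]]) (rule that)
  have "abs (w i x - w i y)<=C * p x y" if xy: "x:X" "y:X" for x y unfolding w_def
  proof (rule mean_dist)
  fix h assume h: "h:GG"
  have "abs (f (act (inv h) x) - f (act (inv h) y))<=p x y" using f[of "act (inv h) x" "act (inv h) y"] act_closed xy h p_invariant by auto
  hence "abs (v i h) * abs (f (act (inv h) x) - f (act (inv h) y))<=C * p x y" using C(2)[OF h] C(1) by (intro mult_mono) auto
  thus "abs (v i h * f (act (inv h) x) - v i h * f (act (inv h) y))<=C * p x y" by (simp flip: right_diff_distrib add: abs_mult)
  qed (use v(1)[OF i] ap_orbit xy in \<open>auto intro!: ap_mult\<close>)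
  thus "EX C. ALL x:X. ALL y:X. abs (w i x - w i y)<=C * p x y" by blast
 next
  fix s i assume s: "s:GG" and i: "i < n"
  obtain d where d: "!!x. x:GG ==> v i (s ## x)=(\<Sum>j<n. d j * v j x)" using v(2)[OF s i] by blast
  have "w i (act s x)=(\<Sum>j<n. d j * w j x)" if x: "x:X" for x
  proof -
  let ?m = "%h. v i h * f (act (inv h) (act s x))"
  have "w i (act s x)=mean (%h. ?m (s ## h))"
  unfolding w_def using mean_left[of ?m s] v(1)[OF i] ap_orbit[OF act_closed[OF s x]] s by (simp add: ap_mult)
  also have "... = mean (%h. \<Sum>j<n. d j * (v j h * f (act (inv h) x)))"
  proof (rule mean_cong)
  fix h assume h: "h:GG"
  have "act (inv (s ## h)) (act s x)=act (inv h) x" using h s x by (simp add: inv_mult_group act_mult act_closed act_inv)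
  thus "?m (s ## h)=(\<Sum>j<n. d j * (v j h * f (act (inv h) x)))" using d[OF h] by (simp add: sum_distrib_right mult.assoc)
  qed
  also have "... = (\<Sum>j<n. d j * w j x)" unfolding w_def using v(1) ap_orbit[OF x]
  by (subst mean_sum) (auto intro!: ap_cmult ap_mult sum.cong mean_cmult)
  finally show ?thesis .
  qed
  thus "EX d. ALL x:X. w i (act s x)=(\<Sum>j<n. d j * w j x)" by blast
 next
  fix x assume x: "x:X"
  let ?o = "%h. f (act (inv h) x)"
  have apu: "ap u" unfolding u_def by (rule apb)
  have apv: "ap (%h. \<Sum>j<n. c j * v j h)" using v(1) by (intro ap_sum ap_cmult) auto
  have "abs (mean (%h. u h * ?o h) - mean (%h. (\<Sum>j<n. c j * v j h) * ?o h))<=m * z / (2 * F) * F"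
  proof (rule mean_dist)
  fix h assume h: "h:GG"
  have "abs (u h - (\<Sum>j<n. c j * v j h)) * abs (?o h)<=m * z / (2 * F) * F"
  using v(3)[OF h] F(2)[OF act_closed[OF inv_closed[OF h] x]] F(1)[OF x] m z unfolding u_def by (intro mult_mono) auto
  thus "abs (u h * ?o h - (\<Sum>j<n. c j * v j h) * ?o h)<=m * z / (2 * F) * F" by (simp flip: left_diff_distrib add: abs_mult)
  qed (use apu apv ap_orbit[OF x] in \<open>auto intro!: ap_mult\<close>)
  also have "... = m * (z / 2)" using F(1)[OF x] by simp
  finally have 1: "abs (mean (%h. u h * ?o h) - mean (%h. (\<Sum>j<n. c j * v j h) * ?o h))<=m * (z / 2)" .
  have 2: "mean (%h. (\<Sum>j<n. c j * v j h) * ?o h)=(\<Sum>j<n. c j * w j x)"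
  unfolding w_def sum_distrib_right mult.assoc using v(1) ap_orbit[OF x]
  by (subst mean_sum) (auto intro!: ap_cmult ap_mult sum.cong mean_cmult)
  have 3: "mean (%h. u h * f x)=m * f x" using mean_cmult[OF apu, of "f x"] by (simp add: mult.commute m_def u_def)
  have dist: "u h * abs (?o h - f x)<=3 * r * u h" if h: "h:GG" for h
  proof (cases "u h=0")
  case False
  have "abs (?o h - f x)<=p (act (inv h) x) x" using f act_closed h x by simp
  also have "... = p (act h (act (inv h) x)) (act h x)" using h x act_closed p_invariant by simp
  also have "... = p (act h x) (act \<one> x)" using h x by (simp add: act_inv act_one p_sym act_closed)
  also have "... <= D h \<one>" using h x by (intro p_le_D) auto
  finally have "abs (?o h - f x)<=3 * r" using supp[OF h False] by simp
  thus ?thesis using u_nonneg[OF h] by (simp add: mult_left_mono mult.commute)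
  qed simp
  have 4: "abs (mean (%h. u h * ?o h) - mean (%h. u h * f x))<=m * (z / 2)"
  proof -
  have ap1: "ap (%h. u h * ?o h)" "ap (%h. u h * f x)" "ap (%h. 3 * r * u h)" using apu ap_orbit[OF x] by (auto intro!: ap_mult ap_cmult)
  have le: "u h * ?o h<=u h * f x + 3 * r * u h" "u h * f x<=u h * ?o h + 3 * r * u h" if h: "h:GG" for h
  proof -
  have "abs (u h * ?o h - u h * f x)<=3 * r * u h" using dist[OF h] u_nonneg[OF h] by (simp flip: right_diff_distrib add: abs_mult)
  thus "u h * ?o h<=u h * f x + 3 * r * u h" "u h * f x<=u h * ?o h + 3 * r * u h" by linarith+
  qed
  have "mean (%h. u h * ?o h)<=mean (%h. u h * f x + 3 * r * u h)"
  "mean (%h. u h * f x)<=mean (%h. u h * ?o h + 3 * r * u h)" using ap1 le by (auto intro!: mean_mono ap_add)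
  moreover have "mean (%h. 3 * r * u h)=m * (z / 2)" using mean_cmult[OF apu, of "3 * r"] by (simp add: m_def u_def r_def)
  ultimately show ?thesis unfolding mean_add[OF ap1(1,3)] mean_add[OF ap1(2,3)] by linarith
  qed
  have "abs (m * f x - (\<Sum>j<n. c j * w j x))<=m * z"
  proof -
  have *: "abs (b - a)<=e" if "abs (t - a)<=e / 2" "abs (t - b)<=e / 2" for a b t e :: real using that by linarith
  show ?thesis by (rule *) (use 1 4 in \<open>simp_all add: 2 3\<close>)
  qed
  hence "abs (f x - (\<Sum>j<n. c j * w j x) / m)<=z" using m by (simp add: abs_le_iff field_simps)
  thus "abs (f x - (\<Sum>j<n. c j / m * w j x))<=z" by (simp add: sum_divide_distrib)
 qed
qed

end

section \<open>Open maps between compact spaces\<close>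

lemma compactin_pointwise:
 assumes "compactin X S" "!!x. x:S ==> openin X (V x) & x:V x"
 obtains F where "finite F" "F<=S" "S<=(\<Union>x\<in>F. V x)"
proof -
 obtain \<F> where "finite \<F>" "\<F><=V ` S" "S<=\<Union>\<F>" using compactinD[OF assms(1), of "V ` S"] assms(2) by blast
 then obtain F where "F<=S" "finite F" "\<F> = V ` F" by (meson finite_subset_image)
 thus thesis using that \<open>S \<subseteq> \<Union>\<F>\<close> by blast
qed

lemma openin_finite_conj:
 assumes "finite I" "!!i. i:I ==> openin X {x:topspace X. P i x}"
 shows "openin X {x:topspace X. ALL i:I. P i x}" using assms
proof (induction I rule: finite_induct)
 case (insert i I)
 have "{x:topspace X. ALL j:insert i I. P j x}={x:topspace X. P i x} Int {x:topspace X. ALL j:I. P j x}" by auto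
 thus ?case using insert by (metis (no_types, lifting) insertCI openin_Int)
qed simp

lemma cont_metric:
 fixes f :: "'a => 'b::metric_space"
 shows "cnt X f \<longleftrightarrow>
  (ALL x:topspace X. ALL e>0. EX U. openin X U & x:U & (ALL y:U. dist (f x) (f y) < e))"
 using Met_TC.continuous_map_to_metric[of X f] by simp

lemma openin_dist_less:
 fixes f :: "'a => 'b::metric_space"
 assumes "cnt X f"
 shows "openin X {y:topspace X. dist (f y) z < e}"
proof -
 show ?thesis using openin_continuous_map_preimage[OF assms, of "ball z e"] by (auto simp: dist_commute)
qed

lemma continuous_map_mult_algebra:
 fixes f g :: "'a => 'b::real_normed_algebra"
 shows "[|cnt X f; cnt X g|] ==> cnt X (%x. f x * g x)" by (simp add: continuous_map_atin tendsto_mult)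

lemma continuous_map_complex_of_real:
 "cntR X f ==> cnt X (%x. complex_of_real (f x))" by (simp add: continuous_map_atin tendsto_of_real)

lemma continuous_map_Re_Im:
 assumes "cnt X (f :: 'a => complex)"
 shows "cntR X (%x. Re (f x))" "cntR X (%x. Im (f x))" using assms by (simp_all add: continuous_map_atin tendsto_Re tendsto_Im)

lemma Tietze_complex:
 fixes f :: "'a => complex"
 assumes "normal_space X" "closedin X S" "cnt (subtopology X S) f"
 obtains g where "cnt X g" "!!x. x:S ==> g x=f x"
proof -
 have "cntR (subtopology X S) (%x. Re (f x))" "cntR (subtopology X S) (%x. Im (f x))" using continuous_map_Re_Im[OF assms(3)] by auto
 then obtain u v where u: "cntR X u" "!!x. x:S ==> u x=Re (f x)"
  and v: "cntR X v" "!!x. x:S ==> v x=Im (f x)" using Tietze_extension_realinterval[OF assms(1,2), of UNIV "%x. Re (f x)"]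
  Tietze_extension_realinterval[OF assms(1,2), of UNIV "%x. Im (f x)"] by (metis UNIV_not_empty is_interval_univ subset_UNIV)
 have "cnt X (%x. complex_of_real (u x) + \<i> * complex_of_real (v x))"
  using u(1) v(1) by (intro continuous_map_add continuous_map_mult_algebra continuous_map_complex_of_real) auto
 thus thesis
 proof (rule that)
  show "complex_of_real (u x) + \<i> * complex_of_real (v x)=f x" if "x:S" for x
  using u(2)[OF that] v(2)[OF that] complex_eq[of "f x"] by simp
 qed
qed

lemma compact_Hausdorff_shrink:
 assumes X: "compact_space X" "Hausdorff_space X" and V: "openin X V" "x:V"
 obtains O' C where "openin X O'" "closedin X C" "x:O'" "O'<=C" "C<=V"
proof -
 have norm: "normal_space X" using X compact_Hausdorff_or_regular_imp_normal_space by blast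
 have "closedin X {x}" using V X(2) openin_subset by (blast intro: closedin_Hausdorff_singleton)
 thus thesis using normal_space_alt[of X] norm V that
  by (metis closure_of_subset closedin_closure_of empty_subsetI insert_subset openin_subset)
qed

text \<open>Besides vanishing outside U i, each function is supported in a closed subset of U i.
  This is what allows coefficient functions that exist only over U i to be extended by zero.\<close>

lemma partition_of_unity:
 assumes X: "compact_space X" "Hausdorff_space X" and I: "finite I"
  and U: "!!i. i:I ==> openin X (U i)" "topspace X<=(\<Union>i\<in>I. U i)"
 obtains r :: "'i => 'a => real" where "!!i. i:I ==> cntR X (r i)"
  "!!i x. i:I ==> x:topspace X ==> 0<=r i x"
  "!!i x. i:I ==> x:topspace X ==> x ~: U i ==> r i x=0"
  "!!i. i:I ==> EX C. closedin X C & C<=U i & (ALL x:topspace X. x ~: C --> r i x=0)"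
  "!!x. x:topspace X ==> (\<Sum>i\<in>I. r i x)=1"
proof -
 have norm: "normal_space X" using X compact_Hausdorff_or_regular_imp_normal_space by blast
 have "EX k f. x:topspace X --> k:I & x:U k & cntR X f & f ` topspace X<={0..1} &
  f x=1 & (EX C. closedin X C & C<=U k & (ALL y:topspace X. y ~: C --> f y=0))" for x
 proof (cases "x:topspace X")
  case True
  then obtain k where k: "k:I" "x:U k" using U(2) by blast
  have clx: "closedin X {x}" using True X(2) by (simp add: closedin_Hausdorff_singleton)
  obtain V C where V: "openin X V" "closedin X C" "x:V" "V<=C" "C<=U k"
  by (rule compact_Hausdorff_shrink[OF X U(1)[OF k(1)] k(2)]) (rule that)
  obtain f where f: "continuous_map X (top_of_set {0..1::real}) f" "f ` (topspace X - V)<={0}" "f ` {x}<={1}"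
  by (rule Urysohn_lemma[OF norm, of "topspace X - V" "{x}" 0 1]) (use V clx in \<open>auto simp: disjnt_def closedin_def\<close>)
  have "closedin X C & C<=U k & (ALL y:topspace X. y ~: C --> f y=0)" using V f(2) by auto
  thus ?thesis using k f(1,3) unfolding continuous_map_in_subtopology by blast
 qed auto
 then obtain k f where kf: "!!x. x:topspace X ==> k x:I & x:U (k x) & cntR X (f x) &
  f x ` topspace X<={0..1::real} & f x x=1 &
  (EX C. closedin X C & C<=U (k x) & (ALL y:topspace X. y ~: C --> f x y=0))" by metis
 obtain F where F: "finite F" "F<=topspace X" "topspace X<=(\<Union>x\<in>F. {y:topspace X. f x y > 1/2})"
 proof (rule compactin_pointwise[of X "topspace X" "%x. {y:topspace X. f x y > 1/2}"])
  show "compactin X (topspace X)" using X(1) by (simp add: compact_space_def)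
  show "openin X {y:topspace X. f x y > 1/2} & x:{y:topspace X. f x y > 1/2}" if "x:topspace X" for x
  using openin_continuous_map_preimage[of X euclideanreal "f x" "{1/2<..}"] kf[OF that] that by auto
 qed
 define g where "g i y=(\<Sum>x\<in>{x\<in>F. k x=i}. f x y)" for i y
 have fpos: "0<=f x y" if "x:F" "y:topspace X" for x y using kf[of x] F(2) that by (auto simp: image_subset_iff)
 have gcont: "cntR X (g i)" for i unfolding g_def using kf F by (intro continuous_map_sum) auto
 have tot: "(\<Sum>i\<in>I. g i y)=(\<Sum>x\<in>F. f x y)" for y unfolding g_def using F(1,2) I kf by (intro sum.group) auto
 have totpos: "(\<Sum>i\<in>I. g i y) > 0" if y: "y:topspace X" for y
 proof -
  obtain x where x: "x:F" "f x y > 1/2" using F(3) y by blast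
  have "f x y<=(\<Sum>x\<in>F. f x y)" using x F(1) fpos y by (intro member_le_sum) auto
  thus ?thesis using x tot by simp
 qed
 have totcont: "cntR X (%y. \<Sum>i\<in>I. g i y)" using gcont I by (intro continuous_map_sum) auto
 have supp: "EX C. closedin X C & C<=U i & (ALL x:topspace X. x ~: C --> g i x / (\<Sum>j\<in>I. g j x)=0)" for i
 proof -
  obtain C where C: "!!x. x:F ==> closedin X (C x) & C x<=U (k x) & (ALL y:topspace X. y ~: C x --> f x y=0)"
  using kf F(2) by (metis subsetD)
  show ?thesis by (rule exI[of _ "\<Union>x\<in>{x\<in>F. k x=i}. C x"])
  (use C F(1) in \<open>fastforce intro!: closedin_Union simp: g_def\<close>)
 qed
 show thesis
 proof (rule that[of "%i y. g i y / (\<Sum>j\<in>I. g j y)"])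
  show "cntR X (%y. g i y / (\<Sum>j\<in>I. g j y))" for i
  using gcont totcont totpos by (intro continuous_map_real_divide) (auto simp: less_le)
  show "0<=g i x / (\<Sum>j\<in>I. g j x)" if "x:topspace X" for i x
  using totpos[OF that] fpos that by (intro divide_nonneg_pos) (auto simp: g_def intro!: sum_nonneg)
  show "(\<Sum>i\<in>I. g i x / (\<Sum>j\<in>I. g j x))=1" if "x:topspace X" for x using totpos[OF that] by (simp flip: sum_divide_distrib)
  show "EX C. closedin X C & C<=U i & (ALL x:topspace X. x ~: C --> g i x / (\<Sum>j\<in>I. g j x)=0)" for i by (rule supp)
  show "g i x / (\<Sum>j\<in>I. g j x)=0" if "x:topspace X" "x ~: U i" for i x using supp[of i] that by blast
 qed
qed

text \<open>The values of a function at the finitely many points \<open>Y\<close> determine its coordinates with respect to \<open>w\<close>.\<close>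

definition evaluation :: "'x set => (('x => 'f::field) => 'f) => bool" where
 "evaluation X d \<longleftrightarrow> (EX Y \<alpha>. finite Y & Y<=X & (ALL u. d u=(\<Sum>y\<in>Y. \<alpha> y * u y)))"

lemma evaluation_point: "x:X ==> evaluation X (%u. u x)" unfolding evaluation_def by (intro exI[of _ "{x}"] exI[of _ "%_. 1"]) auto

lemma evaluation_cmult:
 assumes "evaluation X d"
 shows "evaluation X (%u. r * d u)"
proof -
 obtain Y \<alpha> where "finite Y" "Y<=X" "!!u. d u=(\<Sum>y\<in>Y. \<alpha> y * u y)" using assms unfolding evaluation_def by blast
 thus ?thesis unfolding evaluation_def by (intro exI[of _ Y] exI[of _ "%y. r * \<alpha> y"]) (auto simp: sum_distrib_left mult.assoc)
qed

lemma evaluation_extend: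
 assumes "finite Y" "finite Y'"
 shows "(\<Sum>y\<in>Y. \<alpha> y * u y)=(\<Sum>y\<in>Y Un Y'. (if y:Y then \<alpha> y else 0) * (u y :: 'f::field))"
 using assms by (intro sum.mono_neutral_cong_left) auto

lemma evaluation_add:
 assumes "evaluation X d" "evaluation X r"
 shows "evaluation X (%u. d u + r u)"
proof -
 obtain Y \<alpha> where Y: "finite Y" "Y<=X" "!!u. d u=(\<Sum>y\<in>Y. \<alpha> y * u y)" using assms(1) unfolding evaluation_def by blast
 obtain Z b where Z: "finite Z" "Z<=X" "!!u. r u=(\<Sum>y\<in>Z. b y * u y)" using assms(2) unfolding evaluation_def by blast
 show ?thesis unfolding evaluation_def
 proof (intro exI conjI allI)
  show "finite (Y Un Z)" "Y Un Z<=X" using Y Z by auto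
  show "d u + r u=(\<Sum>y\<in>Y Un Z. ((if y:Y then \<alpha> y else 0) + (if y:Z then b y else 0)) * u y)" for u
  using evaluation_extend[OF Y(1) Z(1), of \<alpha> u] evaluation_extend[OF Z(1) Y(1), of b u]
  by (simp only: Y(3) Z(3) Un_commute[of Z Y] distrib_right sum.distrib)
 qed
qed

lemma evaluation_sum:
 assumes "!!i. i:I ==> evaluation X (d i)"
 shows "evaluation X (%u. \<Sum>i\<in>I. d i u)" using assms
proof (induction I rule: infinite_finite_induct)
 case (insert i I)
 thus ?case using evaluation_add[of X "d i" "%u. \<Sum>i\<in>I. d i u"] by simp
qed (auto simp: evaluation_def intro: exI[of _ "{}"])

text \<open>Induction on n. The new function minus its interpolation by the old ones is nonzero at
  some point x; evaluating such remainders at x, normalised, is dual to the new function and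
  vanishes on the old ones. The old functionals are corrected by multiples of it.\<close>

lemma dual_evaluations_aux:
 fixes w :: "nat => 'x => 'f::field"
 assumes "!!c. (ALL x:X. (\<Sum>i<n. c i * w i x)=0) ==> ALL i<n. c i=0"
 shows "EX d. (ALL j<n. evaluation X (d j)) & (ALL i<n. ALL j<n. d j (w i)=(if i=j then 1 else 0))" using assms
proof (induction n)
 case (Suc n)
 have "ALL i<n. c i=0" if "ALL x:X. (\<Sum>i<n. c i * w i x)=0" for c
 proof -
  have "ALL i<Suc n. (if i < n then c i else 0)=0" by (rule Suc.prems) (use that in auto)
  thus ?thesis by (metis less_SucI)
 qed
 then obtain d where d: "!!j. j < n ==> evaluation X (d j)"
  "!!i j. [|i < n; j < n|] ==> d j (w i)=(if i=j then 1 else 0)" using Suc.IH by blast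
 define r where "r u x=u x - (\<Sum>j<n. d j u * w j x)" for u x
 have "EX x:X. r (w n) x ~= 0"
 proof (rule ccontr)
  assume "~?thesis"
  hence "ALL x:X. (\<Sum>i<Suc n. (if i=n then 1 else - d i (w n)) * w i x)=0" by (auto simp: r_def sum_negf)
  thus False using Suc.prems by fastforce
 qed
 then obtain x where x: "x:X" "r (w n) x ~= 0" by blast
 have r0: "r (w i) x=0" if "i < n" for i
 proof -
  have "(\<Sum>j<n. d j (w i) * w j x)=(\<Sum>j<n. if j=i then w i x else 0)" using that d(2) by (intro sum.cong) auto
  thus ?thesis using that by (simp add: r_def)
 qed
 define e where "e u=inverse (r (w n) x) * (u x + (\<Sum>j<n. (- w j x) * d j u))" for u
 have er: "e u=inverse (r (w n) x) * r u x" for u by (simp add: e_def r_def sum_negf mult.commute)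
 have ev: "evaluation X e" unfolding e_def using d(1) x(1) by (intro evaluation_cmult evaluation_add evaluation_sum evaluation_point) auto
 let ?d = "%j u. if j=n then e u else d j u + (- d j (w n)) * e u"
 have "evaluation X (?d j)" if "j < Suc n" for j
  using that ev d(1)[of j] evaluation_add[OF d(1)[of j] evaluation_cmult[OF ev, of "- d j (w n)"]] by (cases "j=n") auto
 moreover have "?d j (w i)=(if i=j then 1 else 0)" if "i < Suc n" "j < Suc n" for i j using that x(2) d(2) r0 by (auto simp: er less_Suc_eq)
 ultimately show ?case by (intro exI[of _ ?d]) auto
qed auto

lemma dual_evaluations:
 fixes w :: "nat => 'x => 'f::field"
 assumes "!!c. (ALL x:X. (\<Sum>i<n. c i * w i x)=0) ==> ALL i<n. c i=0"
 shows "EX Y \<alpha>. finite Y & Y<=X &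
  (ALL i<n. ALL j<n. (\<Sum>y\<in>Y. \<alpha> j y * w i y)=(if i=j then 1 else 0))"
proof -
 have "EX d. (ALL j<n. evaluation X (d j)) & (ALL i<n. ALL j<n. d j (w i)=(if i=j then 1 else 0))"
  by (rule dual_evaluations_aux) (rule assms)
 then obtain d where "ALL j<n. evaluation X (d j)"
  "ALL i<n. ALL j<n. d j (w i)=(if i=j then 1 else 0)" by blast
 note d = this[rule_format]
 have "ALL j. EX Y \<alpha>. j < n --> finite Y & Y<=X & (ALL u. d j u=(\<Sum>y\<in>Y. \<alpha> y * u y))"
 proof
  fix j
  show "EX Y \<alpha>. j < n --> finite Y & Y<=X & (ALL u. d j u=(\<Sum>y\<in>Y. \<alpha> y * u y))"
  proof (cases "j < n")
  case True
  thus ?thesis using d(1)[OF True] unfolding evaluation_def by simp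
  qed simp
 qed
 then obtain Y \<alpha> where Y: "!!j. j < n ==> finite (Y j) & Y j<=X & (ALL u. d j u=(\<Sum>y\<in>Y j. \<alpha> j y * u y))" by metis
 let ?Y = "\<Union>j<n. Y j"
 let ?\<alpha> = "%j y. if y:Y j then \<alpha> j y else 0"
 have fin: "finite ?Y" using Y by auto
 have "(\<Sum>y\<in>?Y. ?\<alpha> j y * w i y)=d j (w i)" if "j < n" for i j
 proof -
  have "Y j Un ?Y=?Y" using that by auto
  thus ?thesis using evaluation_extend[of "Y j" ?Y "\<alpha> j" "w i"] Y[OF that] fin by simp
 qed
 hence "ALL i<n. ALL j<n. (\<Sum>y\<in>?Y. ?\<alpha> j y * w i y)=(if i=j then 1 else 0)" using d(2) by simp
 moreover have "?Y<=X" using Y by auto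
 ultimately show ?thesis using fin by (intro exI conjI)
qed

locale open_fibration =
 fixes K :: "'k topology" and L :: "'l topology" and q :: "'k => 'l"
 assumes compact_total: "compact_space K" and Hausdorff_total: "Hausdorff_space K"
  and compact_base: "compact_space L" and Hausdorff_base: "Hausdorff_space L"
  and cont_q: "continuous_map K L q"
  and onto_q: "q ` topspace K=topspace L"
  and open_q: "open_map K L q"
begin

abbreviation KK where "KK == topspace K"
abbreviation LL where "LL == topspace L"
abbreviation fsp where "fsp == fibre_space K q"
abbreviation cont :: "('k => 'b::topological_space) => bool" where "cont == cnt K"
abbreviation CK where "CK == mspace (CX K)"
abbreviation CL where "CL == mspace (CX L)"
abbreviation Cf where "Cf l == mspace (CX (fsp l))"
abbreviation ainv where "ainv == arrow_inv K q"
abbreviation acomp where "acomp == arrow_comp K q"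
abbreviation KqK where "KqK == subtopology (prod_topology K K) (fibre_product K q)"

abbreviation fib :: "'l => 'k set" where
 "fib == fibre K q"

lemma fib_iff: "x:fib l \<longleftrightarrow> x:KK & q x=l" by (auto simp: fibre_def)

lemma fib_subset: "fib l<=KK" by (auto simp: fibre_def)

lemma fib_nonempty: "l:LL ==> fib l ~= {}" unfolding fibre_def onto_q[symmetric] by auto

lemma proj_closed: "x:KK ==> q x:LL" using onto_q by auto

lemma topspace_fib [simp]: "topspace (fsp l)=fib l" using fib_subset by (auto simp: topspace_subtopology)

lemma normal_total: "normal_space K" and normal_base: "normal_space L"
 using compact_total Hausdorff_total compact_base Hausdorff_base compact_Hausdorff_or_regular_imp_normal_space by auto

lemma closedin_fib: "l:LL ==> closedin K (fib l)"
 using closedin_continuous_map_preimage[OF cont_q, of "{l}"] closedin_Hausdorff_singleton[OF Hausdorff_base] by (simp add: fibre_def)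

lemma compactin_fib: "l:LL ==> compactin K (fib l)" by (simp add: closedin_compact_space compact_total closedin_fib)

lemma compact_fib: "l:LL ==> compact_space (fsp l)" by (simp add: compact_space_subtopology compactin_fib)

lemma Hausdorff_fib: "Hausdorff_space (fsp l)" by (simp add: Hausdorff_space_subtopology Hausdorff_total)

lemma closed_proj: "closed_map K L q" using continuous_imp_closed_map[OF cont_q] compact_total Hausdorff_base by blast

lemma openin_image: "openin K V ==> openin L (q ` V)" using open_q by (simp add: open_map_def)

text \<open>By compactness q is closed, so the image of the complement of V is a closed set that
  misses l.\<close>

lemma tube:
 assumes "openin K V" "fib l<=V" "l:LL"
 obtains U where "openin L U" "l:U" "!!x. [|x:KK; q x:U|] ==> x:V"
proof
 have "closedin L (q ` (KK - V))" using assms(1) assms(1) closed_proj by (auto simp: openin_closedin_eq closed_map_def)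
 thus "openin L (LL - q ` (KK - V))" by (simp add: openin_diff)
 show "l:LL - q ` (KK - V)" using assms by (auto simp: fibre_def)
qed auto

text \<open>Since \<open>q\<close> is open and closed, nearby fibres are close to each other in the sense of Hausdorff,
 measured by finitely many functions.\<close>

lemma fibres_close:
 fixes s :: "'i => 'k => 'b::metric_space"
 assumes I: "finite I" "!!i. i:I ==> cont (s i)"
  and l0: "l0:LL" and e: "e > 0"
 obtains U where "openin L U" "l0:U"
  "!!l x. [|l:U; x:fib l|] ==> EX y:fib l0. ALL i:I. dist (s i x) (s i y) < e"
  "!!l y. [|l:U; y:fib l0|] ==> EX x:fib l. ALL i:I. dist (s i x) (s i y) < e"
proof -
 define V where "V y={x:KK. ALL i:I. dist (s i x) (s i y) < e / 2}" for y
 have V: "openin K (V y)" for y unfolding V_def using I by (intro openin_finite_conj openin_dist_less)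
 obtain F where F: "finite F" "F<=fib l0" "fib l0<=(\<Union>y\<in>F. V y)"
  by (rule compactin_pointwise[OF compactin_fib[OF l0], of V]) (use V e in \<open>auto simp: V_def fib_iff\<close>)
 obtain U1 where U1: "openin L U1" "l0:U1" "!!x. [|x:KK; q x:U1|] ==> x:(\<Union>y\<in>F. V y)"
  by (rule tube[of "\<Union>y\<in>F. V y" l0]) (use V F(3) l0 in auto)
 define U where "U=U1 Int {l:LL. ALL y:F. l:q ` V y}"
 have img: "{l:LL. l:q ` V y}=q ` V y" for y using proj_closed by (auto simp: V_def)
 show thesis
 proof
  show "openin L U" unfolding U_def using U1(1) F(1) by (intro openin_Int openin_finite_conj) (auto simp: img openin_image V)
  have "y:V y" if "y:F" for y using that F(2) e by (auto simp: V_def fib_iff)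
  thus "l0:U" using U1(2) F(2) l0 by (fastforce simp: U_def fib_iff)
 next
  fix l x assume "l:U" "x:fib l"
  then obtain y where "y:F" "x:V y" using U1(3) by (auto simp: U_def fib_iff)
  thus "EX y:fib l0. ALL i:I. dist (s i x) (s i y) < e" using F(2) e by (force simp: V_def)
 next
  fix l y assume l: "l:U" and "y:fib l0"
  then obtain z where z: "z:F" "y:V z" using F(3) by blast
  obtain x where x: "x:V z" "q x=l" using l z(1) by (auto simp: U_def)
  have "dist (s i x) (s i y) < e" if "i:I" for i
  proof -
  have "dist (s i x) (s i z) < e / 2" "dist (s i y) (s i z) < e / 2" using x(1) z(2) that by (auto simp: V_def)
  thus ?thesis using dist_triangle2[of "s i x" "s i y" "s i z"] by linarith
  qed
  thus "EX x:fib l. ALL i:I. dist (s i x) (s i y) < e" using x by (intro bexI[of _ x]) (auto simp: V_def fib_iff)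
 qed
qed

section \<open>Linear combinations of sections and local frames\<close>

definition comb :: "nat => (nat => 'k => complex) => (nat => complex) => 'k => complex" where
 "comb n s c x=(\<Sum>i<n. c i * s i x)"

definition indep :: "nat => (nat => 'k => complex) => 'l => bool" where
 "indep n s l \<longleftrightarrow> (ALL c. (ALL x:fib l. comb n s c x=0) --> (ALL i<n. c i=0))"

lemma comb_dist:
 assumes "!!i. i < n ==> dist (s i x) (s i y)<=e"
 shows "cmod (comb n s c x - comb n s c y)<=(\<Sum>i<n. cmod (c i)) * e"
proof -
 have "comb n s c x - comb n s c y=(\<Sum>i<n. c i * (s i x - s i y))" by (simp add: comb_def sum_subtractf right_diff_distrib)
 also have "cmod ... <= (\<Sum>i<n. cmod (c i) * e)"
  by (rule sum_norm_le) (use assms in \<open>auto simp: norm_mult dist_norm intro!: mult_left_mono\<close>)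
 finally show ?thesis by (simp add: sum_distrib_right)
qed

lemma continuous_comb:
 "(!!i. i < n ==> cont (s i)) ==> cont (comb n s c)" unfolding comb_def by (intro continuous_map_sum continuous_map_mult_algebra) auto

text \<open>On the fibre over l0, dual point evaluations bound the coefficients by the uniform norm.
  A nearby fibre approximates that one, with an error proportional to the sum of the coefficients
  that can be absorbed.\<close>

lemma coefficient_bound:
 assumes s: "!!i. i < n ==> cont (s i)"
  and l0: "l0:LL" and ind: "indep n s l0"
 shows "EX C U. C > 0 & openin L U & l0:U &
  (ALL l:U. ALL c M. (ALL x:fib l. cmod (comb n s c x)<=M) --> (\<Sum>i<n. cmod (c i))<=C * M)"
proof -
 have "EX Y \<alpha>. finite Y & Y<=fib l0 &
  (ALL i<n. ALL j<n. (\<Sum>y\<in>Y. \<alpha> j y * s i y)=(if i=j then 1 else 0))"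
  by (rule dual_evaluations) (use ind in \<open>auto simp: indep_def comb_def\<close>)
 then obtain Y \<alpha> where "finite Y" "Y<=fib l0"
  "ALL i<n. ALL j<n. (\<Sum>y\<in>Y. \<alpha> j y * s i y)=(if i=j then 1 else 0)" by (elim exE conjE) (rule that)
 note Y = this[rule_format]
 define C where "C=(\<Sum>j<n. \<Sum>y\<in>Y. cmod (\<alpha> j y)) + 1"
 have C1: "C >= 1" unfolding C_def by (simp add: sum_nonneg)
 have bound: "(\<Sum>i<n. cmod (c i))<=C * M" if M: "!!x. x:fib l0 ==> cmod (comb n s c x)<=M" for c M
 proof -
  have "M >= 0" using M fib_nonempty[OF l0] by (metis equals0I norm_ge_zero order_trans)
  have "cmod (c j)<=(\<Sum>y\<in>Y. cmod (\<alpha> j y)) * M" if j: "j < n" for j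
  proof -
  have "(\<Sum>y\<in>Y. \<alpha> j y * comb n s c y)=(\<Sum>i<n. c i * (\<Sum>y\<in>Y. \<alpha> j y * s i y))"
  unfolding comb_def sum_distrib_left by (subst sum.swap) (simp add: mult_ac)
  also have "... = (\<Sum>i<n. c i * (if i=j then 1 else 0))" using Y(3) j by (intro sum.cong) auto
  also have "... = c j" using j by (simp add: if_distrib cong: if_cong)
  finally have "cmod (c j)=cmod (\<Sum>y\<in>Y. \<alpha> j y * comb n s c y)" by simp
  also have "... <= (\<Sum>y\<in>Y. cmod (\<alpha> j y) * M)"
  by (rule sum_norm_le) (use M Y(2) in \<open>auto simp: norm_mult intro!: mult_left_mono\<close>)
  finally show ?thesis by (simp add: sum_distrib_right)
  qed
  hence "(\<Sum>j<n. cmod (c j))<=(\<Sum>j<n. (\<Sum>y\<in>Y. cmod (\<alpha> j y)) * M)" by (intro sum_mono) auto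
  also have "... <= C * M" unfolding C_def using \<open>M \<ge> 0\<close> by (simp add: sum_distrib_left sum_distrib_right algebra_simps)
  finally show ?thesis .
 qed
 \<comment> \<open>With C * e = 1/2 half of the coefficient sum returns on the right-hand side;
   absorbing it doubles the constant.\<close>
 define e where "e=1 / (2 * C)"
 have e: "e > 0" "C * e=1/2" using C1 by (auto simp: e_def)
 obtain U where U: "openin L U" "l0:U"
  "!!l y. [|l:U; y:fib l0|] ==> EX x:fib l. ALL i:{..<n}. dist (s i x) (s i y) < e"
  by (rule fibres_close[of "{..<n}" s, OF _ _ l0 e(1)]) (use s in auto)
 show ?thesis
 proof (intro exI[of _ "2 * C"] exI[of _ U] conjI ballI allI impI)
  fix l c M assume l: "l:U" and M: "ALL x:fib l. cmod (comb n s c x)<=M"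
  let ?S = "\<Sum>i<n. cmod (c i)"
  have "cmod (comb n s c y)<=M + ?S * e" if y: "y:fib l0" for y
  proof -
  obtain x where x: "x:fib l" "ALL i:{..<n}. dist (s i x) (s i y) < e" using U(3)[OF l y] by blast
  hence "cmod (comb n s c x - comb n s c y)<=?S * e" by (intro comb_dist) (auto intro: less_imp_le)
  thus ?thesis using bspec[OF M x(1)] norm_triangle_ineq2[of "comb n s c y" "comb n s c x"] by (simp add: norm_minus_commute)
  qed
  hence "?S<=C * (M + ?S * e)" by (rule bound)
  also have "... = C * M + ?S * (C * e)" by (simp add: algebra_simps)
  finally show "?S<=2 * C * M" using e(2) by simp
 qed (use C1 U in auto)
qed

text \<open>The coefficient bound with M = 0.\<close>

lemma indep_nearby:
 assumes s: "!!i. i < n ==> cont (s i)"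
  and l0: "l0:LL" and ind: "indep n s l0"
 obtains U where "openin L U" "l0:U" "!!l. l:U ==> indep n s l"
proof -
 obtain C U where U: "C > 0" "openin L U" "l0:U"
  "!!l c M. [|l:U; ALL x:fib l. cmod (comb n s c x)<=M|] ==> (\<Sum>i<n. cmod (c i))<=C * M" using coefficient_bound[OF s l0 ind] by blast
 have "indep n s l" if l: "l:U" for l unfolding indep_def
 proof (intro allI impI)
  fix c i assume c: "ALL x:fib l. comb n s c x=0" and i: "i < n"
  have "(\<Sum>i<n. cmod (c i))<=C * 0" by (rule U(4)[OF l]) (use c in auto)
  moreover have "cmod (c i)<=(\<Sum>i<n. cmod (c i))" using i by (intro member_le_sum) auto
  ultimately have "cmod (c i)<=0" by linarith
  thus "c i=0" by simp
 qed
 thus thesis using that U by blast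
qed

text \<open>The sections are continuous on the whole of K although they need to form bases only over
  U. Thus they can be compared on different fibres.\<close>

definition frame_on :: "('l => ('k => complex) set) => 'l set => nat => (nat => 'k => complex) => bool" where
 "frame_on F U n s \<longleftrightarrow> (ALL i<n. cont (s i)) &
  (ALL l:U. F l={restrict (comb n s c) (fib l) | c. True} & indep n s l)"

definition local_frames :: "('l => ('k => complex) set) => bool" where
 "local_frames F \<longleftrightarrow> (ALL l:LL. EX U n s. openin L U & l:U & frame_on F U n s)"

definition unit_ball :: "('l => ('k => complex) set) => 'l => ('k => complex) set" where
 "unit_ball F l={f:F l. ALL z:fib l. cmod (f z)<=1}"

text \<open>The norm, in the dual of F l, of the difference of the evaluations at x and y. Maps
  between fibres that respect F and the uniform norm therefore preserve it.\<close>

definition bpm :: "('l => ('k => complex) set) => 'k \<times> 'k => real" where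
 "bpm F=(%(x, y). SUP f\<in>unit_ball F (q x). cmod (f x - f y))"

lemma unit_ball_diff:
 assumes "f:unit_ball F l" "x:fib l" "y:fib l"
 shows "cmod (f x - f y)<=2"
proof -
 have "cmod (f x)<=1" "cmod (f y)<=1" using assms by (auto simp: unit_ball_def)
 thus ?thesis using norm_triangle_ineq4[of "f x" "f y"] by linarith
qed

lemma ball_pseudometric_upper:
 assumes "f:unit_ball F l" "x:fib l" "y:fib l"
 shows "cmod (f x - f y)<=bpm F (x, y)"
proof -
 have q: "q x=l" using assms by (simp add: fib_iff)
 have "bdd_above ((%f. cmod (f x - f y)) ` unit_ball F l)" using unit_ball_diff assms(2,3) by (intro bdd_aboveI[of _ 2]) auto
 thus ?thesis unfolding bpm_def using assms(1) q by (auto intro: cSUP_upper)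
qed

lemma ball_pseudometric_least:
 assumes "unit_ball F l ~= {}" "x:fib l" "!!f. f:unit_ball F l ==> cmod (f x - f y)<=r"
 shows "bpm F (x, y)<=r"
proof -
 have q: "q x=l" using assms by (simp add: fib_iff)
 show ?thesis unfolding bpm_def using assms q by (auto intro: cSUP_least)
qed

lemma pseudometric_ball_pseudometric:
 assumes "unit_ball F l ~= {}"
 shows "pseudometric_on (fib l) (bpm F)"
proof -
 obtain f0 where f0: "f0:unit_ball F l" using assms by blast
 have nn: "0<=bpm F (x, y)" if "x:fib l" "y:fib l" for x y using ball_pseudometric_upper[OF f0 that] norm_ge_zero order_trans by blast
 have sym: "bpm F (x, y)<=bpm F (y, x)" if "x:fib l" "y:fib l" for x y using that assms ball_pseudometric_upper[of _ F l y x]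
  by (intro ball_pseudometric_least) (auto simp: norm_minus_commute)
 have "bpm F (x, x)<=0" if "x:fib l" for x using that assms by (intro ball_pseudometric_least) auto
 moreover have "bpm F (x, z)<=bpm F (x, y) + bpm F (y, z)"
  if xyz: "x:fib l" "y:fib l" "z:fib l" for x y z
 proof (rule ball_pseudometric_least[OF assms xyz(1)])
  fix f assume f: "f:unit_ball F l"
  show "cmod (f x - f z)<=bpm F (x, y) + bpm F (y, z)" using ball_pseudometric_upper[OF f xyz(1,2)] ball_pseudometric_upper[OF f xyz(2,3)]
  norm_triangle_ineq[of "f x - f y" "f y - f z"] by simp
 qed
 ultimately show ?thesis unfolding pseudometric_on_def using nn sym by (auto intro!: antisym)
qed

text \<open>The coefficients of an element of the unit ball over l define a function over l' of norm
  at most r = 1 + C * e, and division by r returns it to the unit ball. Rescaling costs 2 * C * e,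
  since \<open>bpm\<close> is at most 2; moving x and y costs C * e each.\<close>

lemma ball_pseudometric_compare:
 assumes F: "F l={restrict (comb n s c) (fib l) | c. True}" "F l'={restrict (comb n s c) (fib l') | c. True}"
  and C: "C > 0" "!!c. ALL x:fib l. cmod (comb n s c x)<=1 ==> (\<Sum>i<n. cmod (c i))<=C * 1"
  and e: "e > 0" "!!z'. z':fib l' ==> EX z:fib l. ALL i:{..<n}. dist (s i z) (s i z') < e"
  and xy: "x:fib l" "y:fib l" "x':fib l'" "y':fib l'"
  "!!i. i < n ==> dist (s i x) (s i x')<=e" "!!i. i < n ==> dist (s i y) (s i y')<=e"
 shows "bpm F (x, y)<=bpm F (x', y') + 4 * C * e"
proof (rule ball_pseudometric_least[OF _ xy(1)])
 have "restrict (comb n s (%_. 0)) (fib l):unit_ball F l" unfolding unit_ball_def F by (auto simp: comb_def)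
 thus "unit_ball F l ~= {}" by blast
 fix f assume "f:unit_ball F l"
 then obtain c where c: "f=restrict (comb n s c) (fib l)" "!!x. x:fib l ==> cmod (comb n s c x)<=1" unfolding unit_ball_def F by auto
 let ?S = "\<Sum>i<n. cmod (c i)"
 have Se: "?S * e<=C * e" using C(2)[of c] c(2) e(1) by (simp add: mult_right_mono)
 define r where "r=1 + C * e"
 have r: "r > 0" using C(1) e(1) by (simp add: r_def add_pos_pos)
 have le: "cmod (comb n s c z')<=r" if z': "z':fib l'" for z'
 proof -
  obtain z where z: "z:fib l" "ALL i:{..<n}. dist (s i z) (s i z') < e" using e(2)[OF z'] by blast
  hence "cmod (comb n s c z - comb n s c z')<=?S * e" by (intro comb_dist) (auto intro: less_imp_le)
  thus ?thesis unfolding r_def using c(2)[OF z(1)] Se norm_triangle_ineq2[of "comb n s c z'" "comb n s c z"]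
  by (simp add: norm_minus_commute)
 qed
 define c' where "c' i=c i / of_real r" for i
 have c': "comb n s c' z=comb n s c z / of_real r" for z unfolding comb_def c'_def by (simp add: sum_divide_distrib)
 have "restrict (comb n s c') (fib l'):unit_ball F l'" unfolding unit_ball_def F using le r by (auto simp: c' norm_divide)
 hence "cmod (comb n s c' x' - comb n s c' y')<=bpm F (x', y')"
  "bpm F (x', y')<=2" using ball_pseudometric_upper[of "restrict (comb n s c') (fib l')" F l' x' y'] xy(3,4)
  ball_pseudometric_least[OF _ xy(3), of F y' 2] unit_ball_diff[of _ F l' x' y'] by auto
 moreover have "cmod (comb n s c x' - comb n s c y')=cmod (comb n s c' x' - comb n s c' y') * r"
  using r by (simp add: c' norm_divide flip: diff_divide_distrib)
 ultimately have "cmod (comb n s c x' - comb n s c y')<=bpm F (x', y') * r" using r by (simp add: mult_right_mono)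
 also have "... <= bpm F (x', y') + 2 * (C * e)" using \<open>bpm F (x', y') \<le> 2\<close> C(1) e(1)
  by (simp add: r_def distrib_left mult_right_mono)
 finally have 1: "cmod (comb n s c x' - comb n s c y')<=bpm F (x', y') + 2 * (C * e)" .
 have 2: "cmod (comb n s c x - comb n s c x')<=C * e" "cmod (comb n s c y - comb n s c y')<=C * e"
  using comb_dist[of n s x x' e c] comb_dist[of n s y y' e c] xy(5,6) Se by (auto intro: order_trans)
 have "f x - f y=(comb n s c x - comb n s c x') + (comb n s c x' - comb n s c y') - (comb n s c y - comb n s c y')"
  using c(1) xy(1,2) by simp
 hence "cmod (f x - f y)<=cmod (comb n s c x - comb n s c x') + cmod (comb n s c x' - comb n s c y') + cmod (comb n s c y - comb n s c y')"
  by (metis norm_triangle_ineq norm_triangle_ineq4 order_trans add_right_mono)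
 thus "cmod (f x - f y)<=bpm F (x', y') + 4 * C * e" using 1 2 by linarith
qed

lemma continuous_ball_pseudometric:
 assumes "local_frames F"
 shows "cntR KqK (bpm F)" unfolding cont_metric
proof (intro ballI allI impI)
 let ?T = "KqK"
 fix z0 and e :: real assume z0: "z0:topspace ?T" and e: "e > 0"
 obtain x0 y0 where xy0: "z0=(x0, y0)" by fastforce
 define l0 where "l0=q x0"
 have x0: "x0:fib l0" "y0:fib l0" "l0:LL" using z0 proj_closed by (auto simp: xy0 l0_def fibre_product_def fib_iff)
 obtain U0 n s where U0: "openin L U0" "l0:U0" and fr: "frame_on F U0 n s" using assms x0(3) unfolding local_frames_def by blast
 have s: "!!i. i < n ==> cont (s i)"
  and Fl: "!!l. l:U0 ==> F l={restrict (comb n s c) (fib l) | c. True}" and ind: "indep n s l0"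
  using fr U0(2) unfolding frame_on_def by blast+
 obtain C U1 where U1: "C > 0" "openin L U1" "l0:U1"
  "!!l c M. [|l:U1; ALL x:fib l. cmod (comb n s c x)<=M|] ==> (\<Sum>i<n. cmod (c i))<=C * M"
  using coefficient_bound[OF s x0(3) ind] by blast
 \<comment> \<open>The comparison in both directions then has the error 4 * C * d = e / 2.\<close>
 define d where "d=e / (8 * C)"
 have d: "d > 0" "4 * C * d < e" using e U1(1) by (auto simp: d_def)
 obtain U2 where U2: "openin L U2" "l0:U2"
  "!!l x. [|l:U2; x:fib l|] ==> EX y:fib l0. ALL i:{..<n}. dist (s i x) (s i y) < d"
  "!!l y. [|l:U2; y:fib l0|] ==> EX x:fib l. ALL i:{..<n}. dist (s i x) (s i y) < d"
  by (rule fibres_close[of "{..<n}" s, OF _ _ x0(3) d(1)]) (use s in auto)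
 define V where "V y={x:KK. q x:U0 Int U1 Int U2} Int {x:KK. ALL i:{..<n}. dist (s i x) (s i y) < d}" for y
 have V: "openin K (V y)" for y unfolding V_def using s U0 U1 U2
  by (intro openin_Int openin_continuous_map_preimage[OF cont_q] openin_finite_conj openin_dist_less) auto
 show "EX U. openin ?T U & z0:U & (ALL z:U. dist (bpm F z0) (bpm F z) < e)"
 proof (intro exI[of _ "(V x0 \<times> V y0) Int fibre_product K q"] conjI ballI)
  show "openin ?T (V x0 \<times> V y0 Int fibre_product K q)" unfolding openin_subtopology using V
  by (intro exI[of _ "V x0 \<times> V y0"]) (simp add: openin_prod_Times_iff)
  show "z0:V x0 \<times> V y0 Int fibre_product K q" using x0 d U0 U1 U2 by (auto simp: xy0 V_def fib_iff fibre_product_def)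
  fix z assume "z:V x0 \<times> V y0 Int fibre_product K q"
  then obtain x y where z: "z=(x, y)" "x:V x0" "y:V y0" "q x=q y" by (auto simp: fibre_product_def)
  define l where "l=q x"
  have l: "l:U0" "l:U1" "l:U2" "x:fib l" "y:fib l" using z by (auto simp: V_def l_def fib_iff)
  have dx: "!!i. i < n ==> dist (s i x) (s i x0)<=d" "!!i. i < n ==> dist (s i y) (s i y0)<=d" using z by (force simp: V_def)+
  have c1: "bpm F (x, y)<=bpm F (x0, y0) + 4 * C * d"
  by (rule ball_pseudometric_compare[OF Fl[OF l(1)] Fl[OF U0(2)] U1(1) U1(4)[OF l(2)] d(1)]) (use U2(4)[OF l(3)] l x0 dx in auto)
  have c2: "bpm F (x0, y0)<=bpm F (x, y) + 4 * C * d"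
  by (rule ball_pseudometric_compare[OF Fl[OF U0(2)] Fl[OF l(1)] U1(1) U1(4)[OF U1(3)] d(1)])
  (use U2(3)[OF l(3)] l x0 dx in \<open>auto simp: dist_commute\<close>)
  show "dist (bpm F z0) (bpm F z) < e" using c1 c2 d(2) unfolding z xy0 dist_real_def by linarith
 qed
qed

text \<open>The identity from the compact fibre to the topology of the pseudometrics is continuous,
  and the latter is Hausdorff by separation, so it is a homeomorphism.\<close>

lemma pseudometrics_topology_fib:
 assumes l: "l:LL"
  and cont: "!!p. p:P ==> cntR KqK p"
  and pm: "!!p. p:P ==> pseudometric_on (fib l) p"
  and sep: "!!x y. [|x:fib l; y:fib l; x ~= y|] ==> EX p:P. p (x, y) ~= 0"
 shows "pseudometrics_topology (fib l) P=fsp l"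
proof -
 let ?B = "insert (fib l) {{y:fib l. p (x, y) < r} | p x r. p:P & x:fib l & 0 < r}"
 let ?T = "pseudometrics_topology (fib l) P"
 have top: "topspace ?T=fib l" unfolding pseudometrics_topology_def by (auto simp: topology_generated_by_topspace)
 have basic: "openin ?T {y:fib l. p (x, y) < r}" if "p:P" "x:fib l" "0 < r" for p x r
  unfolding pseudometrics_topology_def using that by (intro topology_generated_by_Basis) blast
 have ball_open: "openin (fsp l) {y:fib l. p (x, y) < r}" if "p:P" "x:fib l" for p x r
 proof -
  have "continuous_map (fsp l) KqK (%y. (x, y))" unfolding continuous_map_in_subtopology using that
  by (auto simp: fib_iff fibre_product_def intro!: continuous_map_pairedI continuous_map_from_subtopology)
  hence "cntR (fsp l) (%y. p (x, y))" using continuous_map_compose[OF _ cont[OF that(1)]] by (simp add: comp_def)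
  thus ?thesis using openin_continuous_map_preimage[of "fsp l" euclideanreal "%y. p (x, y)" "{..<r}"] unfolding topspace_fib by simp
 qed
 have "continuous_map (fsp l) ?T id" unfolding pseudometrics_topology_def
 proof (rule continuous_on_generated_topo)
  fix U assume "U:?B"
  thus "openin (fsp l) (id -` U Int topspace (fsp l))"
  proof (cases "U=fib l")
  case False
  then obtain p x r where U: "U={y:fib l. p (x, y) < r}" "p:P" "x:fib l" using \<open>U \<in> ?B\<close> by blast
  have "id -` U Int topspace (fsp l)=U" using U(1) by (auto simp: fib_iff)
  thus ?thesis using ball_open[OF U(2,3)] U(1) by simp
  next
  case True
  show ?thesis using openin_topspace[of "fsp l"] unfolding topspace_fib True by simp
  qed
 qed auto
 moreover have "Hausdorff_space ?T" unfolding Hausdorff_space_def top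
 proof (intro allI impI)
  fix x y assume "x:fib l & y:fib l & x ~= y"
  then obtain p where xy: "x:fib l" "y:fib l" and p: "p:P" "p (x, y) ~= 0" using sep by blast
  note pmp = pm[OF p(1), unfolded pseudometric_on_def]
  have pos: "p (x, y) > 0" using p(2) pmp xy by (metis less_eq_real_def)
  let ?U = "{z:fib l. p (x, z) < p (x, y) / 2}" and ?V = "{z:fib l. p (y, z) < p (x, y) / 2}"
  have "disjnt ?U ?V" unfolding disjnt_def
  proof (rule ccontr)
  assume "?U Int ?V ~= {}"
  then obtain z where z: "z:fib l" "p (x, z) < p (x, y) / 2" "p (y, z) < p (x, y) / 2" by blast
  have "p (x, y)<=p (x, z) + p (z, y)" "p (z, y)=p (y, z)" using pmp xy z(1) by blast+
  thus False using z by linarith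
  qed
  thus "EX U V. openin ?T U & openin ?T V & x:U & y:V & disjnt U V"
  proof (intro exI conjI)
  show "openin ?T ?U" "openin ?T ?V" by (rule basic[OF p(1)]; use pos xy in simp)+
  show "x:?U" "y:?V" using xy pos pmp by auto
  qed
 qed
 ultimately have "homeomorphic_map (fsp l) ?T id"
  using compact_fib[OF l] top by (intro continuous_imp_homeomorphic_map) (auto simp: fib_iff)
 thus ?thesis by (simp add: homeomorphic_map_id)
qed

text \<open>If all pseudometrics vanish at (x, y), no generating set contains just one of the two
  points; this passes to all open sets and contradicts the Hausdorff property.\<close>

lemma pseudometrics_separate:
 assumes eq: "pseudometrics_topology (fib l) P=fsp l"
  and pm: "!!p. p:P ==> pseudometric_on (fib l) p"
  and xy: "x:fib l" "y:fib l" "x ~= y"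
 obtains p where "p:P" "p (x, y) ~= 0"
proof (rule ccontr)
 note goal = that
 assume "~thesis"
 hence zero: "p (x, y)=0" if "p:P" for p using goal[OF that] by blast
 let ?B = "insert (fib l) {{y:fib l. p (x, y) < r} | p x r. p:P & x:fib l & 0 < r}"
 have iff: "x:U \<longleftrightarrow> y:U" if "generate_topology_on ?B U" for U using that
 proof (induction rule: generate_topology_on.induct)
  case (Basis U)
  show ?case
  proof (cases "U=fib l")
  case False
  then obtain p z r where U: "U={y:fib l. p (z, y) < r}" "p:P" "z:fib l" using Basis by blast
  note pmp = pm[OF U(2), unfolded pseudometric_on_def]
  have "p (z, x)<=p (z, y) + p (y, x)" "p (z, y)<=p (z, x) + p (x, y)" "p (y, x)=p (x, y)" using pmp U(3) xy by blast+
  thus ?thesis using zero[OF U(2)] U(1) xy by auto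
  qed (use xy in auto)
 qed auto
 have "Hausdorff_space (pseudometrics_topology (fib l) P)" unfolding eq by (rule Hausdorff_fib)
 then obtain U where "openin (pseudometrics_topology (fib l) P) U" "x:U" "y ~: U"
  using xy topspace_fib[of l] unfolding Hausdorff_space_def eq disjnt_def by (metis disjoint_iff)
 thus False using iff unfolding pseudometrics_topology_def openin_topology_generated_by_iff by blast
qed

end

section \<open>Ultrafilters and compactness\<close>

definition finite_meet :: "'a set => 'a set set => bool" where
 "finite_meet S \<A> \<longleftrightarrow> (ALL \<B>. finite \<B> & \<B><=\<A> --> S Int \<Inter>\<B> ~= {})"

definition ultra :: "'a set => 'a set set => bool" where
 "ultra S \<U> \<longleftrightarrow> \<U><=Pow S & finite_meet S \<U> & (ALL A<=S. A:\<U> | S - A:\<U>)"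

text \<open>Zorn's lemma. A set missing from a maximal family is disjoint, within S, from a finite
  intersection of members; this cannot happen both for A and for S - A.\<close>

lemma ultra_extends:
 assumes "\<A><=Pow S" "finite_meet S \<A>"
 obtains \<U> where "ultra S \<U>" "\<A><=\<U>"
proof -
 define Z where "Z={\<U>. \<A><=\<U> & \<U><=Pow S & finite_meet S \<U>}"
 have "EX M:Z. ALL X:Z. M<=X --> X=M"
 proof (rule subset_Zorn_nonempty)
  show "Z ~= {}" using assms by (auto simp: Z_def)
  fix \<C> assume C: "\<C> ~= {}" "subset.chain Z \<C>"
  have "finite_meet S (\<Union>\<C>)" unfolding finite_meet_def
  proof (intro allI impI)
  fix \<B> assume "finite \<B> & \<B><=\<Union>\<C>"
  then obtain \<U> where "\<U>:\<C>" "\<B><=\<U>" using finite_subset_Union_chain[of \<B> \<C> Z] C by blast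
  thus "S Int \<Inter>\<B> ~= {}"
  using C(2) \<open>finite \<B> \<and> \<B> \<subseteq> \<Union>\<C>\<close> by (auto simp: subset.chain_def Z_def finite_meet_def subset_iff)
  qed
  moreover have "\<A><=\<Union>\<C>" "\<Union>\<C><=Pow S" using C by (fastforce simp: subset.chain_def Z_def)+
  ultimately show "\<Union>\<C>:Z" by (simp add: Z_def)
 qed
 then obtain M where M: "M:Z" "!!X. X:Z ==> M<=X ==> X=M" by blast
 have miss: "EX \<B>. finite \<B> & \<B><=M & S Int \<Inter>\<B> Int A={}" if A: "A<=S" "A ~: M" for A
 proof -
  have "insert A M ~: Z" using M(2)[of "insert A M"] A(2) by blast
  then obtain \<B> where B: "finite \<B>" "\<B><=insert A M" "S Int \<Inter>\<B> = {}" using M(1) A(1) by (auto simp: Z_def finite_meet_def)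
  have "S Int \<Inter>(\<B> - {A}) Int A={}" using B(3) by auto
  thus ?thesis using B(1,2) by (intro exI[of _ "\<B> - {A}"]) auto
 qed
 have "A:M | S - A:M" if A: "A<=S" for A
 proof (rule ccontr)
  assume "~(A:M | S - A:M)"
  then obtain \<B> \<B>' where B: "finite \<B>" "\<B><=M" "S Int \<Inter>\<B> Int A={}"
  and B': "finite \<B>'" "\<B>'<=M" "S Int \<Inter>\<B>' Int (S - A)={}" using miss[of A] miss[of "S - A"] A by auto
  have "S Int \<Inter>(\<B> Un \<B>')={}" using B(3) B'(3) by auto
  moreover have "finite_meet S M" using M(1) by (simp add: Z_def)
  ultimately show False using B(1,2) B'(1,2) unfolding finite_meet_def by (metis finite_Un Un_subset_iff)
 qed
 thus thesis using M(1) that[of M] by (auto simp: Z_def ultra_def)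
qed

context
 fixes S :: "'a set" and \<U>
 assumes U: "ultra S \<U>"
begin

lemma ultra_meet: "[|A:\<U>; B:\<U>|] ==> A Int B ~= {}"
 using U unfolding ultra_def finite_meet_def by (metis finite.emptyI finite.insertI Inter_insert Inter_empty
  Int_UNIV_right Int_empty_right empty_subsetI insert_subset)

lemma ultra_subset: "A:\<U> ==> A<=S" using U unfolding ultra_def by blast

lemma ultra_compl: "A<=S ==> A ~: \<U> ==> S - A:\<U>" using U unfolding ultra_def by blast

lemma ultra_mono: "[|A:\<U>; A<=B; B<=S|] ==> B:\<U>" using ultra_compl[of B] ultra_meet[of A "S - B"] by blast

lemma ultra_Int:
 assumes "A:\<U>" "B:\<U>"
 shows "A Int B:\<U>"
proof (rule ccontr)
 assume "A Int B ~: \<U>"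
 hence "S - A Int B:\<U>" using assms ultra_subset by (intro ultra_compl) auto
 hence "{A, B, S - A Int B}<=\<U>" "finite {A, B, S - A Int B}" using assms by auto
 hence "S Int \<Inter>{A, B, S - A Int B} ~= {}" using U unfolding ultra_def finite_meet_def by blast
 thus False by auto
qed

lemma ultra_space: "S:\<U>" using U ultra_compl[of S] unfolding ultra_def finite_meet_def
 by (metis Diff_cancel Inter_insert Int_empty_left Int_empty_right finite.emptyI finite.insertI insert_subset empty_subsetI order_refl)

lemma ultra_finite_Union:
 assumes "finite I" "!!i. i:I ==> A i<=S" "B:\<U>" "B<=(\<Union>i\<in>I. A i)"
 obtains i where "i:I" "A i:\<U>"
proof (rule ccontr)
 note goal = that
 assume "~thesis"
 hence notin: "A i ~: \<U>" if "i:I" for i using goal[OF that] by blast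
 have "{x:S. ALL i:J. x ~: A i}:\<U>" if "finite J" "J<=I" for J using that
 proof (induction J rule: finite_induct)
  case (insert i J)
  have "S - A i:\<U>" using insert assms(2) notin by (intro ultra_compl) auto
  hence "(S - A i) Int {x:S. ALL i:J. x ~: A i}:\<U>" using insert by (intro ultra_Int) auto
  moreover have "(S - A i) Int {x:S. ALL i:J. x ~: A i}={x:S. ALL i:insert i J. x ~: A i}" by auto
  ultimately show ?case by simp
 qed (simp add: ultra_space)
 hence "B Int {x:S. ALL i:I. x ~: A i} ~= {}" using assms(1,3) by (intro ultra_meet) auto
 thus False using assms(4) by blast
qed

text \<open>If every point had a neighbourhood whose preimage is not in the ultrafilter, finitely
  many such preimages would cover S.\<close>

lemma ultra_limit:
 assumes Y: "compact_space Y" and h: "h ` S<=topspace Y"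
 obtains y where "y:topspace Y" "!!V. [|openin Y V; y:V|] ==> {s:S. h s:V}:\<U>"
proof (rule ccontr)
 note goal = that
 assume "~thesis"
 hence "ALL y. EX V. y:topspace Y --> openin Y V & y:V & {s:S. h s:V} ~: \<U>" using goal by blast
 then obtain V where V: "!!y. y:topspace Y ==> openin Y (V y) & y:V y & {s:S. h s:V y} ~: \<U>" by metis
 obtain F where F: "finite F" "F<=topspace Y" "topspace Y<=(\<Union>y\<in>F. V y)"
  by (rule compactin_pointwise[of Y "topspace Y" V]) (use V Y in \<open>auto simp: compact_space_def\<close>)
 obtain y where "y:F" "{s:S. h s:V y}:\<U>"
  by (rule ultra_finite_Union[OF F(1) _ ultra_space, of "%y. {s:S. h s:V y}"]) (use F(3) h in blast)+
 thus False using V F(2) by blast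
qed

text \<open>The Kuratowski limit of the relations R s along the ultrafilter.\<close>

definition limit_rel :: "'b topology => ('a => ('b \<times> 'b) set) => ('b \<times> 'b) set" where
 "limit_rel X R={(x, y). x:topspace X & y:topspace X &
  (ALL M N. openin X M & openin X N & x:M & y:N --> {s:S. R s Int M \<times> N ~= {}}:\<U>)}"

text \<open>Otherwise finitely many boxes, each met only by a negligible set of the R s, cover the
  compact product of C and D.\<close>

lemma limit_rel_meets:
 assumes X: "compactin X C" "compactin X D" and hit: "{s:S. R s Int C \<times> D ~= {}}:\<U>"
 obtains x y where "(x, y):limit_rel X R" "x:C" "y:D"
proof (rule ccontr)
 note goal = that
 assume "~thesis"
 hence no: "(x, y) ~: limit_rel X R" if "x:C" "y:D" for x y using goal that by blast
 have sub: "C<=topspace X" "D<=topspace X" using X by (auto simp: compactin_subset_topspace)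
 have "ALL z:C \<times> D. EX MN. openin X (fst MN) & openin X (snd MN) & z:fst MN \<times> snd MN &
  {s:S. R s Int fst MN \<times> snd MN ~= {}} ~: \<U>"
 proof
  fix z assume z: "z:C \<times> D"
  obtain x y where xy: "z=(x, y)" by fastforce
  obtain M N where "openin X M" "openin X N" "x:M" "y:N" "{s:S. R s Int M \<times> N ~= {}} ~: \<U>"
  using no[of x y] z sub unfolding limit_rel_def xy by blast
  thus "EX MN. openin X (fst MN) & openin X (snd MN) & z:fst MN \<times> snd MN &
  {s:S. R s Int fst MN \<times> snd MN ~= {}} ~: \<U>" by (intro exI[of _ "(M, N)"]) (simp add: xy)
 qed
 from bchoice[OF this] obtain MN where MN': "ALL z:C \<times> D. openin X (fst (MN z)) & openin X (snd (MN z)) &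
  z:fst (MN z) \<times> snd (MN z) & {s:S. R s Int fst (MN z) \<times> snd (MN z) ~= {}} ~: \<U>" ..
 define M N where "M z=fst (MN z)" and "N z=snd (MN z)" for z
 have MN: "openin X (M z) & openin X (N z) & z:M z \<times> N z & {s:S. R s Int M z \<times> N z ~= {}} ~: \<U>"
  if "z:C \<times> D" for z using bspec[OF MN' that] unfolding M_def N_def .
 have "compactin (prod_topology X X) (C \<times> D)" using X by (simp add: compactin_Times)
 then obtain F where F: "finite F" "F<=C \<times> D" "C \<times> D<=(\<Union>z\<in>F. M z \<times> N z)"
  by (rule compactin_pointwise[of _ _ "%z. M z \<times> N z"]) (use MN in \<open>auto simp: openin_prod_Times_iff\<close>)
 obtain z where "z:F" "{s:S. R s Int M z \<times> N z ~= {}}:\<U>"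
  by (rule ultra_finite_Union[OF F(1) _ hit, of "%z. {s:S. R s Int M z \<times> N z ~= {}}"]) (use F(3) in blast)+
 thus False using MN F(2) by blast
qed

text \<open>Same covering argument on the second factor alone; the finitely many neighbourhoods of x
  are intersected, so that only points near x remain to be considered.\<close>

lemma limit_rel_total:
 assumes X: "compact_space X" and R: "!!s. s:S ==> R s<=topspace X \<times> topspace X" and x: "x:topspace X"
  and hit: "!!M. [|openin X M; x:M|] ==> {s:S. R s Int M \<times> topspace X ~= {}}:\<U>"
 obtains y where "(x, y):limit_rel X R"
proof (rule ccontr)
 note goal = that
 assume "~thesis"
 hence no: "(x, y) ~: limit_rel X R" for y using goal by blast
 have "ALL y:topspace X. EX MN. openin X (fst MN) & openin X (snd MN) & x:fst MN & y:snd MN &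
  {s:S. R s Int fst MN \<times> snd MN ~= {}} ~: \<U>"
 proof
  fix y assume y: "y:topspace X"
  obtain M N where "openin X M" "openin X N" "x:M" "y:N" "{s:S. R s Int M \<times> N ~= {}} ~: \<U>"
  using no[of y] x y unfolding limit_rel_def by blast
  thus "EX MN. openin X (fst MN) & openin X (snd MN) & x:fst MN & y:snd MN &
  {s:S. R s Int fst MN \<times> snd MN ~= {}} ~: \<U>" by (intro exI[of _ "(M, N)"]) simp
 qed
 from bchoice[OF this] obtain MN where MN': "ALL y:topspace X. openin X (fst (MN y)) & openin X (snd (MN y)) &
  x:fst (MN y) & y:snd (MN y) & {s:S. R s Int fst (MN y) \<times> snd (MN y) ~= {}} ~: \<U>" ..
 define M N where "M z=fst (MN z)" and "N z=snd (MN z)" for z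
 have MN: "openin X (M y) & openin X (N y) & x:M y & y:N y & {s:S. R s Int M y \<times> N y ~= {}} ~: \<U>"
  if "y:topspace X" for y using bspec[OF MN' that] unfolding M_def N_def .
 obtain F where F: "finite F" "F<=topspace X" "topspace X<=(\<Union>y\<in>F. N y)"
  by (rule compactin_pointwise[of X "topspace X" N]) (use MN X in \<open>auto simp: compact_space_def\<close>)
 define M' where "M'={z:topspace X. ALL y:F. z:M y}"
 have "openin X {z:topspace X. z:M y}" if "y:F" for y
 proof -
  have "openin X (M y)" using MN F(2) that by blast
  moreover have "{z:topspace X. z:M y}=M y" using openin_subset[OF calculation] by blast
  ultimately show ?thesis by simp
 qed
 hence "openin X M'" unfolding M'_def using F(1) by (intro openin_finite_conj)
 moreover have "x:M'" using MN F(2) x by (auto simp: M'_def)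
 ultimately have "{s:S. R s Int M' \<times> topspace X ~= {}}:\<U>" by (rule hit)
 then obtain y where "y:F" "{s:S. R s Int M y \<times> N y ~= {}}:\<U>"
  by (rule ultra_finite_Union[OF F(1), rotated, of _ "%y. {s:S. R s Int M y \<times> N y ~= {}}"])
  (use F(3) in \<open>fastforce simp: M'_def\<close>)+
 thus False using MN F(2) by blast
qed

lemma limit_rel_converse: "(y, x):limit_rel X (%s. (R s)\<inverse>) \<longleftrightarrow> (x, y):limit_rel X R"
proof -
 have "(R s)\<inverse> Int N \<times> M ~= {} \<longleftrightarrow> R s Int M \<times> N ~= {}" for s M N by auto
 thus ?thesis unfolding limit_rel_def by auto
qed

end

text \<open>A family of closed sets whose finite intersections meet S is extended to an ultrafilter
  on S. Its limit lies in all of them, since the complement of a member would be a neighbourhood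
  disjoint from that member.\<close>

lemma compactin_ultra:
 assumes "S<=topspace X" "!!\<U>. ultra S \<U> ==> EX x:S. ALL V. openin X V & x:V --> S Int V:\<U>"
 shows "compactin X S" unfolding compactin_fip
proof (intro conjI allI impI)
 fix \<C> assume C: "(ALL C:\<C>. closedin X C) & (ALL \<F>. finite \<F> & \<F><=\<C> --> S Int \<Inter>\<F> ~= {})"
 have "finite_meet S ((\<inter>) S ` \<C>)" unfolding finite_meet_def
 proof (intro allI impI)
  fix \<B> assume "finite \<B> & \<B><=(\<inter>) S ` \<C>"
  then obtain \<F> where F: "finite \<F>" "\<F><=\<C>" "\<B> = (\<inter>) S ` \<F>" by (meson finite_subset_image)
  hence "S Int \<Inter>\<F> ~= {}" using C by blast
  thus "S Int \<Inter>\<B> ~= {}" using F(3) by auto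
 qed
 then obtain \<U> where U: "ultra S \<U>" "(\<inter>) S ` \<C><=\<U>" by (rule ultra_extends[rotated]) auto
 obtain x where x: "x:S" and nbh: "ALL V. openin X V & x:V --> S Int V:\<U>" using assms(2)[OF U(1)] by (rule bexE)
 have "x:C" if "C:\<C>" for C
 proof (rule ccontr)
  assume "x ~: C"
  hence "S Int (topspace X - C):\<U>" using that C x(1) assms(1) by (intro nbh[rule_format]) auto
  moreover have "S Int C:\<U>" using U(2) that by blast
  ultimately show False using ultra_meet[OF U(1), of "S Int (topspace X - C)" "S Int C"] by blast
 qed
 thus "S Int \<Inter>\<C> ~= {}" using x(1) by blast
qed (use assms(1) in auto)

section \<open>The space of maps between fibres\<close>

lemma arrow_sel [simp]: "src (l, m, f)=l" "tgt (l, m, f)=m" "arr (l, m, f)=f" by (auto simp: src_def tgt_def arr_def)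

lemma arrow_eq_iff: "t=h \<longleftrightarrow> src t=src h & tgt t=tgt h & arr t=arr h" by (cases t; cases h) auto

context open_fibration
begin

abbreviation arrows :: "('l, 'k) arrow set" where
 "arrows == fibre_maps K L q"

abbreviation atop :: "('l, 'k) arrow topology" where
 "atop == fibre_maps_topology K L q"

definition W :: "'k set => 'k set => ('l, 'k) arrow set" where
 "W C V={t:arrows. arr t ` (C Int fib (src t))<=V}"

lemma arrowsD:
 assumes "t:arrows"
 shows "src t:LL" "tgt t:LL" "arr t:extensional (fib (src t))"
  "continuous_map (fsp (src t)) (fsp (tgt t)) (arr t)"
  "x:fib (src t) ==> arr t x:fib (tgt t)"
proof -
 show *: "src t:LL" "tgt t:LL" "arr t:extensional (fib (src t))"
  "continuous_map (fsp (src t)) (fsp (tgt t)) (arr t)" using assms by (auto simp: fibre_maps_def)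
 show "x:fib (src t) ==> arr t x:fib (tgt t)" using continuous_map_image_subset_topspace[OF *(4)] unfolding topspace_fib by auto
qed

lemma arrows_topology_W: "atop=topology_generated_by {W C V | C V. compactin K C & openin K V}" unfolding fibre_maps_topology_def W_def ..

lemma openin_W: "[|compactin K C; openin K V|] ==> openin atop (W C V)"
 unfolding arrows_topology_W by (intro topology_generated_by_Basis) blast

lemma topspace_arrows: "topspace atop=arrows"
proof
 show "topspace atop<=arrows" unfolding arrows_topology_W by (auto simp: topology_generated_by_topspace W_def)
 have "W {} {}=arrows" by (auto simp: W_def)
 thus "arrows<=topspace atop" using openin_subset[OF openin_W[of "{}" "{}"]] by simp
qed

lemma openin_proj_preimage: "openin L U ==> openin K {x:KK. q x:U}" by (rule openin_continuous_map_preimage[OF cont_q])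

lemma compactin_closed: "closedin K C ==> compactin K C" by (simp add: closedin_compact_space compact_total)

text \<open>The source is visible in the compact-open topology through an empty target: an arrow
  lies in \<open>W C {}\<close> exactly if C misses its source fibre, and fibres are
  nonempty.\<close>

lemma continuous_src: "continuous_map atop L src" unfolding continuous_map_def topspace_arrows
proof (intro conjI allI impI)
 show "src:arrows \<rightarrow> LL" using arrowsD by auto
 fix U assume U: "openin L U"
 have "{t:arrows. src t:U}=W (KK - {x:KK. q x:U}) {}"
 proof (intro equalityI subsetI)
  fix t assume "t:W (KK - {x:KK. q x:U}) {}"
  hence t: "t:arrows" "(KK - {x:KK. q x:U}) Int fib (src t)={}" by (auto simp: W_def)
  thus "t:{t:arrows. src t:U}" using fib_nonempty[OF arrowsD(1)[OF t(1)]] by (auto simp: fib_iff)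
 qed (auto simp: W_def fib_iff)
 thus "openin atop {t:arrows. src t:U}" using openin_proj_preimage[OF U] by (auto intro!: openin_W compactin_closed)
qed

lemma continuous_tgt: "continuous_map atop L tgt" unfolding continuous_map_def topspace_arrows
proof (intro conjI allI impI)
 show "tgt:arrows \<rightarrow> LL" using arrowsD by auto
 fix U assume U: "openin L U"
 have "{t:arrows. tgt t:U}=W (KK) {x:KK. q x:U}"
 proof (intro equalityI subsetI)
  fix t assume t: "t:W (KK) {x:KK. q x:U}"
  hence "t:arrows" by (simp add: W_def)
  then obtain x where "x:fib (src t)" using fib_nonempty[OF arrowsD(1)] by blast
  thus "t:{t:arrows. tgt t:U}" using arrowsD(5)[OF \<open>t \<in> arrows\<close>] t by (auto simp: W_def fib_iff image_subset_iff)
 next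
  fix t assume "t:{t:arrows. tgt t:U}"
  thus "t:W (KK) {x:KK. q x:U}" using arrowsD(5)[of t] by (auto simp: W_def fib_iff)
 qed
 thus "openin atop {t:arrows. tgt t:U}" using openin_proj_preimage[OF U] compact_total by (auto intro!: openin_W simp: compact_space_def)
qed

lemma evaluation_neighbourhood:
 assumes t: "t:arrows" and x: "x:fib (src t)" and V: "openin K V" "arr t x:V"
 obtains C O' where "compactin K C" "openin K O'" "x:O'" "O'<=C" "t:W C V"
proof -
 have "openin (fsp (tgt t)) (V Int fib (tgt t))" using V(1) by (auto simp: openin_subtopology)
 hence "openin (fsp (src t)) {y:fib (src t). arr t y:V Int fib (tgt t)}"
  using openin_continuous_map_preimage[OF arrowsD(4)[OF t]] unfolding topspace_fib by blast
 then obtain N where N: "openin K N" "{y:fib (src t). arr t y:V Int fib (tgt t)}=N Int fib (src t)" by (auto simp: openin_subtopology)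
 have "x:N" using N(2) x V(2) arrowsD(5)[OF t x] by blast
 then obtain O' C where "openin K O'" "closedin K C" "x:O'" "O'<=C" "C<=N"
  using compact_Hausdorff_shrink[OF compact_total Hausdorff_total N(1)] by metis
 moreover have "t:W C V" using N(2) \<open>C \<subseteq> N\<close> t by (auto simp: W_def)
 ultimately show thesis using that compactin_closed by metis
qed

text \<open>Distinct end points are separated by \<open>src\<close> or \<open>tgt\<close>. For
  parallel arrows with different values at x, sets \<open>W C A\<close> and \<open>W D B\<close>
  alone are not enough, since C or D might miss the source fibre of another arrow. Hence sources are
  confined to q(M \<inter> N), which is open as q is open: there every source fibre contains a point
  of both C and D.\<close>

lemma Hausdorff_arrows: "Hausdorff_space atop" unfolding Hausdorff_space_def topspace_arrows
proof (intro allI impI)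
 fix t u assume *: "t:arrows & u:arrows & t ~= u"
 have by_map: "EX U V. openin atop U & openin atop V & t:U & u:V & disjnt U V"
  if h: "continuous_map atop L h" "h t ~= h u" for h
 proof -
  have "h t:LL" "h u:LL" using continuous_map_image_subset_topspace[OF h(1)] * by (auto simp: topspace_arrows)
  then obtain U V where U: "openin L U" "openin L V" "h t:U" "h u:V" "disjnt U V"
  using h(2) Hausdorff_base unfolding Hausdorff_space_def by metis
  show ?thesis
  proof (intro exI conjI)
  show "openin atop {t:arrows. h t:U}" "openin atop {t:arrows. h t:V}"
  using openin_continuous_map_preimage[OF h(1)] U by (auto simp: topspace_arrows)
  qed (use U * in \<open>auto simp: disjnt_def\<close>)
 qed
 show "EX U V. openin atop U & openin atop V & t:U & u:V & disjnt U V"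
 proof (cases "src t=src u & tgt t=tgt u")
  case True
  hence "arr t ~= arr u" using * by (simp add: arrow_eq_iff)
  then obtain x where x: "x:fib (src t)" "arr t x ~= arr u x" using * True arrowsD(3)[of t] arrowsD(3)[of u] by (metis extensionalityI)
  hence "arr t x:KK" "arr u x:KK" using * True arrowsD(5)[of t x] arrowsD(5)[of u x] by (auto simp: fib_iff)
  then obtain A B where AB: "openin K A" "openin K B" "arr t x:A" "arr u x:B" "disjnt A B"
  using x(2) Hausdorff_total unfolding Hausdorff_space_def by metis
  obtain C M where C: "compactin K C" "openin K M" "x:M" "M<=C" "t:W C A" using evaluation_neighbourhood[of t x A] * x AB by metis
  obtain D N where D: "compactin K D" "openin K N" "x:N" "N<=D" "u:W D B" using evaluation_neighbourhood[of u x B] * x AB True by metis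
  let ?O = "{k:arrows. src k:q ` (M Int N)}"
  have O: "openin atop ?O" using openin_continuous_map_preimage[OF continuous_src openin_image[OF openin_Int[OF C(2) D(2)]]]
  by (simp add: topspace_arrows)
  have "src t:q ` (M Int N)" using x(1) C(3) D(3) by (intro image_eqI[of _ _ x]) (auto simp: fib_iff)
  hence "t:?O" "u:?O" using * True by auto
  moreover have "disjnt (W C A Int ?O) (W D B Int ?O)"
  proof -
  have False if k: "k:W C A" "k:W D B" "k:?O" for k
  proof -
  obtain z where z: "z:M" "z:N" "src k=q z" using k(3) by blast
  hence "z:fib (src k)" using openin_subset[OF C(2)] by (auto simp: fib_iff)
  hence "arr k z:A" "arr k z:B" using k z C(4) D(4) by (auto simp: W_def image_subset_iff)
  thus False using AB(5) by (auto simp: disjnt_def)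
  qed
  thus ?thesis by (auto simp: disjnt_def)
  qed
  ultimately show ?thesis using C(5) D(5) O openin_W[OF C(1) AB(1)] openin_W[OF D(1) AB(2)]
  by (intro exI[of _ "W C A Int ?O"] exI[of _ "W D B Int ?O"]) auto
 qed (use by_map[OF continuous_src] by_map[OF continuous_tgt] in blast)
qed

text \<open>The compact set that will contain the enveloping semigroupoid.\<close>

definition iarr :: "('k \<times> 'k => real) set => ('l, 'k) arrow set" where
 "iarr P={t:arrows. bij_betw (arr t) (fib (src t)) (fib (tgt t)) &
  (ALL p:P. ALL x:fib (src t). ALL y:fib (src t). p (arr t x, arr t y)=p (x, y))}"

lemma pseudometric_neighbourhood:
 assumes p: "cntR KqK p"
  and xy: "x:fib l" "y:fib l" and e: "e > 0"
 obtains M N where "openin K M" "openin K N" "x:M" "y:N"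
  "!!u v. [|u:M; v:N; q u=q v|] ==> abs (p (x, y) - p (u, v)) < e"
proof -
 have "(x, y):topspace KqK" using xy by (auto simp: fibre_product_def fib_iff)
 then obtain U where U: "openin KqK U" "(x, y):U"
  "!!z. z:U ==> dist (p (x, y)) (p z) < e" using p e unfolding cont_metric by meson
 obtain T where T: "openin (prod_topology K K) T" "U=T Int fibre_product K q" using U(1) by (auto simp: openin_subtopology)
 obtain M N where MN: "openin K M" "openin K N" "x:M" "y:N" "M \<times> N<=T"
 proof -
  have "(x, y):T" using U(2) T(2) by blast
  thus thesis using T(1)[unfolded openin_prod_topology_alt, rule_format, of x y] that by blast
 qed
 show thesis
 proof (rule that[OF MN(1-4)])
  fix u v assume "u:M" "v:N" "q u=q v"
  hence "(u, v):U" using T(2) MN openin_subset[OF MN(1)] openin_subset[OF MN(2)] by (auto simp: fibre_product_def)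
  thus "abs (p (x, y) - p (u, v)) < e" using U(3) by (fastforce simp: dist_real_def)
 qed
qed

text \<open>Along an ultrafilter the sources, targets and graphs of the arrows converge. The limit
  relation between the limit fibres is shown to be the graph of an isometric bijection, and the
  arrows converge to it in the compact-open topology.\<close>

lemma compactin_isometric_arrows:
 assumes cont: "!!p. p:P ==> cntR KqK p"
  and pm: "!!p l. p:P ==> l:LL ==> pseudometric_on (fib l) p"
  and top: "!!l. l:LL ==> pseudometrics_topology (fib l) P=fsp l"
 shows "compactin atop (iarr P)"
proof (rule compactin_ultra)
 let ?S = "iarr P"
 show "?S<=topspace atop" by (auto simp: topspace_arrows iarr_def)
 fix \<U> assume U: "ultra ?S \<U>"
 obtain l where l: "l:LL" "!!V. [|openin L V; l:V|] ==> {t:?S. src t:V}:\<U>"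
  by (rule ultra_limit[OF U compact_base, of src]) (auto simp: iarr_def dest: arrowsD)
 obtain m where m: "m:LL" "!!V. [|openin L V; m:V|] ==> {t:?S. tgt t:V}:\<U>"
  by (rule ultra_limit[OF U compact_base, of tgt]) (auto simp: iarr_def dest: arrowsD)
 define R where "R t={(u, v). u:fib (src t) & v=arr t u}" for t :: "('l, 'k) arrow"
 have RS: "R t<=fib (src t) \<times> fib (tgt t)" if "t:?S" for t using that by (auto simp: R_def iarr_def intro: arrowsD(5))
 have RK: "R t<=KK \<times> KK" if "t:?S" for t using RS[OF that] fib_subset by blast
 define \<Gamma> where "\<Gamma> = limit_rel ?S \<U> K R"
 have \<Gamma>_fib: "x:fib l & y:fib m" if xy: "(x, y):\<Gamma>" for x y
 proof -
  have top: "x:KK" "y:KK"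
  and hit: "!!M N. [|openin K M; openin K N; x:M; y:N|] ==> {t:?S. R t Int M \<times> N ~= {}}:\<U>"
  using xy unfolding \<Gamma>_def limit_rel_def[OF U] by blast+
  have "q x=l"
  proof (rule ccontr)
  assume "q x ~= l"
  then obtain A B where AB: "openin L A" "openin L B" "q x:A" "l:B" "disjnt A B"
  using Hausdorff_base l(1) proj_closed[OF top(1)] unfolding Hausdorff_space_def by metis
  have "{t:?S. R t Int {x:KK. q x:A} \<times> KK ~= {}}:\<U>" using AB top by (intro hit openin_proj_preimage) auto
  from ultra_meet[OF U this l(2)[OF AB(2,4)]] show False using AB(5) by (auto simp: R_def fib_iff disjnt_def)
  qed
  moreover have "q y=m"
  proof (rule ccontr)
  assume "q y ~= m"
  then obtain A B where AB: "openin L A" "openin L B" "q y:A" "m:B" "disjnt A B"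
  using Hausdorff_base m(1) proj_closed[OF top(2)] unfolding Hausdorff_space_def by metis
  have "{t:?S. R t Int KK \<times> {x:KK. q x:A} ~= {}}:\<U>" using AB top by (intro hit openin_proj_preimage) auto
  from ultra_meet[OF U this m(2)[OF AB(2,4)]] obtain t where
  "t:?S" "R t Int KK \<times> {x:KK. q x:A} ~= {}" "tgt t:B" by blast
  then obtain a b where ab: "(a, b):R t" "q b:A" by blast
  hence "b:fib (tgt t)" using RS[OF \<open>t \<in> ?S\<close>] by blast
  thus False using AB(5) ab(2) \<open>tgt t \<in> B\<close> by (auto simp: fib_iff disjnt_def)
  qed
  ultimately show ?thesis using top by (simp add: fib_iff)
 qed
 \<comment> \<open>Openness of q enters here: for a neighbourhood M of x the set q(M) is a
   neighbourhood of l, so for almost all t the source fibre has a point in M.\<close>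
 have total: "EX y. (x, y):\<Gamma>" if x: "x:fib l" for x
 proof -
  obtain y where "(x, y):limit_rel ?S \<U> K R"
  proof (rule limit_rel_total[OF U compact_total RK])
  show "x:KK" using x fib_subset by auto
  fix M assume M: "openin K M" "x:M"
  have "{t:?S. src t:q ` M}:\<U>" using x M by (intro l(2) openin_image) (auto simp: fib_iff)
  moreover have "{t:?S. src t:q ` M}<={t:?S. R t Int M \<times> KK ~= {}}"
  proof clarify
  fix t z assume t: "t:?S" "src t=q z" "z:M" and emp: "R t Int M \<times> KK={}"
  have "z:fib (src t)" using t openin_subset[OF M(1)] by (auto simp: fib_iff)
  hence "(z, arr t z):R t Int M \<times> KK" using RK[OF t(1)] t(3) by (auto simp: R_def)
  thus False using emp by blast
  qed
  ultimately show "{t:?S. R t Int M \<times> KK ~= {}}:\<U>" by (rule ultra_mono[OF U]) auto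
  qed
  thus ?thesis unfolding \<Gamma>_def by blast
 qed
 have onto: "EX x. (x, y):\<Gamma>" if y: "y:fib m" for y
 proof -
  obtain x where "(y, x):limit_rel ?S \<U> K (%t. (R t)\<inverse>)"
  proof (rule limit_rel_total[OF U compact_total])
  show "(R t)\<inverse><=KK \<times> KK" if "t:?S" for t using RK[OF that] by auto
  show "y:KK" using y fib_subset by auto
  fix M assume M: "openin K M" "y:M"
  have "{t:?S. tgt t:q ` M}:\<U>" using y M by (intro m(2) openin_image) (auto simp: fib_iff)
  moreover have "{t:?S. tgt t:q ` M}<={t:?S. (R t)\<inverse> Int M \<times> KK ~= {}}"
  proof clarify
  fix t z assume t: "t:?S" "tgt t=q z" "z:M" and emp: "(R t)\<inverse> Int M \<times> KK={}"
  have "z:fib (tgt t)" using t openin_subset[OF M(1)] by (auto simp: fib_iff)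
  moreover have "bij_betw (arr t) (fib (src t)) (fib (tgt t))" using t(1) by (simp add: iarr_def)
  ultimately obtain u where "u:fib (src t)" "z=arr t u" by (metis bij_betw_imp_surj_on imageE)
  hence "(z, u):(R t)\<inverse> Int M \<times> KK" using t(3) fib_subset by (auto simp: R_def)
  thus False using emp by blast
  qed
  ultimately show "{t:?S. (R t)\<inverse> Int M \<times> KK ~= {}}:\<U>" by (rule ultra_mono[OF U]) auto
  qed
  thus ?thesis unfolding \<Gamma>_def limit_rel_converse[OF U] by blast
 qed
 \<comment> \<open>If the two distances differed, a single arrow of the ultrafilter would have graph
   points close to both pairs and fail to be isometric.\<close>
 have iso: "p (y, y')=p (x, x')" if p: "p:P" and xy: "(x, y):\<Gamma>" "(x', y'):\<Gamma>" for p x y x' y'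
 proof (rule ccontr)
  assume ne: "p (y, y') ~= p (x, x')"
  define e where "e=abs (p (y, y') - p (x, x')) / 2"
  have e: "e > 0" using ne by (simp add: e_def)
  obtain M M' where M: "openin K M" "openin K M'" "x:M" "x':M'"
  "!!u v. [|u:M; v:M'; q u=q v|] ==> abs (p (x, x') - p (u, v)) < e"
  by (rule pseudometric_neighbourhood[OF cont[OF p] _ _ e, of x l x']) (use \<Gamma>_fib xy in auto)
  obtain N N' where N: "openin K N" "openin K N'" "y:N" "y':N'"
  "!!u v. [|u:N; v:N'; q u=q v|] ==> abs (p (y, y') - p (u, v)) < e"
  by (rule pseudometric_neighbourhood[OF cont[OF p] _ _ e, of y m y']) (use \<Gamma>_fib xy in auto)
  have "{t:?S. R t Int M \<times> N ~= {}}:\<U>" "{t:?S. R t Int M' \<times> N' ~= {}}:\<U>"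
  using xy M N unfolding \<Gamma>_def limit_rel_def[OF U] by auto
  from ultra_meet[OF U this] obtain t u v where t: "t:?S"
  "u:fib (src t)" "u:M" "arr t u:N" "v:fib (src t)" "v:M'" "arr t v:N'" by (auto simp: R_def)
  have "p (arr t u, arr t v)=p (u, v)" using t p by (simp add: iarr_def)
  moreover have "abs (p (x, x') - p (u, v)) < e" using M(5) t by (simp add: fib_iff)
  moreover have "abs (p (y, y') - p (arr t u, arr t v)) < e"
  proof -
  have "(u, arr t u):R t" "(v, arr t v):R t" using t by (auto simp: R_def)
  hence "arr t u:fib (tgt t)" "arr t v:fib (tgt t)" using RS[OF t(1)] by blast+
  thus ?thesis using N(5) t by (simp add: fib_iff)
  qed
  ultimately have "abs (p (y, y') - p (x, x')) < 2 * e" by linarith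
  thus False by (simp add: e_def)
 qed
 \<comment> \<open>Two partners of x have distance p (x, x) = 0 for all p, and the pseudometrics
   separate the points of a fibre.\<close>
 have uniq: "y=y'" if h: "(x, y):\<Gamma>" "(x, y'):\<Gamma>" for x y y'
 proof (rule ccontr)
  assume "y ~= y'"
  obtain p where "p:P" "p (y, y') ~= 0"
  proof (rule pseudometrics_separate[OF top[OF m(1)] pm[OF _ m(1)], of y y'])
  show "y:fib m" "y':fib m" using \<Gamma>_fib h by blast+
  qed (use \<open>y \<noteq> y'\<close> in auto)
  moreover have "p (x, x)=0" if "p:P" for p
  using pm[OF that l(1)] \<Gamma>_fib \<open>(x, y) \<in> \<Gamma>\<close> by (auto simp: pseudometric_on_def)
  ultimately show False using iso h by metis
 qed
 have inj: "x=x'" if h: "(x, y):\<Gamma>" "(x', y):\<Gamma>" for x x' y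
 proof (rule ccontr)
  assume "x ~= x'"
  obtain p where "p:P" "p (x, x') ~= 0"
  proof (rule pseudometrics_separate[OF top[OF l(1)] pm[OF _ l(1)], of x x'])
  show "x:fib l" "x':fib l" using \<Gamma>_fib h by blast+
  qed (use \<open>x \<noteq> x'\<close> in auto)
  moreover have "p (y, y)=0" if "p:P" for p
  using pm[OF that m(1)] \<Gamma>_fib \<open>(x, y) \<in> \<Gamma>\<close> by (auto simp: pseudometric_on_def)
  ultimately show False using iso h by metis
 qed
 define f where "f=(\<lambda>x\<in>fib l. THE y. (x, y):\<Gamma>)"
 have f: "(x, f x):\<Gamma>" if "x:fib l" for x
 proof -
  have "\<exists>!y. (x, y):\<Gamma>" using total[OF that] uniq by blast
  thus ?thesis unfolding f_def using that theI'[of "%y. (x, y):\<Gamma>"] by simp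
 qed
 have bij: "bij_betw f (fib l) (fib m)" unfolding bij_betw_def
 proof
  show "inj_on f (fib l)" using f inj by (metis inj_onI)
  have "y:f ` fib l" if y: "y:fib m" for y
  proof -
  obtain x where x: "(x, y):\<Gamma>" using onto[OF y] by blast
  thus ?thesis using \<Gamma>_fib f uniq by blast
  qed
  thus "f ` fib l=fib m" using f \<Gamma>_fib by blast
 qed
 have fiso: "p (f x, f y)=p (x, y)" if "p:P" "x:fib l" "y:fib l" for p x y using iso[OF that(1)] f that by blast
 \<comment> \<open>The fibres carry the topologies of the pseudometrics, and the preimage of a ball
   under an isometric bijection is a ball.\<close>
 have "continuous_map (pseudometrics_topology (fib l) P) (pseudometrics_topology (fib m) P) f"
  unfolding pseudometrics_topology_def[of "fib m"]
 proof (rule continuous_on_generated_topo)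
  have topl: "topspace (pseudometrics_topology (fib l) P)=fib l" using top[OF l(1)] topspace_fib by metis
  thus "f ` topspace (pseudometrics_topology (fib l) P)<=\<Union>(insert (fib m) {{y:fib m. p (x, y) < r} |p x r. p:P & x:fib m & 0 < r})"
  using bij by (auto simp: bij_betw_def)
  fix V assume V: "V:insert (fib m) {{y:fib m. p (x, y) < r} |p x r. p:P & x:fib m & 0 < r}"
  have "f -` V Int fib l:insert (fib l) {{y:fib l. p (x, y) < r} |p x r. p:P & x:fib l & 0 < r}"
  proof (cases "V=fib m")
  case True
  thus ?thesis using bij by (auto simp: bij_betw_def)
  next
  case False
  then obtain p y r where p: "V={z:fib m. p (y, z) < r}" "p:P" "y:fib m" "0 < r" using V by blast
  then obtain x where x: "x:fib l" "y=f x" using bij by (auto simp: bij_betw_def)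
  have "f -` V Int fib l={z:fib l. p (x, z) < r}" using fiso[OF p(2) x(1)] bij unfolding p(1) x(2) by (auto simp: bij_betw_def)
  thus ?thesis using p x by blast
  qed
  thus "openin (pseudometrics_topology (fib l) P) (f -` V Int topspace (pseudometrics_topology (fib l) P))"
  unfolding topl unfolding pseudometrics_topology_def by (rule topology_generated_by_Basis)
 qed
 hence contf: "continuous_map (fsp l) (fsp m) f" using top l(1) m(1) by simp
 define t where "t=(l, m, f)"
 have tS: "t:?S" unfolding iarr_def fibre_maps_def t_def using l(1) m(1) contf bij fiso by (auto simp: f_def)
 show "EX t:?S. ALL V. openin atop V & t:V --> ?S Int V:\<U>"
 proof (intro bexI[OF _ tS] allI impI)
  fix V assume V: "openin atop V & t:V"
  hence "generate_topology_on {W C V | C V. compactin K C & openin K V} V"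
  unfolding arrows_topology_W openin_topology_generated_by_iff by blast
  hence "t:V --> ?S Int V:\<U>"
  proof (induction rule: generate_topology_on.induct)
  case (Int A B)
  show ?case
  proof
  assume "t:A Int B"
  hence "?S Int A:\<U>" "?S Int B:\<U>" using Int by auto
  hence "(?S Int A) Int (?S Int B):\<U>" by (rule ultra_Int[OF U])
  moreover have "(?S Int A) Int (?S Int B)=?S Int (A Int B)" by auto
  ultimately show "?S Int (A Int B):\<U>" by simp
  qed
  next
  case (UN \<A>)
  show ?case
  proof
  assume "t:\<Union>\<A>"
  then obtain A where A: "A:\<A>" "t:A" by blast
  hence "?S Int A:\<U>" using UN by blast
  thus "?S Int \<Union>\<A>:\<U>" by (rule ultra_mono[OF U]) (use A in auto)
  qed
  next
  case (Basis B)
  then obtain C V where C: "B=W C V" "compactin K C" "openin K V" by blast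
  show ?case
  proof (rule impI, rule ccontr)
  assume tB: "t:B" and "?S Int B ~: \<U>"
  hence "?S - ?S Int B:\<U>" by (intro ultra_compl[OF U]) auto
  \<comment> \<open>An arrow outside \<open>W C V\<close> has a graph point in the product of C with
    the complement of V. This product is compact, so the limit graph would have such a point
    too.\<close>
  moreover have "?S - ?S Int B<={t:?S. R t Int C \<times> (KK - V) ~= {}}"
  proof
  fix c assume "c:?S - ?S Int B"
  hence c: "c:?S" "c:arrows" "c ~: W C V" by (auto simp: C(1) iarr_def)
  then obtain u where "u:C" "u:fib (src c)" "arr c u ~: V" by (auto simp: W_def)
  hence "(u, arr c u):R c Int C \<times> (KK - V)" using RK[OF c(1)] by (auto simp: R_def)
  thus "c:{t:?S. R t Int C \<times> (KK - V) ~= {}}" using c(1) by blast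
  qed
  ultimately have "{t:?S. R t Int C \<times> (KK - V) ~= {}}:\<U>" by (rule ultra_mono[OF U]) auto
  then obtain x y where xy: "(x, y):\<Gamma>" "x:C" "y ~: V"
  using limit_rel_meets[OF U C(2), of "KK - V" R] C(3) compactin_closed unfolding \<Gamma>_def by blast
  have "x:fib l" using \<Gamma>_fib xy(1) by blast
  moreover have "y=f x" using uniq[OF xy(1)] f[OF calculation] by blast
  ultimately show False using tB xy unfolding C(1) by (auto simp: W_def t_def)
  qed
  qed auto
  thus "?S Int V:\<U>" using V by blast
 qed
qed

end

section \<open>The enveloping semigroupoid of an open extension\<close>

text \<open>By the tube lemma the functions change uniformly in the compact parameter a.\<close>

lemma continuous_map_SUP_compact:
 assumes A: "compact_space A" "topspace A ~= {}"
  and F: "cntR (prod_topology A Z) F"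
 shows "cntR Z (%z. SUP a\<in>topspace A. F (a, z))" unfolding cont_metric
proof (intro ballI allI impI)
 have sec: "cntR A (%a. F (a, z))" if "z:topspace Z" for z
 proof -
  have "continuous_map A (prod_topology A Z) (%a. (a, z))" using that by (auto intro!: continuous_map_pairedI)
  thus ?thesis using continuous_map_compose[OF _ F] by (simp add: comp_def)
 qed
 have bdd: "bdd_above ((%a. F (a, z)) ` topspace A)" if "z:topspace Z" for z
 proof -
  show ?thesis using image_compactin[OF _ sec[OF that]] A(1) by (auto simp: compact_space_def compact_imp_bounded bounded_imp_bdd_above)
 qed
 fix z0 and e :: real assume z0: "z0:topspace Z" and e: "e > 0"
 let ?W = "{w:topspace (prod_topology A Z). dist (F w - F (fst w, z0)) 0 < e / 2}"
 have "cntR (prod_topology A Z) (%w. F (fst w, z0))" using continuous_map_compose[OF continuous_map_fst sec[OF z0]] by (simp add: comp_def)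
 hence "cntR (prod_topology A Z) (%w. F w - F (fst w, z0))" using F by (intro continuous_map_diff)
 hence W: "openin (prod_topology A Z) ?W" by (rule openin_dist_less)
 have sub: "topspace A \<times> {z0}<=?W" using z0 e by auto
 obtain U V where UV: "openin Z V" "topspace A<=U" "z0:V" "U \<times> V<=?W"
  using tube_lemma_left[OF W _ z0 sub] A(1) unfolding compact_space_def by blast
 show "EX U. openin Z U & z0:U & (ALL y:U. dist (SUP a\<in>topspace A. F (a, z0)) (SUP a\<in>topspace A. F (a, y)) < e)"
 proof (intro exI[of _ V] conjI ballI UV, goal_cases)
  case (1 y) note y = 1
  hence yZ: "y:topspace Z" using UV(1) openin_subset by auto
  have near: "abs (F (a, y) - F (a, z0)) < e / 2" if "a:topspace A" for a using UV(2,4) that y by (force simp: dist_real_def)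
  have "(SUP a\<in>topspace A. F (a, z0))<=(SUP a\<in>topspace A. F (a, y)) + e / 2"
  proof (rule cSUP_least[OF A(2)], goal_cases)
  case (1 a) note a = 1
  have "F (a, y)<=(SUP a\<in>topspace A. F (a, y))" by (rule cSUP_upper[OF a bdd[OF yZ]])
  thus ?case using near[OF a] by linarith
  qed
  moreover have "(SUP a\<in>topspace A. F (a, y))<=(SUP a\<in>topspace A. F (a, z0)) + e / 2"
  proof (rule cSUP_least[OF A(2)], goal_cases)
  case (1 a) note a = 1
  have "F (a, z0)<=(SUP a\<in>topspace A. F (a, z0))" by (rule cSUP_upper[OF a bdd[OF z0]])
  thus ?case using near[OF a] by linarith
  qed
  ultimately show ?case using e unfolding dist_real_def by linarith
 qed
qed

locale open_tds_extension = tds_extension +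
 assumes open_projection: "open_map K L q"

sublocale open_tds_extension \<subseteq> open_fibration K L q by unfold_locales
  (simp_all add: total.compact_space total.Hausdorff_space base.compact_space base.Hausdorff_space
  continuous_proj surj_proj open_projection)

context open_tds_extension
begin

lemma phi_closed: "[|g:carrier G; x:KK|] ==> \<phi> g x:KK" using total.element_image by blast

lemma psi_closed: "[|g:carrier G; l:LL|] ==> \<psi> g l:LL" using base.element_image by blast

lemma phi_one: "x:KK ==> \<phi> \<one> x=x" by (metis total.id_eq_one restrict_apply')

lemma psi_one: "l:LL ==> \<psi> \<one> l=l" by (metis base.id_eq_one restrict_apply')

lemma phi_inv: "[|g:carrier G; x:KK|] ==> \<phi> (inv g) (\<phi> g x)=x" using total.orbit_sym_aux by blast

lemma phi_inv': "[|g:carrier G; x:KK|] ==> \<phi> g (\<phi> (inv g) x)=x" using phi_inv[of "inv g" x] by simp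

lemma psi_inv: "[|g:carrier G; l:LL|] ==> \<psi> (inv g) (\<psi> g l)=l" using base.orbit_sym_aux by blast

lemma phi_fib: "[|g:carrier G; x:fib l|] ==> \<phi> g x:fib (\<psi> g l)" using phi_closed equivariant by (auto simp: fib_iff)

lemma phi_inv_fib: "[|g:carrier G; l:LL; x:fib (\<psi> g l)|] ==> \<phi> (inv g) x:fib l"
 using phi_fib[of "inv g" x "\<psi> g l"] psi_inv[of g l] by simp

lemma continuous_phi:
 assumes "g:carrier G"
 shows "continuous_map K K (\<phi> g)"
proof -
 have "continuous_map K (prod_topology T K) (%x. (g, x))" using assms total.topspace_group by (auto intro!: continuous_map_pairedI)
 hence "continuous_map K K ((%(g, x). \<phi> g x) \<circ> (%x. (g, x)))" by (rule continuous_map_compose[OF _ total.continuous_action])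
 thus ?thesis by (simp add: comp_def)
qed

abbreviation act_arrow :: "'a => 'd => ('d, 'c) arrow" where
 "act_arrow == action_arrow K \<phi> \<psi> q"

lemma act_arrow_sel [simp]: "src (act_arrow g l)=l" "tgt (act_arrow g l)=\<psi> g l"
 "x:fib l ==> arr (act_arrow g l) x=\<phi> g x" by (auto simp: action_arrow_def)

lemma act_arrow_bij:
 assumes "g:carrier G" "l:LL"
 shows "bij_betw (arr (act_arrow g l)) (fib l) (fib (\<psi> g l))"
proof (rule bij_betw_byWitness[where f' = "\<phi> (inv g)"])
 show "ALL a:fib l. \<phi> (inv g) (arr (act_arrow g l) a)=a" using assms phi_inv by (auto simp: fib_iff)
 show "ALL a:fib (\<psi> g l). arr (act_arrow g l) (\<phi> (inv g) a)=a" using assms phi_inv' phi_inv_fib[OF assms] by (auto simp: fib_iff)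
 show "arr (act_arrow g l) ` fib l<=fib (\<psi> g l)" using phi_fib assms by auto
 show "\<phi> (inv g) ` fib (\<psi> g l)<=fib l" using phi_inv_fib[OF assms] by auto
qed

lemma act_arrow_arrows:
 assumes "g:carrier G" "l:LL"
 shows "act_arrow g l:arrows"
proof -
 have "continuous_map (fsp l) (fsp (\<psi> g l)) (\<phi> g)" unfolding continuous_map_in_subtopology topspace_fib
  using phi_fib assms by (auto intro: continuous_map_from_subtopology[OF continuous_phi])
 hence "continuous_map (fsp l) (fsp (\<psi> g l)) (restrict (\<phi> g) (fib l))" by (rule continuous_map_eq) (simp add: fib_iff)
 thus ?thesis unfolding fibre_maps_def action_arrow_def using assms psi_closed by auto
qed

text \<open>The competitors in the intersection that defines \<open>env\<close>. Properties of
  \<open>env\<close> are obtained by exhibiting admissible sets that contain it.\<close>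

definition admissible :: "('d, 'c) arrow set => bool" where
 "admissible A \<longleftrightarrow> closedin atop A &
  (ALL t:A. ALL h:A. tgt h=src t --> acomp t h:A) &
  (ALL g:carrier G. ALL l:LL. act_arrow g l:A)"

abbreviation env :: "('d, 'c) arrow set" where
 "env == uniform_enveloping_semigroupoid G K \<phi> L \<psi> q"

lemma env_eq: "env=\<Inter>{A. admissible A}" unfolding uniform_enveloping_semigroupoid_def admissible_def ..

lemma comp_sel [simp]: "src (acomp t h)=src h" "tgt (acomp t h)=tgt t"
 "x:fib (src h) ==> arr (acomp t h) x=arr t (arr h x)" by (auto simp: arrow_comp_def compose_def)

lemma comp_arrows:
 assumes "t:arrows" "h:arrows" "tgt h=src t"
 shows "acomp t h:arrows"
proof -
 have "continuous_map (fsp (src h)) (fsp (tgt t)) (arr t \<circ> arr h)"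
  using arrowsD(4)[OF assms(1)] arrowsD(4)[OF assms(2)] assms(3) by (auto intro: continuous_map_compose)
 hence "continuous_map (fsp (src h)) (fsp (tgt t)) (compose (fib (src h)) (arr t) (arr h))"
  by (rule continuous_map_eq) (simp add: fib_iff compose_def)
 thus ?thesis unfolding fibre_maps_def arrow_comp_def
  using arrowsD(1)[OF assms(2)] arrowsD(2)[OF assms(1)] by (simp add: compose_extensional)
qed

lemma arrow_eqI:
 assumes "t:arrows" "h:arrows" "src t=src h" "tgt t=tgt h" "!!x. x:fib (src t) ==> arr t x=arr h x"
 shows "t=h" unfolding arrow_eq_iff using assms arrowsD(3)[OF assms(1)] arrowsD(3)[OF assms(2)] by (auto intro: extensionalityI)

lemma admissible_arrows: "admissible arrows" unfolding admissible_def using comp_arrows act_arrow_arrows closedin_topspace[of atop]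
 by (simp add: topspace_arrows)

lemma env_subset: "admissible A ==> env<=A" unfolding env_eq by blast

lemma env_arrows: "env<=arrows" by (rule env_subset[OF admissible_arrows])

lemma admissible_env: "admissible env" unfolding admissible_def
proof (intro conjI ballI impI)
 show "closedin atop env" unfolding env_eq using admissible_arrows by (intro closedin_Inter) (auto simp: admissible_def)
qed (auto simp: env_eq admissible_def)

lemma comp_env: "[|t:env; h:env; tgt h=src t|] ==> acomp t h:env" using admissible_env unfolding admissible_def by blast

lemma act_env: "[|g:carrier G; l:LL|] ==> act_arrow g l:env" using admissible_env unfolding admissible_def by blast

lemma inv_sel [simp]: "src (ainv t)=tgt t" "tgt (ainv t)=src t" by (auto simp: arrow_inv_def)

lemma arr_inv:
 assumes "bij_betw (arr t) (fib (src t)) (fib (tgt t))" "y:fib (tgt t)"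
 shows "arr (ainv t) y:fib (src t)" "arr t (arr (ainv t) y)=y"
 using assms by (auto simp: arrow_inv_def bij_betw_def inv_into_into f_inv_into_f)

lemma arr_inv':
 assumes "bij_betw (arr t) (fib (src t)) (fib (tgt t))" "x:fib (src t)"
 shows "arr (ainv t) (arr t x)=x"
proof -
 show ?thesis using assms assms by (auto simp: arrow_inv_def bij_betw_def)
qed

lemma inv_arrows:
 assumes t: "t:arrows" and bij: "bij_betw (arr t) (fib (src t)) (fib (tgt t))"
 shows "ainv t:arrows" "bij_betw (arr (ainv t)) (fib (tgt t)) (fib (src t))"
proof -
 show "bij_betw (arr (ainv t)) (fib (tgt t)) (fib (src t))" by (rule bij_betw_byWitness[where f' = "arr t"])
  (use arr_inv[OF bij] arr_inv'[OF bij] bij in \<open>auto simp: bij_betw_def\<close>)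
 have "homeomorphic_map (fsp (src t)) (fsp (tgt t)) (arr t)" using bij arrowsD[OF t] compact_fib Hausdorff_fib
  by (intro continuous_imp_homeomorphic_map) (unfold topspace_fib, auto simp: bij_betw_def)
 then obtain f where f: "homeomorphic_maps (fsp (src t)) (fsp (tgt t)) (arr t) f" by (auto simp: homeomorphic_map_maps)
 have "continuous_map (fsp (tgt t)) (fsp (src t)) (arr (ainv t))" using continuous_map_eq f topspace_fib arr_inv(1) bij arr_inv(2) by (smt (verit) homeomorphic_maps_def)
 thus "ainv t:arrows" using arrowsD[OF t] unfolding fibre_maps_def by (simp add: arrow_inv_def)
qed

text \<open>For a bijection between fibres, the inverse maps C into V exactly if the map sends the
  complement of V into the complement of C. So inversion exchanges subbasic sets, as compact and
  closed subsets of K coincide.\<close>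

lemma inv_W:
 assumes t: "t:arrows" and bij: "bij_betw (arr t) (fib (src t)) (fib (tgt t))"
 shows "ainv t:W C V \<longleftrightarrow> t:W (KK - V) (KK - C)"
proof
 assume inv: "ainv t:W C V"
 show "t:W (KK - V) (KK - C)" unfolding W_def
 proof clarsimp
  have "arr t x:KK & arr t x ~: C" if x: "x:fib (src t)" "x ~: V" for x
  proof -
  have fx: "arr t x:fib (tgt t)" using arrowsD(5)[OF t x(1)] .
  have "arr t x ~: C"
  proof
  assume "arr t x:C"
  thus False using inv fx x arr_inv'[OF bij x(1)] by (force simp: W_def image_subset_iff)
  qed
  thus ?thesis using fx by (simp add: fib_iff)
  qed
  thus "t:arrows & arr t ` ((KK - V) Int fib (src t))<=KK - C" using t by auto
 qed
next
 assume tW: "t:W (KK - V) (KK - C)"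
 have "arr (ainv t) y:V" if y: "y:C" "y:fib (tgt t)" for y
 proof (rule ccontr)
  let ?x = "arr (ainv t) y"
  assume "?x ~: V"
  moreover have "?x:fib (src t)" by (rule arr_inv(1)[OF bij y(2)])
  ultimately show False using tW arr_inv(2)[OF bij y(2)] y(1) by (force simp: W_def image_subset_iff fib_iff)
 qed
 thus "ainv t:W C V" using inv_arrows(1)[OF t bij] by (auto simp: W_def)
qed

lemma continuous_inv:
 assumes S: "S<=arrows" "!!t. t:S ==> bij_betw (arr t) (fib (src t)) (fib (tgt t))"
 shows "continuous_map (subtopology atop S) atop (ainv)" unfolding arrows_topology_W
proof (rule continuous_on_generated_topo)
 have top: "topspace (subtopology atop S)=S" using S(1) by (auto simp: topspace_arrows topspace_subtopology)
 fix U assume "U:{W C V | C V. compactin K C & openin K V}"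
 then obtain C V where U: "U=W C V" "compactin K C" "openin K V" by blast
 have "ainv -` U Int S=W (KK - V) (KK - C) Int S" unfolding U(1) using inv_W S by blast
 moreover have "openin atop (W (KK - V) (KK - C))" using U(2,3) compactin_imp_closedin[OF Hausdorff_total]
  by (intro openin_W compactin_closed openin_diff) auto
 ultimately show "openin (subtopology (topology_generated_by {W C V |C V. compactin K C & openin K V}) S)
  (ainv -` U Int topspace (subtopology (topology_generated_by {W C V |C V. compactin K C & openin K V}) S))"
  unfolding arrows_topology_W[symmetric] top by (auto simp: openin_subtopology)
next
 have "W {} {}=arrows" by (auto simp: W_def)
 moreover have "W {} {}:{W C V | C V. compactin K C & openin K V}" by (intro CollectI exI conjI) auto
 ultimately have "arrows<=\<Union>{W C V | C V. compactin K C & openin K V}" by blast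
 thus "ainv ` topspace (subtopology (topology_generated_by {W C V |C V. compactin K C & openin K V}) S)
  <= \<Union>{W C V |C V. compactin K C & openin K V}" unfolding arrows_topology_W[symmetric]
 proof (rule order_trans[rotated], goal_cases)
  case 1
  show ?case unfolding topspace_subtopology using inv_arrows(1) S by blast
 qed
qed

lemma isometric_arrowsI:
 assumes "t:arrows" "bij_betw (arr t) (fib (src t)) (fib (tgt t))"
  "!!p x y. [|p:P; x:fib (src t); y:fib (src t)|] ==> p (arr t x, arr t y)=p (x, y)"
 shows "t:iarr P" using assms unfolding iarr_def by blast

text \<open>Minimality of \<open>env\<close> is used twice: for \<open>iarr P\<close>, giving
  compactness and bijectivity, and for the arrows whose inverses stay in \<open>env\<close>, giving
  closure under inversion.\<close>

theorem compact_groupoid_if_pseudoisometric: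
 assumes "pseudoisometric G K \<phi> L q"
 shows "compact_groupoid K L q env"
proof -
 obtain P where P: "isometric_family G K \<phi> L q P" using assms unfolding pseudoisometric_def by blast
 have cont: "!!p. p:P ==> cntR KqK p"
  and inva: "!!p x y g. [|p:P; (x, y):fibre_product K q; g:carrier G|] ==> p (\<phi> g x, \<phi> g y)=p (x, y)"
  and pm: "!!p l. [|p:P; l:LL|] ==> pseudometric_on (fib l) p"
  and top: "!!l. l:LL ==> pseudometrics_topology (fib l) P=fsp l" using P unfolding isometric_family_def by blast+
 let ?S = "iarr P"
 have S: "?S<=arrows" "!!t. t:?S ==> bij_betw (arr t) (fib (src t)) (fib (tgt t))"
  "!!t p x y. [|t:?S; p:P; x:fib (src t); y:fib (src t)|] ==> p (arr t x, arr t y)=p (x, y)" unfolding iarr_def by blast+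
 have compS: "compactin atop ?S" by (rule compactin_isometric_arrows[OF cont pm top])
 have closedS: "closedin atop ?S" by (rule compactin_imp_closedin[OF Hausdorff_arrows compS])
 have admS: "admissible ?S" unfolding admissible_def
 proof (intro conjI ballI impI closedS)
  fix t h assume *: "t:?S" "h:?S" "tgt h=src t"
  have h: "arr h x:fib (src t)" if "x:fib (src h)" for x using arrowsD(5)[of h x] * S(1) that by auto
  have "bij_betw (arr t \<circ> arr h) (fib (src h)) (fib (tgt t))"
  using bij_betw_trans[OF S(2)[OF *(2)], of "arr t"] S(2)[OF *(1)] *(3) by simp
  hence "bij_betw (arr (acomp t h)) (fib (src h)) (fib (tgt t))" by (subst bij_betw_cong[of _ _ "arr t \<circ> arr h"]) auto
  thus "acomp t h:?S"
  proof (intro isometric_arrowsI)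
  show "acomp t h:arrows" using * S(1) by (intro comp_arrows) auto
  fix p x y assume p: "p:P" and "x:fib (src (acomp t h))" "y:fib (src (acomp t h))"
  hence xy: "x:fib (src h)" "y:fib (src h)" by simp_all
  show "p (arr (acomp t h) x, arr (acomp t h) y)=p (x, y)" using S(3)[OF *(1) p h[OF xy(1)] h[OF xy(2)]] S(3)[OF *(2) p xy] xy by simp
  qed simp
 next
  fix g l assume *: "g:carrier G" "l:LL"
  show "act_arrow g l:?S" using * act_arrow_arrows act_arrow_bij inva by (intro isometric_arrowsI) (auto simp: fibre_product_def fib_iff)
 qed
 have envS: "env<=?S" by (rule env_subset[OF admS])
 have bij: "bij_betw (arr t) (fib (src t)) (fib (tgt t))" if "t:env" for t using S(2) envS that by blast
 have closedE: "closedin atop env" using admissible_env by (simp add: admissible_def)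
 \<comment> \<open>This set is closed because inversion is continuous on bijective arrows; inverses
   of composites are composites of inverses, and the inverse of the arrow of g is the arrow of
   g^-1.\<close>
 let ?E = "{t:env. ainv t:env}"
 have "admissible ?E" unfolding admissible_def
 proof (intro conjI ballI impI)
  have "closedin (subtopology atop env) {t:topspace (subtopology atop env). ainv t:env}"
  by (rule closedin_continuous_map_preimage[OF continuous_inv[OF env_arrows bij] closedE])
  moreover have "topspace (subtopology atop env)=env" using env_arrows by (auto simp: topspace_subtopology topspace_arrows)
  ultimately show "closedin atop ?E" using closedin_trans_full closedE by fastforce
 next
  fix t h assume *: "t:?E" "h:?E" "tgt h=src t"
  let ?c = "acomp t h"
  have c: "?c:env" using * comp_env by auto
  have ar: "t:arrows" "h:arrows" "?c:arrows" using * c env_arrows by auto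
  have b: "bij_betw (arr t) (fib (src t)) (fib (tgt t))" "bij_betw (arr h) (fib (src h)) (fib (tgt h))"
  "bij_betw (arr ?c) (fib (src ?c)) (fib (tgt ?c))" by (rule bij; use * c in simp)+
  have "ainv ?c=acomp (ainv h) (ainv t)"
  proof (rule arrow_eqI)
  show "ainv ?c:arrows" by (rule inv_arrows(1)[OF ar(3) b(3)])
  show "acomp (ainv h) (ainv t):arrows" using inv_arrows(1)[OF ar(1) b(1)] inv_arrows(1)[OF ar(2) b(2)] *(3) by (intro comp_arrows) auto
  fix y assume "y:fib (src (ainv ?c))"
  hence y: "y:fib (tgt t)" by simp
  define x where "x=arr (ainv h) (arr (ainv t) y)"
  have 1: "arr (ainv t) y:fib (tgt h)" using arr_inv(1)[OF b(1) y] *(3) by simp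
  have x: "x:fib (src h)" unfolding x_def by (rule arr_inv(1)[OF b(2) 1])
  have "arr (ainv ?c) y=x" using x arr_inv(2)[OF b(2) 1] arr_inv(2)[OF b(1) y] arr_inv'[OF b(3), of x] x by (simp add: x_def)
  thus "arr (ainv ?c) y=arr (acomp (ainv h) (ainv t)) y" using y by (simp add: x_def)
  qed auto
  also have "... : env" using * by (intro comp_env) auto
  finally show "?c:?E" using c by simp
 next
  fix g l assume *: "g:carrier G" "l:LL"
  have "ainv (act_arrow g l)=act_arrow (inv g) (\<psi> g l)"
  proof (rule arrow_eqI)
  show "ainv (act_arrow g l):arrows" using * act_arrow_arrows act_arrow_bij by (intro inv_arrows) auto
  show "act_arrow (inv g) (\<psi> g l):arrows" using * psi_closed by (intro act_arrow_arrows) auto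
  fix y assume "y:fib (src (ainv (act_arrow g l)))"
  hence y: "y:fib (\<psi> g l)" by simp
  have b: "bij_betw (arr (act_arrow g l)) (fib (src (act_arrow g l))) (fib (tgt (act_arrow g l)))" using act_arrow_bij[OF *] by simp
  have "arr (ainv (act_arrow g l)) y=\<phi> (inv g) y" using phi_inv_fib[OF * y] phi_inv'[OF *(1), of y] y arr_inv'[OF b, of "\<phi> (inv g) y"] phi_inv_fib[OF * y] by (simp add: fib_iff)
  thus "arr (ainv (act_arrow g l)) y=arr (act_arrow (inv g) (\<psi> g l)) y" using y by simp
  qed (use * psi_inv in auto)
  thus "act_arrow g l:?E" using act_env * psi_closed by simp
 qed
 hence invE: "ainv t:env" if "t:env" for t using env_subset that by blast
 have "compactin atop env" by (rule closed_compactin[OF compS envS closedE])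
 moreover have "continuous_map (subtopology atop env) (subtopology atop env) (ainv)"
  unfolding continuous_map_in_subtopology using continuous_inv[OF env_arrows bij] invE by (auto simp: topspace_subtopology)
 ultimately show ?thesis unfolding compact_groupoid_def Let_def using bij invE Hausdorff_arrows
  by (auto simp: compact_space_subtopology Hausdorff_space_subtopology)
qed

end

lemma Metric_space_continuous_dist:
 assumes "Metric_space M d"
 shows "cntR (prod_topology (Metric_space.mtopology M d) (Metric_space.mtopology M d)) (%(x, y). d x y)" unfolding cont_metric
proof (intro ballI allI impI)
 interpret Metric_space M d by (rule assms)
 fix z and e :: real assume z: "z:topspace (prod_topology mtopology mtopology)" and e: "e > 0"
 obtain x y where xy: "z=(x, y)" "x:M" "y:M" using z by auto
 show "EX U. openin (prod_topology mtopology mtopology) U & z:U &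
  (ALL w:U. dist (case z of (x, y) => d x y) (case w of (x, y) => d x y) < e)"
 proof (intro exI[of _ "mball x (e/2) \<times> mball y (e/2)"] conjI ballI)
  show "openin (prod_topology mtopology mtopology) (mball x (e/2) \<times> mball y (e/2))" by (simp add: openin_prod_Times_iff openin_mball)
  show "z:mball x (e/2) \<times> mball y (e/2)" using xy e by simp
  fix w assume "w:mball x (e/2) \<times> mball y (e/2)"
  then obtain u v where w: "w=(u, v)" "u:M" "v:M" "d x u < e/2" "d y v < e/2" by auto
  have "d x y<=d x u + d u y" "d u y<=d u v + d v y" "d u v<=d u x + d x v" "d x v<=d x y + d y v" using xy w triangle by auto
  thus "dist (case z of (x, y) => d x y) (case w of (x, y) => d x y) < e"
  using w xy commute[of x u] commute[of y v] by (simp add: dist_real_def)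
 qed
qed

section \<open>Compact enveloping groupoids over ergodic systems\<close>

locale groupoid_extension = open_tds_extension +
 assumes groupoid: "compact_groupoid K L q env"
  and ergodic: "topologically_ergodic G L \<psi>"
begin

lemma compactin_env: "compactin atop env" using groupoid env_arrows unfolding compact_groupoid_def Let_def
 by (simp add: compact_space_subtopology compactin_subspace topspace_arrows)

lemma closedin_env: "closedin atop env" using admissible_env by (simp add: admissible_def)

lemma bij_env: "t:env ==> bij_betw (arr t) (fib (src t)) (fib (tgt t))" using groupoid unfolding compact_groupoid_def Let_def by blast

lemma inv_env: "t:env ==> ainv t:env" using groupoid unfolding compact_groupoid_def Let_def by blast

lemma env_arrow: "t:env ==> t:arrows" using env_arrows by blast

lemma env_fib: "[|t:env; x:fib (src t)|] ==> arr t x:fib (tgt t)" using env_arrow arrowsD(5) by blast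

lemma env_endpoints: "t:env ==> src t:LL" "t:env ==> tgt t:LL" using env_arrow arrowsD(1,2) by blast+

lemma id_env: "l:LL ==> act_arrow \<one> l:env" by (simp add: act_env)

definition out :: "'d => ('d, 'c) arrow set" where
 "out l={t:env. src t=l}"

lemma compactin_out:
 assumes "l:LL"
 shows "compactin atop (out l)"
proof -
 have "closedin atop {t:topspace atop. src t:{l}}"
  by (rule closedin_continuous_map_preimage[OF continuous_src]) (simp add: closedin_Hausdorff_singleton[OF Hausdorff_base assms])
 moreover have "out l=env Int {t:topspace atop. src t:{l}}" using env_arrows by (auto simp: out_def topspace_arrows)
 ultimately have "closedin atop (out l)" using closedin_env by (simp add: closedin_Int)
 thus ?thesis by (rule closed_compactin[OF compactin_env, rotated]) (auto simp: out_def)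
qed

text \<open>The orbit space of the groupoid is normal, as a closed continuous image of L. Two
  different orbits would be separated by a continuous function, whose pullback to L is invariant
  under G and not constant, contrary to ergodicity.\<close>

lemma env_transitive:
 assumes lm: "l:LL" "m:LL"
 obtains t where "t:env" "src t=l" "tgt t=m"
proof (rule ccontr)
 note goal = that
 assume "~thesis"
 hence no: "t ~: env | src t ~= l | tgt t ~= m" for t using goal by blast
 define c where "c l=tgt ` out l" for l
 have self: "l:c l" if l: "l:LL" for l
 proof -
  have "act_arrow \<one> l:out l" using id_env[OF l] by (simp add: out_def)
  moreover have "tgt (act_arrow \<one> l)=l" using l by (simp add: psi_one)
  ultimately show ?thesis unfolding c_def by (metis imageI)
 qed
 have c_eq: "c (src t)=c (tgt t)" if t: "t:env" for t
 proof (intro equalityI subsetI)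
  fix k assume "k:c (src t)"
  then obtain u where u: "u:env" "src u=src t" "k=tgt u" by (auto simp: c_def out_def)
  have "acomp u (ainv t):out (tgt t)" using comp_env[OF u(1) inv_env[OF t]] u(2) by (simp add: out_def)
  thus "k:c (tgt t)" unfolding c_def u(3) by (metis comp_sel(2) imageI)
 next
  fix k assume "k:c (tgt t)"
  then obtain u where u: "u:env" "src u=tgt t" "k=tgt u" by (auto simp: c_def out_def)
  have "acomp u t:out (src t)" using comp_env[OF u(1) t] u(2) by (simp add: out_def)
  thus "k:c (src t)" unfolding c_def u(3) by (metis comp_sel(2) imageI)
 qed
 \<comment> \<open>The quotient topology on the set of orbits, with an orbit encoded as the set of
   targets of the arrows leaving any of its points.\<close>
 define Z where "Z=topology (%U. U<=c ` LL & openin L {l:LL. c l:U})"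
 have "istopology (%U. U<=c ` LL & openin L {l:LL. c l:U})" unfolding istopology_def
 proof (intro conjI allI impI)
  fix S T assume *: "S<=c ` LL & openin L {l:LL. c l:S}" "T<=c ` LL & openin L {l:LL. c l:T}"
  have "{l:LL. c l:S Int T}={l:LL. c l:S} Int {l:LL. c l:T}" by auto
  moreover have "openin L ({l:LL. c l:S} Int {l:LL. c l:T})" using * by (blast intro: openin_Int)
  ultimately show "openin L {l:LL. c l:S Int T}" by simp
  show "S Int T<=c ` LL" using * by auto
 next
  fix \<K> assume *: "ALL S:\<K>. S<=c ` LL & openin L {l:LL. c l:S}"
  have "{l:LL. c l:\<Union>\<K>}=(\<Union>S\<in>\<K>. {l:LL. c l:S})" by auto
  moreover have "openin L (\<Union>S\<in>\<K>. {l:LL. c l:S})" by (rule openin_Union) (use * in blast)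
  ultimately show "openin L {l:LL. c l:\<Union>\<K>}" by simp
  show "\<Union>\<K><=c ` LL" using * by auto
 qed
 hence openZ: "openin Z U \<longleftrightarrow> U<=c ` LL & openin L {l:LL. c l:U}" for U unfolding Z_def by (simp add: topology_inverse')
 have "{l:LL. c l:c ` LL}=LL" by auto
 hence "openin Z (c ` LL)" by (simp add: openZ)
 hence "c ` LL<=topspace Z" by (rule openin_subset)
 moreover have "topspace Z<=c ` LL" using openZ[of "topspace Z"] by simp
 ultimately have topZ: "topspace Z=c ` LL" by simp
 have contc: "continuous_map L Z c" unfolding continuous_map_def topZ using openZ by auto
 \<comment> \<open>The saturation of a closed set C is the set of targets of the arrows starting in
   C. It is closed because the set of these arrows is compact.\<close>
 have closedc: "closed_map L Z c" unfolding closed_map_def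
 proof (intro allI impI)
  fix C assume C: "closedin L C"
  have "closedin atop {t:topspace atop. src t:C}" by (rule closedin_continuous_map_preimage[OF continuous_src C])
  hence "compactin atop (env Int {t:topspace atop. src t:C})"
  using closedin_env by (intro closed_compactin[OF compactin_env] closedin_Int) auto
  hence "compactin L (tgt ` (env Int {t:topspace atop. src t:C}))" by (rule image_compactin[OF _ continuous_tgt])
  moreover have "tgt ` (env Int {t:topspace atop. src t:C})={l:LL. c l:c ` C}"
  proof (intro equalityI subsetI)
  fix k assume "k:tgt ` (env Int {t:topspace atop. src t:C})"
  then obtain t where t: "t:env" "src t:C" "k=tgt t" by blast
  thus "k:{l:LL. c l:c ` C}" using c_eq[OF t(1)] t env_endpoints(2)[OF t(1)] by auto
  next
  fix k assume "k:{l:LL. c l:c ` C}"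
  then obtain m where m: "k:LL" "m:C" "c k=c m" by auto
  hence "k:c m" using self by blast
  then obtain t where t: "t:env" "src t=m" "k=tgt t" by (auto simp: c_def out_def)
  thus "k:tgt ` (env Int {t:topspace atop. src t:C})" using m(2) env_arrow t(3) by (simp add: topspace_arrows)
  qed
  ultimately have "openin L (LL - {l:LL. c l:c ` C})" using compactin_imp_closedin[OF Hausdorff_base] by auto
  moreover have "LL - {l:LL. c l:c ` C}={l:LL. c l:topspace Z - c ` C}" by (auto simp: topZ)
  ultimately have "openin Z (topspace Z - c ` C)" unfolding openZ by (auto simp: topZ)
  moreover have "c ` C<=topspace Z" using closedin_subset[OF C] by (auto simp: topZ)
  ultimately show "closedin Z (c ` C)" by (simp add: closedin_def)
 qed
 have normZ: "normal_space Z" by (rule normal_space_continuous_closed_map_image[OF normal_base contc closedc]) (simp add: topZ)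
 have "closedin Z (c ` {k})" if "k:LL" for k
  using closedc closedin_Hausdorff_singleton[OF Hausdorff_base that] unfolding closed_map_def by blast
 hence sing: "closedin Z {c l}" "closedin Z {c m}" using lm by force+
 have "c l ~= c m"
 proof
  assume "c l=c m"
  hence "m:c l" using self lm by auto
  thus False using no by (auto simp: c_def out_def)
 qed
 hence "disjnt {c l} {c m}" by (simp add: disjnt_def)
 then obtain f where f: "cntR Z f" "f ` {c l}<={0}" "f ` {c m}<={1}" using Urysohn_lemma_alt[OF normZ sing, of 0 1] by metis
 let ?h = "%l. complex_of_real (f (c l))"
 have "cnt L ?h" using continuous_map_compose[OF contc f(1)] by (intro continuous_map_complex_of_real) (simp add: comp_def)
 moreover have "?h (\<psi> g y)=?h y" if "g:carrier G" "y:LL" for g y using c_eq[OF act_env[OF that]] by simp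
 ultimately obtain k where "ALL y:LL. ?h y=k" using ergodic unfolding topologically_ergodic_def by blast
 hence "?h l=?h m" using lm by simp
 thus False using f by simp
qed

text \<open>The supremum over all arrows leaving the fibre makes a function of pairs invariant under
  the whole groupoid, hence under G.\<close>

definition env_sup :: "('c \<times> 'c => real) => 'c \<times> 'c => real" where
 "env_sup r=(%(u, v). SUP t\<in>out (q u). r (arr t u, arr t v))"

lemma env_sup_fib: "u:fib l ==> env_sup r (u, v)=(SUP t\<in>out l. r (arr t u, arr t v))" by (simp add: env_sup_def fib_iff)

lemma id_out: "l:LL ==> act_arrow \<one> l:out l" using id_env by (simp add: out_def)

lemma out_nonempty: "l:LL ==> out l ~= {}" using id_out by blast

text \<open>Composition with h is a bijection between the arrows leaving the target of h and those
  leaving its source.\<close>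

lemma env_sup_invariant:
 assumes h: "h:env" and uv: "u:fib (src h)" "v:fib (src h)"
 shows "env_sup r (arr h u, arr h v)=env_sup r (u, v)"
proof -
 have "(%t. r (arr t (arr h u), arr t (arr h v))) ` out (tgt h)=(%t. r (arr t u, arr t v)) ` out (src h)"
 proof (intro equalityI subsetI)
  fix z assume "z:(%t. r (arr t (arr h u), arr t (arr h v))) ` out (tgt h)"
  then obtain t where t: "t:env" "src t=tgt h" "z=r (arr t (arr h u), arr t (arr h v))" by (auto simp: out_def)
  have "acomp t h:out (src h)" using comp_env[OF t(1) h] t(2) by (simp add: out_def)
  moreover have "z=r (arr (acomp t h) u, arr (acomp t h) v)" using t(3) uv by simp
  ultimately show "z:(%t. r (arr t u, arr t v)) ` out (src h)" by blast
 next
  fix z assume "z:(%t. r (arr t u, arr t v)) ` out (src h)"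
  then obtain k where k: "k:env" "src k=src h" "z=r (arr k u, arr k v)" by (auto simp: out_def)
  let ?t = "acomp k (ainv h)"
  have "?t:out (tgt h)" using comp_env[OF k(1) inv_env[OF h]] k(2) by (simp add: out_def)
  moreover have "z=r (arr ?t (arr h u), arr ?t (arr h v))" using k(3) uv env_fib[OF h] arr_inv'[OF bij_env[OF h]] by simp
  ultimately show "z:(%t. r (arr t (arr h u), arr t (arr h v))) ` out (tgt h)" by blast
 qed
 thus ?thesis using env_sup_fib[OF env_fib[OF h uv(1)]] env_sup_fib[OF uv(1)] by simp
qed

abbreviation out_space :: "'d => ('d, 'c) arrow topology" where
 "out_space l == subtopology atop (out l)"

lemma topspace_out_space [simp]: "topspace (out_space l) = out l"
 using env_arrows by (auto simp: topspace_subtopology topspace_arrows out_def)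

lemma compact_out_space: "l:LL ==> compact_space (out_space l)" by (simp add: compact_space_subtopology compactin_out)

lemma continuous_evaluation:
 "continuous_map (prod_topology (out_space l) (fsp l)) K (%(t, x). arr t x)" unfolding continuous_map_def
proof (intro conjI allI impI)
 let ?P = "prod_topology (out_space l) (fsp l)"
 have top: "topspace ?P = out l \<times> fib l" unfolding topspace_prod_topology topspace_out_space topspace_fib ..
 show "(%(t, x). arr t x):topspace ?P \<rightarrow> KK" unfolding top using env_fib fib_subset by (fastforce simp: out_def)
 fix V assume V: "openin K V"
 show "openin ?P {z:topspace ?P. (case z of (t, x) => arr t x):V}"
 proof (subst openin_subopen, intro ballI)
  fix z assume "z:{z:topspace ?P. (case z of (t, x) => arr t x):V}"
  then obtain t x where z: "z=(t, x)" "t:out l" "x:fib l" "arr t x:V" unfolding top by auto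
  hence t: "t:env" "src t=l" by (auto simp: out_def)
  obtain C O' where C: "compactin K C" "openin K O'" "x:O'" "O'<=C" "t:W C V"
  by (rule evaluation_neighbourhood[OF env_arrow[OF t(1)] _ V z(4)]) (use t(2) z(3) that in auto)
  show "EX T. openin ?P T & z:T & T<={z:topspace ?P. (case z of (t, x) => arr t x):V}"
  proof (intro exI[of _ "(W C V Int out l) \<times> (O' Int fib l)"] conjI)
  show "openin ?P ((W C V Int out l) \<times> (O' Int fib l))"
  unfolding openin_prod_Times_iff using openin_W[OF C(1) V] C(2) by (auto simp: openin_subtopology)
  show "z:(W C V Int out l) \<times> (O' Int fib l)" using z C by auto
  show "(W C V Int out l) \<times> (O' Int fib l)<={z:topspace ?P. (case z of (t, x) => arr t x):V}"
  unfolding top using C(4) by (auto simp: W_def out_def image_subset_iff)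
  qed
 qed
qed

text \<open>By transitivity the arrows leaving one fibre reach all of K; a continuous surjection
  from a compact space onto a Hausdorff space is a quotient map.\<close>

lemma evaluation_quotient:
 assumes l: "l:LL"
 shows "quotient_map (prod_topology (out_space l) (fsp l)) K (%(t, x). arr t x)"
proof (rule continuous_closed_imp_quotient_map[OF continuous_evaluation])
 show "closed_map (prod_topology (out_space l) (fsp l)) K (%(t, x). arr t x)"
  using continuous_imp_closed_map[OF continuous_evaluation] Hausdorff_total compact_out_space[OF l] compact_fib[OF l]
  by (simp add: compact_space_prod_topology)
 show "(%(t, x). arr t x) ` topspace (prod_topology (out_space l) (fsp l))=KK"
 proof (intro equalityI subsetI)
  fix x assume x: "x:KK"
  obtain t where t: "t:env" "src t=l" "tgt t=q x" using env_transitive[OF l proj_closed[OF x]] by blast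
  have "x:arr t ` fib l" using x t(3) bij_env[OF t(1)] t(2) by (auto simp: fib_iff bij_betw_def)
  then obtain y where "y:fib l" "arr t y=x" by blast
  thus "x:(%(t, x). arr t x) ` topspace (prod_topology (out_space l) (fsp l))"
  unfolding topspace_prod_topology topspace_out_space topspace_fib using t by (intro image_eqI[of _ _ "(t, y)"]) (auto simp: out_def)
 qed (use continuous_map_image_subset_topspace[OF continuous_evaluation] in blast)
qed

text \<open>The set of arrows to be considered changes with the fibre. After composition with the
  quotient map \<open>Q\<close> the supremum runs over the arrows leaving one fixed fibre, a compact
  parameter space.\<close>

lemma continuous_env_sup:
 assumes r: "cntR (prod_topology K K) r"
 shows "cntR KqK (env_sup r)"
proof -
 obtain l where l: "l:LL" using base.nonempty_space by blast
 let ?B = "out_space l" and ?X = "fsp l"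
 let ?F = "KqK"
 let ?P = "prod_topology ?B (prod_topology ?X ?X)"
 define Q where "Q=(%(t :: ('d, 'c) arrow, x, y). (arr t x, arr t y))"
 have top: "topspace ?P = out l \<times> fib l \<times> fib l" unfolding topspace_prod_topology topspace_out_space topspace_fib ..
 have "continuous_map ?P (prod_topology ?B ?X) (%z. (fst z, (fst \<circ> snd) z))"
  by (intro continuous_map_pairedI continuous_map_fst continuous_map_compose[OF continuous_map_snd continuous_map_fst])
 from continuous_map_compose[OF this continuous_evaluation]
 have e1: "continuous_map ?P K (%z. arr (fst z) (fst (snd z)))" by (simp add: comp_def)
 have "continuous_map ?P (prod_topology ?B ?X) (%z. (fst z, (snd \<circ> snd) z))"
  by (intro continuous_map_pairedI continuous_map_fst continuous_map_compose[OF continuous_map_snd continuous_map_snd])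
 from continuous_map_compose[OF this continuous_evaluation]
 have e2: "continuous_map ?P K (%z. arr (fst z) (snd (snd z)))" by (simp add: comp_def)
 have "continuous_map ?P (prod_topology K K) Q" using continuous_map_pairedI[OF e1 e2] by (simp add: Q_def case_prod_unfold)
 moreover have "Q ` topspace ?P<=fibre_product K q"
 proof
  fix z assume "z:Q ` topspace ?P"
  then obtain t x y where z: "z=(arr t x, arr t y)" "t:out l" "x:fib l" "y:fib l" unfolding top by (auto simp: Q_def)
  hence "arr t x:fib (tgt t)" "arr t y:fib (tgt t)" using env_fib by (auto simp: out_def)
  thus "z:fibre_product K q" using z(1) by (auto simp: fibre_product_def fib_iff)
 qed
 ultimately have contQ: "continuous_map ?P ?F Q" unfolding continuous_map_in_subtopology by blast
 have compP: "compact_space ?P" using compact_out_space[OF l] compact_fib[OF l] by (simp add: compact_space_prod_topology)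
 have "quotient_map ?P ?F Q"
 proof (rule continuous_closed_imp_quotient_map[OF contQ])
  show "closed_map ?P ?F Q" using continuous_imp_closed_map[OF contQ] compP Hausdorff_total
  by (simp add: Hausdorff_space_subtopology Hausdorff_space_prod_topology)
  show "Q ` topspace ?P=topspace ?F"
  proof (intro equalityI subsetI)
  fix z assume "z:topspace ?F"
  then obtain u v where z: "z=(u, v)" "u:KK" "v:KK" "q u=q v" by (auto simp: fibre_product_def)
  obtain t where t: "t:env" "src t=l" "tgt t=q u" using env_transitive[OF l proj_closed[OF z(2)]] by blast
  have "u:fib (tgt t)" "v:fib (tgt t)" using z t(3) by (auto simp: fib_iff)
  then obtain x y where xy: "x:fib l" "arr t x=u" "y:fib l" "arr t y=v"
  using bij_env[OF t(1)] t(2) unfolding bij_betw_def by (metis imageE)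
  thus "z:Q ` topspace ?P" unfolding top using t z(1) by (intro image_eqI[of _ _ "(t, x, y)"]) (auto simp: Q_def out_def)
  qed (use continuous_map_image_subset_topspace[OF contQ] in blast)
 qed
 \<comment> \<open>By invariance along h, the value at \<open>Q (h, x, y)\<close> is the one at (x,
   y), which does not involve h.\<close>
 moreover have "cntR ?P (env_sup r \<circ> Q)"
 proof -
  have "cntR (prod_topology ?X ?X) (%z. SUP t\<in>topspace ?B. (r \<circ> Q) (t, z))" using continuous_map_compose[OF _ r] contQ continuous_map_in_subtopology continuous_map_SUP_compact compact_out_space l topspace_out_space out_nonempty by metis
  from continuous_map_compose[OF continuous_map_snd this]
  have "cntR ?P ((%z. SUP t\<in>topspace ?B. (r \<circ> Q) (t, z)) \<circ> snd)" .
  thus ?thesis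
  proof (rule continuous_map_eq)
  fix z assume "z:topspace ?P"
  then obtain h x y where z: "z=(h, x, y)" "h:env" "src h=l" "x:fib l" "y:fib l" unfolding top by (auto simp: out_def)
  thus "((%z. SUP t\<in>topspace ?B. (r \<circ> Q) (t, z)) \<circ> snd) z=(env_sup r \<circ> Q) z" unfolding topspace_out_space
  using env_sup_invariant[of h x y r] env_sup_fib[OF z(4), of r y] by (simp add: Q_def)
  qed
 qed
 ultimately show ?thesis by (rule continuous_compose_quotient_map)
qed

lemma continuous_bounded:
 assumes "cntR (prod_topology K K) r"
 obtains C where "!!z. z:KK \<times> KK ==> abs (r z)<=C"
proof -
 have "compactin euclideanreal (r ` (KK \<times> KK))" using compact_total image_compactin[OF _ assms] by (metis compact_space_prod_topology compact_space_def topspace_prod_topology)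
 hence "bounded (r ` (KK \<times> KK))" by (simp add: compact_imp_bounded)
 thus thesis using that by (auto simp: bounded_iff)
qed

lemma env_sup_upper:
 assumes r: "cntR (prod_topology K K) r"
  and "t:out l" "u:fib l" "v:fib l"
 shows "r (arr t u, arr t v)<=env_sup r (u, v)"
proof -
 obtain C where C: "!!z. z:KK \<times> KK ==> abs (r z)<=C" using continuous_bounded[OF r] by blast
 have "r (arr h u, arr h v)<=C" if h: "h:out l" for h
 proof -
  have "arr h u:KK" "arr h v:KK" using env_fib[of h] h assms(3,4) fib_subset unfolding out_def by blast+
  thus ?thesis using C[of "(arr h u, arr h v)"] by simp
 qed
 hence "bdd_above ((%t. r (arr t u, arr t v)) ` out l)" by (intro bdd_aboveI[of _ C]) auto
 thus ?thesis unfolding env_sup_fib[OF assms(3)] using assms(2) by (intro cSUP_upper)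
qed

lemma env_sup_ge:
 assumes "cntR (prod_topology K K) r" "u:fib l" "v:fib l" "l:LL"
 shows "r (u, v)<=env_sup r (u, v)"
proof -
 have "\<phi> \<one> u=u" "\<phi> \<one> v=v" using assms phi_one by (auto simp: fib_iff)
 thus ?thesis using env_sup_upper[OF assms(1) _ assms(2,3), of "act_arrow \<one> l"] id_env[OF assms(4)] assms(2,3) by (simp add: out_def)
qed

lemma pseudometric_env_sup:
 assumes a: "cntR (prod_topology K K) a" "pseudometric_on (KK) a"
  and l: "l:LL"
 shows "pseudometric_on (fib l) (env_sup a)"
proof -
 note pm = a(2)[unfolded pseudometric_on_def]
 have mem: "arr t x:KK" if "t:out l" "x:fib l" for t x using env_fib[of t x] that fib_subset unfolding out_def by blast
 have le: "env_sup a (x, y)<=r" if "x:fib l" "!!t. t:out l ==> a (arr t x, arr t y)<=r" for x y r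
  unfolding env_sup_fib[OF that(1)] using out_nonempty[OF l] that(2) by (intro cSUP_least)
 obtain t0 where t0: "t0:out l" using out_nonempty[OF l] by blast
 have nn: "0<=env_sup a (x, y)" if "x:fib l" "y:fib l" for x y
 proof -
  show ?thesis using pm mem t0 that env_sup_upper[OF a(1) t0 that] by (smt (verit) )
 qed
 have sym: "env_sup a (x, y)<=env_sup a (y, x)" if xy: "x:fib l" "y:fib l" for x y
 proof (rule le[OF xy(1)])
  fix t assume t: "t:out l"
  show "a (arr t x, arr t y)<=env_sup a (y, x)" using pm mem[OF t] xy env_sup_upper[OF a(1) t xy(2,1)] by simp
 qed
 have "env_sup a (x, x)<=0" if x: "x:fib l" for x
 proof (rule le[OF x])
  fix t assume t: "t:out l"
  show "a (arr t x, arr t x)<=0" using pm mem[OF t x] by simp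
 qed
 moreover have "env_sup a (x, z)<=env_sup a (x, y) + env_sup a (y, z)"
  if xyz: "x:fib l" "y:fib l" "z:fib l" for x y z
 proof (rule le[OF xyz(1)])
  fix t assume t: "t:out l"
  show "a (arr t x, arr t z)<=env_sup a (x, y) + env_sup a (y, z)" using pm mem[OF t] xyz env_sup_upper[OF a(1) t xyz(1,2)] env_sup_upper[OF a(1) t xyz(2,3)] by (smt (verit) )
 qed
 ultimately show ?thesis unfolding pseudometric_on_def using nn sym by (auto intro!: antisym)
qed

lemma isometric_family_env_sup:
 assumes R: "!!r. r:R ==> cntR (prod_topology K K) r"
  "!!r. r:R ==> pseudometric_on (KK) r"
  and sep: "!!x y. [|x:KK; y:KK; x ~= y|] ==> EX r:R. r (x, y) ~= 0"
 shows "isometric_family G K \<phi> L q (env_sup ` R)"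
proof -
 have cont: "cntR KqK p" if "p:env_sup ` R" for p using that R(1) continuous_env_sup by blast
 have pm: "pseudometric_on (fib l) p" if "p:env_sup ` R" "l:LL" for p l using that R pseudometric_env_sup by blast
 have fp: "x:fib (q x) & y:fib (q x) & q x:LL" if "(x, y):fibre_product K q" for x y
  using that proj_closed by (auto simp: fibre_product_def fib_iff)
 have nn: "0<=p z" if "p:env_sup ` R" "z:fibre_product K q" for p z
 proof -
  obtain x y where xy: "z=(x, y)" by fastforce
  thus ?thesis using pm[OF that(1)] fp[of x y] that(2) unfolding pseudometric_on_def by blast
 qed
 have inv: "p (\<phi> g x, \<phi> g y)=p (x, y)" if p: "p:env_sup ` R" and xy: "(x, y):fibre_product K q" and g: "g:carrier G" for p x y g
 proof -
  obtain r where r: "p=env_sup r" using p by blast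
  note f = fp[OF xy]
  show ?thesis using env_sup_invariant[OF act_env[OF g], of "q x" x y r] f r by simp
 qed
 have top: "pseudometrics_topology (fib l) (env_sup ` R)=fsp l" if l: "l:LL" for l
 proof (rule pseudometrics_topology_fib[OF l cont pm[OF _ l]])
  fix x y assume xy: "x:fib l" "y:fib l" "x ~= y"
  then obtain r where r: "r:R" "r (x, y) ~= 0" using sep[of x y] by (auto simp: fib_iff)
  have "0<=r (x, y)" using R(2)[OF r(1)] xy fib_subset unfolding pseudometric_on_def by blast
  hence "env_sup r (x, y) ~= 0" using env_sup_ge[OF R(1)[OF r(1)] xy(1,2) l] r(2) by linarith
  thus "EX p:env_sup ` R. p (x, y) ~= 0" using r(1) by blast
 qed
 show ?thesis unfolding isometric_family_def
 proof (intro conjI ballI)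
  fix p assume p: "p:env_sup ` R"
  show "cntR KqK p" by (rule cont[OF p])
  fix z assume z: "z:fibre_product K q"
  show "0<=p z" by (rule nn[OF p z])
  show "case z of (x, y) => ALL g:carrier G. p (\<phi> g x, \<phi> g y)=p (x, y)" using inv[OF p] z by (cases z) simp
 next
  fix l assume l: "l:LL"
  show "pseudometric_on (fib l) p" if "p:env_sup ` R" for p by (rule pm[OF that l])
  show "pseudometrics_topology (fib l) (env_sup ` R)=fsp l" by (rule top[OF l])
 qed
qed

text \<open>The differences |f x - f y| of continuous functions separate points by Urysohn, and the
  passage to \<open>env_sup\<close> only enlarges them.\<close>

theorem pseudoisometric_if_compact_groupoid: "pseudoisometric G K \<phi> L q"
proof -
 let ?R = "{%(x, y). abs (f x - f y) | f. cntR K f}"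
 have "isometric_family G K \<phi> L q (env_sup ` ?R)"
 proof (rule isometric_family_env_sup)
  fix r assume "r:?R"
  then obtain f where f: "r=(%(x, y). abs (f x - f y))" "cntR K f" by blast
  have "cntR (prod_topology K K) (%z. abs (f (fst z) - f (snd z)))" by (intro continuous_map_real_abs continuous_map_diff
  continuous_map_compose[OF continuous_map_fst f(2), unfolded comp_def]
  continuous_map_compose[OF continuous_map_snd f(2), unfolded comp_def])
  thus "cntR (prod_topology K K) r" by (simp add: f(1) case_prod_unfold)
  show "pseudometric_on (KK) r" unfolding pseudometric_on_def f(1) by auto
 next
  fix x y assume xy: "x:KK" "y:KK" "x ~= y"
  have "closedin K {x}" "closedin K {y}" using xy closedin_Hausdorff_singleton[OF Hausdorff_total] by auto
  then obtain f where f: "cntR K f" "f ` {x}<={0}" "f ` {y}<={1}"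
  using Urysohn_lemma_alt[OF normal_total, of "{x}" "{y}" 0 1] xy(3) by (metis disjnt_insert1 disjnt_empty1 singletonD)
  thus "EX r:?R. r (x, y) ~= 0" by (intro bexI[of _ "%(x, y). abs (f x - f y)"]) auto
 qed
 thus ?thesis unfolding pseudoisometric_def by blast
qed

text \<open>A metric of K separates points on its own, so a single pseudometric is made
  invariant.\<close>

theorem isometric_if_compact_groupoid:
 assumes "metrizable_space K"
 shows "isometric G K \<phi> L q"
proof -
 obtain M d where M: "Metric_space M d" "K=Metric_space.mtopology M d" using assms unfolding metrizable_space_def by blast
 interpret Md: Metric_space M d by (rule M(1))
 let ?r = "%(x, y). d x y"
 have "isometric_family G K \<phi> L q (env_sup ` {?r})"
 proof (rule isometric_family_env_sup)
  fix r assume "r:{?r}"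
  hence r: "r=?r" by simp
  show "cntR (prod_topology K K) r" unfolding r M(2) by (rule Metric_space_continuous_dist[OF M(1)])
  show "pseudometric_on (KK) r" unfolding pseudometric_on_def r M(2) by (auto simp: Md.commute Md.triangle)
 qed (auto simp: M(2))
 thus ?thesis unfolding isometric_def by auto
qed

end

section \<open>Invariant bundles of finite rank\<close>

text \<open>Gaussian elimination: an equation with a pivot is removed together with its unknown, and
  the unknown is recovered as t.\<close>

lemma underdetermined_system:
 fixes a :: "'i => 'j => 'f::field"
 assumes "finite J" "finite I" "card J < card I"
 shows "EX c. (EX i:I. c i ~= 0) & (ALL j:J. (\<Sum>i\<in>I. c i * a i j)=0)" using assms
proof (induction J arbitrary: I a rule: finite_induct)
 case empty
 hence "I ~= {}" by auto
 thus ?case by (intro exI[of _ "%_. 1"]) auto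
next
 case (insert j J)
 show ?case
 proof (cases "ALL i:I. a i j=0")
  case True
  obtain c where "EX i:I. c i ~= 0" "ALL j:J. (\<Sum>i\<in>I. c i * a i j)=0" using insert.IH[of I a] insert.prems insert.hyps by auto
  thus ?thesis using True by (intro exI[of _ c]) auto
 next
  case False
  then obtain k where k: "k:I" "a k j ~= 0" by blast
  let ?I = "I - {k}"
  have card: "card J < card ?I" using insert.prems insert.hyps k(1) by simp
  obtain c where c: "EX i:?I. c i ~= 0" "!!j'. j':J ==> (\<Sum>i\<in>?I. c i * (a i j' - a i j / a k j * a k j'))=0"
  using insert.IH[of ?I "%i j'. a i j' - a i j / a k j * a k j'"] insert.prems(1) card by auto
  define t where "t = - (\<Sum>i\<in>?I. c i * a i j) / a k j"
  define d where "d=c(k := t)"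
  have split: "(\<Sum>i\<in>I. d i * a i j')=t * a k j' + (\<Sum>i\<in>?I. c i * a i j')" for j'
  proof -
  have "(\<Sum>i\<in>I. d i * a i j')=d k * a k j' + (\<Sum>i\<in>?I. d i * a i j')" by (rule sum.remove[OF insert.prems(1) k(1)])
  moreover have "(\<Sum>i\<in>?I. d i * a i j')=(\<Sum>i\<in>?I. c i * a i j')" by (rule sum.cong) (auto simp: d_def)
  ultimately show ?thesis by (simp add: d_def)
  qed
  have "(\<Sum>i\<in>I. d i * a i j')=0" if "j':insert j J" for j'
  proof (cases "j'=j")
  case True
  thus ?thesis unfolding split using k(2) by (simp add: t_def)
  next
  case False
  show ?thesis using split c(2)[of j'] False that by (auto simp: right_diff_distrib sum_subtractf sum_distrib_left sum_distrib_right sum_divide_distrib mult_ac t_def)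
  qed
  moreover have "EX i:I. d i ~= 0" using c(1) by (auto simp: d_def)
  ultimately show ?thesis by blast
 qed
qed

definition in_span :: "'x set => nat => (nat => 'x => 'f::field) => ('x => 'f) => bool" where
 "in_span X n w f \<longleftrightarrow> (EX c. ALL x:X. f x=(\<Sum>i<n. c i * w i x))"

definition indon :: "'x set => nat => (nat => 'x => 'f::field) => bool" where
 "indon X n w \<longleftrightarrow> (ALL c. (ALL x:X. (\<Sum>i<n. c i * w i x)=0) --> (ALL i<n. c i=0))"

lemma in_span_basis: "i < n ==> in_span X n w (w i)" unfolding in_span_def
 by (intro exI[of _ "%j. if j=i then 1 else 0"]) (simp add: if_distrib[of "%t. t * _"] cong: if_cong)

lemma in_span_cmult:
 assumes "in_span X n w f"
 shows "in_span X n w (%x. r * f x)"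
proof -
 obtain c where "ALL x:X. f x=(\<Sum>i<n. c i * w i x)" using assms unfolding in_span_def by blast
 thus ?thesis unfolding in_span_def by (intro exI[of _ "%i. r * c i"]) (simp add: sum_distrib_left mult.assoc)
qed

lemma in_span_add:
 assumes "in_span X n w f" "in_span X n w g"
 shows "in_span X n w (%x. f x + g x)"
proof -
 obtain c d where "ALL x:X. f x=(\<Sum>i<n. c i * w i x)" "ALL x:X. g x=(\<Sum>i<n. d i * w i x)" using assms unfolding in_span_def by blast
 thus ?thesis unfolding in_span_def by (intro exI[of _ "%i. c i + d i"]) (simp add: sum.distrib distrib_right)
qed

lemma in_span_zero: "in_span X n w (%x. 0)" unfolding in_span_def by (intro exI[of _ "%_. 0"]) simp

lemma in_span_sum: "(!!i. i:I ==> in_span X n w (f i)) ==> in_span X n w (%x. \<Sum>i\<in>I. f i x)"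
 by (induction I rule: infinite_finite_induct) (auto simp: in_span_zero in_span_add)

lemma in_span_cong: "(!!x. x:X ==> f x=g x) ==> in_span X n w f ==> in_span X n w g" unfolding in_span_def by simp

lemma in_span_trans:
 assumes "in_span X m v f" "!!i. i < m ==> in_span X n w (v i)"
 shows "in_span X n w f"
proof -
 obtain c where c: "ALL x:X. f x=(\<Sum>i<m. c i * v i x)" using assms(1) unfolding in_span_def by blast
 have "in_span X n w (%x. \<Sum>i<m. c i * v i x)" using assms(2) by (intro in_span_sum in_span_cmult) auto
 thus ?thesis by (rule in_span_cong[rotated]) (use c in simp)
qed

text \<open>A system of minimal length with the same span is independent.\<close>

lemma independent_spanning_subsystem:
 fixes w :: "nat => 'x => 'f::field"
 obtains m v where "indon X m v" "!!i. i < n ==> in_span X m v (w i)" "!!i. i < m ==> in_span X n w (v i)"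
proof -
 define P where "P m \<longleftrightarrow> (EX v. (ALL i<n. in_span X m v (w i)) & (ALL i<m. in_span X n w (v i)))" for m
 have "P n" unfolding P_def using in_span_basis by blast
 hence Pm: "P (LEAST m. P m)" by (rule LeastI)
 define m where "m=(LEAST m. P m)"
 obtain v where v: "!!i. i < n ==> in_span X m v (w i)" "!!i. i < m ==> in_span X n w (v i)" using Pm unfolding P_def m_def by blast
 have "indon X m v" unfolding indon_def
 proof (intro allI impI, rule ccontr)
  fix c k assume c: "ALL x:X. (\<Sum>i<m. c i * v i x)=0" and k: "k < m" "c k ~= 0"
  \<comment> \<open>The redundant v k is overwritten by the last entry, so that an initial segment
    of length m - 1 remains.\<close>
  define u where "u i=(if i=k then v (m - 1) else v i)" for i
  have other: "in_span X (m - 1) u (v j)" if j: "j < m" "j ~= k" for j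
  proof (cases "j=m - 1")
  case True
  thus ?thesis using in_span_basis[of k "m - 1" X u] k(1) j by (simp add: u_def)
  next
  case False
  thus ?thesis using in_span_basis[of j "m - 1" X u] j by (simp add: u_def)
  qed
  have vk: "v k x=(\<Sum>j\<in>{..<m} - {k}. (- c j / c k) * v j x)" if "x:X" for x
  proof -
  have "c k * v k x + (\<Sum>j\<in>{..<m} - {k}. c j * v j x)=0" using c that sum.remove[of "{..<m}" k "%i. c i * v i x"] k(1) by simp
  hence "v k x = - (\<Sum>j\<in>{..<m} - {k}. c j * v j x) / c k" using k(2) by (simp add: field_simps add_eq_0_iff)
  thus ?thesis by (simp add: sum_divide_distrib sum_negf)
  qed
  have "in_span X (m - 1) u (%x. \<Sum>j\<in>{..<m} - {k}. (- c j / c k) * v j x)" using other by (intro in_span_sum in_span_cmult) auto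
  hence "in_span X (m - 1) u (v k)" by (rule in_span_cong[rotated]) (simp add: vk)
  hence all: "in_span X (m - 1) u (v j)" if "j < m" for j using other that by (cases "j=k") auto
  have "P (m - 1)" unfolding P_def
  proof (intro exI[of _ u] conjI allI impI)
  show "in_span X (m - 1) u (w i)" if "i < n" for i using in_span_trans[OF v(1)[OF that]] all by blast
  show "in_span X n w (u i)" if "i < m - 1" for i using v(2) k(1) that by (auto simp: u_def)
  qed
  hence "m<=m - 1" unfolding m_def by (rule Least_le)
  thus False using k(1) by simp
 qed
 thus thesis using that v by blast
qed

text \<open>The n + 1 functions s 0, ..., s (n - 1), w k lie in the span of n functions and satisfy
  a nontrivial relation. Independence of s forces the coefficient of w k to be nonzero.\<close>

lemma independent_full_rank_spans:
 fixes w s :: "nat => 'x => 'f::field"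
 assumes s: "!!i. i < n ==> in_span X n w (s i)" and ind: "indon X n s" and k: "k < n"
 shows "in_span X n s (w k)"
proof -
 obtain a where a: "!!i x. [|i < n; x:X|] ==> s i x=(\<Sum>j<n. a i j * w j x)" using s unfolding in_span_def by metis
 define b where "b i j=(if i < n then a i j else if j=k then 1 else 0)" for i j
 have "card {..<n} < card {..<Suc n}" by simp
 then obtain c where c: "EX i:{..<Suc n}. c i ~= 0" "!!j. j < n ==> (\<Sum>i<Suc n. c i * b i j)=0"
  using underdetermined_system[of "{..<n}" "{..<Suc n}" b] by auto
 have rel: "(\<Sum>i<n. c i * s i x) + c n * w k x=0" if x: "x:X" for x
 proof -
  have "(\<Sum>i<n. c i * s i x) + c n * w k x=(\<Sum>i<n. c i * (\<Sum>j<n. a i j * w j x)) + c n * (\<Sum>j<n. (if j=k then 1 else 0) * w j x)"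
  using a x k by (simp add: if_distrib[of "%t. t * _"] cong: if_cong)
  also have "... = (\<Sum>i<Suc n. c i * (\<Sum>j<n. b i j * w j x))" by (simp add: b_def)
  also have "... = (\<Sum>j<n. (\<Sum>i<Suc n. c i * b i j) * w j x)"
  unfolding sum_distrib_left sum_distrib_right by (subst sum.swap) (simp add: mult.assoc)
  also have "... = 0" using c(2) by simp
  finally show ?thesis .
 qed
 have "c n ~= 0" using rel ind c(1) less_Suc_eq by (auto simp: indon_def)
 hence "w k x=(\<Sum>i<n. (- c i / c n) * s i x)" if "x:X" for x
  using rel[OF that] by (simp add: sum_negf field_simps add_eq_0_iff flip: sum_divide_distrib)
 thus ?thesis unfolding in_span_def by (intro exI[of _ "%i. - c i / c n"] ballI)
qed

lemma independent_on_complex: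
 assumes "indon X n (w :: nat => 'x => real)"
 shows "indon X n (%i x. complex_of_real (w i x))" unfolding indon_def
proof (intro allI impI)
 fix c i assume c: "ALL x:X. (\<Sum>i<n. c i * complex_of_real (w i x))=0" and i: "i < n"
 have "(\<Sum>i<n. Re (c i) * w i x)=0 & (\<Sum>i<n. Im (c i) * w i x)=0" if "x:X" for x
 proof -
  have "Re (\<Sum>i<n. c i * complex_of_real (w i x))=0" "Im (\<Sum>i<n. c i * complex_of_real (w i x))=0" using c that by simp_all
  thus ?thesis by simp
 qed
 hence "ALL x:X. (\<Sum>i<n. Re (c i) * w i x)=0" "ALL x:X. (\<Sum>i<n. Im (c i) * w i x)=0" by auto
 hence "ALL i<n. Re (c i)=0" "ALL i<n. Im (c i)=0" using assms[unfolded indon_def, rule_format, of "%i. Re (c i)"]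
  assms[unfolded indon_def, rule_format, of "%i. Im (c i)"] by simp_all
 thus "c i=0" using i by (simp add: complex_eq_iff)
qed

section \<open>Isotropy groups and Peter-Weyl approximation on a fibre\<close>

context groupoid_extension
begin

definition isotropy :: "'d => ('d, 'c) arrow monoid" where
 "isotropy l=\<lparr>carrier={t:env. src t=l & tgt t=l}, mult=acomp, one=act_arrow \<one> l\<rparr>"

lemma isotropy_carrier: "h:carrier (isotropy l) \<longleftrightarrow> h:env & src h=l & tgt h=l" by (simp add: isotropy_def)

lemma group_isotropy:
 assumes l: "l:LL"
 shows "group (isotropy l)"
proof (rule groupI)
 have one: "act_arrow \<one> l:env" "tgt (act_arrow \<one> l)=l" using id_env[OF l] psi_one[OF l] by auto
 show "\<one>\<^bsub>isotropy l\<^esub>:carrier (isotropy l)" using one by (simp add: isotropy_def)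
 fix x assume x: "x:carrier (isotropy l)"
 hence xE: "x:env" "src x=l" "tgt x=l" by (auto simp: isotropy_carrier)
 have comp1: "acomp (act_arrow \<one> l) x:arrows" using comp_env[OF one(1) xE(1)] xE env_arrow by simp
 show "\<one>\<^bsub>isotropy l\<^esub> \<otimes>\<^bsub>isotropy l\<^esub> x=x"
 proof -
  show ?thesis using arrow_eqI comp1 env_arrow xE(1) env_fib xE(3) phi_one xE one by (auto simp: fib_iff isotropy_def)
 qed
 show "EX y:carrier (isotropy l). y \<otimes>\<^bsub>isotropy l\<^esub> x=\<one>\<^bsub>isotropy l\<^esub>"
 proof (intro bexI[of _ "ainv x"])
  have inv: "ainv x:env" by (rule inv_env[OF xE(1)])
  have "acomp (ainv x) x=act_arrow \<one> l"
  proof (rule arrow_eqI)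
  show "acomp (ainv x) x:arrows" using comp_env[OF inv xE(1)] env_arrow by simp
  show "act_arrow \<one> l:arrows" using one env_arrow by simp
  fix y assume "y:fib (src (acomp (ainv x) x))"
  hence y: "y:fib (src x)" by simp
  thus "arr (acomp (ainv x) x) y=arr (act_arrow \<one> l) y" using arr_inv'[OF bij_env[OF xE(1)] y] phi_one xE(2) by (simp add: fib_iff)
  qed (use xE one in auto)
  thus "ainv x \<otimes>\<^bsub>isotropy l\<^esub> x=\<one>\<^bsub>isotropy l\<^esub>" by (simp add: isotropy_def)
  show "ainv x:carrier (isotropy l)" using inv xE by (simp add: isotropy_carrier)
 qed
 fix y assume y: "y:carrier (isotropy l)"
 hence yE: "y:env" "src y=l" "tgt y=l" by (auto simp: isotropy_carrier)
 show "x \<otimes>\<^bsub>isotropy l\<^esub> y:carrier (isotropy l)" using comp_env[OF xE(1) yE(1)] xE yE by (simp add: isotropy_def)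
 fix z assume z: "z:carrier (isotropy l)"
 hence zE: "z:env" "src z=l" "tgt z=l" by (auto simp: isotropy_carrier)
 have "acomp (acomp x y) z=acomp x (acomp y z)"
 proof (rule arrow_eqI)
  show "acomp (acomp x y) z:arrows" "acomp x (acomp y z):arrows" using comp_env xE yE zE env_arrow by simp_all
  fix t assume "t:fib (src (acomp (acomp x y) z))"
  hence t: "t:fib (src z)" by simp
  thus "arr (acomp (acomp x y) z) t=arr (acomp x (acomp y z)) t" using env_fib[OF zE(1)] zE yE t by simp
 qed auto
 thus "x \<otimes>\<^bsub>isotropy l\<^esub> y \<otimes>\<^bsub>isotropy l\<^esub> z=x \<otimes>\<^bsub>isotropy l\<^esub> (y \<otimes>\<^bsub>isotropy l\<^esub> z)" by (simp add: isotropy_def)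
qed

lemma set_action_isotropy:
 assumes l: "l:LL"
 shows "set_action (isotropy l) (fib l) arr"
proof -
 interpret H: group "isotropy l" by (rule group_isotropy[OF l])
 show ?thesis
 proof
  fix g x assume g: "g:carrier (isotropy l)" and x: "x:fib l"
  thus "arr g x:fib l" using env_fib[of g x] by (simp add: isotropy_carrier)
  fix h assume h: "h:carrier (isotropy l)"
  thus "arr (g \<otimes>\<^bsub>isotropy l\<^esub> h) x=arr g (arr h x)"
  using comp_sel(3)[of x h g] x by (simp add: isotropy_carrier) (simp add: isotropy_def)
 next
  fix x assume "x:fib l"
  thus "arr \<one>\<^bsub>isotropy l\<^esub> x=x" using phi_one by (simp add: isotropy_def fib_iff)
 qed
qed

text \<open>The invariant pseudometric generated by f; by construction f is Lipschitz for it with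
  constant 1.\<close>

definition env_dist :: "('c => real) => 'c => 'c => real" where
 "env_dist f x y=env_sup (%(x, y). abs (f x - f y)) (x, y)"

lemma function_pseudometric:
 assumes "cntR K f"
 shows "cntR (prod_topology K K) (%(x, y). abs (f x - f y))"
  "pseudometric_on (KK) (%(x, y). abs (f x - f y))"
proof -
 have "cntR (prod_topology K K) (%z. abs (f (fst z) - f (snd z)))" by (intro continuous_map_real_abs continuous_map_diff
  continuous_map_compose[OF continuous_map_fst assms, unfolded comp_def]
  continuous_map_compose[OF continuous_map_snd assms, unfolded comp_def])
 thus "cntR (prod_topology K K) (%(x, y). abs (f x - f y))" by (simp add: case_prod_unfold)
 show "pseudometric_on (KK) (%(x, y). abs (f x - f y))" unfolding pseudometric_on_def by auto
qed

text \<open>Total boundedness follows from compactness of the fibre: the pseudometric is continuous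
  and vanishes on the diagonal, so finitely many sets of small diameter cover the fibre. The colour
  of a point is a chosen set containing it.\<close>

lemma isometric_action_isotropy:
 assumes l: "l:LL" and f: "cntR K f"
 shows "isometric_action (isotropy l) (fib l) arr (env_dist f)"
proof -
 interpret A: set_action "isotropy l" "fib l" arr by (rule set_action_isotropy[OF l])
 let ?p = "env_sup (%(x, y). abs (f x - f y))"
 note fp = function_pseudometric[OF f]
 note pm = pseudometric_env_sup[OF fp l, unfolded pseudometric_on_def]
 have cont: "cntR KqK ?p" by (rule continuous_env_sup[OF fp(1)])
 show ?thesis
 proof
  show "fib l ~= {}" by (rule fib_nonempty[OF l])
  show "0<=env_dist f x y" if "x:fib l" "y:fib l" for x y using pm that unfolding env_dist_def by blast
  show "env_dist f x x=0" if "x:fib l" for x using pm that unfolding env_dist_def by blast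
  show "env_dist f x y=env_dist f y x" if "x:fib l" "y:fib l" for x y using pm that unfolding env_dist_def by blast
  show "env_dist f x z<=env_dist f x y + env_dist f y z" if "x:fib l" "y:fib l" "z:fib l" for x y z
  using pm that unfolding env_dist_def by blast
  show "env_dist f (arr g x) (arr g y)=env_dist f x y" if "g:carrier (isotropy l)" "x:fib l" "y:fib l" for g x y
  using env_sup_invariant[of g x y] that unfolding env_dist_def by (simp add: isotropy_carrier)
  fix e :: real assume e: "e > 0"
  have "ALL x:fib l. EX V. openin K V & x:V & (ALL u:V. ALL v:V. q u=q v --> ?p (u, v)<=e)"
  proof
  fix x assume x: "x:fib l"
  obtain M N where MN: "openin K M" "openin K N" "x:M" "x:N"
  "!!u v. [|u:M; v:N; q u=q v|] ==> abs (?p (x, x) - ?p (u, v)) < e" by (rule pseudometric_neighbourhood[OF cont x x e]) (rule that)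
  have p0: "?p (x, x)=0" using pm x by blast
  have "?p (u, v)<=e" if "u:M Int N" "v:M Int N" "q u=q v" for u v using MN(5)[of u v] that p0 by simp
  thus "EX V. openin K V & x:V & (ALL u:V. ALL v:V. q u=q v --> ?p (u, v)<=e)" using MN by (intro exI[of _ "M Int N"]) auto
  qed
  from bchoice[OF this] obtain V where V: "ALL x:fib l. openin K (V x) & x:V x & (ALL u:V x. ALL v:V x. q u=q v --> ?p (u, v)<=e)" ..
  obtain F where F: "finite F" "F<=fib l" "fib l<=(\<Union>x\<in>F. V x)"
  by (rule compactin_pointwise[OF compactin_fib[OF l], of V]) (use V in auto)
  obtain i :: "'c => nat" where i: "inj_on i F" using finite_imp_inj_to_nat_seg[OF F(1)] by metis
  define ch where "ch y=(SOME x. x:F & y:V x)" for y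
  have ch: "ch y:F & y:V (ch y)" if "y:fib l" for y unfolding ch_def by (rule someI_ex) (use F(3) that in blast)
  show "EX c :: 'c => nat. finite (c ` fib l) & (ALL x:fib l. ALL y:fib l. c x=c y --> env_dist f x y<=e)"
  proof (intro exI[of _ "%y. i (ch y)"] conjI ballI impI)
  show "finite ((%y. i (ch y)) ` fib l)" by (rule finite_subset[of _ "i ` F"]) (use ch F(1) in auto)
  fix x y assume xy: "x:fib l" "y:fib l" "i (ch x)=i (ch y)"
  hence "ch x=ch y" using i ch by (meson inj_onD)
  hence "x:V (ch x)" "y:V (ch x)" "ch x:fib l" using ch[OF xy(1)] ch[OF xy(2)] F(2) by auto
  moreover have "q x=q y" using xy by (simp add: fib_iff)
  ultimately show "env_dist f x y<=e" using V unfolding env_dist_def by blast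
  qed
 qed
qed

lemma env_dist_ge:
 assumes "l:LL" "cntR K f" "x:fib l" "y:fib l"
 shows "abs (f x - f y)<=env_dist f x y" using env_sup_ge[OF function_pseudometric(1)[OF assms(2)] assms(3,4,1)] by (simp add: env_dist_def)

lemma continuous_extension:
 assumes l: "l:LL" and f: "cntR (fsp l) f"
 obtains g where "cntR K g" "!!x. x:fib l ==> g x=f x"
 by (rule Tietze_extension_realinterval[OF normal_total closedin_fib[OF l], of UNIV f]) (use f that in auto)

text \<open>After extension to K the function is Lipschitz for the pseudometric that it generates
  itself.\<close>

lemma orbit_ap_continuous:
 assumes l: "l:LL" and f: "cntR (fsp l) f"
 shows "set_action.orbit_ap (isotropy l) (fib l) arr f"
proof -
 obtain g where g: "cntR K g" "!!x. x:fib l ==> g x=f x" using continuous_extension[OF l f] by blast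
 interpret A: isometric_action "isotropy l" "fib l" arr "env_dist g" by (rule isometric_action_isotropy[OF l g(1)])
 show ?thesis by (rule A.orbit_ap_lipschitz[of f 1]) (use env_dist_ge[OF l g(1)] g(2) in auto)
qed

definition isys :: "'d => nat => (nat => 'c => real) => bool" where
 "isys l n w \<longleftrightarrow> (ALL i<n. cntR (fsp l) (w i)) &
  (ALL h:carrier (isotropy l). ALL i<n. in_span (fib l) n w (%x. w i (arr h x)))"

text \<open>The approximating functions are Lipschitz for \<open>env_dist f\<close>; since this
  pseudometric is continuous, they are continuous on the fibre.\<close>

lemma Peter_Weyl:
 assumes l: "l:LL" and f: "cntR K f" and r: "r > 0"
 obtains n w c where "isys l n w" "!!x. x:fib l ==> abs (f x - (\<Sum>j<n. c j * w j x))<=r"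
proof -
 interpret A: isometric_action "isotropy l" "fib l" arr "env_dist f" by (rule isometric_action_isotropy[OF l f])
 obtain n :: nat and w c where w: "!!i. i < n ==> EX C. ALL x:fib l. ALL y:fib l. abs (w i x - w i y)<=C * env_dist f x y"
  "!!s i. [|s:carrier (isotropy l); i < n|] ==> EX d. ALL x:fib l. w i (arr s x)=(\<Sum>j<n. d j * w j x)"
  "!!x. x:fib l ==> abs (f x - (\<Sum>j<n. c j * w j x))<=r"
  by (rule A.finite_approximation[OF env_dist_ge[OF l f] r]) (assumption | rule that)+
 let ?p = "env_sup (%(x, y). abs (f x - f y))"
 have cont: "cntR KqK ?p" by (rule continuous_env_sup[OF function_pseudometric(1)[OF f]])
 have "cntR (fsp l) (w i)" if i: "i < n" for i unfolding cont_metric topspace_fib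
 proof (intro ballI allI impI)
  fix x and e :: real assume x: "x:fib l" and e: "e > 0"
  obtain C where C: "ALL x:fib l. ALL y:fib l. abs (w i x - w i y)<=C * env_dist f x y" using w(1)[OF i] by blast
  have d: "e / (abs (C) + 1) > 0" using e by simp
  obtain M N where MN: "openin K M" "openin K N" "x:M" "x:N"
  "!!u v. [|u:M; v:N; q u=q v|] ==> abs (?p (x, x) - ?p (u, v)) < e / (abs (C) + 1)"
  by (rule pseudometric_neighbourhood[OF cont x x d]) (rule that)
  show "EX U. openin (fsp l) U & x:U & (ALL y:U. dist (w i x) (w i y) < e)"
  proof (intro exI[of _ "N Int fib l"] conjI ballI)
  show "openin (fsp l) (N Int fib l)" using MN(2) by (auto simp: openin_subtopology)
  show "x:N Int fib l" using x MN(4) by blast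
  fix y assume y: "y:N Int fib l"
  have nn: "0<=env_dist f x y" using A.p_nonneg x y by blast
  have "abs (?p (x, x) - ?p (x, y)) < e / (abs (C) + 1)" using MN(3) x y by (intro MN(5)) (auto simp: fib_iff)
  hence "env_dist f x y < e / (abs (C) + 1)" using A.p_refl[OF x] by (simp add: env_dist_def)
  hence lt: "(abs (C) + 1) * env_dist f x y < e" by (simp add: field_simps)
  have "abs (w i x - w i y)<=C * env_dist f x y" using C x y by blast
  also have "... <= (abs (C) + 1) * env_dist f x y" using nn by (intro mult_right_mono) auto
  finally show "dist (w i x) (w i y) < e" using lt by (simp add: dist_real_def)
  qed
 qed
 hence "isys l n w" unfolding isys_def in_span_def using w(2) by blast
 thus thesis using that w(3) by blast
qed

lemma invariant_system_join:
 assumes "isys l n w" "isys l m v"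
 obtains k u where "isys l k u"
  "!!i. i < n ==> in_span (fib l) k u (w i)" "!!i. i < m ==> in_span (fib l) k u (v i)"
proof -
 define u where "u i=(if i < n then w i else v (i - n))" for i
 have 1: "in_span (fib l) (n + m) u (w i)" if "i < n" for i using in_span_basis[of i "n + m" "fib l" u] that by (simp add: u_def)
 have 2: "in_span (fib l) (n + m) u (v i)" if "i < m" for i using in_span_basis[of "n + i" "n + m" "fib l" u] that by (simp add: u_def)
 have "isys l (n + m) u" unfolding isys_def
 proof (intro conjI allI impI ballI)
  fix i assume i: "i < n + m"
  thus "cntR (fsp l) (u i)" using assms by (auto simp: u_def isys_def)
  fix h assume h: "h:carrier (isotropy l)"
  show "in_span (fib l) (n + m) u (%x. u i (arr h x))"
  proof (cases "i < n")
  case True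
  thus ?thesis using assms(1) h in_span_trans[OF _ 1] True by (force simp: isys_def u_def)
  next
  case False
  hence "in_span (fib l) m v (%x. v (i - n) (arr h x))" using assms(2) h i by (auto simp: isys_def)
  thus ?thesis using in_span_trans[OF _ 2] False by (simp add: u_def)
  qed
 qed
 thus thesis using that 1 2 by blast
qed

lemma invariant_system_independent:
 assumes "isys l n w"
 obtains m v where "isys l m v" "indon (fib l) m v" "!!i. i < n ==> in_span (fib l) m v (w i)"
proof -
 obtain m v where v: "indon (fib l) m v" "!!i. i < n ==> in_span (fib l) m v (w i)" "!!i. i < m ==> in_span (fib l) n w (v i)"
  by (rule independent_spanning_subsystem[of "fib l" n w]) (rule that)
 have wc: "cntR (fsp l) (w i)" if "i < n" for i using assms that by (simp add: isys_def)
 have "isys l m v" unfolding isys_def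
 proof (intro conjI allI impI ballI)
  fix i assume i: "i < m"
  obtain c where c: "!!x. x:fib l ==> v i x=(\<Sum>j<n. c j * w j x)" using v(3)[OF i] unfolding in_span_def by blast
  have "cntR (fsp l) (%x. \<Sum>j<n. c j * w j x)" using wc by (intro continuous_map_sum continuous_map_real_mult_left) auto
  thus "cntR (fsp l) (v i)" by (rule continuous_map_eq) (unfold topspace_fib, simp add: c)
  fix h assume h: "h:carrier (isotropy l)"
  have hf: "arr h x:fib l" if "x:fib l" for x using env_fib[of h x] h that by (simp add: isotropy_carrier)
  have "in_span (fib l) n w (%x. \<Sum>j<n. c j * w j (arr h x))" using assms h by (intro in_span_sum in_span_cmult) (auto simp: isys_def)
  hence "in_span (fib l) n w (%x. v i (arr h x))" by (rule in_span_cong[rotated]) (simp add: c hf)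
  thus "in_span (fib l) m v (%x. v i (arr h x))" by (rule in_span_trans) (rule v(2))
 qed
 thus thesis using that v(1,2) by blast
qed

text \<open>The bundle associated with an invariant space of functions on the fibre over \<open>l0\<close>: it is
 transported to the other fibres along the arrows of the groupoid.\<close>

definition abun :: "'d => nat => (nat => 'c => real) => 'd => ('c => complex) set" where
 "abun l0 n w l={f:extensional (fib l). ALL h:env. src h=l0 & tgt h=l -->
  in_span (fib l0) n (%i x. complex_of_real (w i x)) (%x. f (arr h x))}"

lemma in_span_complex:
 assumes "in_span X n w (f :: 'x => real)"
 shows "in_span X n (%i x. complex_of_real (w i x)) (%x. complex_of_real (f x))"
proof -
 obtain c where c: "ALL x:X. f x=(\<Sum>i<n. c i * w i x)" using assms unfolding in_span_def by blast
 thus ?thesis unfolding in_span_def by (intro exI[of _ "%i. complex_of_real (c i)"]) simp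
qed

lemma isotropy_diff:
 assumes "u:env" "u':env" "src u=l0" "src u'=l0" "tgt u=tgt u'"
 obtains h where "h:carrier (isotropy l0)" "!!x. x:fib l0 ==> arr u x=arr u' (arr h x)"
proof
 let ?h = "acomp (ainv u') u"
 show "?h:carrier (isotropy l0)" using comp_env[OF inv_env[OF assms(2)] assms(1)] assms by (simp add: isotropy_carrier)
 fix x assume x: "x:fib l0"
 show "arr u x=arr u' (arr ?h x)" using env_fib[OF assms(1)] x assms arr_inv(2)[OF bij_env[OF assms(2)]] x assms by simp
qed

text \<open>One arrow from l0 to l decides membership: any other one differs from it by an element
  of the isotropy group, under which the span of w is invariant.\<close>

lemma assoc_bundleI:
 assumes w: "isys l0 n w" and u: "u:env" "src u=l0" "tgt u=l" and f: "f:extensional (fib l)"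
  "in_span (fib l0) n (%i x. complex_of_real (w i x)) (%x. f (arr u x))"
 shows "f:abun l0 n w l" unfolding abun_def
proof (intro CollectI conjI ballI impI f(1))
 fix z assume z: "z:env" "src z=l0 & tgt z=l"
 obtain h where h: "h:carrier (isotropy l0)" "!!x. x:fib l0 ==> arr z x=arr u (arr h x)"
  by (rule isotropy_diff[OF z(1) u(1)]) (use z u that in auto)
 have hf: "arr h x:fib l0" if "x:fib l0" for x using env_fib[of h x] h that by (simp add: isotropy_carrier)
 obtain c where c: "!!x. x:fib l0 ==> f (arr u x)=(\<Sum>i<n. c i * complex_of_real (w i x))" using f(2) unfolding in_span_def by blast
 have "in_span (fib l0) n (%i x. complex_of_real (w i x)) (%x. \<Sum>i<n. c i * complex_of_real (w i (arr h x)))"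
 proof (intro in_span_sum in_span_cmult)
  fix i assume "i:{..<n}"
  hence "in_span (fib l0) n w (%x. w i (arr h x))" using w h(1) by (simp add: isys_def)
  thus "in_span (fib l0) n (%i x. complex_of_real (w i x)) (%x. complex_of_real (w i (arr h x)))" by (rule in_span_complex)
 qed
 thus "in_span (fib l0) n (%i x. complex_of_real (w i x)) (%x. f (arr z x))" by (rule in_span_cong[rotated]) (simp add: h(2) c hf)
qed

lemma assoc_bundle_invariant:
 assumes w: "isys l0 n w" and l0: "l0:LL" and g: "g:carrier G" and l: "l:LL"
  and f: "f:abun l0 n w l"
 shows "compose (fib (\<psi> g l)) f (\<phi> (inv g)):abun l0 n w (\<psi> g l)"
proof -
 obtain h where h: "h:env" "src h=l0" "tgt h=l" using env_transitive[OF l0 l] by blast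
 show ?thesis
 proof (rule assoc_bundleI[OF w, of "acomp (act_arrow g l) h"])
  show "acomp (act_arrow g l) h:env" using comp_env[OF act_env[OF g l] h(1)] h by simp
  have "in_span (fib l0) n (%i x. complex_of_real (w i x)) (%x. f (arr h x))" using f h by (auto simp: abun_def)
  thus "in_span (fib l0) n (%i x. complex_of_real (w i x))
  (%x. compose (fib (\<psi> g l)) f (\<phi> (inv g)) (arr (acomp (act_arrow g l) h) x))"
  proof (rule in_span_cong[rotated])
  fix x assume x: "x:fib l0"
  show "f (arr h x)=compose (fib (\<psi> g l)) f (\<phi> (inv g)) (arr (acomp (act_arrow g l) h) x)" using env_fib[OF h(1)] x h x h phi_fib[OF g] phi_inv[OF g] by (simp add: compose_def, (simp add: fib_iff))
  qed
 qed (use h in \<open>auto simp: compose_extensional\<close>)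
qed

text \<open>Every continuous function on K is projected, fibre by fibre, to a continuous section of
  the bundle. The projection is the averaged one on the fibre over l0, transported along arrows, and
  it fixes what already is a transported w j.\<close>

lemma assoc_bundle_section:
 assumes w: "isys l0 n w" "indon (fib l0) n w" and l0: "l0:LL"
 obtains sec g where "!!u. cntR K u ==> cntR K (sec u)"
  "!!u v x. [|cntR K u; v:env; src v=l0; x:fib l0|]
  ==> sec u (arr v x)=(\<Sum>i<n. g (%x. u (arr v x)) i * w i x)"
  "!!u v x j. [|cntR K u; v:env; src v=l0; j < n; !!x. x:fib l0 ==> u (arr v x)=w j x; x:fib l0|]
  ==> sec u (arr v x)=w j x"
proof -
 interpret A: set_action "isotropy l0" "fib l0" arr by (rule set_action_isotropy[OF l0])
 have wc: "cntR (fsp l0) (w i)" if "i < n" for i using w(1) that by (simp add: isys_def)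
 have bound: "EX C. ALL i<n. ALL x:fib l0. abs (w i x)<=C"
 proof -
  have "EX C. ALL x:fib l0. abs (w i x)<=C" if "i < n" for i
  proof -
  have "compactin euclideanreal (w i ` fib l0)"
  using image_compactin[OF _ wc[OF that], of "fib l0"] compact_fib[OF l0] unfolding compact_space_def topspace_fib .
  hence "bounded (w i ` fib l0)" by (simp add: compact_imp_bounded)
  thus ?thesis by (auto simp: bounded_iff)
  qed
  then obtain C where C: "!!i x. [|i < n; x:fib l0|] ==> abs (w i x)<=C i" by metis
  have "abs (w i x)<=(\<Sum>i<n. abs (C i))" if "i < n" "x:fib l0" for i x
  proof -
  have "abs (C i)<=(\<Sum>i<n. abs (C i))" using that(1) by (intro member_le_sum) auto
  thus ?thesis using C[OF that] by linarith
  qed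
  thus ?thesis by blast
 qed
 then obtain C where C: "!!i x. [|i < n; x:fib l0|] ==> abs (w i x)<=C" by blast
 have "EX Y \<alpha>. finite Y & Y<=fib l0 & (ALL i<n. ALL j<n. (\<Sum>y\<in>Y. \<alpha> j y * w i y)=(if i=j then 1 else 0))"
  by (rule dual_evaluations) (use w(2) in \<open>auto simp: indon_def\<close>)
 then obtain Y \<alpha> where Y: "finite Y" "Y<=fib l0"
  "ALL i<n. ALL j<n. (\<Sum>y\<in>Y. \<alpha> j y * w i y)=(if i=j then 1 else 0)" by (elim exE conjE) (rule that)
 have wo: "A.orbit_ap (w i)" if "i < n" for i using orbit_ap_continuous[OF l0 wc[OF that]] .
 have winv: "EX d. ALL x:fib l0. w i (arr h x)=(\<Sum>j<n. d j * w j x)" if "h:carrier (isotropy l0)" "i < n" for h i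
  using w(1) that unfolding isys_def in_span_def by blast
 obtain g :: "('c => real) => nat => real" and B where g:
  "!!u s x. [|A.orbit_ap u; s:carrier (isotropy l0); x:fib l0|] ==>
  (\<Sum>i<n. g (%y. u (arr s y)) i * w i x)=(\<Sum>i<n. g u i * w i (arr s x))"
  "!!j x. [|j < n; x:fib l0|] ==> (\<Sum>i<n. g (w j) i * w i x)=w j x"
  "!!u u' e i. [|A.orbit_ap u; A.orbit_ap u'; !!x. x:fib l0 ==> abs (u x - u' x)<=e; e >= 0; i < n|]
  ==> abs (g u i - g u' i)<=B * e"
  by (rule A.equivariant_projection[OF wo C winv Y(1,2), where \<alpha> = \<alpha>]) (use Y(3) that in blast)+
 \<comment> \<open>The Lipschitz estimate with e = 0: the coordinates see only the values on the
   fibre, though g takes functions on the whole type.\<close>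
 have g_cong: "g u i=g u' i" if "A.orbit_ap u" "A.orbit_ap u'" "!!x. x:fib l0 ==> u x=u' x" "i < n" for u u' i
  using g(3)[OF that(1,2), of 0 i] that(3,4) by simp
 have pull: "cntR (fsp l0) (%x. u (arr v x))"
  if u: "cntR K u" and v: "v:env" "src v=l0" for u v
 proof -
  show ?thesis using arrowsD(4)[OF env_arrow[OF v(1)]] v(2) continuous_map_compose[OF _ u] by (auto simp: continuous_map_in_subtopology comp_def)
 qed
 have pull_ap: "A.orbit_ap (%x. u (arr v x))" if "cntR K u" "v:env" "src v=l0" for u v by (rule orbit_ap_continuous[OF l0 pull[OF that]])
 define ch where "ch y=(SOME v. v:env & src v=l0 & tgt v=q y)" for y
 have ch: "ch y:env & src (ch y)=l0 & tgt (ch y)=q y" if "y:KK" for y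
  unfolding ch_def by (rule someI_ex) (use env_transitive[OF l0 proj_closed[OF that]] in blast)
 \<comment> \<open>u is pulled back to the fibre over l0 along the chosen arrow, projected and
   transported back. Equivariance under the isotropy group makes the result independent of the
   choice, as the following fact expresses.\<close>
 define sec where "sec u y=(\<Sum>i<n. g (%x. u (arr (ch y) x)) i * w i (arr (ainv (ch y)) y))" for u y
 have sec: "sec u (arr v x)=(\<Sum>i<n. g (%x. u (arr v x)) i * w i x)"
  if u: "cntR K u" and v: "v:env" "src v=l0" and x: "x:fib l0" for u v x
 proof -
  define y where "y=arr v x"
  have y: "y:fib (tgt v)" unfolding y_def using env_fib[OF v(1)] v(2) x by simp
  hence yK: "y:KK" "q y=tgt v" by (auto simp: fib_iff)
  note c = ch[OF yK(1)]
  obtain h where h: "h:carrier (isotropy l0)" "!!x. x:fib l0 ==> arr v x=arr (ch y) (arr h x)"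
  by (rule isotropy_diff[OF v(1), of "ch y" l0]) (use c v yK that in auto)
  have hf: "arr h x:fib l0" by (rule A.act_closed[OF h(1) x])
  have "arr (ainv (ch y)) y=arr h x"
  proof -
  have "arr (ainv (ch y)) (arr (ch y) (arr h x))=arr h x" using arr_inv'[OF bij_env, of "ch y" "arr h x"] c hf by simp
  moreover have "arr (ch y) (arr h x)=y" using h(2)[OF x] by (simp add: y_def)
  ultimately show ?thesis by simp
  qed
  hence "sec u y=(\<Sum>i<n. g (%x. u (arr (ch y) x)) i * w i (arr h x))" by (simp add: sec_def)
  also have "... = (\<Sum>i<n. g (%z. u (arr (ch y) (arr h z))) i * w i x)" using g(1)[OF pull_ap[OF u, of "ch y"] h(1) x] c by simp
  also have "... = (\<Sum>i<n. g (%z. u (arr v z)) i * w i x)"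
  proof (rule sum.cong[OF refl])
  fix i assume "i:{..<n}"
  moreover have "A.orbit_ap (%z. u (arr (ch y) (arr h z)))"
  proof -
  have "A.orbit_ap (%z. u (arr (acomp (ch y) h) z))"
  using c h(1) comp_env[of "ch y" h] by (intro pull_ap[OF u]) (auto simp: isotropy_carrier)
  moreover have "cntR (fsp l0) (%z. u (arr (ch y) (arr h z)))"
  by (rule continuous_map_eq[OF pull[OF u v]]) (unfold topspace_fib, simp add: h(2))
  ultimately show ?thesis using orbit_ap_continuous[OF l0] by blast
  qed
  ultimately have "g (%z. u (arr (ch y) (arr h z))) i=g (%z. u (arr v z)) i" using h(2) by (intro g_cong pull_ap[OF u v]) auto
  thus "g (%z. u (arr (ch y) (arr h z))) i * w i x=g (%z. u (arr v z)) i * w i x" by simp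
  qed
  finally show ?thesis unfolding y_def .
 qed
 \<comment> \<open>After composition with the evaluation quotient the section is a finite sum of
   coefficients, depending on the arrow, times the functions w i, depending on the point.\<close>
 have cont: "cntR K (sec u)" if u: "cntR K u" for u
 proof (rule continuous_compose_quotient_map[OF evaluation_quotient[OF l0]])
  let ?P = "prod_topology (out_space l0) (fsp l0)"
  have top: "topspace ?P = out l0 \<times> fib l0" unfolding topspace_prod_topology topspace_out_space topspace_fib ..
  have uev: "cntR ?P (%z. u (arr (fst z) (snd z)))"
  using continuous_map_compose[OF continuous_evaluation u] by (simp add: comp_def case_prod_unfold)
  \<comment> \<open>By the tube lemma the pullbacks of u along nearby arrows are uniformly close on
    the fibre, and the coordinates are Lipschitz in the uniform norm.\<close>
  have coeff: "cntR (out_space l0) (%v. g (%x. u (arr v x)) i)" if i: "i < n" for i unfolding cont_metric topspace_out_space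
  proof (intro ballI allI impI)
  fix v0 and e :: real assume v0: "v0:out l0" and e: "e > 0"
  \<comment> \<open>The absolute value and the summand 1 cover an arbitrary sign of B.\<close>
  define d where "d=e / (2 * (abs (B) + 1))"
  have d: "d > 0" "B * d < e"
  proof -
  show "d > 0" using e by (simp add: d_def)
  have "B * d<=(abs (B) + 1) * d" using \<open>d > 0\<close> by (intro mult_right_mono) auto
  also have "... = e / 2" by (simp add: d_def field_simps)
  finally show "B * d < e" using e by simp
  qed
  have v0': "v0:env" "src v0=l0" using v0 by (auto simp: out_def)
  have "cntR ?P (%z. u (arr v0 (snd z)))"
  using continuous_map_compose[OF continuous_map_snd pull[OF u v0'], of "out_space l0"] by (simp add: comp_def)
  hence "cntR ?P (%z. u (arr (fst z) (snd z)) - u (arr v0 (snd z)))" using uev by (intro continuous_map_diff)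
  hence W: "openin ?P {z:topspace ?P. dist (u (arr (fst z) (snd z)) - u (arr v0 (snd z))) 0 < d}" by (rule openin_dist_less)
  have sub: "{v0} \<times> fib l0<={z:topspace ?P. dist (u (arr (fst z) (snd z)) - u (arr v0 (snd z))) 0 < d}"
  unfolding top using v0 d by auto
  have cf: "compactin (fsp l0) (fib l0)" using compact_fib[OF l0] unfolding compact_space_def topspace_fib .
  obtain N M where NM: "openin (out_space l0) N" "v0:N" "fib l0<=M"
  "N \<times> M<={z:topspace ?P. dist (u (arr (fst z) (snd z)) - u (arr v0 (snd z))) 0 < d}"
  using tube_lemma_right[OF W cf _ sub] v0 unfolding topspace_out_space by blast
  show "EX U. openin (out_space l0) U & v0:U & (ALL v:U. dist (g (%x. u (arr v0 x)) i) (g (%x. u (arr v x)) i) < e)"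
  proof (intro exI[of _ N] conjI ballI NM)
  fix v assume v: "v:N"
  have v': "v:env" "src v=l0" using openin_subset[OF NM(1)] v topspace_out_space by (auto simp: out_def)
  have "abs (u (arr v0 x) - u (arr v x))<=d" if x: "x:fib l0" for x using v NM(3) x NM(4) by (force simp: abs_minus_commute)
  hence "abs (g (%x. u (arr v0 x)) i - g (%x. u (arr v x)) i)<=B * d" using d(1) i by (intro g(3) pull_ap[OF u] v0' v') auto
  thus "dist (g (%x. u (arr v0 x)) i) (g (%x. u (arr v x)) i) < e" using d(2) by (simp add: dist_real_def)
  qed
  qed
  have c1: "cntR ?P (%z. g (%x. u (arr (fst z) x)) i)" if "i < n" for i
  using continuous_map_compose[OF continuous_map_fst coeff[OF that], of "fsp l0"] by (simp add: comp_def)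
  have c2: "cntR ?P (%z. w i (snd z))" if "i < n" for i
  using continuous_map_compose[OF continuous_map_snd wc[OF that], of "out_space l0"] by (simp add: comp_def)
  have "cntR ?P (%z. \<Sum>i<n. g (%x. u (arr (fst z) x)) i * w i (snd z))"
  by (intro continuous_map_sum continuous_map_real_mult c1 c2) auto
  thus "cntR ?P (sec u \<circ> (%(t, x). arr t x))"
  proof (rule continuous_map_eq)
  fix z assume "z:topspace ?P"
  then obtain v x where z: "z=(v, x)" "v:env" "src v=l0" "x:fib l0" unfolding top by (auto simp: out_def)
  thus "(\<Sum>i<n. g (%x. u (arr (fst z) x)) i * w i (snd z))=(sec u \<circ> (%(t, x). arr t x)) z" using sec[OF u z(2-4)] by simp
  qed
 qed
 show thesis
 proof (rule that[of sec g])
  show "cntR K (sec u)" if "cntR K u" for u by (rule cont[OF that])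
  show "sec u (arr v x)=(\<Sum>i<n. g (%x. u (arr v x)) i * w i x)"
  if "cntR K u" "v:env" "src v=l0" "x:fib l0" for u v x by (rule sec[OF that])
  fix u v x j assume u: "cntR K u" and v: "v:env" "src v=l0" and j: "j < n"
  and eq: "!!x. x:fib l0 ==> u (arr v x)=w j x" and x: "x:fib l0"
  have "sec u (arr v x)=(\<Sum>i<n. g (%x. u (arr v x)) i * w i x)" by (rule sec[OF u v x])
  also have "... = (\<Sum>i<n. g (w j) i * w i x)" using eq g_cong[OF pull_ap[OF u v] wo[OF j]] by (intro sum.cong) auto
  also have "... = w j x" by (rule g(2)[OF j x])
  finally show "sec u (arr v x)=w j x" .
 qed
qed

text \<open>The frame consists of projections of functions on K, hence of sections that are defined
  over all of L and remain independent near l1. A count of dimensions shows that they span.\<close>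

lemma assoc_bundle_frames:
 assumes w: "isys l0 n w" "indon (fib l0) n w" and l0: "l0:LL" and l1: "l1:LL"
 obtains U s where "openin L U" "l1:U" "frame_on (abun l0 n w) U n s"
  "!!i l. [|i < n; l:LL|] ==> restrict (s i) (fib l):abun l0 n w l"
proof (rule assoc_bundle_section[OF w l0], goal_cases)
 case (1 sec g)
 note that = 1(1) and sec = 1(2-4)
 let ?w = "%i x. complex_of_real (w i x)"
 obtain h1 where h1: "h1:env" "src h1=l0" "tgt h1=l1" using env_transitive[OF l0 l1] by blast
 \<comment> \<open>w i is transported to the fibre over l1 along h1 and extended to K by Tietze.
   Projecting the extension does not change it over l1.\<close>
 have "EX u. cntR K u & (ALL x:fib l0. u (arr h1 x)=w i x)" if i: "i < n" for i
 proof -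
  have "continuous_map (fsp l1) (fsp l0) (arr (ainv h1))" using arrowsD(4)[OF env_arrow[OF inv_env[OF h1(1)]]] h1 by simp
  moreover have "cntR (fsp l0) (w i)" using w(1) i by (simp add: isys_def)
  ultimately have "cntR (fsp l1) (w i \<circ> arr (ainv h1))" by (rule continuous_map_compose)
  then obtain u where u: "cntR K u" "!!x. x:fib l1 ==> u x=(w i \<circ> arr (ainv h1)) x" using continuous_extension[OF l1] by blast
  have "u (arr h1 x)=w i x" if "x:fib l0" for x
  using u(2)[of "arr h1 x"] env_fib[OF h1(1), of x] arr_inv'[OF bij_env[OF h1(1)], of x] h1 that by simp
  thus ?thesis using u(1) by blast
 qed
 then obtain u where u: "!!i. i < n ==> cntR K (u i)"
  "!!i x. [|i < n; x:fib l0|] ==> u i (arr h1 x)=w i x" by metis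
 define s where "s i y=complex_of_real (sec (u i) y)" for i y
 have sc: "cont (s i)" if "i < n" for i unfolding s_def by (intro continuous_map_complex_of_real sec(1) u(1) that)
 have span: "in_span (fib l0) n ?w (%x. s i (arr h x))" if "i < n" "h:env" "src h=l0" for i h
 proof -
  show ?thesis using in_span_def sec(2)[OF u(1)[OF that(1)] that(2,3)] s_def by force
 qed
 have ind1: "indep n s l1" unfolding indep_def comb_def
 proof (intro allI impI)
  fix c i assume c: "ALL y:fib l1. (\<Sum>i<n. c i * s i y)=0" and i: "i < n"
  have "(\<Sum>i<n. c i * ?w i x)=0" if x: "x:fib l0" for x
  proof -
  have "(\<Sum>i<n. c i * s i (arr h1 x))=0" using env_fib[OF h1(1)] x h1 c by blast
  moreover have "s i (arr h1 x)=?w i x" if "i < n" for i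
  unfolding s_def using sec(3)[OF u(1)[OF that] h1(1,2) that u(2)[OF that] x] by simp
  ultimately show ?thesis by simp
  qed
  thus "c i=0" using independent_on_complex[OF w(2)] i unfolding indon_def by blast
 qed
 obtain U where U: "openin L U" "l1:U" "!!l. l:U ==> indep n s l" by (rule indep_nearby[of n s l1, OF sc l1 ind1]) (use that in auto)
 have mem: "restrict (comb n s c) (fib l):abun l0 n w l" if l: "l:LL" for c l
 proof -
  obtain h where h: "h:env" "src h=l0" "tgt h=l" using env_transitive[OF l0 l] by blast
  show ?thesis
  proof (rule assoc_bundleI[OF w(1) h])
  have "in_span (fib l0) n ?w (%x. \<Sum>i<n. c i * s i (arr h x))" using span h by (intro in_span_sum in_span_cmult) auto
  thus "in_span (fib l0) n ?w (%x. restrict (comb n s c) (fib l) (arr h x))"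
  using env_fib[OF h(1)] h by (elim in_span_cong[rotated]) (simp add: comb_def)
  qed auto
 qed
 have fr: "abun l0 n w l={restrict (comb n s c) (fib l) | c. True}" if l: "l:U" for l
 proof (intro equalityI subsetI)
  have lL: "l:LL" using l U(1) openin_subset by blast
  fix f assume f: "f:abun l0 n w l"
  obtain h where h: "h:env" "src h=l0" "tgt h=l" using env_transitive[OF l0 lL] by blast
  let ?s = "%i x. s i (arr h x)"
  have "indon (fib l0) n ?s" unfolding indon_def
  proof (intro allI impI)
  fix c i assume c: "ALL x:fib l0. (\<Sum>i<n. c i * ?s i x)=0" and i: "i < n"
  have "comb n s c y=0" if "y:fib l" for y
  proof -
  show ?thesis using bij_env[OF h(1)] h that c by (force simp: bij_betw_def comb_def)
  qed
  thus "c i=0" using U(3)[OF l] i unfolding indep_def by blast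
  qed
  \<comment> \<open>Pulled back to the fibre over l0, the n sections are independent and lie in the
    span of the n functions w, so they generate it.\<close>
  hence "in_span (fib l0) n ?s (?w k)" if "k < n" for k using that span h by (intro independent_full_rank_spans[of n "fib l0" ?w ?s]) auto
  moreover have "in_span (fib l0) n ?w (%x. f (arr h x))" using f h by (auto simp: abun_def)
  ultimately have "in_span (fib l0) n ?s (%x. f (arr h x))" using in_span_trans by blast
  then obtain c where c: "!!x. x:fib l0 ==> f (arr h x)=(\<Sum>i<n. c i * s i (arr h x))" unfolding in_span_def by blast
  have "f=restrict (comb n s c) (fib l)"
  proof
  fix y
  show "f y=restrict (comb n s c) (fib l) y"
  proof (cases "y:fib l")
  case True
  thus ?thesis using bij_env[OF h(1)] h c True by (force simp: bij_betw_def comb_def)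
  next
  case False
  thus ?thesis using f by (simp add: abun_def extensional_def)
  qed
  qed
  thus "f:{restrict (comb n s c) (fib l) | c. True}" by blast
 next
  fix f assume "f:{restrict (comb n s c) (fib l) | c. True}"
  thus "f:abun l0 n w l" using mem l U(1) openin_subset by blast
 qed
 show thesis
 proof (rule that[OF U(1,2)])
  show "frame_on (abun l0 n w) U n s" unfolding frame_on_def using sc fr U(3) by blast
  fix i l assume i: "i < n" and l: "l:LL"
  have "comb n s (%j. if j=i then 1 else 0)=s i" unfolding comb_def using i by (simp add: if_distrib[of "%t. t * _"] cong: if_cong)
  thus "restrict (s i) (fib l):abun l0 n w l" using mem[OF l, of "%j. if j=i then 1 else 0"] by simp
 qed
qed

end

section \<open>Function spaces as modules\<close>

declare mspace_cfunspace [simp del]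

lemma mspace_CX:
 "compact_space X ==> f:mspace (CX X) \<longleftrightarrow> f:extensional (topspace X) & cnt X f"
 using compactin_mspace_cfunspace[of X "euclidean_metric :: complex metric"] by (auto simp: compact_space_def)

lemma restrict_CX:
 assumes "compact_space X" "cnt X f"
 shows "restrict f (topspace X):mspace (CX X)" using assms by (auto simp: mspace_CX intro: continuous_map_eq[OF assms(2)])

lemma mdist_CX_le:
 assumes "f:mspace (CX X)" "g:mspace (CX X)" "topspace X ~= {}"
 shows "mdist (CX X) f g<=a \<longleftrightarrow> (ALL x:topspace X. cmod (f x - g x)<=a)"
 using cfunspace_mdist_le[OF assms] by (simp add: dist_norm)

lemma zero_CX: "compact_space X ==> (\<lambda>x\<in>topspace X. 0):mspace (CX X)" by (rule restrict_CX) auto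

lemma sup_norm_le:
 assumes "compact_space X" "f:mspace (CX X)" "topspace X ~= {}"
 shows "sup_norm X f<=a \<longleftrightarrow> (ALL x:topspace X. cmod (f x)<=a)"
 unfolding sup_norm_def using mdist_CX_le[OF assms(2) zero_CX[OF assms(1)] assms(3), of a] by simp

lemma closure_CX:
 assumes "topspace X ~= {}"
 shows "f:mtopology_of (CX X) closure_of A \<longleftrightarrow> f:mspace (CX X) &
  (ALL e>0. EX g:A Int mspace (CX X). ALL x:topspace X. cmod (f x - g x)<=e)"
proof -
 interpret C: Metric_space "mspace (CX X)" "mdist (CX X)" by (rule Metric_space_mspace_mdist)
 have "f:mtopology_of (CX X) closure_of A \<longleftrightarrow>
  f:mspace (CX X) & (ALL e>0. EX g:A Int mspace (CX X). mdist (CX X) f g < e)"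
  unfolding mtopology_of_def C.metric_closure_of mem_Collect_eq C.in_mball by blast
 also have "... \<longleftrightarrow> f:mspace (CX X) & (ALL e>0. EX g:A Int mspace (CX X). mdist (CX X) f g<=e)"
 proof (intro conj_cong refl iffI allI impI)
  fix e :: real assume h: "ALL e>0. EX g:A Int mspace (CX X). mdist (CX X) f g < e" and e: "e > 0"
  thus "EX g:A Int mspace (CX X). mdist (CX X) f g<=e" using less_imp_le by blast
 next
  fix e :: real assume h: "ALL e>0. EX g:A Int mspace (CX X). mdist (CX X) f g<=e" and e: "e > 0"
  then obtain g where "g:A Int mspace (CX X)" "mdist (CX X) f g<=e / 2" using half_gt_zero by blast
  thus "EX g:A Int mspace (CX X). mdist (CX X) f g < e" using e by (intro bexI[of _ g]) auto
 qed
 also have "... \<longleftrightarrow> f:mspace (CX X) & (ALL e>0. EX g:A Int mspace (CX X). ALL x:topspace X. cmod (f x - g x)<=e)"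
  using mdist_CX_le[OF _ _ assms, of f] by (metis IntD2)
 finally show ?thesis .
qed

lemma dense_CX:
 assumes "topspace X ~= {}"
 shows "mtopology_of (CX X) closure_of A=mspace (CX X) \<longleftrightarrow>
  (ALL f:mspace (CX X). ALL e>0. EX g:A Int mspace (CX X). ALL x:topspace X. cmod (f x - g x)<=e)"
 unfolding set_eq_iff closure_CX[OF assms] by blast

lemma closedin_CX:
 assumes "topspace X ~= {}" "A<=mspace (CX X)"
 shows "closedin (mtopology_of (CX X)) A \<longleftrightarrow>
  (ALL f:mspace (CX X). (ALL e>0. EX g:A. ALL x:topspace X. cmod (f x - g x)<=e) --> f:A)"
proof -
 have "closedin (mtopology_of (CX X)) A \<longleftrightarrow> mtopology_of (CX X) closure_of A<=A"
  using closure_of_subset_eq[of A "mtopology_of (CX X)"] assms(2) by simp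
 thus ?thesis unfolding subset_iff closure_CX[OF assms(1)] Int_absorb2[OF assms(2)] by blast
qed

text \<open>Submodules are required to contain the inverses of \<open>add_monoid M\<close>, and
  these are given by a definite description; therefore uniqueness of the inverse is among the
  premises.\<close>

lemma submodule_negI:
 fixes M (structure)
 assumes "H<=carrier M" "\<zero>:H" "!!a b. [|a:H; b:H|] ==> a \<oplus> b:H"
  "!!r a. [|r:carrier R; a:H|] ==> r \<odot> a:H"
  and neg: "!!a. a:H ==> neg a:H" "!!a. a:H ==> a \<oplus> neg a=\<zero>" "!!a. a:H ==> neg a \<oplus> a=\<zero>"
  and uniq: "!!a b. [|a:H; b:carrier M; a \<oplus> b=\<zero>|] ==> b=neg a"
 shows "submodule H R M"
proof
 fix x assume x: "x:H"
 have "inv\<^bsub>add_monoid M\<^esub> x=neg x" unfolding m_inv_def using assms(1) neg x uniq by (intro the_equality) auto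
 thus "inv\<^bsub>add_monoid M\<^esub> x:H" using neg(1)[OF x] by simp
qed (use assms in auto)

lemma complex_field_sel [simp]: "carrier complex_field=UNIV" "\<zero>\<^bsub>complex_field\<^esub> = 0"
 "a \<otimes>\<^bsub>complex_field\<^esub> b=a * b" "a \<oplus>\<^bsub>complex_field\<^esub> b=a + b" by (simp_all add: complex_field_def)

lemma cfun_ring_sel [simp]: "carrier (cfun_ring X)=mspace (CX X)" "\<zero>\<^bsub>cfun_ring X\<^esub> = (\<lambda>x\<in>topspace X. 0)"
 "f \<otimes>\<^bsub>cfun_ring X\<^esub> g=(\<lambda>x\<in>topspace X. f x * g x)" "f \<oplus>\<^bsub>cfun_ring X\<^esub> g=(\<lambda>x\<in>topspace X. f x + g x)"
 by (simp_all add: cfun_ring_def)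

lemma cfun_vec_sel [simp]: "carrier (cfun_vec X)=mspace (CX X)" "\<zero>\<^bsub>cfun_vec X\<^esub> = (\<lambda>x\<in>topspace X. 0)"
 "f \<oplus>\<^bsub>cfun_vec X\<^esub> g=(\<lambda>x\<in>topspace X. f x + g x)" "c \<odot>\<^bsub>cfun_vec X\<^esub> f=(\<lambda>x\<in>topspace X. c * f x)"
 by (simp_all add: cfun_vec_def cfun_ring_def ring.defs module.defs)

lemma cfun_module_sel [simp]: "carrier (cfun_module X q)=mspace (CX X)" "\<zero>\<^bsub>cfun_module X q\<^esub> = (\<lambda>x\<in>topspace X. 0)"
 "f \<oplus>\<^bsub>cfun_module X q\<^esub> g=(\<lambda>x\<in>topspace X. f x + g x)" "h \<odot>\<^bsub>cfun_module X q\<^esub> f=(\<lambda>x\<in>topspace X. h (q x) * f x)"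
 by (simp_all add: cfun_module_def cfun_ring_def ring.defs module.defs)

lemma carrier_update_sel [simp]: "\<zero>\<^bsub>M\<lparr>carrier := V\<rparr>\<^esub> = \<zero>\<^bsub>M\<^esub>" "f \<oplus>\<^bsub>M\<lparr>carrier := V\<rparr>\<^esub> g=f \<oplus>\<^bsub>M\<^esub> g"
 "c \<odot>\<^bsub>M\<lparr>carrier := V\<rparr>\<^esub> f=c \<odot>\<^bsub>M\<^esub> f" by simp_all

lemma free_module_sel [simp]: "carrier (free_module R I)={c:I \<rightarrow>\<^sub>E carrier R. finite {i:I. c i ~= \<zero>\<^bsub>R\<^esub>}}"
 "\<zero>\<^bsub>free_module R I\<^esub> = (\<lambda>i\<in>I. \<zero>\<^bsub>R\<^esub>)" "c \<oplus>\<^bsub>free_module R I\<^esub> d=(\<lambda>i\<in>I. c i \<oplus>\<^bsub>R\<^esub> d i)"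
 "r \<odot>\<^bsub>free_module R I\<^esub> c=(\<lambda>i\<in>I. r \<otimes>\<^bsub>R\<^esub> c i)" by (simp_all add: free_module_def)

lemma submodule_functionsI:
 fixes M (structure) and X :: "'a topology"
 assumes M: "H<=carrier M" "carrier M<=extensional (topspace X)" "\<zero> = (\<lambda>x\<in>topspace X. 0 :: complex)"
  "!!f g. f \<oplus> g=(\<lambda>x\<in>topspace X. f x + g x)"
  and H: "(\<lambda>x\<in>topspace X. 0):H" "!!f g. [|f:H; g:H|] ==> (\<lambda>x\<in>topspace X. f x + g x):H"
  "!!r f. [|r:carrier R; f:H|] ==> r \<odot> f:H" "!!f. f:H ==> (\<lambda>x\<in>topspace X. - f x):H"
 shows "submodule H R M"
proof (rule submodule_negI[where neg = "%f. \<lambda>x\<in>topspace X. - f x"])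
 fix f g assume fg: "f:H" "g:carrier M" "f \<oplus> g=\<zero>"
 have "f x + g x=0" if "x:topspace X" for x using fun_cong[OF fg(3)[unfolded M(3,4)], of x] that by simp
 thus "g=(\<lambda>x\<in>topspace X. - f x)" using M(2) fg(2) by (intro extensionalityI[of _ "topspace X"]) (auto simp: add_eq_0_iff)
qed (use M H in auto)

lemma submodule_closed:
 assumes "submodule H R M"
 shows "H<=carrier M" "\<zero>\<^bsub>M\<^esub>:H" "[|f:H; g:H|] ==> f \<oplus>\<^bsub>M\<^esub> g:H" "[|r:carrier R; f:H|] ==> r \<odot>\<^bsub>M\<^esub> f:H"
proof -
 interpret submodule H R M by fact
 show "H<=carrier M" "\<zero>\<^bsub>M\<^esub>:H" "[|f:H; g:H|] ==> f \<oplus>\<^bsub>M\<^esub> g:H" "[|r:carrier R; f:H|] ==> r \<odot>\<^bsub>M\<^esub> f:H"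
  using subset one_closed m_closed smult_closed by auto
qed

lemma module_iso_trans:
 assumes "module_iso R M N h" "module_iso R N P k"
 shows "module_iso R M P (k \<circ> h)"
proof -
 have "h x:carrier N" if "x:carrier M" for x using assms(1) that by (auto simp: module_iso_def bij_betw_def)
 thus ?thesis using assms unfolding module_iso_def by (auto intro: bij_betw_trans)
qed

text \<open>M is merely a record, so closure of its carrier under the operations has to be assumed
  for the inverse map to be additive and homogeneous.\<close>

lemma module_iso_sym:
 assumes h: "module_iso R M N h"
  and M: "!!x y. [|x:carrier M; y:carrier M|] ==> x \<oplus>\<^bsub>M\<^esub> y:carrier M"
  "!!r x. [|r:carrier R; x:carrier M|] ==> r \<odot>\<^bsub>M\<^esub> x:carrier M"
 shows "module_iso R N M (inv_into (carrier M) h)"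
proof -
 let ?k = "inv_into (carrier M) h"
 have bij: "bij_betw h (carrier M) (carrier N)" using h by (simp add: module_iso_def)
 have k: "?k (h x)=x" if "x:carrier M" for x using bij that by (simp add: bij_betw_inv_into_left)
 have img: "EX x:carrier M. u=h x" if "u:carrier N" for u using bij that by (auto simp: bij_betw_def)
 show ?thesis unfolding module_iso_def
 proof (intro conjI ballI)
  show "bij_betw ?k (carrier N) (carrier M)" using bij by (rule bij_betw_inv_into)
  fix u assume "u:carrier N"
  then obtain x where x: "x:carrier M" "u=h x" using img by blast
  { fix v assume "v:carrier N"
  then obtain y where y: "y:carrier M" "v=h y" using img by blast
  have "u \<oplus>\<^bsub>N\<^esub> v=h (x \<oplus>\<^bsub>M\<^esub> y)" using h x y by (simp add: module_iso_def)
  thus "?k (u \<oplus>\<^bsub>N\<^esub> v)=?k u \<oplus>\<^bsub>M\<^esub> ?k v" using k M(1) x y by simp }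
  fix r assume r: "r:carrier R"
  have "r \<odot>\<^bsub>N\<^esub> u=h (r \<odot>\<^bsub>M\<^esub> x)" using h x r by (simp add: module_iso_def)
  thus "?k (r \<odot>\<^bsub>N\<^esub> u)=r \<odot>\<^bsub>M\<^esub> ?k u" using k M(2) x r by simp
 qed
qed

section \<open>Frames and locally trivial bundles\<close>

context open_fibration
begin

lemma mspace_fib:
 "l:LL ==> f:Cf l \<longleftrightarrow> f:extensional (fib l) & cnt (fsp l) f" using mspace_CX[OF compact_fib] unfolding topspace_fib .

lemma mspace_total: "f:CK \<longleftrightarrow> f:extensional (KK) & cont f" by (rule mspace_CX[OF compact_total])

lemma mspace_base: "f:CL \<longleftrightarrow> f:extensional (LL) & cnt L f" by (rule mspace_CX[OF compact_base])

lemma restrict_fib: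
 assumes "l:LL" "cont f"
 shows "restrict f (fib l):Cf l"
 using restrict_CX[OF compact_fib[OF assms(1)] continuous_map_from_subtopology[OF assms(2)]] unfolding topspace_fib .

lemma mdist_fib_le:
 assumes "l:LL" "f:Cf l" "g:Cf l"
 shows "mdist (CX (fsp l)) f g<=a \<longleftrightarrow> (ALL x:fib l. cmod (f x - g x)<=a)"
 using mdist_CX_le[OF assms(2,3)] fib_nonempty[OF assms(1)] unfolding topspace_fib by blast

lemma sup_norm_fib_le:
 assumes "l:LL" "f:Cf l"
 shows "sup_norm (fsp l) f<=a \<longleftrightarrow> (ALL x:fib l. cmod (f x)<=a)"
 using sup_norm_le[OF compact_fib[OF assms(1)] assms(2)] fib_nonempty[OF assms(1)] unfolding topspace_fib by blast

lemma extension_fib: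
 assumes "l:LL" "f:Cf l"
 obtains g where "cont g" "!!x. x:fib l ==> g x=f x"
 using Tietze_complex[OF normal_total closedin_fib[OF assms(1)], of f] assms by (auto simp: mspace_fib)

lemma bounded_sections:
 fixes n :: nat
 assumes "!!i. i < n ==> cont (s i :: 'k => complex)"
 shows "EX B>=0. ALL i<n. ALL x:KK. cmod (s i x)<=B"
proof -
 have "EX B. ALL x:KK. cmod (s i x)<=B" if "i < n" for i
 proof -
  have "compactin euclidean (s i ` KK)" using image_compactin[OF _ assms[OF that]] compact_total unfolding compact_space_def by blast
  hence "bounded (s i ` KK)" by (simp add: compact_imp_bounded)
  thus ?thesis by (auto simp: bounded_iff)
 qed
 then obtain B where B: "!!i x. [|i < n; x:KK|] ==> cmod (s i x)<=B i" by metis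
 have "cmod (s i x)<=(\<Sum>i<n. abs (B i))" if "i < n" "x:KK" for i x
 proof -
  have "abs (B i)<=(\<Sum>i<n. abs (B i))" using that(1) by (intro member_le_sum) auto
  thus ?thesis using B[OF that] by linarith
 qed
 thus ?thesis by (intro exI[of _ "\<Sum>i<n. abs (B i)"]) (auto intro: sum_nonneg)
qed

lemma comb_bound:
 assumes "!!i. i < n ==> cmod (s i x)<=B"
 shows "cmod (comb n s c x)<=(\<Sum>i<n. cmod (c i)) * B" unfolding comb_def sum_distrib_right
 by (rule sum_norm_le) (use assms in \<open>auto simp: norm_mult intro!: mult_left_mono\<close>)

lemma comb_add: "comb n s (%i. c i + d i) x=comb n s c x + comb n s d x" by (simp add: comb_def sum.distrib distrib_right)

lemma comb_diff: "comb n s (%i. c i - d i) x=comb n s c x - comb n s d x" by (simp add: comb_def sum_subtractf left_diff_distrib)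

lemma comb_scale: "comb n s (%i. r * c i) x=r * comb n s c x" by (simp add: comb_def sum_distrib_left mult.assoc)

lemma comb_cong: "(!!i. i < n ==> c i=d i) ==> comb n s c=comb n s d" by (simp add: comb_def fun_eq_iff)

text \<open>Restricted to the index set so that the values are elements of
  \<open>free_module\<close> and of the product topology. By independence the choice is unique
  there.\<close>

definition coeffs :: "nat => (nat => 'k => complex) => 'l => ('k => complex) => nat => complex" where
 "coeffs n s l f=restrict (SOME c. f=restrict (comb n s c) (fib l)) {..<n}"

lemma comb_coeffs:
 assumes "frame_on F U n s" "l:U" "f:F l"
 shows "restrict (comb n s (coeffs n s l f)) (fib l)=f"
proof -
 have "EX c. f=restrict (comb n s c) (fib l)" using assms by (auto simp: frame_on_def)
 hence f: "f=restrict (comb n s (SOME c. f=restrict (comb n s c) (fib l))) (fib l)" by (rule someI_ex)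
 have "comb n s (coeffs n s l f)=comb n s (SOME c. f=restrict (comb n s c) (fib l))" by (rule comb_cong) (simp add: coeffs_def)
 thus ?thesis using f by simp
qed

lemma indep_unique:
 assumes "indep n s l" "!!x. x:fib l ==> comb n s c x=comb n s d x" "i < n"
 shows "c i=d i"
proof -
 have "ALL x:fib l. comb n s (%i. c i - d i) x=0" using assms(2) by (simp add: comb_diff)
 hence "c i - d i=0" using assms(1,3) unfolding indep_def by blast
 thus ?thesis by simp
qed

lemma coeffs_comb:
 assumes "indep n s l"
 shows "coeffs n s l (restrict (comb n s c) (fib l))=restrict c {..<n}"
proof -
 define d where "d=(SOME d. restrict (comb n s c) (fib l)=restrict (comb n s d) (fib l))"
 have eq: "restrict (comb n s c) (fib l)=restrict (comb n s d) (fib l)"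
  unfolding d_def by (rule someI[where P = "%d. restrict (comb n s c) (fib l)=restrict (comb n s d) (fib l)", OF refl])
 have "comb n s c x=comb n s d x" if "x:fib l" for x using fun_cong[OF eq, of x] that by simp
 hence "c i=d i" if "i < n" for i using indep_unique[OF assms _ that] by blast
 thus ?thesis unfolding coeffs_def d_def[symmetric] by (intro restrict_ext) auto
qed

lemma coeffs_eqI:
 assumes "indep n s l" "f=restrict (comb n s c) (fib l)" "i < n"
 shows "coeffs n s l f i=c i" using coeffs_comb[OF assms(1), of c] assms(2,3) by simp

lemma frame_mspace:
 assumes "frame_on F U n s" "l:U" "l:LL"
 shows "F l<=Cf l"
proof -
 have "cont (comb n s c)" for c using assms(1) by (intro continuous_comb) (simp add: frame_on_def)
 thus ?thesis using assms restrict_fib[OF assms(3)] by (auto simp: frame_on_def)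
qed

lemma frame_iso:
 assumes fr: "frame_on F U n s" and l: "l:U"
 shows "module_iso complex_field (cfun_vec (fsp l)\<lparr>carrier := F l\<rparr>) (free_module complex_field {..<n}) (coeffs n s l)"
proof -
 have ind: "indep n s l" and Fl: "F l={restrict (comb n s c) (fib l) | c. True}" using fr l by (auto simp: frame_on_def)
 note sel = cfun_vec_sel[of "fsp l", unfolded topspace_fib]
 have "bij_betw (coeffs n s l) (F l) ({..<n} \<rightarrow>\<^sub>E UNIV)"
 proof (rule bij_betw_byWitness[where f' = "%c. restrict (comb n s c) (fib l)"])
  show "ALL f:F l. restrict (comb n s (coeffs n s l f)) (fib l)=f" using comb_coeffs[OF fr l] by blast
  show "ALL c:{..<n} \<rightarrow>\<^sub>E UNIV. coeffs n s l (restrict (comb n s c) (fib l))=c"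
  using coeffs_comb[OF ind] by (auto simp: PiE_restrict)
  show "coeffs n s l ` F l<={..<n} \<rightarrow>\<^sub>E UNIV" by (simp add: image_subset_iff coeffs_def restrict_PiE_iff)
  show "(%c. restrict (comb n s c) (fib l)) ` ({..<n} \<rightarrow>\<^sub>E UNIV)<=F l" using Fl by blast
 qed
 moreover have "coeffs n s l (\<lambda>x\<in>fib l. f x + g x)=(\<lambda>i\<in>{..<n}. coeffs n s l f i + coeffs n s l g i)"
  if "f:F l" "g:F l" for f g
 proof -
  obtain c d where cd: "f=restrict (comb n s c) (fib l)" "g=restrict (comb n s d) (fib l)" using Fl \<open>f \<in> F l\<close> \<open>g \<in> F l\<close> by blast
  have eq: "(\<lambda>x\<in>fib l. f x + g x)=restrict (comb n s (%i. c i + d i)) (fib l)" unfolding cd by (intro restrict_ext) (simp add: comb_add)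
  thus ?thesis unfolding eq unfolding cd coeffs_comb[OF ind] by (intro restrict_ext) simp
 qed
 moreover have "coeffs n s l (\<lambda>x\<in>fib l. r * f x)=(\<lambda>i\<in>{..<n}. r * coeffs n s l f i)" if "f:F l" for f r
 proof -
  obtain c where c: "f=restrict (comb n s c) (fib l)" using Fl \<open>f \<in> F l\<close> by blast
  have eq: "(\<lambda>x\<in>fib l. r * f x)=restrict (comb n s (%i. r * c i)) (fib l)" unfolding c by (intro restrict_ext) (simp add: comb_scale)
  thus ?thesis unfolding eq unfolding c coeffs_comb[OF ind] by (intro restrict_ext) simp
 qed
 ultimately show ?thesis unfolding module_iso_def by (simp add: sel del: cfun_vec_sel)
qed

lemma frame_closed_under:
 assumes fr: "frame_on F U n s" and l: "l:U"
 shows "(\<lambda>x\<in>fib l. 0):F l" "[|f:F l; g:F l|] ==> (\<lambda>x\<in>fib l. f x + g x):F l" "f:F l ==> (\<lambda>x\<in>fib l. r * f x):F l"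
proof -
 have Fl: "F l={restrict (comb n s c) (fib l) | c. True}" using fr l by (auto simp: frame_on_def)
 have "(\<lambda>x\<in>fib l. 0)=restrict (comb n s (%_. 0)) (fib l)" by (intro restrict_ext) (simp add: comb_def)
 thus "(\<lambda>x\<in>fib l. 0):F l" using Fl by blast
 show "(\<lambda>x\<in>fib l. f x + g x):F l" if fg: "f:F l" "g:F l"
 proof -
  obtain c d where cd: "f=restrict (comb n s c) (fib l)" "g=restrict (comb n s d) (fib l)" using Fl fg by blast
  have "(\<lambda>x\<in>fib l. f x + g x)=restrict (comb n s (%i. c i + d i)) (fib l)" unfolding cd by (intro restrict_ext) (simp add: comb_add)
  thus ?thesis using Fl by blast
 qed
 show "(\<lambda>x\<in>fib l. r * f x):F l" if f: "f:F l"
 proof -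
  obtain c where c: "f=restrict (comb n s c) (fib l)" using Fl f by blast
  have "(\<lambda>x\<in>fib l. r * f x)=restrict (comb n s (%i. r * c i)) (fib l)" unfolding c by (intro restrict_ext) (simp add: comb_scale)
  thus ?thesis using Fl by blast
 qed
qed

text \<open>A space of finite dimension is closed. The coefficients of the limit are written down
  directly by applying the dual evaluations to f; they are close to those of every good
  approximation.\<close>

lemma comb_closed:
 assumes ind: "indep n s l" and s: "!!i. i < n ==> cont (s i)"
  and f: "f:extensional (fib l)" "!!e. e > 0 ==> EX c. ALL x:fib l. cmod (f x - comb n s c x)<=e"
 obtains c where "f=restrict (comb n s c) (fib l)"
proof -
 obtain B where B: "B >= 0" "!!i x. [|i < n; x:KK|] ==> cmod (s i x)<=B" using bounded_sections[of n s] s by blast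
 have "EX Y \<alpha>. finite Y & Y<=fib l & (ALL i<n. ALL j<n. (\<Sum>y\<in>Y. \<alpha> j y * s i y)=(if i=j then 1 else 0))"
  by (rule dual_evaluations) (use ind in \<open>auto simp: indep_def comb_def\<close>)
 then obtain Y \<alpha> where Y: "finite Y" "Y<=fib l"
  "ALL i<n. ALL j<n. (\<Sum>y\<in>Y. \<alpha> j y * s i y)=(if i=j then 1 else 0)" by (elim exE conjE) (rule that)
 define A where "A=(\<Sum>i<n. \<Sum>y\<in>Y. cmod (\<alpha> i y))"
 define c where "c j=(\<Sum>y\<in>Y. \<alpha> j y * f y)" for j
 have eval: "(\<Sum>y\<in>Y. \<alpha> j y * comb n s d y)=d j" if j: "j < n" for d j
 proof -
  have "(\<Sum>y\<in>Y. \<alpha> j y * comb n s d y)=(\<Sum>i<n. d i * (\<Sum>y\<in>Y. \<alpha> j y * s i y))"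
  unfolding comb_def sum_distrib_left by (subst sum.swap) (simp add: mult_ac)
  also have "... = (\<Sum>i<n. d i * (if i=j then 1 else 0))" using Y(3) j by (intro sum.cong) auto
  also have "... = d j" using j by (simp add: if_distrib[of "%t. _ * t"] cong: if_cong)
  finally show ?thesis .
 qed
 have "cmod (f x - comb n s c x)<=(1 + A * B) * e" if e: "e > 0" and x: "x:fib l" for x e
 proof -
  obtain d where d: "!!x. x:fib l ==> cmod (f x - comb n s d x)<=e" using f(2)[OF e] by blast
  have cd: "cmod (c j - d j)<=(\<Sum>y\<in>Y. cmod (\<alpha> j y)) * e" if j: "j < n" for j
  proof -
  have "c j - d j=(\<Sum>y\<in>Y. \<alpha> j y * (f y - comb n s d y))" unfolding right_diff_distrib sum_subtractf eval[OF j] c_def ..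
  also have "cmod ... <= (\<Sum>y\<in>Y. cmod (\<alpha> j y) * e)"
  by (rule sum_norm_le) (use d Y(2) in \<open>auto simp: norm_mult intro!: mult_left_mono\<close>)
  finally show ?thesis by (simp add: sum_distrib_right)
  qed
  have "cmod (comb n s d x - comb n s c x)=cmod (comb n s (%i. c i - d i) x)" by (simp add: comb_diff norm_minus_commute)
  also have "... <= (\<Sum>i<n. cmod (c i - d i)) * B" using x by (intro comb_bound B(2)) (auto simp: fib_iff)
  also have "... <= (A * e) * B"
  proof (rule mult_right_mono[OF _ B(1)])
  have "(\<Sum>i<n. cmod (c i - d i))<=(\<Sum>i<n. (\<Sum>y\<in>Y. cmod (\<alpha> i y)) * e)" using cd by (intro sum_mono) auto
  also have "... = A * e" by (simp add: A_def flip: sum_distrib_right)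
  finally show "(\<Sum>i<n. cmod (c i - d i))<=A * e" .
  qed
  finally have "cmod (comb n s d x - comb n s c x)<=A * B * e" by (simp add: mult_ac)
  moreover have "cmod (f x - comb n s c x)<=cmod (f x - comb n s d x) + cmod (comb n s d x - comb n s c x)"
  using norm_triangle_ineq[of "f x - comb n s d x" "comb n s d x - comb n s c x"] by simp
  ultimately show ?thesis using d[OF x] by (simp add: algebra_simps)
 qed
 moreover have "1 + A * B > 0"
 proof -
  have "A >= 0" unfolding A_def by (intro sum_nonneg) auto
  thus ?thesis using B(1) by (simp add: add_pos_nonneg)
 qed
 ultimately have small: "cmod (f x - comb n s c x)<=r" if "r > 0" "x:fib l" for r x
  using that by (metis divide_pos_pos nonzero_mult_div_cancel_left less_numeral_extra(3) times_divide_eq_right)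
 have "f x=comb n s c x" if "x:fib l" for x
 proof -
  have "cmod (f x - comb n s c x)<=0" using small[OF _ that] by (rule field_le_epsilon) simp
  thus ?thesis by simp
 qed
 thus thesis using f(1) by (intro that[of c] extensionalityI[of _ "fib l"]) auto
qed

lemma frame_closedin:
 assumes fr: "frame_on F U n s" and l: "l:U" "l:LL"
 shows "closedin (mtopology_of (CX (fsp l))) (F l)"
proof -
 have Fl: "F l={restrict (comb n s c) (fib l) | c. True}" "indep n s l" "!!i. i < n ==> cont (s i)" using fr l by (auto simp: frame_on_def)
 have ne: "topspace (fsp l) ~= {}" unfolding topspace_fib by (rule fib_nonempty[OF l(2)])
 show ?thesis unfolding closedin_CX[OF ne frame_mspace[OF fr l]] topspace_fib
 proof (intro ballI impI)
  fix f assume f: "f:Cf l" and app: "ALL e>0. EX g:F l. ALL x:fib l. cmod (f x - g x)<=e"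
  have "EX c. ALL x:fib l. cmod (f x - comb n s c x)<=e" if e: "e > 0" for e
  proof -
  obtain g where g: "g:F l" "ALL x:fib l. cmod (f x - g x)<=e" using app e by blast
  then obtain c where "g=restrict (comb n s c) (fib l)" using Fl(1) by blast
  thus ?thesis using g(2) by (intro exI[of _ c]) simp
  qed
  moreover have "f:extensional (fib l)" using f l(2) by (simp add: mspace_fib)
  ultimately obtain c where "f=restrict (comb n s c) (fib l)" using comb_closed[OF Fl(2,3), of f] by blast
  thus "f:F l" using Fl(1) by blast
 qed
qed


section \<open>The topology of the function bundle and trivialisation by frames\<close>

abbreviation btop :: "('l \<times> ('k => complex)) topology" where
 "btop == fun_bundle_topology K L q"

definition bundle_of :: "('l => ('k => complex) set) => ('l, 'k) fibre_functions" where
 "bundle_of F=Sigma (LL) F"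

definition tube_nbhd :: "('k => complex) => 'l set => real => ('l, 'k) fibre_functions" where
 "tube_nbhd F U e={(l, f):fun_bundle K L q. l:U & mdist (CX (fsp l)) f (restrict F (fib l)) < e}"

lemma mem_fun_bundle: "(l, f):fun_bundle K L q \<longleftrightarrow> l:LL & f:Cf l" by (simp add: fun_bundle_def)

lemma bundle_topology_eq:
 "btop=topology_generated_by {tube_nbhd F U e | F U e. F:CK & openin L U & 0 < e}" unfolding fun_bundle_topology_def tube_nbhd_def ..

lemma tube_nbhdD:
 assumes "cont F" "(l, f):tube_nbhd F U e"
 shows "l:U" "x:fib l ==> cmod (f x - F x)<=e"
proof -
 have h: "(l, f):fun_bundle K L q" "l:U" "mdist (CX (fsp l)) f (restrict F (fib l)) < e" using assms by (auto simp: tube_nbhd_def)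
 thus "l:U" by simp
 have l: "l:LL" "f:Cf l" using h(1) by (auto simp: mem_fun_bundle)
 show "cmod (f x - F x)<=e" if "x:fib l" using mdist_fib_le[OF l restrict_fib[OF l(1) assms(1)], of e] h(3) that by auto
qed

lemma tube_nbhdI:
 assumes "cont F" "l:LL" "f:Cf l" "l:U"
  "!!x. x:fib l ==> cmod (f x - F x)<=d" "d < e"
 shows "(l, f):tube_nbhd F U e"
proof -
 have "mdist (CX (fsp l)) f (restrict F (fib l))<=d"
  unfolding mdist_fib_le[OF assms(2,3) restrict_fib[OF assms(2,1)]] using assms(5) by simp
 thus ?thesis using assms by (simp add: tube_nbhd_def mem_fun_bundle)
qed

lemma openin_tube_nbhd:
 assumes "cont F" "openin L U" "e > 0"
 shows "openin btop (tube_nbhd F U e)"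
proof -
 have "tube_nbhd F U e=tube_nbhd (restrict F (KK)) U e" by (simp add: tube_nbhd_def Int_absorb1[OF fib_subset])
 moreover have "restrict F (KK):CK" by (rule restrict_CX[OF compact_total assms(1)])
 ultimately show ?thesis unfolding bundle_topology_eq using assms(2,3) by (intro topology_generated_by_Basis) blast
qed

lemma fun_bundle_tube:
 assumes "l:U" "(l, f):fun_bundle K L q"
 shows "EX e>0. (l, f):tube_nbhd (%_. 0) U e"
proof -
 have l: "l:LL" "f:Cf l" using assms by (auto simp: mem_fun_bundle)
 obtain g where g: "cont g" "!!x. x:fib l ==> g x=f x" by (rule extension_fib[OF l]) (rule that)
 obtain B where B: "B >= 0" "!!x. x:KK ==> cmod (g x)<=B" using bounded_sections[of 1 "%_. g"] g(1) by auto
 have "(l, f):tube_nbhd (%_. 0) U (B + 1)"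
 proof (intro tube_nbhdI[where d = B] l assms(1))
  show "cmod (f x - 0)<=B" if "x:fib l" for x using B(2)[of x] g(2)[OF that] that by (simp add: fib_iff)
 qed auto
 thus ?thesis using B(1) by (intro exI[of _ "B + 1"]) auto
qed

lemma topspace_bundle: "topspace btop=fun_bundle K L q"
proof (intro equalityI subsetI)
 show "z:fun_bundle K L q" if "z:topspace btop" for z
  using that unfolding bundle_topology_eq topology_generated_by_topspace tube_nbhd_def by blast
 fix z assume z: "z:fun_bundle K L q"
 obtain l f where lf: "z=(l, f)" by fastforce
 have "l:LL" using z lf by (simp add: mem_fun_bundle)
 then obtain e where "e > 0" "(l, f):tube_nbhd (%_. 0) (LL) e" using fun_bundle_tube[of l "LL" f] z lf by blast
 thus "z:topspace btop" using openin_subset[OF openin_tube_nbhd[of "%_. 0" "LL" e]] lf by auto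
qed

lemma continuous_bundle_fst: "continuous_map btop L fst" unfolding continuous_map_openin_preimage_eq
proof (intro conjI allI impI)
 show "fst:topspace btop \<rightarrow> LL" unfolding topspace_bundle by (auto simp: fun_bundle_def)
 fix U assume U: "openin L U"
 have "topspace btop Int fst -` U=(\<Union>e\<in>{0<..}. tube_nbhd (%_. 0) U e)"
 proof (intro equalityI subsetI)
  fix z assume z: "z:topspace btop Int fst -` U"
  obtain l f where lf: "z=(l, f)" by fastforce
  have "EX e>0. (l, f):tube_nbhd (%_. 0) U e" using z lf unfolding topspace_bundle by (intro fun_bundle_tube) auto
  thus "z:(\<Union>e\<in>{0<..}. tube_nbhd (%_. 0) U e)" using lf by auto
 qed (unfold topspace_bundle, auto simp: tube_nbhd_def)
 moreover have "openin btop (\<Union>e\<in>{0<..}. tube_nbhd (%_. 0) U e)" using U by (intro openin_Union) (auto intro!: openin_tube_nbhd)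
 ultimately show "openin btop (topspace btop Int fst -` U)" by simp
qed

lemma continuous_into_bundle:
 assumes "!!z. z:topspace Z ==> g z:fun_bundle K L q"
  and "!!F U e z. [|cont F; openin L U; e > 0; z:topspace Z; g z:tube_nbhd F U e|]
  ==> EX N. openin Z N & z:N & (ALL w:N. g w:tube_nbhd F U e)"
 shows "continuous_map Z btop g" unfolding bundle_topology_eq
proof (rule continuous_on_generated_topo)
 show "g ` topspace Z<=\<Union> {tube_nbhd F U e |F U e. F:CK & openin L U & 0 < e}"
  using assms(1) topspace_bundle unfolding bundle_topology_eq topology_generated_by_topspace by auto
 fix V assume "V:{tube_nbhd F U e |F U e. F:CK & openin L U & 0 < e}"
 then obtain F U e where V: "V=tube_nbhd F U e" "F:CK" "openin L U" "e > 0" by blast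
 have F: "cont F" using V(2) by (simp add: mspace_total)
 show "openin Z (g -` V Int topspace Z)"
 proof (subst openin_subopen, intro ballI)
  fix z assume z: "z:g -` V Int topspace Z"
  then obtain N where N: "openin Z N" "z:N" "ALL w:N. g w:tube_nbhd F U e" using assms(2)[OF F V(3,4), of z] V(1) by auto
  thus "EX T. openin Z T & z:T & T<=g -` V Int topspace Z" using openin_subset[OF N(1)] V(1) by (intro exI[of _ N]) auto
 qed
qed

definition frame_map :: "nat => (nat => 'k => complex) => 'l \<times> (nat => complex) => 'l \<times> ('k => complex)" where
 "frame_map n s=(%(l, c). (l, restrict (comb n s c) (fib l)))"

abbreviation coord_space :: "nat => (nat => complex) topology" where
 "coord_space n == product_topology (%_. euclidean) {..<n}"

text \<open>Small changes of the coefficients are uniformly controlled by the bound B of the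
  sections, and a change of the base point by the tube lemma applied to the difference of
  \<open>comb n s c0\<close> and F.\<close>

lemma continuous_frame_map:
 assumes s: "!!i. i < n ==> cont (s i)"
 shows "continuous_map (prod_topology L (coord_space n)) btop (frame_map n s)"
proof (rule continuous_into_bundle)
 let ?P = "prod_topology L (coord_space n)"
 have cc: "cont (comb n s c)" for c by (rule continuous_comb) (rule s)
 have in_space: "restrict (comb n s c) (fib l):Cf l" if "l:LL" for c l by (rule restrict_fib[OF that cc])
 show "frame_map n s z:fun_bundle K L q" if "z:topspace ?P" for z using that in_space by (auto simp: frame_map_def mem_fun_bundle)
 fix F U and e :: real and z
 assume F: "cont F" and U: "openin L U" and e: "e > 0" and z: "z:topspace ?P"
  and mem: "frame_map n s z:tube_nbhd F U e"
 obtain m0 c0 where mc: "z=(m0, c0)" "m0:LL" "c0:{..<n} \<rightarrow>\<^sub>E UNIV" using z by auto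
 define r where "r=mdist (CX (fsp m0)) (restrict (comb n s c0) (fib m0)) (restrict F (fib m0))"
 have r: "r < e" "m0:U" using mem mc by (auto simp: frame_map_def tube_nbhd_def r_def)
 have rb: "ALL x:fib m0. cmod (comb n s c0 x - F x)<=r"
  using mdist_fib_le[OF mc(2) in_space[OF mc(2)] restrict_fib[OF mc(2) F], of c0 r] unfolding r_def by simp
 \<comment> \<open>Two errors of size k, one from the coefficients and one from the base point,
   leave r + 2 * k < e.\<close>
 define k where "k=(e - r) / 4"
 have k: "k > 0" "r + 2 * k < e" using r(1) by (auto simp: k_def field_simps)
 obtain B where B: "B >= 0" "!!i x. [|i < n; x:KK|] ==> cmod (s i x)<=B" using bounded_sections[of n s] s by blast
 define d where "d=k / (real n * B + 1)"
 have nB: "real n * B + 1 > 0" using B(1) by (simp add: add_nonneg_pos)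
 hence d: "d > 0" "real n * d * B<=k"
 proof -
  show d0: "d > 0" using k nB by (simp add: d_def)
  have "real n * d * B<=(real n * B + 1) * d" using d0 by (simp add: algebra_simps)
  also have "... = k" using nB by (simp add: d_def)
  finally show "real n * d * B<=k" .
 qed
 have T: "openin K {x:KK. dist (comb n s c0 x - F x) 0 < r + k}" by (intro openin_dist_less continuous_map_diff cc F)
 have sub: "fib m0<={x:KK. dist (comb n s c0 x - F x) 0 < r + k}" using rb k by (force simp: fib_iff)
 obtain U1 where U1: "openin L U1" "m0:U1"
  "!!x. [|x:KK; q x:U1|] ==> x:{x:KK. dist (comb n s c0 x - F x) 0 < r + k}" by (rule tube[OF T sub mc(2)]) (rule that)
 let ?N = "(U Int U1) \<times> (PiE {..<n} (%i. ball (c0 i) d))"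
 show "EX N. openin ?P N & z:N & (ALL w:N. frame_map n s w:tube_nbhd F U e)"
 proof (intro exI[of _ ?N] conjI ballI)
  have "openin (coord_space n) (PiE {..<n} (%i. ball (c0 i) d))" by (subst openin_PiE) auto
  thus "openin ?P ?N" using U U1(1) by (simp add: openin_prod_Times_iff openin_Int)
  show "z:?N" using mc r U1(2) d(1) by (auto simp: PiE_iff)
  fix w assume w: "w:?N"
  then obtain m c where mc': "w=(m, c)" "m:U" "m:U1" "!!i. i < n ==> dist (c0 i) (c i) < d" by (auto simp: PiE_iff)
  have m: "m:LL" using U mc'(2) openin_subset by blast
  have "cmod (restrict (comb n s c) (fib m) x - F x)<=r + 2 * k" if x: "x:fib m" for x
  proof -
  have "cmod (comb n s c x - comb n s c0 x)=cmod (comb n s (%i. c i - c0 i) x)" by (simp add: comb_diff)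
  also have "... <= (\<Sum>i<n. cmod (c i - c0 i)) * B" using x by (intro comb_bound B(2)) (auto simp: fib_iff)
  also have "... <= (real n * d) * B" using sum_bounded_above[of "{..<n}" "%i. cmod (c i - c0 i)" d] mc'(4) B(1)
  by (intro mult_right_mono) (auto simp: dist_norm norm_minus_commute less_imp_le)
  finally have "cmod (comb n s c x - comb n s c0 x)<=k" using d(2) by linarith
  moreover have "cmod (comb n s c0 x - F x) < r + k" using U1(3)[of x] x mc'(3) by (auto simp: fib_iff)
  moreover have "cmod (comb n s c x - F x)<=cmod (comb n s c x - comb n s c0 x) + cmod (comb n s c0 x - F x)"
  using norm_triangle_ineq[of "comb n s c x - comb n s c0 x" "comb n s c0 x - F x"] by simp
  ultimately show ?thesis using x by simp
  qed
  thus "frame_map n s w:tube_nbhd F U e"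
  unfolding mc'(1) frame_map_def prod.case by (intro tube_nbhdI[where d = "r + 2 * k"] F m in_space mc'(2) k(2)) auto
 qed
qed

text \<open>Functions of the bundle close to a combination with coefficients c0 have coefficients
  close to c0, by \<open>coefficient_bound\<close> applied to the difference.\<close>

lemma frame_coeffs_continuous:
 assumes fr: "frame_on F U n s" and U: "openin L U" and D: "D<=U"
 shows "continuous_map (subtopology btop {e:bundle_of F. fst e:D}) (prod_topology (subtopology L D) (coord_space n))
  (%(l, f). (l, coeffs n s l f))"
proof -
 let ?S = "{e:bundle_of F. fst e:D}"
 let ?T = "subtopology btop ?S"
 have s: "!!i. i < n ==> cont (s i)" and ind: "!!l. l:U ==> indep n s l" using fr by (auto simp: frame_on_def)
 have "continuous_map ?T (subtopology L D) fst"
  using continuous_map_from_subtopology[OF continuous_bundle_fst] by (auto simp: continuous_map_in_subtopology)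
 moreover have "continuous_map ?T (coord_space n) (%z. coeffs n s (fst z) (snd z))" unfolding continuous_map_componentwise
 proof (intro conjI ballI)
  show "(%z. coeffs n s (fst z) (snd z)) ` topspace ?T<=extensional {..<n}" by (auto simp: coeffs_def)
  fix k assume "k:{..<n}"
  hence k: "k < n" by simp
  show "cnt ?T (%z. coeffs n s (fst z) (snd z) k)" unfolding cont_metric
  proof (intro ballI allI impI)
  fix z and e :: real assume z: "z:topspace ?T" and e: "e > 0"
  obtain m0 f0 where mf: "z=(m0, f0)" by fastforce
  have zS: "m0:D" "f0:F m0" "m0:LL" using z mf by (auto simp: bundle_of_def)
  hence m0U: "m0:U" using D by blast
  define c0 where "c0=coeffs n s m0 f0"
  have f0: "restrict (comb n s c0) (fib m0)=f0" unfolding c0_def by (rule comb_coeffs[OF fr m0U zS(2)])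
  obtain C U1 where C: "C > 0" "openin L U1" "m0:U1"
  "!!l c M. [|l:U1; ALL x:fib l. cmod (comb n s c x)<=M|] ==> (\<Sum>i<n. cmod (c i))<=C * M"
  using coefficient_bound[OF s zS(3) ind[OF m0U]] by blast
  define a where "a=e / (2 * C)"
  have a: "a > 0" "C * a < e" using C(1) e by (auto simp: a_def)
  have cc: "cont (comb n s c0)" by (rule continuous_comb) (rule s)
  show "EX N. openin ?T N & z:N & (ALL w:N. dist (coeffs n s (fst z) (snd z) k) (coeffs n s (fst w) (snd w) k) < e)"
  proof (intro exI[of _ "tube_nbhd (comb n s c0) U1 a Int ?S"] conjI ballI)
  show "openin ?T (tube_nbhd (comb n s c0) U1 a Int ?S)" using openin_tube_nbhd[OF cc C(2) a(1)] by (auto simp: openin_subtopology)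
  have "f0:mspace (CX (fsp m0))" using frame_mspace[OF fr m0U zS(3)] zS(2) by blast
  hence "z:tube_nbhd (comb n s c0) U1 a" unfolding mf using f0 a(1) C(3) zS(3) by (intro tube_nbhdI[where d = 0] cc) auto
  thus "z:tube_nbhd (comb n s c0) U1 a Int ?S" using z by auto
  fix w assume w: "w:tube_nbhd (comb n s c0) U1 a Int ?S"
  obtain m f where mf': "w=(m, f)" by fastforce
  have m: "m:U" "f:F m" using w mf' D by (auto simp: bundle_of_def)
  have wt: "(m, f):tube_nbhd (comb n s c0) U1 a" using w mf' by blast
  define c where "c=coeffs n s m f"
  have f: "restrict (comb n s c) (fib m)=f" unfolding c_def by (rule comb_coeffs[OF fr m])
  have "ALL x:fib m. cmod (comb n s (%i. c i - c0 i) x)<=a"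
  proof
  fix x assume x: "x:fib m"
  have "f x=comb n s c x" using fun_cong[OF f, of x] x by simp
  thus "cmod (comb n s (%i. c i - c0 i) x)<=a" using tube_nbhdD(2)[OF cc wt x] by (simp add: comb_diff)
  qed
  hence "(\<Sum>i<n. cmod (c i - c0 i))<=C * a" by (intro C(4)[OF tube_nbhdD(1)[OF cc wt]])
  moreover have "cmod (c k - c0 k)<=(\<Sum>i<n. cmod (c i - c0 i))" using k by (intro member_le_sum) auto
  ultimately show "dist (coeffs n s (fst z) (snd z) k) (coeffs n s (fst w) (snd w) k) < e"
  using a(2) unfolding mf mf' fst_conv snd_conv c_def[symmetric] c0_def[symmetric] by (simp add: dist_norm norm_minus_commute)
  qed
  qed
 qed
 ultimately show ?thesis by (simp add: continuous_map_paired case_prod_unfold)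
qed

lemma bundle_fibre_bundle_of: "l:LL ==> bundle_fibre (bundle_of F) l=F l" by (simp add: bundle_fibre_def bundle_of_def)

text \<open>The coefficient map of a frame is the trivialisation, with inverse
  \<open>frame_map\<close>. The lower norm estimate comes from the bound B of the sections, the
  upper one from \<open>coefficient_bound\<close>.\<close>

lemma locally_trivial_frames:
 assumes F: "local_frames F"
 shows "locally_trivial K L q (bundle_of F)" unfolding locally_trivial_def
proof
 fix l assume l: "l:LL"
 obtain U n s where U: "openin L U" "l:U" "frame_on F U n s" using F l unfolding local_frames_def by blast
 have s: "!!i. i < n ==> cont (s i)" and ind: "!!l. l:U ==> indep n s l" using U(3) by (auto simp: frame_on_def)
 obtain C U1 where C: "C > 0" "openin L U1" "l:U1"
  "!!l c M. [|l:U1; ALL x:fib l. cmod (comb n s c x)<=M|] ==> (\<Sum>i<n. cmod (c i))<=C * M"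
  using coefficient_bound[OF s l ind[OF U(2)]] by blast
 obtain B where B: "B >= 0" "!!i x. [|i < n; x:KK|] ==> cmod (s i x)<=B" using bounded_sections[of n s] s by blast
 have UU: "openin L (U Int U1)" "l:U Int U1" using U C by auto
 obtain O' D where D: "openin L O'" "closedin L D" "l:O'" "O'<=D" "D<=U Int U1"
  by (rule compact_Hausdorff_shrink[OF compact_base Hausdorff_base UU]) (rule that)
 let ?a = "%(l, f). (l, coeffs n s l f)"
 let ?S = "{e:bundle_of F. fst e:D}"
 have DL: "D<=LL" using D(2) closedin_subset by blast
 have DU: "D<=U" using D(5) by blast
 define c1 where "c1=1 / (real n * B + 1)"
 have nB: "real n * B + 1 > 0" using B(1) by (simp add: add_nonneg_pos)
 have Fm: "F m={restrict (comb n s c) (fib m) | c. True}" if "m:D" for m using U(3) DU that unfolding frame_on_def by blast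
 have "homeomorphic_maps (subtopology btop ?S) (prod_topology (subtopology L D) (coord_space n)) ?a (frame_map n s)"
  unfolding homeomorphic_maps_def
 proof (intro conjI ballI)
  show "continuous_map (subtopology btop ?S) (prod_topology (subtopology L D) (coord_space n)) ?a"
  by (rule frame_coeffs_continuous[OF U(3,1) DU])
  have "continuous_map (prod_topology (subtopology L D) (coord_space n)) btop (frame_map n s)"
  using continuous_map_from_subtopology[OF continuous_frame_map, of n s "D \<times> topspace (coord_space n)"] s
  by (simp add: prod_topology_subtopology)
  moreover have "frame_map n s z:?S" if "z:topspace (prod_topology (subtopology L D) (coord_space n))" for z
  using that Fm DL by (auto simp: frame_map_def bundle_of_def)
  ultimately show "continuous_map (prod_topology (subtopology L D) (coord_space n)) (subtopology btop ?S) (frame_map n s)"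
  unfolding continuous_map_in_subtopology by blast
  fix z assume "z:topspace (subtopology btop ?S)"
  then obtain m f where z: "z=(m, f)" "m:D" "f:F m" by (auto simp: bundle_of_def)
  thus "frame_map n s (?a z)=z" using comb_coeffs[OF U(3), of m f] DU by (auto simp: frame_map_def)
 next
  fix z assume "z:topspace (prod_topology (subtopology L D) (coord_space n))"
  then obtain m c where z: "z=(m, c)" "m:D" "c:{..<n} \<rightarrow>\<^sub>E UNIV" by auto
  thus "?a (frame_map n s z)=z" using coeffs_comb[OF ind, of m c] DU by (auto simp: frame_map_def PiE_restrict)
 qed
 hence "homeomorphic_map (subtopology btop ?S) (prod_topology (subtopology L D) (coord_space n)) ?a" by (auto simp: homeomorphic_map_maps)
 moreover have "module_iso complex_field (cfun_vec (fsp m)\<lparr>carrier := bundle_fibre (bundle_of F) m\<rparr>)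
  (free_module complex_field {..<n}) (%f. snd (?a (m, f)))" if m: "m:D" for m
 proof -
  have "m:U" "m:LL" using m DU DL by auto
  thus ?thesis using frame_iso[OF U(3), of m] by (simp add: bundle_fibre_bundle_of)
 qed
 moreover have "c1 * sup_norm (fsp m) f<=L2_set (%i. cmod (snd (?a (m, f)) i)) {..<n} &
  L2_set (%i. cmod (snd (?a (m, f)) i)) {..<n}<=C * sup_norm (fsp m) f"
  if mf: "(m, f):bundle_of F" "m:D" for m f
 proof
  have m: "m:U" "m:LL" "m:U1" "f:F m" using mf D(5) by (auto simp: bundle_of_def)
  define c where "c=coeffs n s m f"
  have f: "f=restrict (comb n s c) (fib m)" unfolding c_def by (rule comb_coeffs[OF U(3) m(1,4), symmetric])
  have fm: "f:Cf m" using frame_mspace[OF U(3) m(1,2)] m(4) by blast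
  have le: "cmod (c i)<=L2_set (%i. cmod (c i)) {..<n}" if "i < n" for i using member_le_L2_set[of "{..<n}" i "%i. cmod (c i)"] that by simp
  have sn: "cmod (f x)<=sup_norm (fsp m) f" if "x:fib m" for x using sup_norm_fib_le[OF m(2) fm, of "sup_norm (fsp m) f"] that by simp
  have "sup_norm (fsp m) f<=(real n * B + 1) * L2_set (%i. cmod (c i)) {..<n}" unfolding sup_norm_fib_le[OF m(2) fm]
  proof
  fix x assume x: "x:fib m"
  have "cmod (f x)<=(\<Sum>i<n. cmod (c i)) * B" unfolding f using x comb_bound[of n s x B c] B(2) by (simp add: fib_iff)
  also have "... <= (real n * L2_set (%i. cmod (c i)) {..<n}) * B"
  using sum_bounded_above[of "{..<n}" "%i. cmod (c i)" "L2_set (%i. cmod (c i)) {..<n}"] le B(1) by (intro mult_right_mono) auto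
  also have "... <= (real n * B + 1) * L2_set (%i. cmod (c i)) {..<n}" by (simp add: algebra_simps L2_set_nonneg)
  finally show "cmod (f x)<=(real n * B + 1) * L2_set (%i. cmod (c i)) {..<n}" .
  qed
  thus "c1 * sup_norm (fsp m) f<=L2_set (%i. cmod (snd (?a (m, f)) i)) {..<n}" using nB by (simp add: c1_def c_def field_simps)
  have "L2_set (%i. cmod (c i)) {..<n}<=(\<Sum>i<n. cmod (c i))" by (rule L2_set_le_sum) simp
  also have "... <= C * sup_norm (fsp m) f" using sn f by (intro C(4)[OF m(3)]) (auto simp: restrict_def split: if_splits)
  finally show "L2_set (%i. cmod (snd (?a (m, f)) i)) {..<n}<=C * sup_norm (fsp m) f" by (simp add: c_def)
 qed
 moreover have "compactin L D" by (rule closedin_compact_space[OF compact_base D(2)])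
 moreover have "c1 > 0" using nB by (simp add: c1_def)
 ultimately show "EX D. compactin L D & (EX U. openin L U & l:U & U<=D) &
  (EX (n :: nat) (c1 :: real) (c2 :: real) a.
  0 < c1 & 0 < c2 &
  homeomorphic_map (subtopology (fun_bundle_topology K L q) {e:bundle_of F. fst e:D})
  (prod_topology (subtopology L D) (product_topology (%_. euclidean) {..<n})) a &
  (ALL e:bundle_of F. fst e:D --> fst (a e)=fst e) &
  (ALL m:D. module_iso complex_field (cfun_vec (fsp m)\<lparr>carrier := bundle_fibre (bundle_of F) m\<rparr>)
  (free_module complex_field {..<n}) (%f. snd (a (m, f)))) &
  (ALL (m, f):bundle_of F. m:D -->
  c1 * sup_norm (fsp m) f<=L2_set (%i. cmod (snd (a (m, f)) i)) {..<n} &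
  L2_set (%i. cmod (snd (a (m, f)) i)) {..<n}<=c2 * sup_norm (fsp m) f))" using D(1,3,4) C(1)
  by (intro exI[of _ D] exI[of _ O'] exI[of _ n] exI[of _ c1] exI[of _ C] exI[of _ ?a] conjI ballI) (auto simp del: split_paired_Ex)
qed

lemma subbundle_frames:
 assumes F: "local_frames F"
 shows "subbundle K L q (bundle_of F)" unfolding subbundle_def
proof (intro conjI ballI)
 have fr: "EX U n s. openin L U & l:U & frame_on F U n s" if "l:LL" for l using F that unfolding local_frames_def by blast
 have ms: "F l<=Cf l" if "l:LL" for l using fr[OF that] frame_mspace that by blast
 thus sub: "bundle_of F<=fun_bundle K L q" by (auto simp: bundle_of_def fun_bundle_def)
 fix l assume l: "l:LL"
 obtain U n s where U: "openin L U" "l:U" "frame_on F U n s" using fr[OF l] by blast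
 show "closedin (mtopology_of (CX (fsp l))) (bundle_fibre (bundle_of F) l)"
  unfolding bundle_fibre_bundle_of[OF l] by (rule frame_closedin[OF U(3,2) l])
 note cl = frame_closed_under[OF U(3,2)]
 show "submodule (bundle_fibre (bundle_of F) l) complex_field (cfun_vec (fsp l))" unfolding bundle_fibre_bundle_of[OF l]
 proof (rule submodule_functionsI[where X = "fsp l"])
  show "carrier (cfun_vec (fsp l))<=extensional (topspace (fsp l))" unfolding cfun_vec_sel topspace_fib using mspace_fib[OF l] by blast
  show "(\<lambda>x\<in>topspace (fsp l). - f x):F l" if "f:F l" for f unfolding topspace_fib using cl(3)[OF that, of "-1"] by simp
 qed (unfold topspace_fib cfun_vec_sel, use ms[OF l] cl in auto)
next
 show "open_map (subtopology btop (bundle_of F)) L fst" unfolding open_map_def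
 proof (intro allI impI)
  fix A assume "openin (subtopology btop (bundle_of F)) A"
  then obtain T where T: "openin btop T" "A=T Int bundle_of F" by (auto simp: openin_subtopology)
  show "openin L (fst ` A)"
  proof (subst openin_subopen, intro ballI)
  fix l assume "l:fst ` A"
  then obtain f where f: "(l, f):T" "l:LL" "f:F l" using T(2) by (auto simp: bundle_of_def)
  obtain U n s where U: "openin L U" "l:U" "frame_on F U n s" using F f(2) unfolding local_frames_def by blast
  have s: "!!i. i < n ==> cont (s i)" using U(3) by (simp add: frame_on_def)
  define c where "c=coeffs n s l f"
  have fc: "restrict (comb n s c) (fib l)=f" unfolding c_def by (rule comb_coeffs[OF U(3,2) f(3)])
  have "continuous_map L (coord_space n) (%_. c)" by (rule continuous_map_const[THEN iffD2]) (simp add: c_def coeffs_def restrict_PiE_iff)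
  hence "continuous_map L (prod_topology L (coord_space n)) (%m. (m, c))"
  using continuous_map_id[of L] by (intro continuous_map_pairedI) (simp_all only: id_def)
  from continuous_map_compose[OF this continuous_frame_map[OF s]]
  have cont: "continuous_map L btop (%m. (m, restrict (comb n s c) (fib m)))" by (simp add: comp_def frame_map_def)
  \<comment> \<open>Constant coefficients give a continuous local section through the given point;
    the base points at which it stays inside T form a neighbourhood contained in the image.\<close>
  let ?V = "U Int {m:LL. (m, restrict (comb n s c) (fib m)):T}"
  have "openin L ?V" using openin_continuous_map_preimage[OF cont T(1)] U(1) by auto
  moreover have "l:?V" using f U fc by auto
  moreover have "?V<=fst ` A"
  proof
  fix m assume m: "m:?V"
  hence "restrict (comb n s c) (fib m):F m" using U(3) unfolding frame_on_def by blast
  hence "(m, restrict (comb n s c) (fib m)):A" using m T(2) by (auto simp: bundle_of_def)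
  thus "m:fst ` A" by force
  qed
  ultimately show "EX V. openin L V & l:V & V<=fst ` A" by blast
  qed
 qed
qed


text \<open>The value of the section at m0 is extended to a function F on K. Near m0 the section is
  uniformly close to F, and F is continuous at x0.\<close>

lemma section_continuous:
 assumes s: "continuous_map (subtopology L D) btop s" "!!m. m:D ==> fst (s m)=m" and D: "D<=LL"
 shows "cnt (subtopology K {x:KK. q x:D}) (%x. snd (s (q x)) x)" unfolding cont_metric
proof (intro ballI allI impI)
 let ?KD = "{x:KK. q x:D}"
 fix x0 and e :: real assume "x0:topspace (subtopology K ?KD)" and e: "e > 0"
 hence x0: "x0:KK" "q x0:D" by auto
 define m0 where "m0=q x0"
 have m0: "m0:D" "m0:LL" "x0:fib m0" using x0 D by (auto simp: m0_def fib_iff)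
 have top: "topspace (subtopology L D)=D" using D by auto
 obtain f0 where f0: "s m0=(m0, f0)" using s(2)[OF m0(1)] by (metis prod.collapse)
 have f0s: "f0:mspace (CX (fsp m0))" using continuous_map_image_subset_topspace[OF s(1)] m0(1) top topspace_bundle f0 by (auto simp: mem_fun_bundle)
 obtain F where F: "cont F" "!!x. x:fib m0 ==> F x=f0 x" by (rule extension_fib[OF m0(2) f0s]) (rule that)
 define T where "T=tube_nbhd F (LL) (e / 3)"
 have T: "openin btop T" unfolding T_def using F(1) e by (intro openin_tube_nbhd) auto
 have "s m0:T" unfolding f0 T_def using F e m0(2) f0s by (intro tube_nbhdI[where d = 0]) auto
 hence "openin (subtopology L D) {m:topspace (subtopology L D). s m:T}" "m0:{m:topspace (subtopology L D). s m:T}"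
  using openin_continuous_map_preimage[OF s(1) T] m0(1) unfolding top by auto
 then obtain U where U: "openin L U" "{m:D. s m:T}=U Int D" unfolding openin_subtopology top by blast
 let ?N = "{x:KK. q x:U} Int {x:KK. dist (F x) (F x0) < e / 3}"
 show "EX N. openin (subtopology K ?KD) N & x0:N & (ALL x:N. dist (snd (s (q x0)) x0) (snd (s (q x)) x) < e)"
 proof (intro exI[of _ "?N Int ?KD"] conjI ballI)
  have "openin K ?N" by (intro openin_Int openin_continuous_map_preimage[OF cont_q U(1)] openin_dist_less F(1))
  thus "openin (subtopology K ?KD) (?N Int ?KD)" by (auto simp: openin_subtopology)
  have "m0:U" using U(2) m0(1) \<open>s m0 \<in> T\<close> by blast
  thus "x0:?N Int ?KD" using x0 e by (simp add: m0_def)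
  fix x assume x: "x:?N Int ?KD"
  define m where "m=q x"
  have m: "m:D" "s m:T" "x:fib m" using x U(2) by (auto simp: m_def fib_iff)
  have "(m, snd (s m)):tube_nbhd F (LL) (e / 3)" using m(2) s(2)[OF m(1)] unfolding T_def by (metis prod.collapse)
  hence 1: "cmod (snd (s m) x - F x)<=e / 3" using tube_nbhdD(2)[OF F(1)] m(3) by blast
  have 2: "dist (F x) (F x0) < e / 3" using x by simp
  have 3: "snd (s (q x0)) x0=F x0" using F(2)[OF m0(3)] f0 by (simp flip: m0_def)
  have "dist (F x0) (snd (s m) x)<=dist (F x0) (F x) + dist (F x) (snd (s m) x)" by (rule dist_triangle)
  moreover have "dist (F x) (snd (s m) x)<=e / 3" using 1 by (simp add: dist_norm norm_minus_commute)
  ultimately show "dist (snd (s (q x0)) x0) (snd (s (q x)) x) < e" using 2 e unfolding 3 m_def[symmetric] by (simp add: dist_commute)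
 qed
qed

text \<open>The unit vectors, pulled back through the trivialisation over the compact neighbourhood
  D, form a frame there. Tietze's theorem over the closed preimage of D makes its members continuous
  on K.\<close>

lemma locally_trivial_local_frames:
 assumes sub: "subbundle K L q F" and lt: "locally_trivial K L q F"
 shows "local_frames (bundle_fibre F)" unfolding local_frames_def
proof
 fix l assume l: "l:LL"
 obtain D U and n :: nat and c1 c2 :: real and b where D: "compactin L D" "openin L U" "l:U" "U<=D"
  and hom: "homeomorphic_map (subtopology btop {e:F. fst e:D}) (prod_topology (subtopology L D) (coord_space n)) b"
  and over: "ALL e:F. fst e:D --> fst (b e)=fst e"
  and iso: "ALL m:D. module_iso complex_field (cfun_vec (fsp m)\<lparr>carrier := bundle_fibre F m\<rparr>)
  (free_module complex_field {..<n}) (%f. snd (b (m, f)))"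
  using lt[unfolded locally_trivial_def, rule_format, OF l] by (elim exE conjE) (rule that)
 let ?T = "subtopology btop {e:F. fst e:D}"
 let ?P = "prod_topology (subtopology L D) (coord_space n)"
 obtain d where d: "homeomorphic_maps ?T ?P b d" using hom unfolding homeomorphic_map_maps by blast
 have DL: "D<=LL" using D(1) by (rule compactin_subset_topspace)
 have Dc: "closedin L D" using D(1) Hausdorff_base by (rule compactin_imp_closedin[rotated])
 define u where "u i=restrict (%j. if j=i then 1 else 0 :: complex) {..<n}" for i :: nat
 define a where "a i m=d (m, u i)" for i m
 have uP: "u i:topspace (coord_space n)" for i by (simp add: u_def restrict_PiE_iff)
 have topP: "topspace ?P=D \<times> topspace (coord_space n)" using DL unfolding topspace_prod_topology by auto
 have FT: "topspace ?T={e:F. fst e:D}" using sub unfolding subbundle_def by (auto simp: topspace_bundle)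
 have a: "a i m:F & fst (a i m)=m & b (a i m)=(m, u i)" if m: "m:D" for i m
 proof -
  have p: "(m, u i):topspace ?P" unfolding topP using m uP by blast
  hence "a i m:topspace ?T" using d unfolding a_def homeomorphic_maps_def continuous_map_def by blast
  hence e: "a i m:F" "fst (a i m):D" unfolding FT by auto
  have "b (a i m)=(m, u i)" using d p unfolding a_def homeomorphic_maps_def by blast
  thus ?thesis using e over by force
 qed
 have ac: "continuous_map (subtopology L D) btop (a i)" for i
 proof -
  have "continuous_map (subtopology L D) (coord_space n) (%_. u i)" by (intro continuous_map_const[THEN iffD2] disjI2 uP)
  hence "continuous_map (subtopology L D) ?P (%m. (m, u i))"
  using continuous_map_id[of "subtopology L D"] by (intro continuous_map_pairedI) (simp_all only: id_def)
  moreover have "continuous_map ?P btop d" using d unfolding homeomorphic_maps_def continuous_map_in_subtopology by blast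
  ultimately show ?thesis using continuous_map_compose unfolding a_def comp_def by fastforce
 qed
 have "EX s. cont s & (ALL x:{x:KK. q x:D}. s x=snd (a i (q x)) x)" for i
 proof -
  have "closedin K {x:KK. q x:D}" by (rule closedin_continuous_map_preimage[OF cont_q Dc])
  moreover have "cnt (subtopology K {x:KK. q x:D}) (%x. snd (a i (q x)) x)" using a by (intro section_continuous[OF ac _ DL]) auto
  ultimately show ?thesis by (rule Tietze_complex[OF normal_total]) blast
 qed
 then obtain s where s: "!!i. cont (s i)"
  "!!i x. x:KK ==> q x:D ==> s i x=snd (a i (q x)) x" by (simp del: split_paired_All) metis
 have "frame_on (bundle_fibre F) U n s" unfolding frame_on_def
 proof (intro conjI allI impI ballI s(1))
  fix m assume "m:U"
  hence m: "m:D" "m:LL" using D(4) DL by auto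
  let ?F = "bundle_fibre F m"
  define h where "h f=snd (b (m, f))" for f
  have sm: "submodule ?F complex_field (cfun_vec (fsp m))" using sub m(2) unfolding subbundle_def by blast
  have Fs: "?F<=Cf m" using submodule_closed(1)[OF sm] by simp
  have F0: "(\<lambda>x\<in>fib m. 0):?F" using submodule_closed(2)[OF sm] unfolding cfun_vec_sel topspace_fib .
  have Fadd: "(\<lambda>x\<in>fib m. f x + g x):?F" if "f:?F" "g:?F" for f g
  using submodule_closed(3)[OF sm that] unfolding cfun_vec_sel topspace_fib .
  have Fmul: "(\<lambda>x\<in>fib m. r * f x):?F" if "f:?F" for f r
  using submodule_closed(4)[OF sm _ that, of r] unfolding cfun_vec_sel topspace_fib by simp
  note hm = iso[rule_format, OF m(1), folded h_def, unfolded module_iso_def]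
  have hadd: "h (\<lambda>x\<in>fib m. f x + g x)=(\<lambda>i\<in>{..<n}. h f i + h g i)" if "f:?F" "g:?F" for f g
  using hm that cfun_vec_sel(3)[of "fsp m", unfolded topspace_fib] by (simp del: cfun_vec_sel)
  have hmul: "h (\<lambda>x\<in>fib m. r * f x)=(\<lambda>i\<in>{..<n}. r * h f i)" if "f:?F" for f r
  using hm that cfun_vec_sel(4)[of "fsp m", unfolded topspace_fib] by (simp del: cfun_vec_sel)
  have hbij: "inj_on h ?F" "!!f. f:?F ==> h f:{..<n} \<rightarrow>\<^sub>E UNIV" using hm by (auto simp: bij_betw_def)
  have sF: "restrict (s i) (fib m):?F & h (restrict (s i) (fib m))=u i" for i
  proof -
  have e: "a i m=(m, snd (a i m))" using a[OF m(1), of i] by (metis prod.collapse)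
  have in_F: "snd (a i m):?F" using a[OF m(1), of i] e unfolding bundle_fibre_def by (metis mem_Collect_eq)
  hence "restrict (s i) (fib m)=snd (a i m)" using Fs mspace_fib[OF m(2)] s(2) m(1) by (intro extensionalityI[of _ "fib m"], (auto simp: fib_iff))
  moreover have "h (snd (a i m))=u i" using a[OF m(1), of i] e unfolding h_def by (metis snd_conv)
  ultimately show ?thesis using in_F by simp
  qed
  \<comment> \<open>Additivity is available for two summands, so the partial sums are treated one
    after the other; the coordinates from k on are still zero.\<close>
  have comb_h: "restrict (comb k s c) (fib m):?F & h (restrict (comb k s c) (fib m))=(\<lambda>i\<in>{..<n}. if i < k then c i else 0)"
  if "k<=n" for c k using that
  proof (induction k)
  case 0
  have eq: "restrict (comb 0 s c) (fib m)=(\<lambda>x\<in>fib m. 0)" by (intro restrict_ext) (simp add: comb_def)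
  have h0: "h (\<lambda>x\<in>fib m. 0)=(\<lambda>i\<in>{..<n}. 0)" using hmul[OF F0, of 0] by simp
  show ?case unfolding eq h0 by (intro conjI F0 restrict_ext) simp
  next
  case (Suc k)
  let ?f = "restrict (comb k s c) (fib m)" and ?g = "\<lambda>x\<in>fib m. c k * restrict (s k) (fib m) x"
  have kn: "k<=n" using Suc.prems by simp
  note IH = Suc.IH[OF kn, THEN conjunct1] Suc.IH[OF kn, THEN conjunct2]
  have g: "?g:?F" by (rule Fmul[OF sF[THEN conjunct1]])
  have hg: "h ?g=(\<lambda>i\<in>{..<n}. c k * u k i)" unfolding hmul[OF sF[THEN conjunct1]] sF[THEN conjunct2] ..
  have eq: "restrict (comb (Suc k) s c) (fib m)=(\<lambda>x\<in>fib m. ?f x + ?g x)" by (intro restrict_ext) (simp add: comb_def)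
  have "h (\<lambda>x\<in>fib m. ?f x + ?g x)=(\<lambda>i\<in>{..<n}. if i < Suc k then c i else 0)"
  unfolding hadd[OF IH(1) g] IH(2) hg using Suc.prems by (intro restrict_ext) (auto simp: u_def less_Suc_eq)
  thus ?case unfolding eq using Fadd[OF IH(1) g] by blast
  qed
  have comb_h': "restrict (comb n s c) (fib m):?F" "h (restrict (comb n s c) (fib m))=restrict c {..<n}" for c using restrict_ext comb_h order_refl by auto
  show "?F={restrict (comb n s c) (fib m) | c. True}"
  proof (intro equalityI subsetI)
  fix f assume f: "f:?F"
  have "f=restrict (comb n s (h f)) (fib m)" using comb_h'(2) hbij(2)[OF f] hbij(1) f comb_h'(1) by (metis PiE_restrict inj_onD)
  thus "f:{restrict (comb n s c) (fib m) | c. True}" by blast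
  qed (use comb_h'(1) in blast)
  show "indep n s m" unfolding indep_def
  proof (intro allI impI)
  fix c i assume c: "ALL x:fib m. comb n s c x=0" and i: "i < n"
  have "restrict (comb n s c) (fib m)=restrict (comb n s (%_. 0)) (fib m)" using c by (intro restrict_ext) (simp add: comb_def)
  hence "restrict c {..<n}=restrict (%_. 0) {..<n}" using comb_h'(2) by metis
  thus "c i=0" using i by (metis lessThan_iff restrict_apply')
  qed
 qed
 thus "EX U n s. openin L U & l:U & frame_on (bundle_fibre F) U n s" using D(2,3) by blast
qed

lemma separating_function:
 assumes "x:KK" "y:KK" "x ~= y"
 obtains u :: "'k => complex" where "cont u" "u x=0" "u y=1"
proof -
 have "closedin K {x}" "closedin K {y}" using assms closedin_Hausdorff_singleton[OF Hausdorff_total] by auto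
 then obtain f where f: "continuous_map K (top_of_set {0..1::real}) f" "f ` {x}<={0}" "f ` {y}<={1}"
  using Urysohn_lemma[OF normal_total, of "{x}" "{y}" 0 1] assms(3) by auto
 have "cntR K f" using f(1) by (simp add: continuous_map_in_subtopology)
 thus thesis using f(2,3) by (intro that[of "%x. complex_of_real (f x)"] continuous_map_complex_of_real) auto
qed

text \<open>Two fibres under one frame are both isomorphic to the space of coefficients.\<close>

lemma frames_same_dim:
 assumes fr: "frame_on F U n s" and m: "m:U" "m':U" and dim: "has_complex_dim (fsp m) k (F m)"
 shows "has_complex_dim (fsp m') k (F m')"
proof -
 obtain h where h: "module_iso complex_field (cfun_vec (fsp m)\<lparr>carrier := F m\<rparr>) (free_module complex_field {..<k}) h"
  using dim unfolding has_complex_dim_def by blast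
 have "module_iso complex_field (free_module complex_field {..<n}) (cfun_vec (fsp m)\<lparr>carrier := F m\<rparr>)
  (inv_into (carrier (cfun_vec (fsp m)\<lparr>carrier := F m\<rparr>)) (coeffs n s m))"
 proof (rule module_iso_sym[OF frame_iso[OF fr m(1)]])
  note sel = carrier_update_sel cfun_vec_sel(3,4)[of "fsp m", unfolded topspace_fib]
  show "f \<oplus>\<^bsub>cfun_vec (fsp m)\<lparr>carrier := F m\<rparr>\<^esub> g:carrier (cfun_vec (fsp m)\<lparr>carrier := F m\<rparr>)"
  if "f:carrier (cfun_vec (fsp m)\<lparr>carrier := F m\<rparr>)" "g:carrier (cfun_vec (fsp m)\<lparr>carrier := F m\<rparr>)" for f g
  using frame_closed_under(2)[OF fr m(1), of f g] that unfolding sel by simp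
  show "r \<odot>\<^bsub>cfun_vec (fsp m)\<lparr>carrier := F m\<rparr>\<^esub> f:carrier (cfun_vec (fsp m)\<lparr>carrier := F m\<rparr>)"
  if "f:carrier (cfun_vec (fsp m)\<lparr>carrier := F m\<rparr>)" for r f
  using frame_closed_under(3)[OF fr m(1), of f r] that unfolding sel by simp
 qed
 from module_iso_trans[OF module_iso_trans[OF frame_iso[OF fr m(2)] this] h]
 show ?thesis unfolding has_complex_dim_def by blast
qed

end

section \<open>From invariant bundles to pseudometrics, and constancy of the dimension\<close>

context open_tds_extension
begin

abbreviation lti where "lti == locally_trivial_invariant_subbundles G K \<phi> L \<psi> q"
abbreviation fgp where "fgp == fg_projective_closed_invariant_submodules G K \<phi> L q"

text \<open>The pseudometrics \<open>bpm F\<close> are continuous by the frames and invariant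
  because pullback along g maps unit balls into unit balls. This is the common route back from
  bundles and from modules.\<close>

lemma pseudoisometric_if_frames:
 assumes fr: "!!F. F:B ==> local_frames F"
  and inv: "!!F g l f. [|F:B; g:carrier G; l:LL; f:F (\<psi> g l)|] ==> compose (fib l) f (\<phi> g):F l"
  and sep: "!!l x y. [|l:LL; x:fib l; y:fib l; x ~= y|] ==> EX F:B. EX f:F l. f x ~= f y"
 shows "pseudoisometric G K \<phi> L q" unfolding pseudoisometric_def
proof
 have frame: "EX U n s. openin L U & l:U & frame_on F U n s" if "F:B" "l:LL" for F l
  using fr[OF that(1)] that(2) unfolding local_frames_def by blast
 have ball: "unit_ball F l ~= {}" if F: "F:B" "l:LL" for F l
 proof -
  obtain U n s where U: "l:U" "frame_on F U n s" using frame[OF F] by blast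
  show ?thesis using frame_closed_under(1)[OF U(2,1)] by (auto simp: unit_ball_def)
 qed
 have pm: "pseudometric_on (fib l) (bpm F)" if "F:B" "l:LL" for F l by (rule pseudometric_ball_pseudometric[OF ball[OF that]])
 have cont: "cntR KqK (bpm F)" if "F:B" for F by (rule continuous_ball_pseudometric[OF fr[OF that]])
 have le: "bpm F (\<phi> g x, \<phi> g y)<=bpm F (x, y)"
  if F: "F:B" and g: "g:carrier G" and l: "l:LL" and xy: "x:fib l" "y:fib l" for F g l x y
 proof (rule ball_pseudometric_least[OF ball[OF F psi_closed[OF g l]]])
  show "\<phi> g x:fib (\<psi> g l)" by (rule phi_fib[OF g xy(1)])
  fix f assume f: "f:unit_ball F (\<psi> g l)"
  have "compose (fib l) f (\<phi> g):unit_ball F l" using f inv F g l phi_fib by (auto simp: unit_ball_def compose_def)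
  from ball_pseudometric_upper[OF this xy]
  show "cmod (f (\<phi> g x) - f (\<phi> g y))<=bpm F (x, y)" using xy by (simp add: compose_def)
 qed
 have eq: "bpm F (\<phi> g x, \<phi> g y)=bpm F (x, y)"
  if F: "F:B" and g: "g:carrier G" and l: "l:LL" and xy: "x:fib l" "y:fib l" for F g l x y
 \<comment> \<open>The reverse inequality is \<open>le\<close> for the inverse of g.\<close>
 proof (rule antisym[OF le[OF F g l xy]])
  have "bpm F (\<phi> (inv g) (\<phi> g x), \<phi> (inv g) (\<phi> g y))<=bpm F (\<phi> g x, \<phi> g y)"
  using g xy psi_closed[OF g l] by (intro le[OF F, of "inv g" "\<psi> g l"] phi_fib) auto
  thus "bpm F (x, y)<=bpm F (\<phi> g x, \<phi> g y)" using phi_inv[OF g] xy by (simp add: fib_iff)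
 qed
 have sep': "EX p:bpm ` B. p (x, y) ~= 0" if l: "l:LL" and xy: "x:fib l" "y:fib l" "x ~= y" for l x y
 proof -
  obtain F f where F: "F:B" "f:F l" "f x ~= f y" using sep[OF l xy] by blast
  obtain U n s where U: "l:U" "frame_on F U n s" using frame[OF F(1) l] by blast
  define M where "M=sup_norm (fsp l) f"
  have fm: "f:Cf l" using frame_mspace[OF U(2,1) l] F(2) by blast
  have M: "!!z. z:fib l ==> cmod (f z)<=M" using sup_norm_fib_le[OF l fm, of M] by (simp add: M_def)
  have M0: "M + 1 > 0" using M[OF xy(1)] norm_ge_zero[of "f x"] by linarith
  \<comment> \<open>Scaling puts f into the unit ball without losing that it distinguishes x and y;
    M + 1 is positive even for f = 0.\<close>
  define r where "r=complex_of_real (1 / (M + 1))"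
  have "1 / (M + 1) ~= 0" using M0 by simp
  hence r: "r ~= 0" unfolding r_def of_real_eq_0_iff .
  have r': "cmod r=1 / (M + 1)" using M0 unfolding r_def norm_of_real by simp
  have "(\<lambda>z\<in>fib l. r * f z):unit_ball F l" unfolding unit_ball_def
  proof (intro CollectI conjI ballI frame_closed_under(3)[OF U(2,1) F(2)])
  fix z assume z: "z:fib l"
  thus "cmod ((\<lambda>z\<in>fib l. r * f z) z)<=1" using M[OF z] M0 by (simp add: norm_mult r')
  qed
  from ball_pseudometric_upper[OF this xy(1,2)]
  have "cmod (r * (f x - f y))<=bpm F (x, y)" using xy by (simp add: right_diff_distrib)
  moreover have "cmod (r * (f x - f y)) > 0" using r F(3) by simp
  ultimately show ?thesis using F(1) by (intro bexI[of _ "bpm F"]) auto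
 qed
 show "isometric_family G K \<phi> L q (bpm ` B)" unfolding isometric_family_def
 proof (intro conjI ballI)
  fix p assume "p:bpm ` B"
  then obtain F where F: "F:B" "p=bpm F" by blast
  show "cntR KqK p" unfolding F(2) by (rule cont[OF F(1)])
  fix z assume z: "z:fibre_product K q"
  obtain x y where xy: "z=(x, y)" by fastforce
  have f: "q x:LL" "x:fib (q x)" "y:fib (q x)" using z xy proj_closed by (auto simp: fibre_product_def fib_iff)
  show "0<=p z" using pm[OF F(1) f(1)] f unfolding pseudometric_on_def F(2) xy by blast
  show "case z of (x, y) => ALL g:carrier G. p (\<phi> g x, \<phi> g y)=p (x, y)" unfolding xy F(2) using eq[OF F(1) _ f] by simp
 next
  fix l assume l: "l:LL"
  show "pseudometric_on (fib l) p" if "p:bpm ` B" for p using pm l that by blast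
  show "pseudometrics_topology (fib l) (bpm ` B)=fsp l" by (rule pseudometrics_topology_fib[OF l]) (use cont pm l sep' in auto)
 qed
qed

lemma invariant_subbundle_pullback:
 assumes F: "invariant_subbundle G K \<phi> L \<psi> q F" and g: "g:carrier G" and l: "l:LL"
  and f: "f:bundle_fibre F (\<psi> g l)"
 shows "compose (fib l) f (\<phi> g):bundle_fibre F l"
proof -
 have "(\<psi> (inv g) (\<psi> g l), compose (fib (\<psi> (inv g) (\<psi> g l))) f (\<phi> (inv (inv g)))):F"
  using F g f unfolding invariant_subbundle_def bundle_fibre_def by fastforce
 thus ?thesis using psi_inv[OF g l] g by (simp add: bundle_fibre_def)
qed

theorem pseudoisometric_if_fibrewise_dense:
 assumes dense: "fibrewise_dense K L q (\<Union>lti)"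
 shows "pseudoisometric G K \<phi> L q"
proof (rule pseudoisometric_if_frames[where B = "bundle_fibre ` lti"])
 fix F assume "F:bundle_fibre ` lti"
 then obtain E where E: "F=bundle_fibre E" "invariant_subbundle G K \<phi> L \<psi> q E" "locally_trivial K L q E"
  unfolding locally_trivial_invariant_subbundles_def by blast
 show "local_frames F" unfolding E(1) using E(2,3) by (intro locally_trivial_local_frames) (auto simp: invariant_subbundle_def)
 show "compose (fib l) f (\<phi> g):F l" if "g:carrier G" "l:LL" "f:F (\<psi> g l)" for g l f
  using invariant_subbundle_pullback[OF E(2)] that unfolding E(1) by blast
next
 fix l x y assume l: "l:LL" and xy: "x:fib l" "y:fib l" "x ~= y"
 obtain u :: "'c => complex" where u: "cont u" "u x=0" "u y=1"
  by (rule separating_function[of x y]) (use xy that in \<open>auto simp: fib_iff\<close>)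
 have "EX g:bundle_fibre (\<Union>lti) l Int Cf l.
  ALL z:fib l. cmod (restrict u (fib l) z - g z)<=1 / 4"
 proof -
  have ne: "topspace (fsp l) ~= {}" unfolding topspace_fib by (rule fib_nonempty[OF l])
  show ?thesis
  using dense[unfolded fibrewise_dense_def, rule_format, OF l, unfolded dense_CX[OF ne], rule_format, OF restrict_fib[OF l u(1)], of "1 / 4"]
  unfolding topspace_fib by simp
 qed
 then obtain g E where g: "E:lti" "g:bundle_fibre E l"
  "!!z. z:fib l ==> cmod (u z - g z)<=1 / 4" unfolding bundle_fibre_def by auto
 \<comment> \<open>Since u takes the values 0 and 1, a common value of g within 1/4 of both is
   impossible.\<close>
 have "g x ~= g y"
 proof
  assume "g x=g y"
  hence "cmod (1 - g x)<=1 / 4" "cmod (0 - g x)<=1 / 4" using g(3)[OF xy(1)] g(3)[OF xy(2)] u by auto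
  thus False using norm_triangle_ineq4[of "1 - g x" "0 - g x"] by simp
 qed
 thus "EX F:bundle_fibre ` lti. EX f:F l. f x ~= f y" using g(1,2) by blast
qed

lemma invariant_same_dim:
 assumes F: "invariant_subbundle G K \<phi> L \<psi> q F" and g: "g:carrier G" and l: "l:LL"
  and dim: "has_complex_dim (fsp l) n (bundle_fibre F l)"
 shows "has_complex_dim (fsp (\<psi> g l)) n (bundle_fibre F (\<psi> g l))"
proof -
 let ?h = "%f. compose (fib l) f (\<phi> g)"
 have gl: "\<psi> g l:LL" by (rule psi_closed[OF g l])
 have ext: "f:extensional (fib m)" if "f:bundle_fibre F m" "m:LL" for f m using F mspace_fib that by (auto simp: invariant_subbundle_def subbundle_def fun_bundle_def bundle_fibre_def)
 have "bij_betw ?h (bundle_fibre F (\<psi> g l)) (bundle_fibre F l)"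
 proof (rule bij_betw_byWitness[where f' = "%f. compose (fib (\<psi> g l)) f (\<phi> (inv g))"])
  show "ALL f:bundle_fibre F (\<psi> g l). compose (fib (\<psi> g l)) (?h f) (\<phi> (inv g))=f"
  using ext[OF _ gl] phi_inv_fib[OF g l] phi_inv'[OF g]
  by (auto intro!: extensionalityI[of _ "fib (\<psi> g l)"] simp: compose_def) (auto simp: fib_iff)
  show "ALL f:bundle_fibre F l. ?h (compose (fib (\<psi> g l)) f (\<phi> (inv g)))=f" using ext[OF _ l] phi_fib[OF g] phi_inv[OF g]
  by (auto intro!: extensionalityI[of _ "fib l"] simp: compose_def) (auto simp: fib_iff)
  show "?h ` bundle_fibre F (\<psi> g l)<=bundle_fibre F l" using invariant_subbundle_pullback[OF F g l] by blast
  show "(%f. compose (fib (\<psi> g l)) f (\<phi> (inv g))) ` bundle_fibre F l<=bundle_fibre F (\<psi> g l)"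
  using F g unfolding invariant_subbundle_def bundle_fibre_def by fastforce
 qed
 moreover have "?h (\<lambda>x\<in>fib (\<psi> g l). f x + k x)=(\<lambda>x\<in>fib l. ?h f x + ?h k x)" for f k :: "'c => complex"
  unfolding compose_def using phi_fib[OF g, of _ l] by (intro restrict_ext) simp
 moreover have "?h (\<lambda>x\<in>fib (\<psi> g l). r * f x)=(\<lambda>x\<in>fib l. r * ?h f x)" for f :: "'c => complex" and r
  unfolding compose_def using phi_fib[OF g, of _ l] by (intro restrict_ext) simp
 ultimately have "module_iso complex_field (cfun_vec (fsp (\<psi> g l))\<lparr>carrier := bundle_fibre F (\<psi> g l)\<rparr>)
  (cfun_vec (fsp l)\<lparr>carrier := bundle_fibre F l\<rparr>) ?h"
  unfolding module_iso_def carrier_update_sel cfun_vec_sel(3,4) topspace_fib by simp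
 thus ?thesis using dim module_iso_trans unfolding has_complex_dim_def by blast
qed

text \<open>The dimension is locally constant by frames, hence a continuous function on L, and
  invariant because translation is a linear bijection of fibres. Ergodicity makes it
  constant.\<close>

theorem constant_dimension:
 assumes erg: "topologically_ergodic G L \<psi>" and F: "F:lti"
 shows "constant_finite_dim K L q F"
proof -
 have E: "invariant_subbundle G K \<phi> L \<psi> q F" "locally_trivial K L q F" "subbundle K L q F"
  using F by (auto simp: locally_trivial_invariant_subbundles_def invariant_subbundle_def)
 let ?dim = "%l k. has_complex_dim (fsp l) k (bundle_fibre F l)"
 have frame: "EX U n s. openin L U & l:U & frame_on (bundle_fibre F) U n s" if "l:LL" for l
  using locally_trivial_local_frames[OF E(3,2)] that unfolding local_frames_def by blast
 \<comment> \<open>The least k turns the relation \<open>has_complex_dim\<close> into a function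
   without an appeal to uniqueness of the dimension.\<close>
 define d where "d l=(LEAST k. ?dim l k)" for l
 have dim: "?dim l (d l)" if l: "l:LL" for l
 proof -
  obtain U n s where "l:U" "frame_on (bundle_fibre F) U n s" using frame[OF l] by blast
  hence "?dim l n" using frame_iso unfolding has_complex_dim_def by blast
  thus ?thesis unfolding d_def by (rule LeastI)
 qed
 have same: "d l=d m" if "!!k. ?dim l k \<longleftrightarrow> ?dim m k" for l m using that by (simp add: d_def)
 have "cnt L (%l. of_nat (d l) :: complex)" unfolding cont_metric
 proof (intro ballI allI impI)
  fix l and e :: real assume l: "l:LL" and e: "e > 0"
  obtain U n s where U: "openin L U" "l:U" "frame_on (bundle_fibre F) U n s" using frame[OF l] by blast
  have "d l=d m" if "m:U" for m using frames_same_dim[OF U(3)] U(2) that by (intro same) blast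
  thus "EX U. openin L U & l:U & (ALL y:U. dist (of_nat (d l) :: complex) (of_nat (d y)) < e)" using U(1,2) e by (intro exI[of _ U]) auto
 qed
 moreover have "ALL g:carrier G. ALL y:LL. (of_nat (d (\<psi> g y)) :: complex) = of_nat (d y)"
 proof (intro ballI)
  fix g y assume g: "g:carrier G" and y: "y:LL"
  have "?dim y k" if "?dim (\<psi> g y) k" for k
  using invariant_same_dim[OF E(1) _ psi_closed[OF g y] that, of "inv g"] psi_inv[OF g y] g by simp
  thus "(of_nat (d (\<psi> g y)) :: complex) = of_nat (d y)" using invariant_same_dim[OF E(1) g y] by (metis same)
 qed
 ultimately obtain c :: complex where c: "ALL y:LL. of_nat (d y)=c" using erg unfolding topologically_ergodic_def by blast
 obtain l where l: "l:LL" using base.nonempty_space by blast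
 have "d y=d l" if "y:LL" for y using c l that by (metis of_nat_eq_iff)
 thus ?thesis unfolding constant_finite_dim_def using dim by (intro exI[of _ "d l"] ballI) metis
qed

end

section \<open>Fibrewise density of the invariant bundles\<close>

context groupoid_extension
begin

lemma in_span_assoc_mono:
 assumes "!!i. i < n ==> in_span (fib l0) k u (w i)"
 shows "abun l0 n w l<=abun l0 k u l"
proof
 fix f assume f: "f:abun l0 n w l"
 show "f:abun l0 k u l" unfolding abun_def
 proof (intro CollectI conjI ballI impI)
  show "f:extensional (fib l)" using f by (simp add: abun_def)
  fix h assume "h:env" "src h=l0 & tgt h=l"
  hence "in_span (fib l0) n (%i x. complex_of_real (w i x)) (%x. f (arr h x))" using f by (auto simp: abun_def)
  thus "in_span (fib l0) k (%i x. complex_of_real (u i x)) (%x. f (arr h x))" by (rule in_span_trans) (rule in_span_complex, rule assms)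
 qed
qed

text \<open>The function is moved to the fibre over l0, where real and imaginary part are
  approximated separately. The two invariant systems are joined, made independent, and the
  approximation is transported back.\<close>

lemma assoc_bundle_approximation:
 assumes l0: "l0:LL" and l: "l:LL" and f: "cont (f :: 'c => complex)" and e: "e > 0"
 obtains n w h where "isys l0 n w" "indon (fib l0) n w" "h:abun l0 n w l"
  "!!x. x:fib l ==> cmod (f x - h x)<=e"
proof -
 obtain t where t: "t:env" "src t=l0" "tgt t=l" using env_transitive[OF l0 l] by blast
 have "continuous_map (fsp l0) K (arr t)" using arrowsD(4)[OF env_arrow[OF t(1)]] t(2) by (simp add: continuous_map_in_subtopology)
 from continuous_map_compose[OF this f] have "cnt (fsp l0) (%x. f (arr t x))" by (simp add: comp_def)
 then obtain g where g: "cont g" "!!x. x:fib l0 ==> g x=f (arr t x)" using Tietze_complex[OF normal_total closedin_fib[OF l0]] by blast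
 have e2: "e / 2 > 0" using e by simp
 obtain n1 w1 c1 where 1: "isys l0 n1 w1" "!!x. x:fib l0 ==> abs (Re (g x) - (\<Sum>j<n1. c1 j * w1 j x))<=e / 2"
  by (rule Peter_Weyl[OF l0 continuous_map_Re_Im(1)[OF g(1)] e2]) (rule that)
 obtain n2 w2 c2 where 2: "isys l0 n2 w2" "!!x. x:fib l0 ==> abs (Im (g x) - (\<Sum>j<n2. c2 j * w2 j x))<=e / 2"
  by (rule Peter_Weyl[OF l0 continuous_map_Re_Im(2)[OF g(1)] e2]) (rule that)
 obtain k u where u: "isys l0 k u"
  "!!i. i < n1 ==> in_span (fib l0) k u (w1 i)" "!!i. i < n2 ==> in_span (fib l0) k u (w2 i)"
  by (rule invariant_system_join[OF 1(1) 2(1)]) (rule that)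
 obtain m v where v: "isys l0 m v" "indon (fib l0) m v" "!!i. i < k ==> in_span (fib l0) m v (u i)"
  by (rule invariant_system_independent[OF u(1)]) (rule that)
 define a where "a x=complex_of_real (\<Sum>j<n1. c1 j * w1 j x) + \<i> * complex_of_real (\<Sum>j<n2. c2 j * w2 j x)" for x
 have "in_span (fib l0) m v (%x. \<Sum>j<n1. c1 j * w1 j x)" "in_span (fib l0) m v (%x. \<Sum>j<n2. c2 j * w2 j x)"
  using in_span_trans[OF u(2) v(3)] in_span_trans[OF u(3) v(3)] by (auto intro!: in_span_sum in_span_cmult)
 hence a: "in_span (fib l0) m (%i x. complex_of_real (v i x)) a" unfolding a_def by (intro in_span_add in_span_cmult in_span_complex)
 have close: "cmod (g x - a x)<=e" if x: "x:fib l0" for x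
 proof -
  have "cmod (g x - a x)<=abs (Re (g x - a x)) + abs (Im (g x - a x))" by (rule cmod_le)
  also have "... <= e / 2 + e / 2" using 1(2)[OF x] 2(2)[OF x] by (intro add_mono) (simp_all add: a_def)
  finally show ?thesis by simp
 qed
 define h where "h=(\<lambda>y\<in>fib l. a (arr (ainv t) y))"
 have h: "h (arr t x)=a x" if "x:fib l0" for x using env_fib[OF t(1), of x] arr_inv'[OF bij_env[OF t(1)], of x] that t by (simp add: h_def)
 show thesis
 proof (rule that[OF v(1,2), of h])
  show "h:abun l0 m v l"
  proof (rule assoc_bundleI[OF v(1) t])
  show "h:extensional (fib l)" by (simp add: h_def)
  show "in_span (fib l0) m (%i x. complex_of_real (v i x)) (%x. h (arr t x))" using a by (rule in_span_cong[rotated]) (simp add: h)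
  qed
  fix y assume y: "y:fib l"
  then obtain x where x: "x:fib l0" "y=arr t x" using bij_env[OF t(1)] t by (auto simp: bij_betw_def)
  show "cmod (f y - h y)<=e" using close[OF x(1)] g(2)[OF x(1)] h[OF x(1)] x(2) by simp
 qed
qed

lemma local_frames_assoc_bundle:
 assumes w: "isys l0 n w" "indon (fib l0) n w" and l0: "l0:LL"
 shows "local_frames (abun l0 n w)" unfolding local_frames_def
proof
 fix l assume l: "l:LL"
 show "EX U n' s. openin L U & l:U & frame_on (abun l0 n w) U n' s" by (rule assoc_bundle_frames[OF w l0 l]) blast
qed

lemma assoc_bundle_subbundle:
 assumes w: "isys l0 n w" "indon (fib l0) n w" and l0: "l0:LL"
 shows "bundle_of (abun l0 n w):lti"
proof -
 note fr = local_frames_assoc_bundle[OF w l0]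
 have "(\<psi> g l, compose (fib (\<psi> g l)) f (\<phi> (inv g))):bundle_of (abun l0 n w)"
  if "g:carrier G" "(l, f):bundle_of (abun l0 n w)" for g l f
  using assoc_bundle_invariant[OF w(1) l0 that(1), of l f] psi_closed[OF that(1), of l] that(2) by (simp add: bundle_of_def)
 thus ?thesis unfolding locally_trivial_invariant_subbundles_def invariant_subbundle_def
  using locally_trivial_frames[OF fr] subbundle_frames[OF fr] by blast
qed

theorem fibrewise_dense_if_compact_groupoid:
 "fibrewise_dense K L q (\<Union>lti)" unfolding fibrewise_dense_def
proof
 fix l assume l: "l:LL"
 have ne: "topspace (fsp l) ~= {}" unfolding topspace_fib by (rule fib_nonempty[OF l])
 show "mtopology_of (CX (fsp l)) closure_of bundle_fibre (\<Union>lti) l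
  = Cf l" unfolding dense_CX[OF ne] topspace_fib
 proof (intro ballI allI impI)
  fix f and e :: real assume f: "f:Cf l" and e: "e > 0"
  obtain g where g: "cont g" "!!x. x:fib l ==> g x=f x" by (rule extension_fib[OF l f]) (rule that)
  obtain n w h where h: "isys l n w" "indon (fib l) n w" "h:abun l n w l"
  "!!x. x:fib l ==> cmod (g x - h x)<=e" by (rule assoc_bundle_approximation[OF l l g(1) e]) (rule that)
  have E: "bundle_of (abun l n w):lti" by (rule assoc_bundle_subbundle[OF h(1,2) l])
  have mem: "(l, h):bundle_of (abun l n w)" using h(3) l by (simp add: bundle_of_def)
  have "h:Cf l" using E mem unfolding locally_trivial_invariant_subbundles_def invariant_subbundle_def subbundle_def fun_bundle_def by blast
  moreover have "h:bundle_fibre (\<Union>lti) l" using E mem unfolding bundle_fibre_def by blast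
  ultimately show "EX g:bundle_fibre (\<Union>lti) l Int Cf l.
  ALL x:fib l. cmod (f x - g x)<=e" using h(4) g(2) by (intro bexI[of _ h]) auto
 qed
qed

end

section \<open>Invariant submodules\<close>

lemma continuous_map_uniform_limit_dist:
 fixes f :: "'a => 'b::metric_space"
 assumes "!!e. e > 0 ==> EX g. cnt X g & (ALL x:topspace X. dist (f x) (g x)<=e)"
 shows "cnt X f" unfolding cont_metric
proof (intro ballI allI impI)
 fix x and e :: real assume x: "x:topspace X" and e: "e > 0"
 then obtain g where g: "cnt X g" "!!x. x:topspace X ==> dist (f x) (g x)<=e / 4" using assms[of "e / 4"] by auto
 let ?U = "{y:topspace X. dist (g y) (g x) < e / 4}"
 have "dist (f x) (f y) < e" if y: "y:?U" for y
 proof -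
  have "dist (f x) (f y)<=dist (f x) (g x) + (dist (g x) (g y) + dist (g y) (f y))"
  using dist_triangle[of "f x" "f y" "g x"] dist_triangle[of "g x" "f y" "g y"] by linarith
  moreover have "dist (f x) (g x)<=e / 4" "dist (g y) (f y)<=e / 4" "dist (g x) (g y) < e / 4"
  using g(2)[OF x] g(2)[of y] y by (simp_all add: dist_commute)
  ultimately show ?thesis using e by linarith
 qed
 thus "EX U. openin X U & x:U & (ALL y:U. dist (f x) (f y) < e)"
  using openin_dist_less[OF g(1), of "g x" "e / 4"] x e by (intro exI[of _ ?U]) auto
qed

text \<open>Outside U the complement of the closed support C is a neighbourhood on which the
  extension vanishes.\<close>

lemma continuous_map_zero_extension:
 fixes g :: "'a => 'b::real_normed_vector"
 assumes U: "openin X U" and g: "cnt (subtopology X U) g"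
  and C: "closedin X C" "C<=U" "!!x. x:U ==> x ~: C ==> g x=0"
 shows "cnt X (%x. if x:U then g x else 0)" unfolding cont_metric
proof (intro ballI allI impI)
 fix x and e :: real assume x: "x:topspace X" and e: "e > 0"
 show "EX V. openin X V & x:V & (ALL y:V. dist (if x:U then g x else 0) (if y:U then g y else 0) < e)"
 proof (cases "x:U")
  case True
  have top: "topspace (subtopology X U)=U" using openin_subset[OF U] by auto
  obtain V where V: "openin (subtopology X U) V" "x:V" "ALL y:V. dist (g x) (g y) < e" using g[unfolded cont_metric top] True e by blast
  have "openin X V" "V<=U" using V(1) U by (auto simp: openin_open_subtopology)
  thus ?thesis using V True by (intro exI[of _ V]) auto
 next
  case False
  show ?thesis using x False C e by (intro exI[of _ "topspace X - C"]) auto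
 qed
qed

context open_fibration
begin

abbreviation base_ring :: "('l => complex) ring" where
 "base_ring == cfun_ring L"

abbreviation total_module :: "('l => complex, 'k => complex) module" where
 "total_module == cfun_module K q"

lemma continuous_base:
 fixes h :: "'l => 'b::topological_space"
 shows "cnt L h ==> cont (%x. h (q x))" using continuous_map_compose[OF cont_q] by (simp add: comp_def)

lemma const_base: "(\<lambda>l\<in>LL. c):CL" by (rule restrict_CX[OF compact_base]) simp

lemma submodule_totalI:
 assumes H: "H<=M" "M<=CK" "(\<lambda>x\<in>KK. 0):H"
  "!!f g. [|f:H; g:H|] ==> (\<lambda>x\<in>KK. f x + g x):H"
  "!!h f. [|h:CL; f:H|] ==> (\<lambda>x\<in>KK. h (q x) * f x):H"
 shows "submodule H base_ring (total_module\<lparr>carrier := M\<rparr>)"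
proof (rule submodule_functionsI[where X = K])
 show "carrier (total_module\<lparr>carrier := M\<rparr>)<=extensional (KK)" using H(2) mspace_total by auto
 fix f assume f: "f:H"
 have "(\<lambda>x\<in>KK. - f x)=(\<lambda>x\<in>KK. (\<lambda>l\<in>LL. -1) (q x) * f x)" using proj_closed by (intro restrict_ext) simp
 thus "(\<lambda>x\<in>KK. - f x):H" using H(5)[OF const_base f, of "-1"] by simp
qed (use H in auto)

lemma total_update: "total_module\<lparr>carrier := CK\<rparr> = total_module"
 by (simp add: cfun_module_def cfun_ring_def ring.defs module.defs)

lemma submodule_totalD:
 assumes "submodule M base_ring total_module"
 shows "M<=CK" "(\<lambda>x\<in>KK. 0):M"
  "[|f:M; g:M|] ==> (\<lambda>x\<in>KK. f x + g x):M"
  "[|h:CL; f:M|] ==> (\<lambda>x\<in>KK. h (q x) * f x):M" using submodule_closed[OF assms] by simp_all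

lemma submodule_sum:
 assumes zero: "(\<lambda>x\<in>KK. 0):N"
  and add: "!!f g. [|f:N; g:N|] ==> (\<lambda>x\<in>KK. f x + g x):N"
  and mul: "!!h f. [|h:CL; f:N|] ==> (\<lambda>x\<in>KK. h (q x) * f x):N"
  and c: "!!j. j:J ==> c j:CL" and e: "!!j. j:J ==> e j:N"
 shows "(\<lambda>x\<in>KK. \<Sum>j\<in>J. c j (q x) * e j x):N" using c e
proof (induction J rule: infinite_finite_induct)
 case (insert j J)
 let ?f = "\<lambda>x\<in>KK. c j (q x) * e j x" and ?g = "\<lambda>x\<in>KK. \<Sum>j\<in>J. c j (q x) * e j x"
 have f: "?f:N" using mul[of "c j" "e j"] insert.prems by blast
 have g: "?g:N" using insert.IH insert.prems by blast
 have eq: "(\<lambda>x\<in>KK. \<Sum>j\<in>insert j J. c j (q x) * e j x)=(\<lambda>x\<in>KK. ?f x + ?g x)"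
  using insert.hyps by (intro restrict_ext) simp
 show ?case unfolding eq by (rule add[OF f g])
qed (simp_all add: zero)

lemma submodule_freeI:
 fixes I :: "'i set"
 assumes I: "finite I" and H: "H<=I \<rightarrow>\<^sub>E CL" "(\<lambda>i\<in>I. \<lambda>l\<in>LL. 0):H"
  "!!c d. [|c:H; d:H|] ==> (\<lambda>i\<in>I. \<lambda>l\<in>LL. c i l + d i l):H"
  "!!r c. [|r:CL; c:H|] ==> (\<lambda>i\<in>I. \<lambda>l\<in>LL. r l * c i l):H"
 shows "submodule H base_ring (free_module base_ring I)"
proof (rule submodule_negI[where neg = "%c. \<lambda>i\<in>I. \<lambda>l\<in>LL. - c i l"])
 show "H<=carrier (free_module base_ring I)" using H(1) I by auto
 show "(\<lambda>i\<in>I. \<lambda>l\<in>LL. - c i l):H" if "c:H" for c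
 proof -
  have "(\<lambda>i\<in>I. \<lambda>l\<in>LL. (\<lambda>l\<in>LL. -1) l * c i l)=(\<lambda>i\<in>I. \<lambda>l\<in>LL. - c i l)"
  by (intro restrict_ext) simp
  thus ?thesis using H(4)[OF const_base that, of "-1"] by simp
 qed
 fix c d assume cd: "c:H" "d:carrier (free_module base_ring I)" "c \<oplus>\<^bsub>free_module base_ring I\<^esub> d=\<zero>\<^bsub>free_module base_ring I\<^esub>"
 have dE: "d:I \<rightarrow>\<^sub>E CL" using cd(2) by simp
 have "d i=(\<lambda>l\<in>LL. - c i l)" if i: "i:I" for i
 proof (rule extensionalityI[of _ "LL"])
  show "d i:extensional (LL)" using dE i mspace_base by blast
  fix l assume l: "l:LL"
  have "(\<lambda>l\<in>LL. c i l + d i l)=(\<lambda>l\<in>LL. 0)" using fun_cong[OF cd(3), of i] i by simp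
  from fun_cong[OF this, of l] show "d i l=(\<lambda>l\<in>LL. - c i l) l" using l by (simp add: add_eq_0_iff)
 qed simp
 thus "d=(\<lambda>i\<in>I. \<lambda>l\<in>LL. - c i l)" using dE by (intro extensionalityI[of _ I]) (auto simp: PiE_iff)
qed (use H in \<open>auto intro!: restrict_ext\<close>)

context
 fixes M :: "('k => complex) set" and I :: "'i set" and e :: "'i => 'k => complex" and \<phi> :: "'i => ('k => complex) => 'l => complex"
 assumes sub: "submodule M base_ring total_module" and I: "finite I" and e: "!!i. i:I ==> e i:M"
  and \<phi>: "!!i f. [|i:I; f:M|] ==> \<phi> i f:mspace (CX L)"
  and \<phi>_add: "!!i f g l. [|i:I; f:M; g:M; l:topspace L|] ==> \<phi> i (\<lambda>x\<in>topspace K. f x + g x) l=\<phi> i f l + \<phi> i g l"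
  and \<phi>_mul: "!!i h f l. [|i:I; h:mspace (CX L); f:M; l:topspace L|] ==> \<phi> i (\<lambda>x\<in>topspace K. h (q x) * f x) l=h l * \<phi> i f l"
  and dual: "!!f x. [|f:M; x:topspace K|] ==> f x=(\<Sum>i\<in>I. \<phi> i f (q x) * e i x)"
begin

lemma dual_basis_generated: "finitely_generated_module base_ring (total_module\<lparr>carrier := M\<rparr>)"
 unfolding finitely_generated_module_def
proof (intro exI[of _ "e ` I"] conjI)
 note M = submodule_totalD[OF sub]
 show "finite (e ` I)" using I by simp
 show "e ` I<=carrier (total_module\<lparr>carrier := M\<rparr>)" using e by auto
 have "submodule M base_ring (total_module\<lparr>carrier := M\<rparr>)" using M by (intro submodule_totalI) auto
 moreover have "M<=N" if N: "submodule N base_ring (total_module\<lparr>carrier := M\<rparr>)" "e ` I<=N" for N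
 proof
  fix f assume f: "f:M"
  have "(\<lambda>x\<in>KK. \<Sum>i\<in>I. \<phi> i f (q x) * e i x):N"
  using submodule_closed[OF N(1)] N(2) \<phi>[OF _ f] by (intro submodule_sum) auto
  moreover have "f=(\<lambda>x\<in>KK. \<Sum>i\<in>I. \<phi> i f (q x) * e i x)"
  using f M(1) mspace_total dual[OF f] by (intro extensionalityI[of _ "KK"]) auto
  ultimately show "f:N" by simp
 qed
 ultimately show "\<Inter>{N. submodule N base_ring (total_module\<lparr>carrier := M\<rparr>) & e ` I<=N}=carrier (total_module\<lparr>carrier := M\<rparr>)"
  using e by auto
qed

text \<open>The dual basis lemma: f |-> (\<phi> i f) embeds M into the free module, and c |-> \<Sum>
  c i * e i is a left inverse. The image of M and the kernel Q of the left inverse are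
  complementary.\<close>

lemma dual_basis_summand:
 "EX P Q h. let F=free_module base_ring I in
  submodule P base_ring F & submodule Q base_ring F & P Int Q={\<zero>\<^bsub>F\<^esub>} &
  (ALL x:carrier F. EX u:P. EX v:Q. x=u \<oplus>\<^bsub>F\<^esub> v) &
  module_iso base_ring (total_module\<lparr>carrier := M\<rparr>) (F\<lparr>carrier := P\<rparr>) h"
proof -
 note M = submodule_totalD[OF sub]
 let ?F = "free_module base_ring I"
 define h where "h f=(\<lambda>i\<in>I. \<phi> i f)" for f
 define a where "a c=(\<lambda>x\<in>KK. \<Sum>i\<in>I. c i (q x) * e i x)" for c
 define Q where "Q={c:I \<rightarrow>\<^sub>E CL. ALL x:KK. (\<Sum>i\<in>I. c i (q x) * e i x)=0}"
 have carF: "carrier ?F=I \<rightarrow>\<^sub>E CL" using I by auto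
 have hE: "h f:I \<rightarrow>\<^sub>E CL" if "f:M" for f using \<phi>[OF _ that] by (simp add: h_def)
 have \<phi>ext: "\<phi> i f:extensional (LL)" if "i:I" "f:M" for i f using \<phi>[OF that] mspace_base by blast
 have hadd: "h (\<lambda>x\<in>KK. f x + g x)=(\<lambda>i\<in>I. \<lambda>l\<in>LL. h f i l + h g i l)" if "f:M" "g:M" for f g
  unfolding h_def using \<phi>_add[OF _ that] \<phi>ext[OF _ M(3)[OF that]] by (intro restrict_ext extensionalityI[of _ "LL"]) auto
 have hmul: "h (\<lambda>x\<in>KK. r (q x) * f x)=(\<lambda>i\<in>I. \<lambda>l\<in>LL. r l * h f i l)" if "r:CL" "f:M" for f r
  unfolding h_def using \<phi>_mul[OF _ that] \<phi>ext[OF _ M(4)[OF that]] by (intro restrict_ext extensionalityI[of _ "LL"]) auto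
 have hzero: "h (\<lambda>x\<in>KK. 0)=(\<lambda>i\<in>I. \<lambda>l\<in>LL. 0)"
 proof -
  have "(\<lambda>x\<in>KK. (\<lambda>l\<in>LL. 0) (q x) * (\<lambda>x\<in>KK. 0) x)=(\<lambda>x\<in>KK. 0 :: complex)"
  by (intro restrict_ext) simp
  moreover have "(\<lambda>i\<in>I. \<lambda>l\<in>LL. (\<lambda>l\<in>LL. 0) l * h (\<lambda>x\<in>KK. 0) i l)=(\<lambda>i\<in>I. \<lambda>l\<in>LL. 0)"
  by (intro restrict_ext) simp
  ultimately show ?thesis using hmul[OF const_base M(2), of 0] by simp
 qed
 have aM: "a c:M" if "c:I \<rightarrow>\<^sub>E CL" for c unfolding a_def using that e by (intro submodule_sum M(2,3,4)) auto
 have ah: "a (h f)=f" if f: "f:M" for f using f M(1) mspace_total dual[OF f] by (intro extensionalityI[of _ "KK"]) (auto simp: a_def h_def)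
 have P: "submodule (h ` M) base_ring ?F"
 proof (rule submodule_freeI[OF I])
  show "h ` M<=I \<rightarrow>\<^sub>E CL" using hE by blast
  show "(\<lambda>i\<in>I. \<lambda>l\<in>LL. 0):h ` M" using hzero M(2) by (metis imageI)
  show "(\<lambda>i\<in>I. \<lambda>l\<in>LL. c i l + d i l):h ` M" if cd: "c:h ` M" "d:h ` M" for c d
  proof -
  obtain f g where fg: "c=h f" "d=h g" "f:M" "g:M" using cd by blast
  show ?thesis unfolding fg(1,2) hadd[OF fg(3,4), symmetric] by (rule imageI[OF M(3)[OF fg(3,4)]])
  qed
  show "(\<lambda>i\<in>I. \<lambda>l\<in>LL. r l * c i l):h ` M" if rc: "r:CL" "c:h ` M" for r c
  proof -
  obtain f where f: "c=h f" "f:M" using rc(2) by blast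
  show ?thesis unfolding f(1) hmul[OF rc(1) f(2), symmetric] by (rule imageI[OF M(4)[OF rc(1) f(2)]])
  qed
 qed
 have Q: "submodule Q base_ring ?F"
 proof (rule submodule_freeI[OF I])
  show "Q<=I \<rightarrow>\<^sub>E CL" by (auto simp: Q_def)
  show "(\<lambda>i\<in>I. \<lambda>l\<in>LL. 0):Q" using const_base[of 0] proj_closed by (auto simp: Q_def intro!: sum.neutral)
  show "(\<lambda>i\<in>I. \<lambda>l\<in>LL. c i l + d i l):Q" if cd: "c:Q" "d:Q" for c d
  proof -
  have "(\<lambda>l\<in>LL. c i l + d i l):CL" if "i:I" for i
  using cd that mspace_base by (intro restrict_CX[OF compact_base] continuous_map_add) (auto simp: Q_def PiE_iff)
  moreover have "(\<Sum>i\<in>I. (c i (q x) + d i (q x)) * e i x)=0" if "x:KK" for x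
  using cd that by (simp add: Q_def distrib_right sum.distrib)
  ultimately show ?thesis using proj_closed by (simp add: Q_def)
  qed
  show "(\<lambda>i\<in>I. \<lambda>l\<in>LL. r l * c i l):Q" if rc: "r:CL" "c:Q" for r c
  proof -
  have "(\<lambda>l\<in>LL. r l * c i l):CL" if "i:I" for i
  using rc that mspace_base by (intro restrict_CX[OF compact_base] continuous_map_mult_algebra) (auto simp: Q_def PiE_iff)
  moreover have "(\<Sum>i\<in>I. (r (q x) * c i (q x)) * e i x)=0" if "x:KK" for x
  using rc that by (simp add: Q_def mult.assoc flip: sum_distrib_left)
  ultimately show ?thesis using proj_closed by (simp add: Q_def)
  qed
 qed
 have PQ: "h ` M Int Q={\<zero>\<^bsub>?F\<^esub>}"
 proof (intro equalityI subsetI)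
  fix c assume c: "c:h ` M Int Q"
  then obtain f where f: "c=h f" "f:M" by blast
  have "f=a c" using ah[OF f(2)] f(1) by simp
  also have "... = (\<lambda>x\<in>KK. 0)" unfolding a_def using c by (intro restrict_ext) (simp add: Q_def)
  finally show "c:{\<zero>\<^bsub>?F\<^esub>}" using hzero f(1) by simp
 next
  fix c assume "c:{\<zero>\<^bsub>?F\<^esub>}"
  thus "c:h ` M Int Q" using submodule_closed(2)[OF P] submodule_closed(2)[OF Q] by blast
 qed
 have split: "EX u:h ` M. EX v:Q. c=u \<oplus>\<^bsub>?F\<^esub> v" if c: "c:carrier ?F" for c
 proof -
  have cE: "c:I \<rightarrow>\<^sub>E CL" using c unfolding carF .
  let ?u = "h (a c)"
  let ?v = "\<lambda>i\<in>I. \<lambda>l\<in>LL. c i l - ?u i l"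
  have uE: "?u:I \<rightarrow>\<^sub>E CL" by (rule hE[OF aM[OF cE]])
  have "?v:Q"
  proof -
  have "(\<lambda>l\<in>LL. c i l - ?u i l):CL" if "i:I" for i
  using cE uE that mspace_base by (intro restrict_CX[OF compact_base] continuous_map_diff) (auto simp: PiE_iff)
  moreover have "(\<Sum>i\<in>I. (c i (q x) - ?u i (q x)) * e i x)=0" if x: "x:KK" for x
  using fun_cong[OF ah[OF aM[OF cE]], of x] x by (simp add: a_def left_diff_distrib sum_subtractf)
  ultimately show ?thesis using proj_closed by (simp add: Q_def)
  qed
  moreover have "c=?u \<oplus>\<^bsub>?F\<^esub> ?v"
  proof -
  have "c i=(\<lambda>l\<in>LL. c i l)" if "i:I" for i using cE that mspace_base by (intro extensionalityI[of _ "LL"]) (auto simp: PiE_iff)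
  hence "c=(\<lambda>i\<in>I. \<lambda>l\<in>LL. c i l)" using cE by (intro extensionalityI[of _ I]) (auto simp: PiE_iff)
  also have "... = ?u \<oplus>\<^bsub>?F\<^esub> ?v" unfolding free_module_sel cfun_ring_sel by (intro restrict_ext) simp
  finally show ?thesis .
  qed
  ultimately show ?thesis using aM[OF cE] by blast
 qed
 have "module_iso base_ring (total_module\<lparr>carrier := M\<rparr>) (?F\<lparr>carrier := h ` M\<rparr>) h"
  unfolding module_iso_def carrier_update_sel cfun_module_sel free_module_sel cfun_ring_sel
 proof (intro conjI ballI)
  have "inj_on h M" using ah by (intro inj_on_inverseI)
  thus "bij_betw h (carrier (total_module\<lparr>carrier := M\<rparr>)) (carrier (?F\<lparr>carrier := h ` M\<rparr>))" by (simp add: bij_betw_def)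
  show "h (\<lambda>x\<in>KK. f x + g x)=(\<lambda>i\<in>I. \<lambda>l\<in>LL. h f i l + h g i l)"
  if "f:carrier (total_module\<lparr>carrier := M\<rparr>)" "g:carrier (total_module\<lparr>carrier := M\<rparr>)" for f g using hadd that by simp
  show "h (\<lambda>x\<in>KK. r (q x) * f x)=(\<lambda>i\<in>I. \<lambda>l\<in>LL. r l * h f i l)"
  if "r:CL" "f:carrier (total_module\<lparr>carrier := M\<rparr>)" for r f using hmul that by simp
 qed
 thus ?thesis unfolding Let_def using P Q PQ split by blast
qed

end

section \<open>Modules of sections\<close>

definition sections :: "('l => ('k => complex) set) => ('k => complex) set" where
 "sections F={f:CK. ALL l:LL. restrict f (fib l):F l}"

lemma restrict_restrict_fib: "restrict (restrict f (KK)) (fib l)=restrict f (fib l)" using fib_subset by (simp add: Int_absorb1)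

lemma sectionsI:
 "[|cont f; !!l. l:LL ==> restrict f (fib l):F l|] ==> restrict f (KK):sections F"
 unfolding sections_def mem_Collect_eq restrict_restrict_fib using restrict_CX[OF compact_total] by blast

lemma submodule_sections:
 assumes F: "local_frames F"
 shows "submodule (sections F) base_ring total_module"
proof -
 have fr: "EX U n s. l:U & frame_on F U n s" if "l:LL" for l using F that unfolding local_frames_def by blast
 have cl: "(\<lambda>x\<in>fib l. 0):F l" "[|f:F l; g:F l|] ==> (\<lambda>x\<in>fib l. f x + g x):F l" "f:F l ==> (\<lambda>x\<in>fib l. r * f x):F l"
  if l: "l:LL" for l f g r using fr[OF l] frame_closed_under by blast+
 have "submodule (sections F) base_ring (total_module\<lparr>carrier := CK\<rparr>)"
 proof (rule submodule_totalI)
  show "(\<lambda>x\<in>KK. 0):sections F" using cl(1) by (intro sectionsI) auto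
  show "(\<lambda>x\<in>KK. f x + g x):sections F" if fg: "f:sections F" "g:sections F" for f g
  proof (rule sectionsI)
  show "cont (%x. f x + g x)" using fg mspace_total by (intro continuous_map_add) (auto simp: sections_def)
  fix l assume l: "l:LL"
  have "(\<lambda>x\<in>fib l. restrict f (fib l) x + restrict g (fib l) x):F l" using fg l unfolding sections_def by (intro cl(2)) blast+
  moreover have "(\<lambda>x\<in>fib l. restrict f (fib l) x + restrict g (fib l) x)=(\<lambda>x\<in>fib l. f x + g x)" by (intro restrict_ext) simp
  ultimately show "(\<lambda>x\<in>fib l. f x + g x):F l" by simp
  qed
  show "(\<lambda>x\<in>KK. h (q x) * f x):sections F" if hf: "h:CL" "f:sections F" for h f
  proof (rule sectionsI)
  show "cont (%x. h (q x) * f x)"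
  using hf mspace_total mspace_base by (intro continuous_map_mult_algebra continuous_base) (auto simp: sections_def)
  fix l assume l: "l:LL"
  have "(\<lambda>x\<in>fib l. h l * restrict f (fib l) x):F l" using hf l unfolding sections_def by (intro cl(3)) blast+
  moreover have "(\<lambda>x\<in>fib l. h l * restrict f (fib l) x)=(\<lambda>x\<in>fib l. h (q x) * f x)" by (intro restrict_ext) (simp add: fib_iff)
  ultimately show "(\<lambda>x\<in>fib l. h (q x) * f x):F l" by simp
  qed
 qed (auto simp: sections_def)
 thus ?thesis unfolding total_update .
qed

lemma total_nonempty: "l:LL ==> KK ~= {}" using fib_nonempty fib_subset by blast

lemma closedin_sections:
 assumes F: "local_frames F" and ne: "LL ~= {}"
 shows "closedin (mtopology_of (CX K)) (sections F)"
proof -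
 have neK: "KK ~= {}" using ne total_nonempty by blast
 have sub: "sections F<=CK" by (auto simp: sections_def)
 show ?thesis unfolding closedin_CX[OF neK sub]
 proof (intro ballI impI)
  fix f assume f: "f:CK" and app: "ALL e>0. EX g:sections F. ALL x:KK. cmod (f x - g x)<=e"
  have "restrict f (fib l):F l" if l: "l:LL" for l
  proof -
  obtain U n s where U: "l:U" "frame_on F U n s" using F l unfolding local_frames_def by blast
  have nel: "topspace (fsp l) ~= {}" unfolding topspace_fib by (rule fib_nonempty[OF l])
  have fl: "restrict f (fib l):Cf l" using f mspace_total by (intro restrict_fib[OF l]) blast
  have "EX g:F l. ALL x:fib l. cmod (restrict f (fib l) x - g x)<=e" if e: "e > 0" for e
  proof -
  obtain g where g: "g:sections F" "ALL x:KK. cmod (f x - g x)<=e" using app e by blast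
  thus ?thesis using l fib_subset by (intro bexI[of _ "restrict g (fib l)"]) (auto simp: sections_def fib_iff)
  qed
  thus ?thesis using frame_closedin[OF U(2,1) l, unfolded closedin_CX[OF nel frame_mspace[OF U(2,1) l]] topspace_fib] fl by blast
  qed
  thus "f:sections F" using f by (simp add: sections_def)
 qed
qed

lemma coeffs_section_continuous:
 assumes fr: "frame_on F U n s" and U: "openin L U" and f: "cont f"
  and mem: "!!l. l:U ==> restrict f (fib l):F l" and i: "i < n"
 shows "cnt (subtopology L U) (%l. coeffs n s l (restrict f (fib l)) i)"
proof -
 have UL: "U<=LL" using openin_subset[OF U] .
 \<comment> \<open>The function f is regarded as a system of one section with the constant
   coefficient 1, so that the continuity of \<open>frame_map\<close> applies to it.\<close>
 define c where "c=restrict (%_. 1 :: complex) {..<1::nat}"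
 have comb1: "comb 1 (%_. f) c=f" by (simp add: comb_def c_def fun_eq_iff)
 have "continuous_map L (coord_space 1) (%_. c)" by (rule continuous_map_const[THEN iffD2]) (simp add: c_def restrict_PiE_iff)
 hence "continuous_map L (prod_topology L (coord_space 1)) (%m. (m, c))"
  using continuous_map_id[of L] by (intro continuous_map_pairedI) (simp_all only: id_def)
 from continuous_map_compose[OF this continuous_frame_map[of 1 "%_. f", OF f]]
 have "continuous_map L btop (%l. (l, restrict f (fib l)))" unfolding comp_def frame_map_def prod.case comb1 .
 hence "continuous_map (subtopology L U) (subtopology btop {e:bundle_of F. fst e:U}) (%l. (l, restrict f (fib l)))"
  using mem UL by (auto simp: continuous_map_in_subtopology bundle_of_def intro: continuous_map_from_subtopology)
 from continuous_map_compose[OF this frame_coeffs_continuous[OF fr U order_refl]]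
 have "continuous_map (subtopology L U) (prod_topology (subtopology L U) (coord_space n)) (%l. (l, coeffs n s l (restrict f (fib l))))"
  by (simp add: comp_def)
 from continuous_map_compose[OF this continuous_map_snd]
 have "continuous_map (subtopology L U) (coord_space n) (%l. coeffs n s l (restrict f (fib l)))" by (simp add: comp_def)
 thus ?thesis using i unfolding continuous_map_componentwise by blast
qed

end

context open_fibration
begin

lemma frame_coeffs_linear:
 assumes fr: "frame_on F U n s" and l: "l:U" and i: "i < n"
 shows "[|f:F l; g:F l|] ==> coeffs n s l (\<lambda>x\<in>fib l. f x + g x) i=coeffs n s l f i + coeffs n s l g i"
  "f:F l ==> coeffs n s l (\<lambda>x\<in>fib l. r * f x) i=r * coeffs n s l f i"
proof -
 have ind: "indep n s l" using fr l by (auto simp: frame_on_def)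
 have cf: "f x=comb n s (coeffs n s l f) x" if "f:F l" "x:fib l" for f x
  using fun_cong[OF comb_coeffs[OF fr l that(1)], of x] that(2) by simp
 show "coeffs n s l (\<lambda>x\<in>fib l. f x + g x) i=coeffs n s l f i + coeffs n s l g i" if fg: "f:F l" "g:F l"
 proof -
  have "(\<lambda>x\<in>fib l. f x + g x)=restrict (comb n s (%i. coeffs n s l f i + coeffs n s l g i)) (fib l)"
  unfolding comb_add using cf fg by (intro restrict_ext) (simp add: comb_add)
  from coeffs_eqI[OF ind this i] show ?thesis .
 qed
 show "coeffs n s l (\<lambda>x\<in>fib l. r * f x) i=r * coeffs n s l f i" if f: "f:F l" using cf f restrict_ext coeffs_eqI ind i by (smt (verit) comb_scale)
qed

text \<open>A partition of unity subordinate to finitely many frames of global sections yields a finite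
 dual basis of the module of sections.\<close>

lemma sections_fg_projective:
 fixes F :: "'l => ('k => complex) set"
 assumes fr: "!!l. l:LL ==> EX U n s. openin L U & l:U & frame_on F U n s &
  (ALL i<n. ALL m:LL. restrict (s i) (fib m):F m)"
 shows "finitely_generated_module base_ring (total_module\<lparr>carrier := sections F\<rparr>)"
  "projective_module base_ring (total_module\<lparr>carrier := sections F\<rparr>)"
proof -
 have lf: "local_frames F" using fr by (force simp: local_frames_def)
 note sub = submodule_sections[OF lf]
 have "ALL l:LL. EX D. openin L (fst D) & l:fst D & frame_on F (fst D) (fst (snd D)) (snd (snd D)) &
  (ALL i<fst (snd D). ALL m:LL. restrict (snd (snd D) i) (fib m):F m)"
 proof
  fix l assume l: "l:LL"
  obtain U n s where "openin L U" "l:U" "frame_on F U n s" "ALL i<n. ALL m:LL. restrict (s i) (fib m):F m"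
  using fr[OF l] by (elim exE conjE) (rule that)
  thus "EX D. openin L (fst D) & l:fst D & frame_on F (fst D) (fst (snd D)) (snd (snd D)) &
  (ALL i<fst (snd D). ALL m:LL. restrict (snd (snd D) i) (fib m):F m)" by (intro exI[of _ "(U, n, s)"]) (simp only: fst_conv snd_conv)
 qed
 from bchoice[OF this] obtain D where D: "ALL l:LL. openin L (fst (D l)) & l:fst (D l) &
  frame_on F (fst (D l)) (fst (snd (D l))) (snd (snd (D l))) &
  (ALL i<fst (snd (D l)). ALL m:LL. restrict (snd (snd (D l)) i) (fib m):F m)" ..
 define U n s where "U l=fst (D l)" and "n l=fst (snd (D l))" and "s l=snd (snd (D l))" for l
 have U: "openin L (U l)" "l:U l" "frame_on F (U l) (n l) (s l)"
  "!!i m. [|i < n l; m:LL|] ==> restrict (s l i) (fib m):F m" if "l:LL" for l using D that unfolding U_def n_def s_def by blast+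
 have "compactin L (LL)" using compact_base by (simp add: compact_space_def)
 then obtain A where A: "finite A" "A<=LL" "LL<=(\<Union>l\<in>A. U l)" by (rule compactin_pointwise[of L "LL" U]) (use U in auto)
 obtain r :: "'l => 'l => real" where r: "!!a. a:A ==> cntR L (r a)"
  "!!a. a:A ==> EX C. closedin L C & C<=U a & (ALL x:LL. x ~: C --> r a x=0)"
  "!!a x. a:A ==> x:LL ==> x ~: U a ==> r a x=0"
  "!!x. x:LL ==> (\<Sum>a\<in>A. r a x)=1" by (rule partition_of_unity[OF compact_base Hausdorff_base A(1), of U]) (use U A in auto)
 define J where "J=(SIGMA a:A. {..<n a})"
 have finJ: "finite J" using A(1) by (simp add: J_def)
 define e where "e j=restrict (s (fst j) (snd j)) (KK)" for j
 \<comment> \<open>Local coordinates cut off by the partition of unity. Reassembled with the global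
   sections e, the pieces over each neighbourhood give r a times f, and these add up to f.\<close>
 define \<phi> where "\<phi> j f=(\<lambda>m\<in>LL. if m:U (fst j) then
  complex_of_real (r (fst j) m) * coeffs (n (fst j)) (s (fst j)) m (restrict f (fib m)) (snd j) else 0)" for j f
 have J: "fst j:A & fst j:LL & snd j < n (fst j)" if "j:J" for j using that A(2) by (auto simp: J_def)
 have secF: "cont f" "!!m. m:LL ==> restrict f (fib m):F m" if "f:sections F" for f using that mspace_total by (auto simp: sections_def)
 have eS: "e j:sections F" if "j:J" for j unfolding e_def using U(3,4) J[OF that] by (intro sectionsI) (auto simp: frame_on_def)
 have \<phi>C: "\<phi> j f:CL" if j: "j:J" and f: "f:sections F" for j f
 proof -
  let ?a = "fst j"
  let ?g = "%m. complex_of_real (r ?a m) * coeffs (n ?a) (s ?a) m (restrict f (fib m)) (snd j)"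
  note a = J[OF j]
  have UL: "U ?a<=LL" using U(1) a openin_subset by blast
  obtain C where C: "closedin L C" "C<=U ?a" "ALL x:LL. x ~: C --> r ?a x=0" using r(2) a by blast
  have "cnt (subtopology L (U ?a)) (%m. coeffs (n ?a) (s ?a) m (restrict f (fib m)) (snd j))"
  using a U(1,3) secF[OF f] UL by (intro coeffs_section_continuous) auto
  moreover have "cntR (subtopology L (U ?a)) (r ?a)" using r(1) a by (intro continuous_map_from_subtopology) auto
  ultimately have "cnt (subtopology L (U ?a)) ?g" by (intro continuous_map_mult_algebra continuous_map_complex_of_real)
  hence "cnt L (%m. if m:U ?a then ?g m else 0)" using C UL U(1) a by (intro continuous_map_zero_extension[OF _ _ C(1,2)]) auto
  thus ?thesis unfolding \<phi>_def by (rule restrict_CX[OF compact_base])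
 qed
 have add: "\<phi> j (\<lambda>x\<in>KK. f x + g x) m=\<phi> j f m + \<phi> j g m"
  if j: "j:J" and fg: "f:sections F" "g:sections F" and m: "m:LL" for j f g m
 proof -
  have "restrict (\<lambda>x\<in>KK. f x + g x) (fib m)=(\<lambda>x\<in>fib m. restrict f (fib m) x + restrict g (fib m) x)"
  unfolding restrict_restrict_fib by (intro restrict_ext) simp
  thus ?thesis
  using frame_coeffs_linear(1)[OF U(3), of "fst j" m "snd j" "restrict f (fib m)" "restrict g (fib m)"] J[OF j] secF(2)[OF fg(1) m] secF(2)[OF fg(2) m] m
  unfolding \<phi>_def by (simp only: restrict_apply' ring_distribs) (simp add: ring_distribs)
 qed
 have mul: "\<phi> j (\<lambda>x\<in>KK. h (q x) * f x) m=h m * \<phi> j f m"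
  if j: "j:J" and h: "h:CL" and f: "f:sections F" and m: "m:LL" for j h f m
 proof -
  have "restrict (\<lambda>x\<in>KK. h (q x) * f x) (fib m)=(\<lambda>x\<in>fib m. h m * restrict f (fib m) x)"
  unfolding restrict_restrict_fib by (intro restrict_ext) (simp add: fib_iff)
  thus ?thesis using frame_coeffs_linear(2)[OF U(3), of "fst j" m "snd j" "restrict f (fib m)" "h m"] J[OF j] secF(2)[OF f m] m
  unfolding \<phi>_def by (simp only: restrict_apply') simp
 qed
 have dual: "f x=(\<Sum>j\<in>J. \<phi> j f (q x) * e j x)" if f: "f:sections F" and x: "x:KK" for f x
 proof -
  define m where "m=q x"
  have m: "m:LL" "x:fib m" using x proj_closed by (auto simp: m_def fib_iff)
  have inner: "(\<Sum>i<n a. \<phi> (a, i) f m * e (a, i) x)=complex_of_real (r a m) * f x" if a: "a:A" for a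
  proof (cases "m:U a")
  case True
  have aL: "a:LL" using a A(2) by blast
  have "restrict (comb (n a) (s a) (coeffs (n a) (s a) m (restrict f (fib m)))) (fib m) x=restrict f (fib m) x"
  by (rule fun_cong[OF comb_coeffs[OF U(3)[OF aL] True secF(2)[OF f m(1)]]])
  hence "f x=comb (n a) (s a) (coeffs (n a) (s a) m (restrict f (fib m))) x" unfolding restrict_apply'[OF m(2)] by (rule sym)
  thus ?thesis using True x m(1) by (simp add: \<phi>_def e_def comb_def sum_distrib_left mult.assoc)
  next
  case False
  thus ?thesis using r(3)[OF a m(1) False] m(1) by (simp add: \<phi>_def)
  qed
  have "(\<Sum>j\<in>J. \<phi> j f m * e j x)=(\<Sum>a\<in>A. \<Sum>i<n a. \<phi> (a, i) f m * e (a, i) x)"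
  unfolding J_def using A(1) by (subst sum.Sigma) (auto simp: case_prod_unfold)
  also have "... = (\<Sum>a\<in>A. complex_of_real (r a m)) * f x" by (simp add: inner sum_distrib_right)
  also have "(\<Sum>a\<in>A. complex_of_real (r a m))=1" using r(4)[OF m(1)] by (simp flip: of_real_sum)
  finally show ?thesis by (simp add: m_def)
 qed
 show "finitely_generated_module base_ring (total_module\<lparr>carrier := sections F\<rparr>)"
  by (rule dual_basis_generated[where I = J and e = e and \<phi> = \<phi>]) (fact sub finJ eS \<phi>C add mul dual)+
 obtain b :: "'l \<times> nat => nat" where b: "inj_on b J" using finite_imp_inj_to_nat_seg[OF finJ] by metis
 \<comment> \<open>\<open>projective_module\<close> wants index sets of the type of the module
   elements, so J is copied into that type as a set of distinct constant functions.\<close>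
 define \<kappa> where "\<kappa> j=(%_ :: 'k. of_nat (b j) :: complex)" for j
 have \<kappa>: "inj_on \<kappa> J" using b unfolding inj_on_def \<kappa>_def by (metis of_nat_eq_iff)
 let ?v = "inv_into J \<kappa>"
 have v: "?v i:J" if "i:\<kappa> ` J" for i using that by (rule inv_into_into)
 have dual': "f x=(\<Sum>i\<in>\<kappa> ` J. \<phi> (?v i) f (q x) * e (?v i) x)" if "f:sections F" "x:KK" for f x
  using dual[OF that] \<kappa> by (simp add: sum.reindex)
 have fin': "finite (\<kappa> ` J)" using finJ by simp
 have "EX P Q h. let F'=free_module base_ring (\<kappa> ` J) in
  submodule P base_ring F' & submodule Q base_ring F' & P Int Q={\<zero>\<^bsub>F'\<^esub>} &
  (ALL x:carrier F'. EX u:P. EX v:Q. x=u \<oplus>\<^bsub>F'\<^esub> v) &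
  module_iso base_ring (total_module\<lparr>carrier := sections F\<rparr>) (F'\<lparr>carrier := P\<rparr>) h"
  by (rule dual_basis_summand[where e = "%i. e (?v i)" and \<phi> = "%i. \<phi> (?v i)"])
  (fact sub fin' eS[OF v] \<phi>C[OF v] add[OF v] mul[OF v] dual')+
 thus "projective_module base_ring (total_module\<lparr>carrier := sections F\<rparr>)" unfolding projective_module_def by (rule exI)
qed

section \<open>Finitely generated closed submodules have local frames\<close>

text \<open>The explicit combinations with coefficients in C(L) form a submodule containing the
  generators, hence all of M.\<close>

lemma finite_generators:
 assumes sub: "submodule M base_ring total_module"
  and fg: "finitely_generated_module base_ring (total_module\<lparr>carrier := M\<rparr>)"
 obtains n :: nat and s where "!!i. i < n ==> s i:M"
  "!!f. f:M ==> EX c. (ALL i<n. c i:CL) & (ALL x:KK. f x=(\<Sum>i<n. c i (q x) * s i x))"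
proof -
 note M = submodule_totalD[OF sub]
 obtain S where S: "finite S" "S<=M" "\<Inter>{N. submodule N base_ring (total_module\<lparr>carrier := M\<rparr>) & S<=N}=M"
  using fg unfolding finitely_generated_module_def by auto
 obtain n s where s: "S=s ` {i. i < (n :: nat)}" using S(1) finite_imp_nat_seg_image_inj_on by blast
 have sM: "s i:M" if "i < n" for i using S(2) s that by blast
 define N where "N={f:M. EX c. (ALL i<n. c i:CL) & (ALL x:KK. f x=(\<Sum>i<n. c i (q x) * s i x))}"
 have N: "submodule N base_ring (total_module\<lparr>carrier := M\<rparr>)"
 proof (rule submodule_totalI)
  show "N<=M" "M<=CK" using M(1) by (auto simp: N_def)
  have "ALL x:KK. (\<lambda>x\<in>KK. 0) x=(\<Sum>i<n. (\<lambda>l\<in>LL. 0) (q x) * s i x)" using proj_closed by simp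
  thus "(\<lambda>x\<in>KK. 0):N" unfolding N_def using M(2) const_base by (intro CollectI conjI exI[of _ "%i. \<lambda>l\<in>LL. 0"]) auto
  show "(\<lambda>x\<in>KK. f x + g x):N" if fg: "f:N" "g:N" for f g
  proof -
  obtain c d where cd: "ALL i<n. c i:CL" "ALL x:KK. f x=(\<Sum>i<n. c i (q x) * s i x)"
  "ALL i<n. d i:CL" "ALL x:KK. g x=(\<Sum>i<n. d i (q x) * s i x)" "f:M" "g:M" using fg unfolding N_def by blast
  have "(\<lambda>l\<in>LL. c i l + d i l):CL" if "i < n" for i
  using cd that mspace_base by (intro restrict_CX[OF compact_base] continuous_map_add) auto
  moreover have "f x + g x=(\<Sum>i<n. (\<lambda>l\<in>LL. c i l + d i l) (q x) * s i x)" if "x:KK" for x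
  using cd that proj_closed by (simp add: distrib_right sum.distrib)
  ultimately show ?thesis
  unfolding N_def using M(3)[OF cd(5,6)] by (intro CollectI conjI exI[of _ "%i. \<lambda>l\<in>LL. c i l + d i l"]) auto
  qed
  show "(\<lambda>x\<in>KK. h (q x) * f x):N" if hf: "h:CL" "f:N" for h f
  proof -
  obtain c where c: "ALL i<n. c i:CL" "ALL x:KK. f x=(\<Sum>i<n. c i (q x) * s i x)" "f:M" using hf(2) unfolding N_def by blast
  have "(\<lambda>l\<in>LL. h l * c i l):CL" if "i < n" for i
  using c hf(1) that mspace_base by (intro restrict_CX[OF compact_base] continuous_map_mult_algebra) auto
  moreover have "h (q x) * f x=(\<Sum>i<n. (\<lambda>l\<in>LL. h l * c i l) (q x) * s i x)" if "x:KK" for x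
  using c that proj_closed by (simp add: sum_distrib_left mult.assoc)
  ultimately show ?thesis
  unfolding N_def using M(4)[OF hf(1) c(3)] by (intro CollectI conjI exI[of _ "%i. \<lambda>l\<in>LL. h l * c i l"]) auto
  qed
 qed
 have "s k:N" if k: "k < n" for k
 proof -
  have "s k x=(\<Sum>i<n. (\<lambda>l\<in>LL. if i=k then 1 else 0) (q x) * s i x)" if "x:KK" for x
  using k that proj_closed by (simp add: if_distrib[of "%t. t * _"] cong: if_cong)
  thus ?thesis unfolding N_def using sM[OF k] const_base
  by (intro CollectI conjI exI[of _ "%i. \<lambda>l\<in>LL. if i=k then 1 else 0"]) auto
 qed
 hence "S<=N" using s by blast
 hence "M<=N" using S(3) N by blast
 thus thesis using sM by (intro that[of n s]) (auto simp: N_def)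
qed

text \<open>Neighbouring fibres approximate each other in both directions, which bounds the change
  of the supremum from above and from below.\<close>

lemma continuous_fibre_norm:
 assumes f: "cont (f :: 'k => complex)"
 shows "cntR L (%l. SUP x\<in>fib l. cmod (f x))"
  "x:KK ==> cmod (f x)<=(SUP x\<in>fib (q x). cmod (f x))"
proof -
 obtain B where B: "!!x. x:KK ==> cmod (f x)<=B" using bounded_sections[of 1 "%_. f"] f by auto
 have bdd: "bdd_above ((%x. cmod (f x)) ` fib l)" for l using B fib_subset by (intro bdd_aboveI[of _ B]) blast
 show "cmod (f x)<=(SUP x\<in>fib (q x). cmod (f x))" if "x:KK" using that by (intro cSUP_upper bdd) (simp add: fib_iff)
 show "cntR L (%l. SUP x\<in>fib l. cmod (f x))" unfolding cont_metric
 proof (intro ballI allI impI)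
  fix l0 and e :: real assume l0: "l0:LL" and e: "e > 0"
  have e2: "e / 2 > 0" using e by simp
  obtain U where U: "openin L U" "l0:U"
  "!!l x. [|l:U; x:fib l|] ==> EX y:fib l0. ALL i:{()}. dist (f x) (f y) < e / 2"
  "!!l y. [|l:U; y:fib l0|] ==> EX x:fib l. ALL i:{()}. dist (f x) (f y) < e / 2"
  by (rule fibres_close[of "{()}" "%_. f", OF _ f l0 e2]) (use that in auto)
  have le: "(SUP x\<in>fib l. cmod (f x))<=(SUP x\<in>fib m. cmod (f x)) + e / 2"
  if l: "l:LL" and near: "!!x. x:fib l ==> EX y:fib m. dist (f x) (f y) < e / 2" for l m
  proof (rule cSUP_least[OF fib_nonempty[OF l]])
  fix x assume "x:fib l"
  then obtain y where y: "y:fib m" "dist (f x) (f y) < e / 2" using near by blast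
  have "cmod (f y)<=(SUP x\<in>fib m. cmod (f x))" by (rule cSUP_upper[OF y(1) bdd])
  moreover have "cmod (f x)<=cmod (f y) + dist (f x) (f y)" unfolding dist_norm using norm_triangle_sub by blast
  ultimately show "cmod (f x)<=(SUP x\<in>fib m. cmod (f x)) + e / 2" using y(2) by linarith
  qed
  have "dist (SUP x\<in>fib l0. cmod (f x)) (SUP x\<in>fib l. cmod (f x)) < e" if l: "l:U" for l
  proof -
  have lL: "l:LL" using l U(1) openin_subset by blast
  have "(SUP x\<in>fib l. cmod (f x))<=(SUP x\<in>fib l0. cmod (f x)) + e / 2" using U(3)[OF l] by (intro le[OF lL]) auto
  moreover have "(SUP x\<in>fib l0. cmod (f x))<=(SUP x\<in>fib l. cmod (f x)) + e / 2"
  using U(4)[OF l] by (intro le[OF l0]) (auto simp: dist_commute)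
  ultimately show ?thesis using e unfolding dist_real_def by linarith
  qed
  thus "EX U. openin L U & l0:U & (ALL y:U. dist (SUP x\<in>fib l0. cmod (f x)) (SUP x\<in>fib y. cmod (f x)) < e)" using U(1,2) by blast
 qed
qed

text \<open>A section that vanishes on the fibre over \<open>l0\<close> is \<open>\<surd>N \<cdot> f / \<surd>N\<close>, where \<open>N\<close> is the fibrewise
 norm and the second factor is a limit of elements of \<open>M\<close>.\<close>

lemma vanishing_coefficients:
 assumes sub: "submodule M base_ring total_module" and cl: "closedin (mtopology_of (CX K)) M"
  and gen: "!!f. f:M ==> EX c. (ALL i<n. c i:CL) & (ALL x:KK. f x=(\<Sum>i<n. c i (q x) * s i x))"
  and f: "f:M" and l0: "l0:LL" and zero: "!!x. x:fib l0 ==> f x=0"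
 shows "EX c. (ALL i<(n::nat). cnt L (c i) & c i l0=(0 :: complex)) & (ALL x:KK. f x=(\<Sum>i<n. c i (q x) * s i x))"
proof -
 note M = submodule_totalD[OF sub]
 have fc: "cont f" using f M(1) mspace_total by blast
 define R where "R l=sqrt (SUP x\<in>fib l. cmod (f x))" for l
 have Rc: "cntR L R" unfolding R_def using continuous_fibre_norm(1)[OF fc] by (simp add: continuous_map_atin tendsto_real_sqrt)
 have fR: "cmod (f x)<=R (q x) * R (q x) & 0<=R (q x)" if "x:KK" for x
 proof -
  have "cmod (f x)<=(SUP x\<in>fib (q x). cmod (f x))" by (rule continuous_fibre_norm(2)[OF fc that])
  moreover from this have "0<=(SUP x\<in>fib (q x). cmod (f x))" using norm_ge_zero order_trans by blast
  ultimately show ?thesis by (simp add: R_def)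
 qed
 have R0: "R l0=0"
 proof -
  have "(SUP x\<in>fib l0. cmod (f x))=(SUP x\<in>fib l0. 0)" using zero by (intro SUP_cong) auto
  thus ?thesis using fib_nonempty[OF l0] by (simp add: R_def)
 qed
 \<comment> \<open>Where R vanishes so does f, and the convention for division by zero gives g = 0
   there. Thus |g| is at most R everywhere.\<close>
 define g where "g x=f x / complex_of_real (R (q x))" for x
 have gle: "cmod (g x)<=R (q x)" if x: "x:KK" for x
 proof (cases "R (q x)=0")
  case False
  hence "R (q x) > 0" using fR[OF x] by simp
  thus ?thesis using fR[OF x] by (simp add: g_def norm_divide field_simps)
 qed (simp add: g_def)
 \<comment> \<open>Truncating the denominator at d keeps the factor continuous, so that its product
   with f stays in M.\<close>
 define k where "k d=(\<lambda>l\<in>LL. complex_of_real (1 / max (R l) d))" for d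
 have kC: "k d:CL" if d: "d > 0" for d unfolding k_def
 proof (intro restrict_CX[OF compact_base] continuous_map_complex_of_real)
  have "cntR L (%l. max (R l) d)" using Rc by (intro continuous_map_real_max) auto
  thus "cntR L (%l. 1 / max (R l) d)" using d by (intro continuous_map_real_divide) auto
 qed
 have kM: "(\<lambda>x\<in>KK. k d (q x) * f x):M" if "d > 0" for d by (rule M(4)[OF kC[OF that] f])
 \<comment> \<open>Nothing changes where R is at least d; elsewhere both terms are bounded by d,
   because |g| is at most R and |f| at most R^2.\<close>
 have close: "cmod (g x - k d (q x) * f x)<=2 * d" if d: "d > 0" and x: "x:KK" for d x
 proof (cases "R (q x) >= d")
  case True
  thus ?thesis using d proj_closed[OF x] by (simp add: g_def k_def max_def divide_inverse mult.commute)
 next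
  case False
  have "cmod (k d (q x) * f x)=cmod (f x) / d" using False d proj_closed[OF x] by (simp add: k_def max_def norm_divide)
  also have "... <= (d * d) / d"
  proof (rule divide_right_mono)
  have "R (q x) * R (q x)<=d * d" using False fR[OF x] d by (intro mult_mono) auto
  thus "cmod (f x)<=d * d" using fR[OF x] by linarith
  qed (use d in simp)
  finally have "cmod (k d (q x) * f x)<=d" using d by simp
  thus ?thesis using gle[OF x] False norm_triangle_ineq4[of "g x" "k d (q x) * f x"] by linarith
 qed
 have gc: "cont g"
 proof (rule continuous_map_uniform_limit_dist)
  fix e :: real assume e: "e > 0"
  hence e2: "e / 2 > 0" by simp
  have "cont (\<lambda>x\<in>KK. k (e / 2) (q x) * f x)" using kM[OF e2] M(1) mspace_total by blast
  moreover have "ALL x:KK. dist (g x) ((\<lambda>x\<in>KK. k (e / 2) (q x) * f x) x)<=e" using close[OF e2] by (simp add: dist_norm)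
  ultimately show "EX h. cont h & (ALL x:KK. dist (g x) (h x)<=e)" by blast
 qed
 have "restrict g (KK):M"
 proof -
  have app: "EX h:M. ALL x:KK. cmod (restrict g (KK) x - h x)<=e" if e: "e > 0" for e
  proof -
  have e2: "e / 2 > 0" using e by simp
  show ?thesis using close[OF e2] by (intro bexI[OF _ kM[OF e2]]) simp
  qed
  show ?thesis using cl[unfolded closedin_CX[OF total_nonempty[OF l0] M(1)]] restrict_CX[OF compact_total gc] app by blast
 qed
 then obtain c where c: "ALL i<n. c i:CL" "ALL x:KK. restrict g (KK) x=(\<Sum>i<n. c i (q x) * s i x)" using gen by blast
 show ?thesis
 proof (intro exI[of _ "%i l. complex_of_real (R l) * c i l"] conjI allI impI ballI)
  show "cnt L (%l. complex_of_real (R l) * c i l)" if "i < n" for i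
  using c(1) that mspace_base Rc by (intro continuous_map_mult_algebra continuous_map_complex_of_real) auto
  show "complex_of_real (R l0) * c i l0=0" for i using R0 by simp
  fix x assume x: "x:KK"
  have "f x=complex_of_real (R (q x)) * g x" using fR[OF x] by (cases "R (q x)=0") (auto simp: g_def)
  also have "... = (\<Sum>i<n. complex_of_real (R (q x)) * c i (q x) * s i x)" using c(2) x by (simp add: sum_distrib_left mult.assoc)
  finally show "f x=(\<Sum>i<n. complex_of_real (R (q x)) * c i (q x) * s i x)" .
 qed
qed

definition restrictions :: "('k => complex) set => 'l => ('k => complex) set" where
 "restrictions M l=(%f. restrict f (fib l)) ` M"

text \<open>Nakayama's lemma: generators that are independent on one fibre and span there also do so on
 the neighbouring fibres.\<close>

lemma local_frames_restrictions:
 assumes sub: "submodule M base_ring total_module" and cl: "closedin (mtopology_of (CX K)) M"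
  and fg: "finitely_generated_module base_ring (total_module\<lparr>carrier := M\<rparr>)"
 shows "local_frames (restrictions M)" unfolding local_frames_def
proof
 fix l0 assume l0: "l0:LL"
 note M = submodule_totalD[OF sub]
 obtain n :: nat and s where s: "!!i. i < n ==> s i:M"
  "!!f. f:M ==> EX c. (ALL i<n. c i:CL) & (ALL x:KK. f x=(\<Sum>i<n. c i (q x) * s i x))" by (rule finite_generators[OF sub fg]) (rule that)
 have sc: "cont (s i)" if "i < n" for i using s(1)[OF that] M(1) mspace_total by blast
 have combM: "restrict (comb k t c) (KK):M" if t: "!!i. i < k ==> restrict (t i) (KK):M" for k t c
 proof -
  have "(\<lambda>x\<in>KK. \<Sum>i\<in>{..<k}. (\<lambda>l\<in>LL. c i) (q x) * restrict (t i) (KK) x):M"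
  by (rule submodule_sum[OF M(2) M(3) M(4) const_base]) (assumption | (rule t, simp))+
  moreover have eq: "(\<lambda>x\<in>KK. \<Sum>i\<in>{..<k}. (\<lambda>l\<in>LL. c i) (q x) * restrict (t i) (KK) x)=restrict (comb k t c) (KK)"
  using proj_closed by (intro restrict_ext) (simp add: comb_def)
  ultimately show ?thesis unfolding eq by blast
 qed
 have sM: "restrict (s i) (KK):M" if "i < n" for i
 proof -
  have "restrict (s i) (KK)=s i" using s(1)[OF that] M(1) mspace_total by (intro extensionalityI[of _ "KK"]) auto
  thus ?thesis using s(1)[OF that] by simp
 qed
 obtain m :: nat and v where v: "indon (fib l0) m v" "!!i. i < n ==> in_span (fib l0) m v (s i)"
  "!!i. i < m ==> in_span (fib l0) n s (v i)" by (rule independent_spanning_subsystem[of "fib l0" n s]) (rule that)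
 \<comment> \<open>The basis v of the fibre is replaced by combinations t of the generators, which
   are elements of M over all of L.\<close>
 have "ALL i. EX a. i < m --> (ALL x:fib l0. v i x=comb n s a x)" using v(3) unfolding in_span_def comb_def by blast
 from choice[OF this] obtain a where a: "!!i x. [|i < m; x:fib l0|] ==> v i x=comb n s (a i) x" by blast
 define t where "t i=comb n s (a i)" for i
 have tc: "cont (t i)" for i unfolding t_def using sc by (rule continuous_comb)
 have tM: "restrict (t i) (KK):M" for i unfolding t_def by (rule combM) (rule sM)
 have "ALL j. EX b. j < n --> (ALL x:fib l0. s j x=comb m t b x)"
 proof
  fix j
  show "EX b. j < n --> (ALL x:fib l0. s j x=comb m t b x)"
  proof (cases "j < n")
  case True
  then obtain b where "ALL x:fib l0. s j x=(\<Sum>i<m. b i * v i x)" using v(2) unfolding in_span_def by blast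
  thus ?thesis using a by (intro exI[of _ b]) (simp add: comb_def t_def)
  qed simp
 qed
 from choice[OF this] obtain b where b: "!!j x. [|j < n; x:fib l0|] ==> s j x=comb m t (b j) x" by blast
 have ind: "indep m t l0" unfolding indep_def
 proof (intro allI impI)
  fix c i assume c: "ALL x:fib l0. comb m t c x=0" and i: "i < m"
  have "ALL x:fib l0. (\<Sum>i<m. c i * v i x)=0" using c a by (simp add: comb_def t_def)
  thus "c i=0" using v(1) i unfolding indon_def by blast
 qed
 \<comment> \<open>The difference of s j and its combination of the t i vanishes over l0, so it is a
   combination of the generators with coefficients that vanish at l0.\<close>
 have "ALL j. EX h. j < n --> (ALL i<n. cnt L (h i) & h i l0=0) &
  (ALL x:KK. s j x - comb m t (b j) x=(\<Sum>i<n. h i (q x) * s i x))"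
 proof
  fix j
  show "EX h. j < n --> (ALL i<n. cnt L (h i) & h i l0=0) &
  (ALL x:KK. s j x - comb m t (b j) x=(\<Sum>i<n. h i (q x) * s i x))"
  proof (cases "j < n")
  case True
  let ?f = "\<lambda>x\<in>KK. s j x + restrict (comb m t (%i. - b j i)) (KK) x"
  have f: "?f:M" by (intro M(3) s(1) True combM tM)
  have neg: "comb m t (%i. - b j i) x = - comb m t (b j) x" for x by (simp add: comb_def sum_negf)
  have "EX c. (ALL i<n. cnt L (c i) & c i l0=0) & (ALL x:KK. ?f x=(\<Sum>i<n. c i (q x) * s i x))"
  by (rule vanishing_coefficients[OF sub cl s(2) f l0]) (use b[OF True] in \<open>auto simp: neg fib_iff\<close>)
  thus ?thesis by (auto simp: neg)
  qed simp
 qed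
 from choice[OF this] obtain h where h: "!!j i. [|j < n; i < n|] ==> cnt L (h j i) & h j i l0=0"
  "!!j x. [|j < n; x:KK|] ==> s j x - comb m t (b j) x=(\<Sum>i<n. h j i (q x) * s i x)" by blast
 obtain U1 where U1: "openin L U1" "l0:U1" "!!l. l:U1 ==> indep m t l" by (rule indep_nearby[of m t l0, OF tc l0 ind]) (rule that)
 \<comment> \<open>Here the matrix h has row sums below 1/2, which makes the iteration that
   expresses s through t a contraction.\<close>
 define U2 where "U2={l:LL. ALL j:{..<n}. dist (\<Sum>i<n. cmod (h j i l)) 0 < 1 / 2}"
 have "openin L U2" unfolding U2_def
 proof (rule openin_finite_conj)
  fix j assume "j:{..<n}"
  hence "cntR L (%l. \<Sum>i<n. cmod (h j i l))" using h(1) by (intro continuous_map_sum continuous_map_norm) auto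
  thus "openin L {l:LL. dist (\<Sum>i<n. cmod (h j i l)) 0 < 1 / 2}" by (rule openin_dist_less)
 qed simp
 moreover have "l0:U2" using h(1) l0 by (simp add: U2_def)
 ultimately have U: "openin L (U1 Int U2)" "l0:U1 Int U2" using U1 by auto
 obtain B where B: "B >= 0" "!!i x. [|i < n; x:KK|] ==> cmod (s i x)<=B" using bounded_sections[of n s] sc by blast
 have span: "in_span (fib l) m t (s j)" if l: "l:U1 Int U2" and j: "j < n" for l j
 proof -
  have half: "(\<Sum>i<n. cmod (h j i l))<=1 / 2" if j: "j < n" for j
  proof -
  have "dist (\<Sum>i<n. cmod (h j i l)) 0 < 1 / 2" using l j unfolding U2_def by blast
  thus ?thesis unfolding dist_real_def by linarith
  qed
  \<comment> \<open>Inserting the approximations of all s k into s j = \<open>comb m t (b j)\<close>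
    + \<Sum> h j k * s k halves the error. This replaces inverting the identity minus h; exact
    membership follows because the span of t on the fibre is closed.\<close>
  have appr: "EX c. ALL x:fib l. cmod (s j x - comb m t c x)<=B / 2 ^ N" if "j < n" for N j using that
  proof (induction N arbitrary: j)
  case 0
  have "ALL x:fib l. cmod (s j x - comb m t (%_. 0) x)<=B / 2 ^ 0" using B(2) 0 by (simp add: comb_def fib_iff)
  thus ?case by blast
  next
  case (Suc N)
  have "ALL k. EX c. k < n --> (ALL x:fib l. cmod (s k x - comb m t c x)<=B / 2 ^ N)" using Suc.IH by blast
  from choice[OF this] obtain c where c: "!!k x. [|k < n; x:fib l|] ==> cmod (s k x - comb m t (c k) x)<=B / 2 ^ N" by blast
  define d where "d i=b j i + (\<Sum>k<n. h j k l * c k i)" for i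
  have combd: "comb m t d x=comb m t (b j) x + (\<Sum>k<n. h j k l * comb m t (c k) x)" for x
  proof -
  have "(\<Sum>i<m. (\<Sum>k<n. h j k l * c k i) * t i x)=(\<Sum>k<n. h j k l * (\<Sum>i<m. c k i * t i x))"
  unfolding sum_distrib_left sum_distrib_right by (subst sum.swap) (simp add: mult.assoc)
  thus ?thesis by (simp add: comb_def d_def distrib_right sum.distrib)
  qed
  have "cmod (s j x - comb m t d x)<=B / 2 ^ Suc N" if x: "x:fib l" for x
  proof -
  have "s j x - comb m t d x=(\<Sum>k<n. h j k l * (s k x - comb m t (c k) x))"
  using h(2)[OF Suc.prems, of x] x by (simp add: combd fib_iff right_diff_distrib sum_subtractf algebra_simps)
  also have "cmod ... <= (\<Sum>k<n. cmod (h j k l) * (B / 2 ^ N))"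
  proof (rule sum_norm_le)
  fix k assume "k:{..<n}"
  thus "cmod (h j k l * (s k x - comb m t (c k) x))<=cmod (h j k l) * (B / 2 ^ N)"
  unfolding norm_mult using c[of k x] x by (intro mult_left_mono) auto
  qed
  also have "... <= 1 / 2 * (B / 2 ^ N)"
  unfolding sum_distrib_right[symmetric] using half[OF Suc.prems] B(1) by (intro mult_right_mono) auto
  finally show ?thesis by simp
  qed
  thus ?case by blast
  qed
  have lL: "l:LL" using U(1) l openin_subset by blast
  have "EX c. ALL x:fib l. cmod (restrict (s j) (fib l) x - comb m t c x)<=e" if e: "e > 0" for e
  proof -
  obtain N where "B / e < real N" using reals_Archimedean2 by blast
  also have "real N < 2 ^ N" by (rule of_nat_less_two_power)
  finally have "B / 2 ^ N<=e" using e by (simp add: field_simps)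
  thus ?thesis using appr[OF j, of N] by (metis order_trans restrict_apply')
  qed
  then obtain c where eq: "restrict (s j) (fib l)=restrict (comb m t c) (fib l)"
  using comb_closed[of m t l "restrict (s j) (fib l)"] U1(3) l tc by blast
  have "s j x=comb m t c x" if "x:fib l" for x using fun_cong[OF eq, of x] unfolding restrict_apply'[OF that] .
  thus ?thesis unfolding in_span_def comb_def by blast
 qed
 have "frame_on (restrictions M) (U1 Int U2) m t" unfolding frame_on_def
 proof (intro conjI allI impI ballI tc)
  fix l assume l: "l:U1 Int U2"
  show "indep m t l" using U1(3) l by blast
  show "restrictions M l={restrict (comb m t c) (fib l) | c. True}"
  proof (intro equalityI subsetI)
  fix f assume "f:restrictions M l"
  then obtain f0 where f0: "f=restrict f0 (fib l)" "f0:M" by (auto simp: restrictions_def)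
  obtain c where c: "ALL x:KK. f0 x=(\<Sum>i<n. c i (q x) * s i x)" using s(2)[OF f0(2)] by blast
  have "in_span (fib l) n s f0" unfolding in_span_def using c by (intro exI[of _ "%i. c i l"]) (simp add: fib_iff)
  from in_span_trans[OF this span[OF l]] obtain d where "ALL x:fib l. f0 x=comb m t d x" unfolding in_span_def comb_def by blast
  hence "f=restrict (comb m t d) (fib l)" unfolding f0(1) by (intro restrict_ext) simp
  thus "f:{restrict (comb m t c) (fib l) | c. True}" by blast
  next
  fix f assume "f:{restrict (comb m t c) (fib l) | c. True}"
  then obtain c where c: "f=restrict (comb m t c) (fib l)" by blast
  have eq: "f=restrict (restrict (comb m t c) (KK)) (fib l)" unfolding c restrict_restrict_fib ..
  have "restrict (comb m t c) (KK):M" by (rule combM) (rule tM)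
  thus "f:restrictions M l" unfolding restrictions_def eq by (rule imageI)
  qed
 qed
 thus "EX U n s. openin L U & l0:U & frame_on (restrictions M) U n s" using U by blast
qed

end

section \<open>Density of the invariant submodules\<close>

context open_tds_extension
begin

text \<open>The fibrewise restrictions of a module form an invariant bundle with local frames.
  Density provides elements that distinguish x and y, by approximating a function with the values 0
  and 1 up to 1/4.\<close>

theorem pseudoisometric_if_submodules_dense:
 assumes dense: "mtopology_of (CX K) closure_of \<Union>fgp=CK"
 shows "pseudoisometric G K \<phi> L q"
proof (rule pseudoisometric_if_frames[where B = "restrictions ` fgp"])
 fix F assume "F:restrictions ` fgp"
 then obtain M where M: "F=restrictions M" "M:fgp" by blast
 show "local_frames F"
  unfolding M(1) using M(2) unfolding fg_projective_closed_invariant_submodules_def by (intro local_frames_restrictions) blast+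
 fix g l f assume g: "g:carrier G" and l: "l:LL" and f: "f:F (\<psi> g l)"
 obtain f0 where f0: "f0:M" "f=restrict f0 (fib (\<psi> g l))" using f unfolding M(1) restrictions_def by blast
 have "compose (fib l) f (\<phi> g)=restrict (compose (KK) f0 (\<phi> g)) (fib l)"
  unfolding f0(2) compose_def restrict_restrict_fib using phi_fib[OF g] by (intro restrict_ext) simp
 moreover have "compose (KK) f0 (\<phi> g):M" using M(2) f0(1) g unfolding fg_projective_closed_invariant_submodules_def by blast
 ultimately show "compose (fib l) f (\<phi> g):F l" unfolding M(1) restrictions_def by blast
next
 fix l x y assume l: "l:LL" and xy: "x:fib l" "y:fib l" "x ~= y"
 have xyK: "x:KK" "y:KK" using xy by (auto simp: fib_iff)
 obtain u :: "'c => complex" where u: "cont u" "u x=0" "u y=1" by (rule separating_function[OF xyK xy(3)]) (rule that)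
 have "EX f:\<Union>fgp Int CK.
  ALL z:KK. cmod (restrict u (KK) z - f z)<=1 / 4"
  using dense[unfolded dense_CX[OF total_nonempty[OF l]], rule_format, OF restrict_CX[OF compact_total u(1)], of "1 / 4"] by simp
 then obtain f M where f: "M:fgp" "f:M"
  "!!z. z:KK ==> cmod (u z - f z)<=1 / 4" by auto
 have "f x ~= f y"
 proof
  assume "f x=f y"
  hence "cmod (1 - f x)<=1 / 4" "cmod (0 - f x)<=1 / 4" using f(3)[OF xyK(1)] f(3)[OF xyK(2)] u by auto
  thus False using norm_triangle_ineq4[of "1 - f x" "0 - f x"] by simp
 qed
 hence neq: "restrict f (fib l) x ~= restrict f (fib l) y" using xy by simp
 have "restrict f (fib l):restrictions M l" unfolding restrictions_def using f(2) by (rule imageI)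
 thus "EX F:restrictions ` fgp. EX f:F l. f x ~= f y" using neq f(1) by blast
qed

end

context groupoid_extension
begin

lemma invariant_systems_join:
 assumes "finite I" "!!i. i:I ==> isys l (n i) (w i)"
 shows "EX k u. isys l k u & (ALL i:I. ALL j<n i. in_span (fib l) k u (w i j))" using assms
proof (induction I rule: finite_induct)
 case empty
 have "isys l 0 (%_ _. 0)" by (simp add: isys_def)
 thus ?case by blast
next
 case (insert i I)
 then obtain k u where u: "isys l k u" "!!i j. [|i:I; j < n i|] ==> in_span (fib l) k u (w i j)" by blast
 have wi: "isys l (n i) (w i)" using insert.prems by blast
 obtain k' u' where u': "isys l k' u'" "!!j. j < n i ==> in_span (fib l) k' u' (w i j)"
  "!!j. j < k ==> in_span (fib l) k' u' (u j)" by (rule invariant_system_join[OF wi u(1)]) (rule that)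
 have "in_span (fib l) k' u' (w a j)" if "a:insert i I" "j < n a" for a j
 proof (cases "a=i")
  case False
  thus ?thesis using that by (intro in_span_trans[OF u(2) u'(3)]) auto
 qed (use that u'(2) in simp)
 thus ?case using u'(1) by blast
qed

text \<open>The local frames consist of global sections, so constant coefficients extend h to all of
  L.\<close>

lemma assoc_bundle_global_section:
 assumes w: "isys l0 n w" "indon (fib l0) n w" and l0: "l0:LL"
  and l: "l:LL" and h: "h:abun l0 n w l"
 obtains f where "f:sections (abun l0 n w)" "!!x. x:fib l ==> f x=h x"
proof -
 obtain U s where U: "openin L U" "l:U" "frame_on (abun l0 n w) U n s"
  "!!i m. [|i < n; m:LL|] ==> restrict (s i) (fib m):abun l0 n w m" by (rule assoc_bundle_frames[OF w l0 l]) (rule that)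
 have fr: "local_frames (abun l0 n w)" by (rule local_frames_assoc_bundle[OF w l0])
 note M = submodule_totalD[OF submodule_sections[OF fr]]
 obtain c where c: "h=restrict (comb n s c) (fib l)" using U(2,3) h unfolding frame_on_def by blast
 have sS: "restrict (s i) (KK):sections (abun l0 n w)" if "i < n" for i using U(3,4) that by (intro sectionsI) (auto simp: frame_on_def)
 show thesis
 proof (rule that)
  show "(\<lambda>x\<in>KK. \<Sum>i\<in>{..<n}. (\<lambda>l\<in>LL. c i) (q x) * restrict (s i) (KK) x):sections (abun l0 n w)"
  by (rule submodule_sum[OF M(2) M(3) M(4) const_base]) (assumption | (rule sS, simp))+
  show "(\<lambda>x\<in>KK. \<Sum>i\<in>{..<n}. (\<lambda>l\<in>LL. c i) (q x) * restrict (s i) (KK) x) x=h x" if "x:fib l" for x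
  using that l unfolding c by (simp add: fib_iff comb_def)
 qed
qed

lemma sections_assoc_bundle_mem:
 assumes w: "isys l0 n w" "indon (fib l0) n w" and l0: "l0:LL"
 shows "sections (abun l0 n w):fgp"
proof -
 let ?F = "abun l0 n w"
 have fr: "local_frames ?F" by (rule local_frames_assoc_bundle[OF w l0])
 have glob: "EX U n' s. openin L U & l:U & frame_on ?F U n' s & (ALL i<n'. ALL m:LL. restrict (s i) (fib m):?F m)"
  if l: "l:LL" for l by (rule assoc_bundle_frames[OF w l0 l]) (intro exI conjI allI impI ballI; assumption)
 have ne: "LL ~= {}" using l0 by blast
 have inv: "compose (KK) f (\<phi> g):sections ?F" if f: "f:sections ?F" and g: "g:carrier G" for f g
 proof -
  have fc: "cont f" and fF: "!!l. l:LL ==> restrict f (fib l):?F l" using f mspace_total by (auto simp: sections_def)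
  have "cont (%x. f (\<phi> g x))" using continuous_map_compose[OF continuous_phi[OF g] fc] by (simp add: comp_def)
  hence "restrict (%x. f (\<phi> g x)) (KK):sections ?F"
  proof (rule sectionsI)
  fix l assume l: "l:LL"
  have gl: "\<psi> g l:LL" by (rule psi_closed[OF g l])
  have "compose (fib (\<psi> (inv g) (\<psi> g l))) (restrict f (fib (\<psi> g l))) (\<phi> (inv (inv g))):?F (\<psi> (inv g) (\<psi> g l))"
  using g by (intro assoc_bundle_invariant[OF w(1) l0 _ gl fF[OF gl]]) simp
  hence "compose (fib l) (restrict f (fib (\<psi> g l))) (\<phi> g):?F l" using psi_inv[OF g l] g by simp
  moreover have "compose (fib l) (restrict f (fib (\<psi> g l))) (\<phi> g)=restrict (%x. f (\<phi> g x)) (fib l)"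
  unfolding compose_def using phi_fib[OF g] by (intro restrict_ext) simp
  ultimately show "restrict (%x. f (\<phi> g x)) (fib l):?F l" by simp
  qed
  thus ?thesis by (simp add: compose_def)
 qed
 show ?thesis unfolding fg_projective_closed_invariant_submodules_def
 proof (intro CollectI conjI ballI)
  show "finitely_generated_module base_ring (total_module\<lparr>carrier := sections ?F\<rparr>)"
  by (rule sections_fg_projective(1)[OF glob])
  show "projective_module base_ring (total_module\<lparr>carrier := sections ?F\<rparr>)" by (rule sections_fg_projective(2)[OF glob])
 qed (use submodule_sections[OF fr] closedin_sections[OF fr ne] inv in auto)
qed

text \<open>An approximation on one fibre extends to a global section that is still good over a
  neighbourhood. Finitely many such sections are glued by a partition of unity, whose members are
  scalars of the module.\<close>

theorem submodules_dense_if_compact_groupoid: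
 "mtopology_of (CX K) closure_of \<Union>fgp=CK"
proof -
 obtain l0 where l0: "l0:LL" using base.nonempty_space by blast
 have neK: "KK ~= {}" by (rule total_nonempty[OF l0])
 show ?thesis unfolding dense_CX[OF neK]
 proof (intro ballI allI impI)
  fix f and e :: real assume f: "f:CK" and e: "e > 0"
  have fc: "cont f" using f mspace_total by blast
  have e2: "e / 2 > 0" using e by simp
  have "EX z. isys l0 (fst z) (fst (snd z)) & indon (fib l0) (fst z) (fst (snd z)) &
  snd (snd z):sections (abun l0 (fst z) (fst (snd z))) & (ALL x:fib l. cmod (f x - snd (snd z) x)<=e / 2)"
  if l: "l:LL" for l
  proof -
  obtain n w h where h: "isys l0 n w" "indon (fib l0) n w" "h:abun l0 n w l"
  "!!x. x:fib l ==> cmod (f x - h x)<=e / 2" by (rule assoc_bundle_approximation[OF l0 l fc e2]) (rule that)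
  obtain a where a: "a:sections (abun l0 n w)" "!!x. x:fib l ==> a x=h x"
  by (rule assoc_bundle_global_section[OF h(1,2) l0 l h(3)]) (rule that)
  have "ALL x:fib l. cmod (f x - a x)<=e / 2" using h(4) a(2) by simp
  thus ?thesis using h(1,2) a(1) by (intro exI[of _ "(n, w, a)"]) (simp only: fst_conv snd_conv simp_thms)
  qed
  hence "ALL l:LL. EX z. isys l0 (fst z) (fst (snd z)) & indon (fib l0) (fst z) (fst (snd z)) &
  snd (snd z):sections (abun l0 (fst z) (fst (snd z))) & (ALL x:fib l. cmod (f x - snd (snd z) x)<=e / 2)" by (intro ballI)
  from bchoice[OF this] obtain z where z: "ALL l:LL. isys l0 (fst (z l)) (fst (snd (z l))) &
  indon (fib l0) (fst (z l)) (fst (snd (z l))) &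
  snd (snd (z l)):sections (abun l0 (fst (z l)) (fst (snd (z l)))) & (ALL x:fib l. cmod (f x - snd (snd (z l)) x)<=e / 2)" ..
  define n w a where "n l=fst (z l)" and "w l=fst (snd (z l))" and "a l=snd (snd (z l))" for l
  have nwa: "isys l0 (n l) (w l)" "a l:sections (abun l0 (n l) (w l))"
  "!!x. x:fib l ==> cmod (f x - a l x)<=e / 2" if "l:LL" for l using z that unfolding n_def w_def a_def by blast+
  have ac: "cont (a l)" if "l:LL" for l using nwa(2)[OF that] mspace_total by (auto simp: sections_def)
  have "EX U. openin L U & l:U & (ALL x:KK. q x:U --> cmod (f x - a l x) < e)" if l: "l:LL" for l
  proof -
  have T: "openin K {x:KK. dist (f x - a l x) 0 < e}" by (intro openin_dist_less continuous_map_diff fc ac l)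
  have sub: "fib l<={x:KK. dist (f x - a l x) 0 < e}" using nwa(3)[OF l] e by (force simp: fib_iff)
  obtain U where U: "openin L U" "l:U" "!!x. [|x:KK; q x:U|] ==> x:{x:KK. dist (f x - a l x) 0 < e}" by (rule tube[OF T sub l]) (rule that)
  thus ?thesis by (intro exI[of _ U]) (auto simp: dist_norm)
  qed
  hence "ALL l:LL. EX U. openin L U & l:U & (ALL x:KK. q x:U --> cmod (f x - a l x) < e)" by (intro ballI)
  from bchoice[OF this] obtain U where U: "ALL l:LL. openin L (U l) & l:U l &
  (ALL x:KK. q x:U l --> cmod (f x - a l x) < e)" ..
  have "compactin L (LL)" using compact_base by (simp add: compact_space_def)
  then obtain A where A: "finite A" "A<=LL" "LL<=(\<Union>l\<in>A. U l)" by (rule compactin_pointwise[of L "LL" U]) (use U in auto)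
  have UA: "openin L (U l)" if "l:A" for l using U A(2) that by blast
  obtain r :: "'d => 'd => real" where r: "!!l. l:A ==> cntR L (r l)"
  "!!l m. l:A ==> m:LL ==> 0<=r l m"
  "!!l m. l:A ==> m:LL ==> m ~: U l ==> r l m=0"
  "!!m. m:LL ==> (\<Sum>l\<in>A. r l m)=1"
  by (rule partition_of_unity[OF compact_base Hausdorff_base A(1) UA A(3)]) (assumption | rule that)+
  \<comment> \<open>The sections belong to different bundles; joining the finitely many invariant
    systems yields one module that contains all of them.\<close>
  have "EX k u. isys l0 k u & (ALL l:A. ALL j<n l. in_span (fib l0) k u (w l j))"
  by (rule invariant_systems_join[OF A(1)]) (use nwa(1) A(2) in blast)
  then obtain k u where u: "isys l0 k u" "!!l j. [|l:A; j < n l|] ==> in_span (fib l0) k u (w l j)" by blast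
  obtain m v where v: "isys l0 m v" "indon (fib l0) m v" "!!i. i < k ==> in_span (fib l0) m v (u i)"
  by (rule invariant_system_independent[OF u(1)]) (rule that)
  let ?M = "sections (abun l0 m v)"
  have fr: "local_frames (abun l0 m v)" by (rule local_frames_assoc_bundle[OF v(1,2) l0])
  note M = submodule_totalD[OF submodule_sections[OF fr]]
  have aM: "a l:?M" if l: "l:A" for l
  proof -
  have "in_span (fib l0) m v (w l j)" if "j < n l" for j by (rule in_span_trans[OF u(2)[OF l that] v(3)])
  hence "abun l0 (n l) (w l) l'<=abun l0 m v l'" for l' by (rule in_span_assoc_mono)
  thus ?thesis using nwa(2)[of l] l A(2) unfolding sections_def by blast
  qed
  define c where "c l=(\<lambda>m\<in>LL. complex_of_real (r l m))" for l
  have cL: "c l:CL" if "l:A" for l unfolding c_def by (intro restrict_CX[OF compact_base] continuous_map_complex_of_real r(1) that)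
  let ?g = "\<lambda>x\<in>KK. \<Sum>l\<in>A. c l (q x) * a l x"
  have gM: "?g:?M" by (rule submodule_sum[OF M(2) M(3) M(4) cL aM])
  have "cmod (f x - ?g x)<=e" if x: "x:KK" for x
  proof -
  have qx: "q x:LL" by (rule proj_closed[OF x])
  have "f x=(\<Sum>l\<in>A. complex_of_real (r l (q x))) * f x" using r(4)[OF qx] by (simp flip: of_real_sum)
  hence "f x - ?g x=(\<Sum>l\<in>A. complex_of_real (r l (q x)) * (f x - a l x))"
  using x qx by (simp add: c_def right_diff_distrib sum_subtractf sum_distrib_right)
  also have "cmod ... <= (\<Sum>l\<in>A. r l (q x) * e)"
  proof (rule sum_norm_le)
  fix l assume l: "l:A"
  show "cmod (complex_of_real (r l (q x)) * (f x - a l x))<=r l (q x) * e"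
  proof (cases "q x:U l")
  case True
  hence "cmod (f x - a l x) < e" using U l A(2) x by blast
  thus ?thesis using r(2)[OF l qx] by (simp add: norm_mult mult_left_mono)
  next
  case False
  thus ?thesis using r(3)[OF l qx] by simp
  qed
  qed
  also have "... = e" using r(4)[OF qx] by (simp flip: sum_distrib_right)
  finally show ?thesis .
  qed
  moreover have "?g:\<Union>fgp Int CK" using sections_assoc_bundle_mem[OF v(1,2) l0] gM M(1) by blast
  ultimately show "EX g:\<Union>fgp Int CK. ALL x:KK. cmod (f x - g x)<=e" by blast
 qed
qed

end

theorem theorem7p2:
  fixes G :: "('g, 'r) monoid_scheme" and T :: "'g topology"
    and K :: "'k topology" and \<phi> :: "'g \<Rightarrow> 'k \<Rightarrow> 'k"
    and L :: "'l topology" and \<psi> :: "'g \<Rightarrow> 'l \<Rightarrow> 'l"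
    and q :: "'k \<Rightarrow> 'l"
  assumes "tds_extension G T K \<phi> L \<psi> q"
    and "open_map K L q"
    and "topologically_ergodic G L \<psi>"
  shows
    "(pseudoisometric G K \<phi> L q
        \<longleftrightarrow> compact_groupoid K L q (uniform_enveloping_semigroupoid G K \<phi> L \<psi> q)) \<and>
     (compact_groupoid K L q (uniform_enveloping_semigroupoid G K \<phi> L \<psi> q)
        \<longleftrightarrow> fibrewise_dense K L q (\<Union>(locally_trivial_invariant_subbundles G K \<phi> L \<psi> q))) \<and>
     (fibrewise_dense K L q (\<Union>(locally_trivial_invariant_subbundles G K \<phi> L \<psi> q))
        \<longleftrightarrow> mtopology_of (CX K) closure_of \<Union>(fg_projective_closed_invariant_submodules G K \<phi> L q)
              = mspace (CX K)) \<and>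
     (pseudoisometric G K \<phi> L q
        \<longrightarrow> (\<forall>F\<in>locally_trivial_invariant_subbundles G K \<phi> L \<psi> q.
               constant_finite_dim K L q F)) \<and>
     (metrizable_space K
        \<longrightarrow> (isometric G K \<phi> L q
               \<longleftrightarrow> compact_groupoid K L q (uniform_enveloping_semigroupoid G K \<phi> L \<psi> q)))"
proof -
 interpret open_tds_extension G T K \<phi> L \<psi> q by (intro open_tds_extension.intro open_tds_extension_axioms.intro assms(1,2))
 have ext: "groupoid_extension G T K \<phi> L \<psi> q" if "compact_groupoid K L q env"
  by (intro groupoid_extension.intro groupoid_extension_axioms.intro open_tds_extension_axioms that assms(3))
 note ab = compact_groupoid_if_pseudoisometric
 note ba = groupoid_extension.pseudoisometric_if_compact_groupoid[OF ext]
 note bc = groupoid_extension.fibrewise_dense_if_compact_groupoid[OF ext]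
 note bd = groupoid_extension.submodules_dense_if_compact_groupoid[OF ext]
 have iso: "isometric G K \<phi> L q" if "metrizable_space K" "compact_groupoid K L q env"
  using groupoid_extension.isometric_if_compact_groupoid[OF ext] that by blast
 have "pseudoisometric G K \<phi> L q" if "isometric G K \<phi> L q" using that unfolding isometric_def pseudoisometric_def by blast
 thus ?thesis using ab ba bc bd iso pseudoisometric_if_fibrewise_dense pseudoisometric_if_submodules_dense
  constant_dimension[OF assms(3)] by blast
qed

end
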